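(* Let $m\ge2$, $n\ge1$ be integers and let $E\subset\mathbb{R}^m$ be any centrally symmetric convex body. For $T\in\mathbb{N}$ let $$\mathcal{K}_{n,T}(E):=\max_{A_1}\min_{\bar\varepsilon_1}\cdots\max_{A_T}\min_{\bar\varepsilon_T}\|A_1\bar\varepsilon_1+\cdots+A_T\bar\varepsilon_T\|_E,$$ where each $A_t$ ranges over all real $m\times n$ matrices whose columns have Euclidean length at most $1$ and each $\bar\varepsilon_t$ ranges over $\{-1,1\}^n$. Then $$\lim_{T\to\infty}\frac{\mathcal{K}_{n,T}(E)}{\sqrt T}=\frac{1}{\sqrt{2\tau_n(E)}},$$ where $\tau_n(E)$ is the extinction time of $E$ under the flow by the sum of the largest $\min(n,m-1)$ principal curvatures.
   Context: A centrally symmetric convex body is a compact convex set $E$ with nonempty interior and $E=-E$; $\|\cdot\|_E$ is the norm on $\mathbb{R}^m$ with closed unit ball $E$. The max/min are nested: $A_t$ may depend on all earlier matrices and signs, and $\bar\varepsilon_t$ may depend on $A_1,\dots,A_t$ and the earlier signs. Extinction time $\tau_n(E)$. Let $k=\min(n,m-1)$. The flow starting from $E$ is the family $(E_t)_{t\ge0}$ with $E_0=E$ whose boundary $\partial E_t$ moves with inner normal velocity equal to the sum of the $k$ largest principal curvatures of $\partial E_t$; the $E_t$ are centrally symmetric convex bodies that shrink to $\{0\}$ at a finite time. $\tau_n(E)$ is the supremum of the $t>0$ such that such a flow from $E$ exists and is non-vanishing on $(0,t)$. For general (possibly non-smooth) $E$ the flow is understood in the level set sense: for symmetric $M\in\mathbb{R}^{m\times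 m}$ and $p\neq0$ let $F(M,p)$ be the sum of the $k$ largest eigenvalues of the quadratic form $\xi\mapsto(M\xi,\xi)$ restricted to $p^\perp$, with envelopes $F^*(M,p)=\limsup_{(M',p')\to(M,p),\,p'\neq0}F(M',p')$ and $F_*(M,p)=\liminf_{(M',p')\to(M,p),\,p'\neq0}F(M',p')$. Let $u:\mathbb{R}^m\times(-\infty,0]\to\mathbb{R}$ be the unique viscosity solution, of at most linear growth in $x$ uniformly on each $[-S,0]$, of $\partial_tu+F(D^2u,\nabla u)=0$ in $\mathbb{R}^m\times(-\infty,0)$, $u(x,0)=\|x\|_E$. Then $E_t=\{x:u(x,-t)\le1\}$ and $\tau_n(E)=\sup\{t>0:E_t\text{ has nonempty interior}\}$. Viscosity solution: an upper semicontinuous $u$ is a subsolution if, whenever $\phi$ is a test function (with $\partial_t\phi,\nabla\phi,D^2\phi$ continuous) and $u-\phi$ has a local maximum at $(x_0,t_0)$, $t_0<0$, one has $\partial_t\phi+F^*(D^2\phi,\nabla\phi)\ge0$ at $(x_0,t_0)$. A lower semicontinuous $u$ is a supersolution if, whenever $u-\phi$ has a local minimum at $(x_0,t_0)$, $t_0<0$, one has $\partial_t\phi+F_*(D^2\phi,\nabla\phi)\le0$ at $(x_0,t_0)$. A solution is both. *)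

theory Defs
  imports "HOL-Analysis.Analysis" "HOL-Library.Multiset"
begin

definition sym_convex_body :: "(real^'m) set \<Rightarrow> bool" where
  "sym_convex_body E \<longleftrightarrow> compact E \<and> convex E \<and> interior E \<noteq> {} \<and> E = uminus ` E"

text \<open>The Minkowski functional, which for \<open>sym_convex_body E\<close> is the norm with closed unit
  ball \<open>E\<close>.\<close>

definition body_norm :: "(real^'m) set \<Rightarrow> real^'m \<Rightarrow> real" where
  "body_norm E x = Inf {r. 0 < r \<and> x \<in> (\<lambda>y. r *\<^sub>R y) ` E}"


subsection \<open>The game\<close>

definition unit_column_matrices :: "(real^'n^'m) set" where
  "unit_column_matrices = {A. \<forall>j. norm (column j A) \<le> 1}"

definition sign_vectors :: "(real^'n) set" where
  "sign_vectors = {s. \<forall>j. s $ j \<in> {-1, 1}}"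

text \<open>The argument \<open>T\<close> is the number of rounds still to be played and \<open>x\<close> is the sum of the
  vectors chosen so far.  The supremum is a maximum, because the value is continuous in \<open>x\<close> and
  the set of admissible matrices is compact.  The type argument carries the number of columns.\<close>

primrec game_value_from ::
    "'n::finite itself \<Rightarrow> (real^'m) set \<Rightarrow> nat \<Rightarrow> real^'m \<Rightarrow> real" where
  "game_value_from N E 0 x = body_norm E x"
| "game_value_from N E (Suc T) x =
     (SUP A\<in>(unit_column_matrices :: (real^'n^'m) set).
        MIN s\<in>sign_vectors. game_value_from N E T (x + A *v s))"

definition game_value :: "'n::finite itself \<Rightarrow> (real^'m) set \<Rightarrow> nat \<Rightarrow> real" where
  "game_value N E T = game_value_from N E T 0"


subsection \<open>The operator of the flow\<close>

text \<open>Eigenvalues are listed with multiplicity; for symmetric \<open>M\<close> and \<open>p \<noteq> 0\<close> there are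
  \<open>CARD('m) - 1\<close> of them.  The eigenspace consists of the eigenvectors, together with \<open>0\<close>, of the quadratic form of the symmetric matrix \<open>M\<close>
  restricted to the orthogonal complement of \<open>p\<close>.\<close>

definition restricted_eigenspace :: "real^'m^'m \<Rightarrow> real^'m \<Rightarrow> real \<Rightarrow> (real^'m) set" where
  "restricted_eigenspace M p l =
     {v. v \<bullet> p = 0 \<and> (\<forall>w. w \<bullet> p = 0 \<longrightarrow> (M *v v) \<bullet> w = l * (v \<bullet> w))}"

definition restricted_eigenvalues :: "real^'m^'m \<Rightarrow> real^'m \<Rightarrow> real multiset" where
  "restricted_eigenvalues M p =
     (\<Sum>l | restricted_eigenspace M p l \<noteq> {0}.
        replicate_mset (dim (restricted_eigenspace M p l)) l)"

definition curv_op :: "nat \<Rightarrow> real^'m^'m \<Rightarrow> real^'m \<Rightarrow> real" where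
  "curv_op k M p =
     sum_list (take k (rev (sorted_list_of_multiset (restricted_eigenvalues M p))))"

definition curv_op_domain :: "((real^'m^'m) \<times> (real^'m)) set" where
  "curv_op_domain = {(M, p). transpose M = M \<and> p \<noteq> 0}"

definition curv_op_upper :: "nat \<Rightarrow> real^'m^'m \<Rightarrow> real^'m \<Rightarrow> ereal" where
  "curv_op_upper k M p =
     Limsup (at (M, p) within curv_op_domain) (\<lambda>(M', p'). ereal (curv_op k M' p'))"

definition curv_op_lower :: "nat \<Rightarrow> real^'m^'m \<Rightarrow> real^'m \<Rightarrow> ereal" where
  "curv_op_lower k M p =
     Liminf (at (M, p) within curv_op_domain) (\<lambda>(M', p'). ereal (curv_op k M' p'))"


subsection \<open>Viscosity solutions\<close>

definition usc_on :: "'a::topological_space set \<Rightarrow> ('a \<Rightarrow> real) \<Rightarrow> bool" where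
  "usc_on S f \<longleftrightarrow> (\<forall>x\<in>S. \<forall>c>f x. \<forall>\<^sub>F y in at x within S. f y < c)"

definition lsc_on :: "'a::topological_space set \<Rightarrow> ('a \<Rightarrow> real) \<Rightarrow> bool" where
  "lsc_on S f \<longleftrightarrow> (\<forall>x\<in>S. \<forall>c<f x. \<forall>\<^sub>F y in at x within S. c < f y)"

text \<open>The equation is \<open>\<partial>\<^sub>t u + F(D\<^sup>2u, \<nabla>u) = 0\<close> for \<open>t < 0\<close>, with data prescribed at the final
  time \<open>t = 0\<close>; this is why the inequalities are reversed compared with those for an
  initial value problem.  \<open>\<phi>t\<close>, \<open>g\<close>, \<open>H\<close> are the time derivative, the spatial gradient and the spatial Hessian
  of \<open>\<phi>\<close>.\<close>

definition test_function ::
    "((real^'m) \<times> real \<Rightarrow> real) \<Rightarrow> ((real^'m) \<times> real \<Rightarrow> real) \<Rightarrow>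
     ((real^'m) \<times> real \<Rightarrow> real^'m) \<Rightarrow> ((real^'m) \<times> real \<Rightarrow> real^'m^'m) \<Rightarrow> bool" where
  "test_function \<phi> \<phi>t g H \<longleftrightarrow>
     (\<forall>x. \<forall>t<0.
        ((\<lambda>s. \<phi> (x, s)) has_real_derivative \<phi>t (x, t)) (at t) \<and>
        ((\<lambda>y. \<phi> (y, t)) has_derivative (\<lambda>h. g (x, t) \<bullet> h)) (at x) \<and>
        ((\<lambda>y. g (y, t)) has_derivative (\<lambda>h. H (x, t) *v h)) (at x)) \<and>
     continuous_on (UNIV \<times> {..<0}) \<phi>t \<and>
     continuous_on (UNIV \<times> {..<0}) g \<and>
     continuous_on (UNIV \<times> {..<0}) H"

definition viscosity_subsolution :: "nat \<Rightarrow> ((real^'m) \<times> real \<Rightarrow> real) \<Rightarrow> bool" where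
  "viscosity_subsolution k u \<longleftrightarrow>
     usc_on (UNIV \<times> {..0}) u \<and>
     (\<forall>\<phi> \<phi>t g H x t.
        test_function \<phi> \<phi>t g H \<and> t < 0 \<and>
        (\<forall>\<^sub>F z in nhds (x, t). u z - \<phi> z \<le> u (x, t) - \<phi> (x, t)) \<longrightarrow>
        ereal (\<phi>t (x, t)) + curv_op_upper k (H (x, t)) (g (x, t)) \<ge> 0)"

definition viscosity_supersolution :: "nat \<Rightarrow> ((real^'m) \<times> real \<Rightarrow> real) \<Rightarrow> bool" where
  "viscosity_supersolution k u \<longleftrightarrow>
     lsc_on (UNIV \<times> {..0}) u \<and>
     (\<forall>\<phi> \<phi>t g H x t.
        test_function \<phi> \<phi>t g H \<and> t < 0 \<and>
        (\<forall>\<^sub>F z in nhds (x, t). u z - \<phi> z \<ge> u (x, t) - \<phi> (x, t)) \<longrightarrow>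
        ereal (\<phi>t (x, t)) + curv_op_lower k (H (x, t)) (g (x, t)) \<le> 0)"

definition viscosity_solution :: "nat \<Rightarrow> ((real^'m) \<times> real \<Rightarrow> real) \<Rightarrow> bool" where
  "viscosity_solution k u \<longleftrightarrow> viscosity_subsolution k u \<and> viscosity_supersolution k u"

definition linear_growth :: "((real^'m) \<times> real \<Rightarrow> real) \<Rightarrow> bool" where
  "linear_growth u \<longleftrightarrow>
     (\<forall>S>0. \<exists>C. \<forall>x. \<forall>t\<in>{-S..0}. \<bar>u (x, t)\<bar> \<le> C * (1 + norm x))"


subsection \<open>The level set flow and its extinction time\<close>

text \<open>The solution lives on \<open>t \<le> 0\<close>; membership in \<^const>\<open>extensional\<close> fixes the irrelevant
  values at \<open>t > 0\<close>, so that the definite description is unique.\<close>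

definition level_set_solution :: "nat \<Rightarrow> (real^'m) set \<Rightarrow> (real^'m) \<times> real \<Rightarrow> real" where
  "level_set_solution k E =
     (THE u. u \<in> extensional (UNIV \<times> {..0}) \<and> viscosity_solution k u \<and> linear_growth u \<and>
        (\<forall>x. u (x, 0) = body_norm E x))"

definition curvature_flow :: "nat \<Rightarrow> (real^'m) set \<Rightarrow> real \<Rightarrow> (real^'m) set" where
  "curvature_flow n E t =
     {x. level_set_solution (min n (CARD('m) - 1)) E (x, - t) \<le> 1}"

text \<open>The set below is nonempty and bounded above for every centrally symmetric convex body, so
  the supremum in the reals is the intended one.\<close>

definition extinction_time :: "nat \<Rightarrow> (real^'m) set \<Rightarrow> real" where
  "extinction_time n E = Sup {t. 0 < t \<and> interior (curvature_flow n E t) \<noteq> {}}"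

end

theory Submission
 imports Defs
begin

text \<open>Rescale the game by \<open>c\<close> in space and \<open>c^2\<close> in time. By a vector balancing argument the minimising player can
 answer any matrix by a sign vector whose second-order effect on a smooth function with gradient \<open>p\<close> and Hessian
 \<open>M\<close> is at most half the largest sum of at most \<open>k\<close> eigenvalues of \<open>M\<close> on the hyperplane orthogonal to \<open>p\<close>, while
 eigenvectors as columns force this amount. Hence the upper and lower relaxed limits of the rescaled values are a sub- and a
 supersolution of the equation for this operator. A comparison principle for three points shows that both limits
 coincide and are convex in space; on convex functions the operator is the sum of the \<open>k\<close> largest eigenvalues, so
 the limit is the level set solution. By scaling its value at the origin is \<open>l * sqrt (2 * t)\<close>, where \<open>l\<close> is the limit
 sought, and by convexity and evenness the origin is the last point to disappear, when this value reaches \<open>1\<close>.\<close>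

subsection \<open>Rademacher's theorem\<close>

text \<open>Two obstacles shape the proof. Where the gradient vanishes the operator is
  discontinuous, and there the game yields less than its envelopes: only
  \<open>phit + n^2 * l >= 0\<close> for a Hessian bounded above by \<open>l\<close>. Comparison has
  to work with subsolutions this weak, and penalties are fourth powers, whose Hessian is small
  wherever their gradient is. Secondly, the maximising player may leave columns zero, so the game
  sees the largest sum of at most \<open>k\<close> eigenvalues, which exceeds the sum of the
  \<open>k\<close> largest when some of these are negative. Convexity of the limit closes this gap;
  it comes from comparing \<open>2 w\<close> at a midpoint with \<open>v\<close> at the two end
  points, which works because sums of largest eigenvalues are convex in the matrix. The relaxed
  limits are only semicontinuous, so they are replaced by sup-convolutions, which are convex up to a
  quadratic. The second-order expansions needed at a contact point are those of Alexandrov's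
  theorem, read off from the proximal map, which is nonexpansive and hence almost everywhere
  differentiable. This is the purpose of Rademacher's theorem.\<close>

lemma emeasure_UN_mono_factor:
 fixes X :: "'i => 'a set"
 assumes "countable I" "!!i. i \<in> I ==> X i \<in> sets M" "!!i. i \<in> I ==> X i \<in> sets N"
  "disjoint_family_on X I"
  and le: "!!i. i \<in> I ==> emeasure M (X i) <= c * emeasure N (X i)"
 shows "emeasure M (\<Union>i\<in>I. X i) <= c * emeasure N (\<Union>i\<in>I. X i)"
proof -
 have "emeasure M (\<Union>i\<in>I. X i) = (\<integral>\<^sup>+i. emeasure M (X i) \<partial>count_space I)"
  using assms by (intro emeasure_UN_countable) auto
 also have "... <= (\<integral>\<^sup>+i. c * emeasure N (X i) \<partial>count_space I)"
  using le by (intro nn_integral_mono) auto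
 also have "... = c * (\<integral>\<^sup>+i. emeasure N (X i) \<partial>count_space I)"
  by (intro nn_integral_cmult) auto
 also have "(\<integral>\<^sup>+i. emeasure N (X i) \<partial>count_space I) = emeasure N (\<Union>i\<in>I. X i)"
  using assms by (intro emeasure_UN_countable[symmetric]) auto
 finally show ?thesis .
qed

section \<open>Derivates of Lipschitz functions on the line\<close>

text \<open>The intervals must contain the point but need not be centred at it, as difference
  quotients from either side require. Keeping them inside an open \<open>U\<close> preserves
  fineness and later bounds the measure of their union by that of \<open>U\<close>.\<close>

lemma vitali_intervals:
 fixes S :: "real set"
 assumes fine: "!!x d. x \<in> S ==> 0 < d ==> EX u v. u < v & u <= x & x <= v & v - u < d & R u v"
  and "open U" "S <= U"
 obtains C where "countable C" "!!u v. (u,v) \<in> C ==> u < v & R u v & {u..v} <= U"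
  "disjoint_family_on (%(u,v). {u..v}) C" "negligible (S - (\<Union>(u,v)\<in>C. {u..v}))"
proof -
 let ?K = "{(u::real,v). u < v & R u v & {u..v} <= U}"
 let ?a = "%(u,v). (u+v)/2 :: real" and ?r = "%(u,v). (v-u)/2 :: real"
 have cb: "cball (?a i) (?r i) = (%(u,v). {u..v}) i" for i
  by (cases i) (auto simp: cball_eq_atLeastAtMost field_simps)
 obtain C where C: "countable C" "C <= ?K"
  "pairwise (%i j. disjnt (cball (?a i) (?r i)) (cball (?a j) (?r j))) C"
  "negligible(S - (\<Union>i \<in> C. cball (?a i) (?r i)))"
 proof (rule Vitali_covering_theorem_cballs[of ?K ?r S ?a])
  show "0 < ?r i" if "i \<in> ?K" for i using that by (auto split: prod.splits)
  show "EX i. i \<in> ?K & x \<in> cball (?a i) (?r i) & ?r i < d" if xd: "x \<in> S" "0 < d" for x d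
  proof -
   obtain e where e: "e > 0" "ball x e <= U" using xd assms openE[of U x] by blast
   obtain u v where uv: "u < v" "u <= x" "x <= v" "v - u < min d e" "R u v"
    using fine[OF xd(1), of "min d e"] xd e by auto
   have "{u..v} <= ball x e" using uv by (auto simp: dist_real_def)
   then have "(u,v) \<in> ?K" using uv e by auto
   moreover have "x \<in> cball (?a (u,v)) (?r (u,v))" unfolding cb using uv by auto
   moreover have "?r (u,v) < d" using uv by auto
   ultimately show ?thesis by blast
  qed
 qed auto
 show ?thesis
 proof (rule that[of C])
  show "disjoint_family_on (%(u,v). {u..v}) C"
   using C(3) unfolding cb by (auto simp: disjoint_family_on_def pairwise_def disjnt_def)
  show "negligible (S - (\<Union>(u,v)\<in>C. {u..v}))" using C(4) unfolding cb by simp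
 qed (use C in auto)
qed

text \<open>Two Vitali coverings. Flat intervals cover \<open>S\<close> up to a null set inside an
  open set barely larger than \<open>S\<close>, so their union has Stieltjes mass at most
  \<open>a\<close> times about the measure of \<open>S\<close>. Steep intervals inside them cover
  \<open>S\<close> again, with mass at least \<open>b\<close> times its measure. Since
  \<open>a < b\<close>, that measure is zero.\<close>

lemma monotone_two_slopes_null:
 fixes f :: "real => real"
 assumes mono: "!!x y. x <= y ==> f x <= f y" and cont: "continuous_on UNIV f"
  and ab: "0 <= a" "a < b" and S: "S \<in> sets borel" "bounded S"
  and low: "!!x d. x \<in> S ==> 0 < d ==> EX u v. u < v & u <= x & x <= v & v - u < d & f v - f u <= a * (v - u)"
  and upp: "!!x d. x \<in> S ==> 0 < d ==> EX u v. u < v & u <= x & x <= v & v - u < d & b * (v - u) <= f v - f u"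
 shows "emeasure lborel S = 0"
proof -
 let ?mu = "interval_measure f"
 have mu: "emeasure ?mu {u..v} = ennreal (f v - f u)" if "u <= v" for u v
  by (rule emeasure_interval_measure_Icc[OF that mono cont])
 have Sfin: "emeasure lborel S < \<infinity>" by (rule emeasure_bounded_finite[OF S(2)])
 have key: "ennreal b * emeasure lborel S <= ennreal a * (emeasure lborel S + ennreal e)" if "e > 0" for e
 proof -
  obtain U where U: "open U" "S <= U" "emeasure lborel (U - S) < ennreal e"
   using outer_regular_lborel[OF S(1) \<open>e > 0\<close>] by blast
  obtain C where C: "countable C" "!!u v. (u,v) \<in> C ==> u < v & f v - f u <= a * (v - u) & {u..v} <= U"
   "disjoint_family_on (%(u,v). {u..v}) C" "negligible (S - (\<Union>(u,v)\<in>C. {u..v}))"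
  proof (rule vitali_intervals[of S "%u v. f v - f u <= a * (v - u)" U])
   show "EX u v. u < v & u <= x & x <= v & v - u < d & f v - f u <= a * (v - u)"
    if "x \<in> S" "0 < d" for x d by (rule low[OF that])
  qed (use U in auto)
  define V where "V = (\<Union>i\<in>C. (%(u,v). {u..v}) i)"
  \<comment> \<open>The steep intervals must stay inside the flat ones. Without end points the flat
    ones form an open set, at the price of countably many points.\<close>
  define V0 where "V0 = (\<Union>(u,v)\<in>C. {u<..<v})"
  have oV0: "open V0" unfolding V0_def by auto
  have V0V: "V0 <= V" unfolding V_def V0_def by fastforce
  have cnt: "countable (V - V0)"
  proof (rule countable_subset)
   show "V - V0 <= fst ` C Un snd ` C"
   proof
    fix x assume x: "x \<in> V - V0"
    then obtain u v where uv: "(u,v) \<in> C" "u <= x" "x <= v" unfolding V_def by auto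
    moreover from uv x have "~ (u < x & x < v)" unfolding V0_def by auto
    ultimately have "x = u | x = v" by auto
    with uv(1) show "x \<in> fst ` C Un snd ` C" by force
   qed
   show "countable (fst ` C Un snd ` C)" using C(1) by auto
  qed
  have Vb: "V \<in> sets borel" unfolding V_def using C(1) by (intro sets.countable_UN') auto
  have mV: "emeasure ?mu V <= ennreal a * emeasure lborel V"
   unfolding V_def
  proof (rule emeasure_UN_mono_factor[OF C(1) _ _ C(3)])
   fix i assume "i \<in> C"
   then show "emeasure ?mu ((%(u,v). {u..v}) i) <= ennreal a * emeasure lborel ((%(u,v). {u..v}) i)"
    using C(2)[of "fst i" "snd i"] ab by (auto split: prod.splits simp: mu ennreal_mult'[symmetric] intro!: ennreal_leI)
  qed (auto split: prod.splits)
  obtain D where D: "countable D" "!!u v. (u,v) \<in> D ==> u < v & b * (v - u) <= f v - f u & {u..v} <= V0"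
   "disjoint_family_on (%(u,v). {u..v}) D" "negligible ((S Int V0) - (\<Union>(u,v)\<in>D. {u..v}))"
  proof (rule vitali_intervals[of "S Int V0" "%u v. b * (v - u) <= f v - f u" V0])
   show "EX u v. u < v & u <= x & x <= v & v - u < d & b * (v - u) <= f v - f u"
    if "x \<in> S Int V0" "0 < d" for x d using that by (intro upp) auto
  qed (use oV0 in auto)
  define W where "W = (\<Union>i\<in>D. (%(u,v). {u..v}) i)"
  have Wb: "W \<in> sets borel" unfolding W_def using D(1) by (intro sets.countable_UN') auto
  have "emeasure lborel W <= ennreal (1/b) * emeasure ?mu W"
   unfolding W_def
  proof (rule emeasure_UN_mono_factor[OF D(1) _ _ D(3)])
   fix i assume "i \<in> D"
   then show "emeasure lborel ((%(u,v). {u..v}) i) <= ennreal (1/b) * emeasure ?mu ((%(u,v). {u..v}) i)"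
    using D(2)[of "fst i" "snd i"] ab
    by (auto split: prod.splits simp: mu ennreal_mult'[symmetric] field_simps intro!: ennreal_leI)
  qed (auto split: prod.splits)
  then have "ennreal b * emeasure lborel W <= ennreal b * (ennreal (1/b) * emeasure ?mu W)"
   by (rule mult_left_mono) auto
  also have "... = emeasure ?mu W" using ab by (simp add: mult.assoc[symmetric] ennreal_mult'[symmetric])
  finally have mW: "ennreal b * emeasure lborel W <= emeasure ?mu W" .
  have WV: "W <= V0" unfolding W_def using D(2) by blast
  have VU: "V <= U" unfolding V_def using C(2) by blast
  have "negligible (S - W)"
  proof (rule negligible_subset)
   show "negligible (((S Int V0) - W) Un ((S - V) Un (V - V0)))"
   proof (intro negligible_Un)
    show "negligible (V - V0)"
     by (intro negligible_iff_null_sets[THEN iffD2] null_sets_completionI countable_imp_null_set_lborel cnt)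
   qed (use C(4) D(4) in "auto simp: V_def W_def")
  qed auto
  then have nul: "S - W \<in> null_sets lborel"
   using S Wb by (subst (asm) negligible_iff_null_sets) (simp add: null_sets_completion_iff)
  have "emeasure lborel S <= emeasure lborel (W Un (S - W))"
   using S Wb by (intro emeasure_mono) auto
  also have "... = emeasure lborel W"
   by (rule emeasure_Un_null_set[OF _ nul]) (use Wb in simp)
  finally have "emeasure lborel S <= emeasure lborel W" .
  then have "ennreal b * emeasure lborel S <= ennreal b * emeasure lborel W" by (rule mult_left_mono) auto
  also have "... <= emeasure ?mu W" by (rule mW)
  also have "... <= emeasure ?mu V" using WV V0V Vb by (intro emeasure_mono) auto
  also have "... <= ennreal a * emeasure lborel V" by (rule mV)
  also have "... <= ennreal a * emeasure lborel U" using VU U(1) by (intro mult_left_mono emeasure_mono) auto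
  also have "emeasure lborel U = emeasure lborel S + emeasure lborel (U - S)"
   using S U by (subst plus_emeasure) (auto simp: Un_absorb1 )
  also have "ennreal a * (emeasure lborel S + emeasure lborel (U - S)) <= ennreal a * (emeasure lborel S + ennreal e)"
   using U(3) by (intro mult_left_mono add_left_mono) auto
  finally show ?thesis .
 qed
 obtain s where s: "emeasure lborel S = ennreal s" "s >= 0" using Sfin by (metis ennreal_cases infinity_ennreal_def less_irrefl)
 have "b * s <= a * s + e" if "e > 0" for e
 proof -
  have "a * (s + e / (a+1)) <= a * s + e" using ab that by (simp add: field_simps)
  moreover have "b * s <= a * (s + e/(a+1))"
   using key[of "e/(a+1)"] that ab s
   by (auto simp: ennreal_mult'[symmetric] ennreal_plus[symmetric] simp del: ennreal_plus)
  ultimately show ?thesis by linarith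
 qed
 then have "b * s <= a * s" by (rule field_le_epsilon)
 then have "s <= 0" using ab by (metis mult_le_cancel_right not_le)
 then show ?thesis using s by (simp add: ennreal_neg)
qed

text \<open>With \<open>- f\<close> and \<open>- b\<close> the same set captures quotients above
  \<open>b\<close>, so one definition serves the lower and the upper derivate.\<close>

definition low_slope :: "('a::real_normed_vector => real) => 'a => real => 'a set" where
 "low_slope f e a = {x. ALL d>0. EX s. s ~= 0 & \<bar>s\<bar> < d & (f (x + s *\<^sub>R e) - f x) / s < a}"

text \<open>Only the scale has to be made countable; the union over the uncountably many increments
  \<open>s\<close> is a union of open sets.\<close>

lemma low_slope_borel:
 fixes f :: "'a::euclidean_space => real"
 assumes "continuous_on UNIV f"
 shows "low_slope f e a \<in> sets borel"
proof -
 have *: "low_slope f e a = (\<Inter>n. \<Union>s\<in>{s. s ~= 0 & \<bar>s\<bar> < 1 / real (Suc n)}. {x. (f (x + s *\<^sub>R e) - f x) / s < a})"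
  (is "_ = ?R")
 proof (intro set_eqI iffI)
  fix x assume "x \<in> low_slope f e a"
  then show "x \<in> ?R" unfolding low_slope_def
   by (auto simp: zero_less_divide_iff)
 next
  fix x assume x: "x \<in> ?R"
  show "x \<in> low_slope f e a" unfolding low_slope_def
  proof safe
   fix d :: real assume "d > 0"
   then obtain n where n: "1 / real (Suc n) < d" using nat_approx_posE by blast
   from x have "x \<in> (\<Union>s\<in>{s. s ~= 0 & \<bar>s\<bar> < 1 / real (Suc n)}. {x. (f (x + s *\<^sub>R e) - f x) / s < a})" by blast
   with n show "EX s. s ~= 0 & \<bar>s\<bar> < d & (f (x + s *\<^sub>R e) - f x) / s < a" by force
  qed
 qed
 have "open {x. (f (x + s *\<^sub>R e) - f x) / s < a}" for s
 proof -
  have "continuous_on UNIV (%x. (f (x + s *\<^sub>R e) - f x) / s)"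
   by (cases "s = 0") (auto intro!: continuous_intros continuous_on_compose2[OF assms])
  then show ?thesis by (intro open_Collect_less) auto
 qed
 then have "open (\<Union>s\<in>{s. s ~= 0 & \<bar>s\<bar> < 1 / real (Suc n)}. {x. (f (x + s *\<^sub>R e) - f x) / s < a})" for n by auto
 then show ?thesis unfolding * by (intro sets.countable_INT'') (auto intro: borel_open)
qed

lemma lipschitz_two_slopes_null_real:
 fixes F :: "real => real"
 assumes lip: "!!x y. \<bar>F x - F y\<bar> <= L * \<bar>x - y\<bar>" and "a < b"
 shows "emeasure lborel (low_slope F 1 a Int low_slope (%x. - F x) 1 (-b)) = 0"
proof -
 have lip': "dist (F x) (F y) <= L * dist x y" for x y using lip by (auto simp: dist_real_def)
 have L0: "L >= 0" using lip[of 0 1] by auto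
 have "L-lipschitz_on UNIV F" using lip' L0 by (auto simp: lipschitz_on_def)
 then have cF: "continuous_on UNIV F" by (rule lipschitz_on_continuous_on)
 let ?S = "low_slope F 1 a Int low_slope (%x. - F x) 1 (-b)"
 have Sb: "?S \<in> sets borel" using cF by (intro sets.Int low_slope_borel continuous_intros) auto
 \<comment> \<open>The tilt makes the function monotone and raises both slopes by \<open>L\<close>,
   so the gap between them survives.\<close>
 let ?f = "%t. F t + L * t"
 have slope: "EX u v. u < v & u <= x & x <= v & v - u < d & (F v - F u) / (v - u) = (F (x + s) - F x) / s"
  if "s ~= 0" "\<bar>s\<bar> < d" for x s d
 proof (cases "s > 0")
  case True then show ?thesis using that by (intro exI[of _ x] exI[of _ "x+s"]) auto
 next
  case False
  then have "(F x - F (x+s)) / (x - (x+s)) = (F (x + s) - F x) / s" using that by (simp add: field_simps)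
  then show ?thesis using False that by (intro exI[of _ "x+s"] exI[of _ x]) auto
 qed
 have "?S Int cball 0 (real n) \<in> null_sets lborel" for n
 \<comment> \<open>\<open>monotone_two_slopes_null\<close> asks for a nonnegative lower slope; below
   \<open>- L\<close> no difference quotient of \<open>F\<close> occurs.\<close>
 proof (cases "a + L < 0")
  case True
  have "low_slope F 1 a = {}"
  proof safe
   fix x assume "x \<in> low_slope F 1 a"
   then have "EX s. s ~= 0 & \<bar>s\<bar> < 1 & (F (x + s) - F x) / s < a"
    by (simp add: low_slope_def)
   then obtain s where s: "s ~= 0" "(F (x + s) - F x) / s < a" by blast
   then have "L < \<bar>(F (x+s) - F x) / s\<bar>" using True by linarith
   also have "... = \<bar>F (x+s) - F x\<bar> / \<bar>s\<bar>" by simp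
   also have "... <= L" using lip[of "x+s" x] s by (simp add: pos_divide_le_eq)
   finally show "x \<in> {}" by simp
  qed
  then show ?thesis by simp
 next
  case False
  have "emeasure lborel (?S Int cball 0 (real n)) = 0"
  proof (rule monotone_two_slopes_null[of ?f "a + L" "b + L"])
   show "?f x <= ?f y" if "x <= y" for x y
    using lip[of x y] that by (auto simp: algebra_simps abs_if split: if_splits)
   show "continuous_on UNIV ?f" using cF by (intro continuous_intros) auto
   show "EX u v. u < v & u <= x & x <= v & v - u < d & ?f v - ?f u <= (a + L) * (v - u)"
    if x: "x \<in> ?S Int cball 0 (real n)" and "0 < d" for x d
   proof -
    obtain s where s: "s ~= 0" "\<bar>s\<bar> < d" "(F (x + s) - F x) / s < a"
     using x \<open>d > 0\<close> unfolding low_slope_def by auto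
    obtain u v where uv: "u < v" "u <= x" "x <= v" "v - u < d" "(F v - F u) / (v - u) = (F (x + s) - F x) / s"
     using slope[OF s(1,2)] by blast
    have "(F v - F u) / (v - u) <= a" using uv s by simp
    then have "F v - F u <= a * (v - u)" using uv(1) by (simp add: pos_divide_le_eq)
    then show ?thesis using uv by (intro exI[of _ u] exI[of _ v]) (auto simp: algebra_simps)
   qed
   show "EX u v. u < v & u <= x & x <= v & v - u < d & (b + L) * (v - u) <= ?f v - ?f u"
    if x: "x \<in> ?S Int cball 0 (real n)" and "0 < d" for x d
   proof -
    obtain s where s: "s ~= 0" "\<bar>s\<bar> < d" "(- F (x + s) - - F x) / s < - b"
     using x \<open>d > 0\<close> unfolding low_slope_def by auto
    have s3: "b < (F (x + s) - F x) / s" using s(3) by (simp add: minus_divide_left[symmetric] diff_divide_distrib)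
    obtain u v where uv: "u < v" "u <= x" "x <= v" "v - u < d" "(F v - F u) / (v - u) = (F (x + s) - F x) / s"
     using slope[OF s(1,2)] by blast
    have "b <= (F v - F u) / (v - u)" using uv s3 by simp
    then have "b * (v - u) <= F v - F u" using uv(1) by (simp add: pos_le_divide_eq)
    then show ?thesis using uv by (intro exI[of _ u] exI[of _ v]) (auto simp: algebra_simps)
   qed
  qed (use False \<open>a < b\<close> Sb in "auto simp: bounded_Int")
  then show ?thesis using Sb by (auto simp: null_sets_def)
 qed
 then have "(\<Union>n. ?S Int cball 0 (real n)) \<in> null_sets lborel" by (intro null_sets_UN) auto
 moreover have "(\<Union>n. ?S Int cball 0 (real n)) = ?S" by (auto simp: real_arch_simple)
 ultimately show ?thesis by (auto simp: null_sets_def)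
qed

section \<open>Directional derivatives almost everywhere\<close>

text \<open>All translates of \<open>S\<close> along \<open>e\<close> have the measure of
  \<open>S\<close>, so averaging over shifts in \<open>{0..1}\<close> returns it. Exchanging the
  integrals gives an integral of one-dimensional slices, which are null. In this way no coordinates
  adapted to \<open>e\<close> have to be chosen.\<close>

lemma null_set_if_lines_null:
 fixes S :: "'a::euclidean_space set"
 assumes S: "S \<in> sets borel" and line: "!!x. emeasure lborel {s::real. x + s *\<^sub>R e \<in> S} = 0"
 shows "S \<in> null_sets lborel"
proof -
 let ?f = "%(x::'a, s::real). indicator S (x + s *\<^sub>R e) * indicator {0..1} s :: ennreal"
 have meas: "?f \<in> borel_measurable (lborel \<Otimes>\<^sub>M lborel)"
 proof -
  have [measurable]: "S \<in> sets borel" by (rule S)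
  have [measurable]: "(%z::'a \<times> real. fst z + snd z *\<^sub>R e) \<in> borel_measurable (lborel \<Otimes>\<^sub>M lborel)"
   by (simp add: lborel_prod, intro borel_measurable_continuous_onI continuous_intros)
  show ?thesis unfolding case_prod_beta by measurable
 qed
 have "emeasure lborel S = (\<integral>\<^sup>+x. indicator S x \<partial>lborel)" using S by simp
 have shift: "(\<integral>\<^sup>+x. indicator S (x + s *\<^sub>R e) \<partial>lborel) = emeasure lborel S" for s
 proof -
  have "emeasure lborel S = (\<integral>\<^sup>+x. indicator S x \<partial>distr lborel borel ((+) (s *\<^sub>R e)))"
   using S by (simp add: lborel_distr_plus)
  also have "... = (\<integral>\<^sup>+x. indicator S (s *\<^sub>R e + x) \<partial>lborel)"
   using S by (subst nn_integral_distr) auto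
  finally show ?thesis by (simp add: add.commute)
 qed
 have Sm: "(%x. indicator S (x + s *\<^sub>R e) :: ennreal) \<in> borel_measurable lborel" for s
  using S by (auto intro!: measurable_compose[of "%x. x + s *\<^sub>R e" lborel borel])
 have "(\<integral>\<^sup>+s. (\<integral>\<^sup>+x. ?f (x, s) \<partial>lborel) \<partial>lborel) = (\<integral>\<^sup>+s. emeasure lborel S * indicator {0..1::real} s \<partial>lborel)"
  using Sm by (intro nn_integral_cong) (simp add: nn_integral_multc shift)
 also have "... = emeasure lborel S" by (simp add: nn_integral_cmult)
 finally have 1: "(\<integral>\<^sup>+s. (\<integral>\<^sup>+x. ?f (x, s) \<partial>lborel) \<partial>lborel) = emeasure lborel S" .
 have "(\<integral>\<^sup>+x. (\<integral>\<^sup>+s. ?f (x, s) \<partial>lborel) \<partial>lborel) = (\<integral>\<^sup>+x. 0 \<partial>(lborel::'a measure))"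
 proof (rule nn_integral_cong)
  fix x :: 'a
  have b: "{s::real. x + s *\<^sub>R e \<in> S} \<in> sets borel"
   using measurable_sets_borel[of "%s::real. x + s *\<^sub>R e" borel S] S by (simp add: vimage_def)
  have "(\<integral>\<^sup>+s. ?f (x, s) \<partial>lborel) <= (\<integral>\<^sup>+s. indicator {s::real. x + s *\<^sub>R e \<in> S} s \<partial>lborel)"
   by (intro nn_integral_mono) (auto simp: indicator_def)
  also have "... = 0" using b line[of x] by simp
  finally show "(\<integral>\<^sup>+s. ?f (x, s) \<partial>lborel) = 0" by simp
 qed
 then have "(\<integral>\<^sup>+x. (\<integral>\<^sup>+s. ?f (x, s) \<partial>lborel) \<partial>lborel) = 0" by simp
 moreover have "(\<integral>\<^sup>+s. (\<integral>\<^sup>+x. ?f (x, s) \<partial>lborel) \<partial>lborel) = (\<integral>\<^sup>+x. (\<integral>\<^sup>+s. ?f (x, s) \<partial>lborel) \<partial>lborel)"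
  using lborel_pair.Fubini[OF meas] by simp
 ultimately show ?thesis using 1 S by (auto simp: null_sets_def)
qed

lemma lipschitz_two_slopes_null:
 fixes f :: "'a::euclidean_space => real"
 assumes lip: "!!x y. \<bar>f x - f y\<bar> <= L * norm (x - y)" and "a < b" and e: "norm e = 1"
 shows "low_slope f e a Int low_slope (%x. - f x) e (-b) \<in> null_sets lborel"
proof (rule null_set_if_lines_null)
 have L0: "L >= 0" using lip[of 0 e] e by (smt (verit) norm_minus_cancel diff_0 mult_cancel_left2 mult_1_right)
 have "L-lipschitz_on UNIV f" using lip L0 by (auto simp: lipschitz_on_def dist_norm)
 then have cF: "continuous_on UNIV f" by (rule lipschitz_on_continuous_on)
 then show "low_slope f e a Int low_slope (%x. - f x) e (-b) \<in> sets borel"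
  by (intro sets.Int low_slope_borel continuous_intros) auto
 fix x
 let ?F = "%s. f (x + s *\<^sub>R e)"
 have "{s. x + s *\<^sub>R e \<in> low_slope f e a Int low_slope (%x. - f x) e (-b)} =
  low_slope ?F 1 a Int low_slope (%s. - ?F s) 1 (-b)"
  by (auto simp: low_slope_def algebra_simps)
 moreover have "emeasure lborel (low_slope ?F 1 a Int low_slope (%s. - ?F s) 1 (-b)) = 0"
 proof (rule lipschitz_two_slopes_null_real[of ?F L])
  fix s t :: real
  have "\<bar>?F s - ?F t\<bar> <= L * norm ((s - t) *\<^sub>R e)" using lip[of "x + s *\<^sub>R e" "x + t *\<^sub>R e"] by (simp add: algebra_simps)
  then show "\<bar>?F s - ?F t\<bar> <= L * \<bar>s - t\<bar>" using e by simp
 qed (rule \<open>a < b\<close>)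
 ultimately show "emeasure lborel {s. x + s *\<^sub>R e \<in> low_slope f e a Int low_slope (%x. - f x) e (-b)} = 0" by simp
qed

text \<open>The limit is the supremum of the eventual lower bounds. Only rational gaps are tested,
  so that a countable union of null sets suffices for the existence of a directional
  derivative.\<close>

lemma tendsto_if_no_gap:
 fixes q :: "'b => real"
 assumes bd: "!!s. \<bar>q s\<bar> <= L" and nt: "F ~= bot"
  and gap: "!!a b. a \<in> \<rat> ==> b \<in> \<rat> ==> a < b ==> (\<forall>\<^sub>F s in F. a <= q s) | (\<forall>\<^sub>F s in F. q s <= b)"
 shows "EX D. (q \<longlongrightarrow> D) F"
proof -
 define A where "A = {a. \<forall>\<^sub>F s in F. a <= q s}"
 have A1: "- L \<in> A" unfolding A_def using bd by (auto intro!: always_eventually simp: abs_le_iff minus_le_iff)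
 have A2: "a <= L" if "a \<in> A" for a
 proof -
  have "\<forall>\<^sub>F s in F. a <= L" using that unfolding A_def mem_Collect_eq
   by (rule eventually_mono) (use bd in "auto simp: abs_le_iff intro: order_trans")
  then show ?thesis using nt by (simp add: eventually_const_iff)
 qed
 then have bdd: "bdd_above A" by (auto simp: bdd_above_def)
 define D where "D = Sup A"
 have "(q \<longlongrightarrow> D) F"
 proof (rule order_tendstoI)
  fix y assume "y < D"
  then obtain a where "a \<in> A" "y < a" unfolding D_def using less_cSup_iff[of A y] A1 bdd by auto
  then show "\<forall>\<^sub>F s in F. y < q s" unfolding A_def by (auto elim: eventually_mono)
 next
  fix y assume "D < y"
  obtain a where a: "a \<in> \<rat>" "D < a" "a < y" using Rats_dense_in_real[OF \<open>D < y\<close>] by blast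
  obtain b where b: "b \<in> \<rat>" "a < b" "b < y" using Rats_dense_in_real[OF \<open>a < y\<close>] by blast
  have "a ~: A" using a(2) cSup_upper[OF _ bdd, of a] unfolding D_def by auto
  then have "\<forall>\<^sub>F s in F. q s <= b" using gap[OF a(1) b(1,2)] unfolding A_def by auto
  then show "\<forall>\<^sub>F s in F. q s < y" by (rule eventually_mono) (use b in auto)
 qed
 then show ?thesis by blast
qed

section \<open>Porous points and total differentiability\<close>

text \<open>A disjoint Vitali family of balls covers almost all porous points of \<open>A\<close>,
  and each ball contains a hole of proportional measure that misses \<open>A\<close>. The holes lie
  in the small difference between the set and an open neighbourhood, so the measure of the set is at
  most a constant times that of the difference.\<close>

lemma porous_points_null:
 fixes A :: "'a::euclidean_space set"
 assumes A: "closed A" and theta: "0 < theta" "theta <= 1"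
 defines "B == {x. ALL n. EX d y. 0 < d & d < 1 / real (Suc n) & y \<in> ball x d & ball y (theta * d) Int A = {}}"
 shows "A Int B \<in> null_sets lborel"
proof -
 have Bb: "B \<in> sets borel"
 proof -
  have "B = (\<Inter>n. \<Union>(d,y)\<in>{(d,y). 0 < d & d < 1 / real (Suc n) & ball y (theta * d) Int A = {}}. ball y d)"
  proof (intro set_eqI iffI)
   fix x assume "x \<in> B"
   then show "x \<in> (\<Inter>n. \<Union>(d,y)\<in>{(d,y). 0 < d & d < 1 / real (Suc n) & ball y (theta * d) Int A = {}}. ball y d)"
    unfolding B_def by (fastforce simp: dist_commute)
  next
   fix x assume x: "x \<in> (\<Inter>n. \<Union>(d,y)\<in>{(d,y). 0 < d & d < 1 / real (Suc n) & ball y (theta * d) Int A = {}}. ball y d)"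
   show "x \<in> B" unfolding B_def
   proof safe
    fix n
    from x have "x \<in> (\<Union>(d,y)\<in>{(d,y). 0 < d & d < 1 / real (Suc n) & ball y (theta * d) Int A = {}}. ball y d)" by blast
    then show "EX d y. 0 < d & d < 1 / real (Suc n) & y \<in> ball x d & ball y (theta * d) Int A = {}"
     by (auto simp: dist_commute simp del: of_nat_Suc)
   qed
  qed
  also have "... \<in> sets borel" by (intro sets.countable_INT'') (auto intro!: borel_open open_UN)
  finally show ?thesis .
 qed
 define N where "N = DIM('a)"
 have ball_scale: "emeasure lborel (ball x (c * r)) = ennreal (c ^ N) * emeasure lborel (ball y r)"
  if "0 <= c" "0 <= r" for c r :: real and x y :: 'a
  using that unfolding N_def by (simp add: emeasure_ball power_mult_distrib ennreal_mult'[symmetric] algebra_simps)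
 have "(A Int B) Int ball 0 (real k) \<in> null_sets lborel" for k
 proof -
  let ?S = "(A Int B) Int ball 0 (real k)"
  have Sb: "?S \<in> sets borel" using A Bb by auto
  have key: "emeasure lborel ?S <= ennreal ((2/theta) ^ N) * ennreal e" if "e > 0" for e
  proof -
   obtain U where U: "open U" "?S <= U" "emeasure lborel (U - ?S) < ennreal e"
    using outer_regular_lborel[OF Sb \<open>e > 0\<close>] by blast
   \<comment> \<open>The radius \<open>2 * d\<close> lets the ball around \<open>x\<close> contain
     the hole of radius \<open>theta * d\<close> around a point \<open>y\<close> within distance
     \<open>d\<close>; the quotient of the two radii is the \<open>2 / theta\<close> in
     \<open>key\<close>.\<close>
   let ?K = "{(x::'a, d::real, y). 0 < d & y \<in> ball x d & ball y (theta * d) Int A = {} & ball x (2*d) <= U}"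
   let ?a = "%(x::'a, d::real, y::'a). x" and ?r = "%(x::'a, d::real, y::'a). 2 * d"
   obtain C where C: "countable C" "C <= ?K" "pairwise (%i j. disjnt (ball (?a i) (?r i)) (ball (?a j) (?r j))) C"
    "negligible (?S - (\<Union>i\<in>C. ball (?a i) (?r i)))"
   proof (rule Vitali_covering_theorem_balls[of ?S ?K ?a ?r])
    fix x and d :: real assume x: "x \<in> ?S" and "0 < d"
    obtain eps where eps: "eps > 0" "ball x eps <= U" using x U(1,2) openE[of U x] by blast
    have "0 < min eps d / 2" using eps \<open>0 < d\<close> by auto
    then obtain n where n: "1 / real (Suc n) < min eps d / 2" using nat_approx_posE by blast
    obtain d' y where d': "0 < d'" "d' < 1 / real (Suc n)" "y \<in> ball x d'" "ball y (theta * d') Int A = {}"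
     using x unfolding B_def by blast
    have "ball x (2*d') <= ball x eps" using d' n by (intro subset_ball) auto
    then have "(x, d', y) \<in> ?K" using d' eps by auto
    then show "EX i. i \<in> ?K & x \<in> ball (?a i) (?r i) & ?r i < d" using d' n
     by (intro exI[of _ "(x,d',y)"]) auto
   qed auto
   let ?X = "%i. ball (?a i) (?r i)" and ?H = "%(x::'a, d::real, y::'a). ball y (theta * d)"
   have HX: "?H i <= ?X i" if "i \<in> C" for i
   proof -
    obtain x d y where i: "i = (x, d, y)" by (cases i)
    have *: "0 < d" "dist x y < d" using that C(2) i by auto
    have "theta * d <= d" using theta * by auto
    have "ball y (theta * d) <= ball x (2 * d)"
    proof
     fix z assume "z \<in> ball y (theta * d)"
     then have "dist y z < d" using \<open>theta * d <= d\<close> by auto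
     then show "z \<in> ball x (2 * d)" using *(2) dist_triangle[of x z y] by auto
    qed
    then show ?thesis using i by simp
   qed
   have disX: "disjoint_family_on ?X C"
    using C(3) unfolding disjoint_family_on_def pairwise_def disjnt_def by blast
   have disH: "disjoint_family_on ?H C"
    unfolding disjoint_family_on_def
   proof (intro ballI impI)
    fix i j assume "i \<in> C" "j \<in> C" "i ~= j"
    then have "?X i Int ?X j = {}" using disX unfolding disjoint_family_on_def by blast
    then show "?H i Int ?H j = {}" using HX[OF \<open>i \<in> C\<close>] HX[OF \<open>j \<in> C\<close>] by blast
   qed
   let ?V = "\<Union>i\<in>C. ?X i" and ?W = "\<Union>i\<in>C. ?H i"
   have Vb: "?V \<in> sets borel" using C(1) by (intro sets.countable_UN') (auto split: prod.splits)
   have "emeasure lborel ?V = (\<integral>\<^sup>+i. emeasure lborel (?X i) \<partial>count_space C)"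
    using C(1) disX by (intro emeasure_UN_countable) (auto split: prod.splits)
   also have "... = (\<integral>\<^sup>+i. ennreal ((2/theta) ^ N) * emeasure lborel (?H i) \<partial>count_space C)"
   proof (intro nn_integral_cong)
    fix i assume "i \<in> space (count_space C)"
    then have "i \<in> C" by simp
    obtain x d y where i: "i = (x, d, y)" by (cases i)
    have "0 < d" using \<open>i \<in> C\<close> C(2) i by auto
    have "emeasure lborel (ball x ((2/theta) * (theta * d))) = ennreal ((2/theta) ^ N) * emeasure lborel (ball y (theta * d))"
     using theta \<open>0 < d\<close> by (intro ball_scale) auto
    then show "emeasure lborel (?X i) = ennreal ((2/theta) ^ N) * emeasure lborel (?H i)" using i theta by simp
   qed
   also have "... = ennreal ((2/theta) ^ N) * (\<integral>\<^sup>+i. emeasure lborel (?H i) \<partial>count_space C)"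
    by (intro nn_integral_cmult) auto
   also have "(\<integral>\<^sup>+i. emeasure lborel (?H i) \<partial>count_space C) = emeasure lborel ?W"
    using C(1) disH by (intro emeasure_UN_countable[symmetric]) (auto split: prod.splits)
   finally have VW: "emeasure lborel ?V = ennreal ((2/theta) ^ N) * emeasure lborel ?W" .
   have VU: "?V <= U" using C(2) by auto
   have WU: "?W <= U - ?S"
   proof
    fix z assume "z \<in> ?W"
    then obtain i where i: "i \<in> C" "z \<in> ?H i" by blast
    then have "z \<in> ?V" using HX by blast
    moreover have "?H i Int A = {}" using subsetD[OF C(2) i(1)] by (cases i) auto
    then have "z ~: A" using i(2) by blast
    ultimately show "z \<in> U - ?S" using VU by blast
   qed
   have "emeasure lborel ?W <= emeasure lborel (U - ?S)" using WU U(1) Sb by (intro emeasure_mono) auto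
   also have "... <= ennreal e" using U(3) by simp
   finally have We: "emeasure lborel ?W <= ennreal e" .
   have nul: "?S - ?V \<in> null_sets lborel"
    using C(4) Sb Vb by (subst (asm) negligible_iff_null_sets) (simp add: null_sets_completion_iff)
   have "emeasure lborel ?S <= emeasure lborel (?V Un (?S - ?V))"
    using Sb Vb by (intro emeasure_mono) auto
   also have "... = emeasure lborel ?V"
    by (rule emeasure_Un_null_set[OF _ nul]) (use Vb in simp)
   also have "... <= ennreal ((2/theta) ^ N) * ennreal e" unfolding VW using We by (intro mult_left_mono) auto
   finally show ?thesis .
  qed
  have c: "(2/theta) ^ N > 0" using theta by simp
  have "emeasure lborel ?S <= 0 + ennreal e" if "e > 0" for e
  proof -
   have "emeasure lborel ?S <= ennreal ((2/theta) ^ N) * ennreal (e / (2/theta)^N)"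
    using that c by (intro key) (rule divide_pos_pos)
   also have "... = ennreal ((2/theta) ^ N * (e / (2/theta)^N))"
    using c that by (intro ennreal_mult[symmetric] less_imp_le divide_pos_pos)
   also have "(2/theta) ^ N * (e / (2/theta)^N) = e" using theta by simp
   finally show ?thesis by simp
  qed
  then have "emeasure lborel ?S <= 0" by (rule ennreal_le_epsilon)
  then have "emeasure lborel ?S = 0" by simp
  then show "?S \<in> null_sets lborel" using Sb by (simp add: null_sets_def)
 qed
 then have "(\<Union>k. (A Int B) Int ball 0 (real k)) \<in> null_sets lborel" by (intro null_sets_UN) auto
 moreover have "(\<Union>k. (A Int B) Int ball 0 (real k)) = A Int B" by (auto simp: reals_Archimedean2)
 ultimately show ?thesis by simp
qed

text \<open>At a non-porous point \<open>x\<close> of the set where all difference quotients in the coordinate directions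
 are close to constants \<open>c b\<close>, an arbitrary increment is decomposed into coordinate increments, each of
 which may be started at a nearby point of the set.\<close>

lemma rademacher_approx:
 fixes f :: "'a::euclidean_space => real"
 assumes lip: "!!x y. \<bar>f x - f y\<bar> <= L * norm (x - y)" and L: "0 <= L" and eps: "0 < eps" "eps <= 1" and r: "0 < r"
  and A: "!!x b s. x \<in> A ==> b \<in> Basis ==> \<bar>s\<bar> <= r ==> \<bar>f (x + s *\<^sub>R b) - f x - c b * s\<bar> <= eps * \<bar>s\<bar>"
  and np: "d0 > 0" "!!d y. 0 < d ==> d < d0 ==> y \<in> ball x d ==> ball y (eps * d) Int A ~= {}"
 shows "EX delta>0. ALL h. norm h < delta -->
  \<bar>f (x + h) - f x - (\<Sum>b\<in>Basis. c b * (h \<bullet> b))\<bar> <= real DIM('a) * ((1 + 2 * L * (real DIM('a) + 1)) * eps * norm h)"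
proof -
 \<comment> \<open>Partial sums of the coordinate increments have norm at most
   \<open>DIM('a) * norm h\<close>; the extra unit puts them strictly inside the open ball to which
   non-porosity applies.\<close>
 define N where "N = real DIM('a) + 1"
 have N: "N >= 1" unfolding N_def by simp
 define delta where "delta = min r (d0 / N)"
 have "delta > 0" unfolding delta_def using r np N by auto
 moreover have "\<bar>f (x + h) - f x - (\<Sum>b\<in>Basis. c b * (h \<bullet> b))\<bar> <= real DIM('a) * ((1 + 2 * L * N) * eps * norm h)"
  if h: "norm h < delta" for h
 proof (cases "h = 0")
  case True then show ?thesis by simp
 next
  case False
  then have nh: "norm h > 0" by simp
  have "N * norm h < d0" using h N unfolding delta_def by (simp add: pos_less_divide_eq mult.commute)
  have "\<bar>f (x + (\<Sum>b\<in>B. (h \<bullet> b) *\<^sub>R b)) - f x - (\<Sum>b\<in>B. c b * (h \<bullet> b))\<bar> <= real (card B) * ((1 + 2 * L * N) * eps * norm h)"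
   if "finite B" "B <= Basis" for B
   using that
  proof (induction B rule: finite_induct)
   case empty then show ?case by simp
  next
   case (insert b B)
   let ?y = "x + (\<Sum>b\<in>B. (h \<bullet> b) *\<^sub>R b)" and ?s = "h \<bullet> b"
   have bB: "b \<in> Basis" using insert by auto
   have s: "\<bar>?s\<bar> <= norm h" using bB by (rule Basis_le_norm)
   have "norm (\<Sum>b\<in>B. (h \<bullet> b) *\<^sub>R b) <= (\<Sum>b\<in>B. norm h)"
    using insert by (intro sum_norm_le) (auto simp: subset_iff intro: Basis_le_norm)
   also have "... <= real DIM('a) * norm h"
    using insert card_mono[of Basis B] by (simp add: mult_right_mono)
   also have "... < N * norm h" unfolding N_def using nh by simp
   finally have "?y \<in> ball x (N * norm h)" by (simp add: dist_norm)
   then obtain x' where x': "x' \<in> A" "dist ?y x' < eps * (N * norm h)"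
    using np(2)[of "N * norm h" ?y] \<open>N * norm h < d0\<close> nh N by auto
   have 1: "\<bar>f (x' + ?s *\<^sub>R b) - f x' - c b * ?s\<bar> <= eps * \<bar>?s\<bar>"
    using A[OF x'(1) bB, of ?s] s h unfolding delta_def by auto
   have dx: "norm (?y - x') <= eps * (N * norm h)" using x'(2) by (simp add: dist_norm)
   have "L * norm (?y - x') <= L * (eps * (N * norm h))" by (rule mult_left_mono[OF dx L])
   then have 2: "\<bar>f ?y - f x'\<bar> <= L * (eps * (N * norm h))" using lip[of ?y x'] by linarith
   have "\<bar>f (?y + ?s *\<^sub>R b) - f (x' + ?s *\<^sub>R b)\<bar> <= L * norm (?y - x')" using lip[of "?y + ?s *\<^sub>R b" "x' + ?s *\<^sub>R b"] by simp
   then have 3: "\<bar>f (?y + ?s *\<^sub>R b) - f (x' + ?s *\<^sub>R b)\<bar> <= L * (eps * (N * norm h))"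
    using \<open>L * norm (?y - x') <= L * (eps * (N * norm h))\<close> by linarith
   have "eps * \<bar>?s\<bar> <= eps * norm h" using s eps by (intro mult_left_mono) auto
   then have 4: "\<bar>f (?y + ?s *\<^sub>R b) - f ?y - c b * ?s\<bar> <= (1 + 2 * L * N) * eps * norm h"
    using 1 2 3 by (simp add: algebra_simps abs_le_iff)
   have eq: "x + (\<Sum>b\<in>insert b B. (h \<bullet> b) *\<^sub>R b) = ?y + ?s *\<^sub>R b" using insert by (simp add: algebra_simps)
   have "\<bar>f ?y - f x - (\<Sum>b\<in>B. c b * (h \<bullet> b))\<bar> <= real (card B) * ((1 + 2 * L * N) * eps * norm h)"
    using insert by auto
   with 4 have "\<bar>f (?y + ?s *\<^sub>R b) - f x - (c b * ?s + (\<Sum>b\<in>B. c b * (h \<bullet> b)))\<bar> <=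
     (1 + 2 * L * N) * eps * norm h + real (card B) * ((1 + 2 * L * N) * eps * norm h)" by linarith
   then show ?case unfolding eq using insert.hyps by (simp add: algebra_simps)
  qed
  from this[of Basis] show ?thesis by (simp add: euclidean_representation)
 qed
 ultimately show ?thesis unfolding N_def by blast
qed

text \<open>\<open>G1\<close> collects the points at which a partial difference quotient oscillates
  across a rational gap, \<open>G2\<close> the porous points of countably many sets
  \<open>A c eps r\<close> with rational slopes \<open>c\<close>. Any other point lies, for every
  tolerance, in such a set whose slopes approximate its partial derivatives, and is not porous
  there, so \<open>rademacher_approx\<close> applies.\<close>

theorem rademacher_real:
 fixes f :: "'a::euclidean_space => real"
 assumes lip: "!!x y. \<bar>f x - f y\<bar> <= L * norm (x - y)" and L: "0 <= L"
 shows "negligible {x. ~ f differentiable (at x)}"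
proof -
 have "L-lipschitz_on UNIV f" using lip L by (auto simp: lipschitz_on_def dist_norm)
 then have cf: "continuous_on UNIV f" by (rule lipschitz_on_continuous_on)
 define G1 where "G1 = (\<Union>b\<in>Basis. \<Union>(p,q)\<in>{(p,q). p \<in> \<rat> & q \<in> \<rat> & p < q}. low_slope f b p Int low_slope (%x. - f x) b (-q))"
 have G1: "G1 \<in> null_sets lborel"
 proof -
  have "countable {(p,q). p \<in> \<rat> & q \<in> (\<rat>::real set) & p < q}"
   by (rule countable_subset[of _ "\<rat> \<times> \<rat>"]) (auto intro: countable_rat)
  then show ?thesis unfolding G1_def
   by (intro null_sets_UN' uncountable_infinite) (auto intro!: null_sets_UN' lipschitz_two_slopes_null[OF lip] intro: countable_finite)
 qed
 define Q where "Q = (PiE (Basis::'a set) (%_. \<rat>) :: ('a => real) set)"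
 have Q: "countable Q" unfolding Q_def by (intro countable_PiE) (auto intro: countable_rat)
 define A where "A c eps r = (\<Inter>b\<in>Basis. \<Inter>s\<in>{-r..r}. {x. \<bar>f (x + s *\<^sub>R b) - f x - c b * s\<bar> <= eps * \<bar>s\<bar>})" for c and eps r :: real
 have clA: "closed (A c eps r)" for c eps r
  unfolding A_def
  by (intro closed_INT ballI closed_Collect_le continuous_intros continuous_on_compose2[OF cf]) auto
 define P where "P A theta = {x::'a. ALL n. EX d y. 0 < d & d < 1 / real (Suc n) & y \<in> ball x d & ball y (theta * d) Int A = {}}" for A and theta :: real
 define e where "e j = 1 / real (Suc j)" for j
 have e: "0 < e j" "e j <= 1" for j unfolding e_def by auto
 define G2 where "G2 = (\<Union>c\<in>Q. \<Union>j. \<Union>k. A c (e j) (e k) Int P (A c (e j) (e k)) (e j))"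
 have G2: "G2 \<in> null_sets lborel"
  unfolding G2_def P_def using Q by (intro null_sets_UN' null_sets_UN porous_points_null clA e) auto
 have "f differentiable (at x)" if x: "x ~: G1" "x ~: G2" for x
 proof -
  have "EX D. ((%s. (f (x + s *\<^sub>R b) - f x) / s) \<longlongrightarrow> D) (at 0)" if b: "b \<in> Basis" for b
  proof (rule tendsto_if_no_gap[of _ L])
   fix s :: real
   show "\<bar>(f (x + s *\<^sub>R b) - f x) / s\<bar> <= L"
    using lip[of "x + s *\<^sub>R b" x] b L by (cases "s = 0") (auto simp: pos_divide_le_eq)
  next
   fix p q :: real assume pq: "p \<in> \<rat>" "q \<in> \<rat>" "p < q"
   then have "x ~: low_slope f b p | x ~: low_slope (%x. - f x) b (-q)" using x(1) b unfolding G1_def by auto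
   then show "(\<forall>\<^sub>F s in at 0. p <= (f (x + s *\<^sub>R b) - f x) / s) | (\<forall>\<^sub>F s in at 0. (f (x + s *\<^sub>R b) - f x) / s <= q)"
   proof
    assume "x ~: low_slope f b p"
    then obtain d where d: "d > 0" "ALL s. ~ (s ~= 0 & \<bar>s\<bar> < d & (f (x + s *\<^sub>R b) - f x) / s < p)"
     unfolding low_slope_def by blast
    then have "\<forall>\<^sub>F s in at 0. p <= (f (x + s *\<^sub>R b) - f x) / s" unfolding eventually_at
     by (intro exI[of _ d]) (auto simp: dist_real_def not_less)
    then show ?thesis ..
   next
    assume "x ~: low_slope (%x. - f x) b (-q)"
    then obtain d where d0: "d > 0" "ALL s. ~ (s ~= 0 & \<bar>s\<bar> < d & (- f (x + s *\<^sub>R b) - - f x) / s < - q)"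
     unfolding low_slope_def by blast
    then have d: "d > 0" "!!s. s ~= 0 ==> \<bar>s\<bar> < d ==> - q <= (- f (x + s *\<^sub>R b) - - f x) / s"
     by (auto simp: not_less)
    have "(f (x + s *\<^sub>R b) - f x) / s <= q" if "s ~= 0" "\<bar>s\<bar> < d" for s
    proof -
     have "(- f (x + s *\<^sub>R b) - - f x) / s = - ((f (x + s *\<^sub>R b) - f x) / s)" by (simp add: minus_divide_left)
     with d(2)[OF that] show ?thesis by linarith
    qed
    then show ?thesis unfolding eventually_at using d(1) by (auto simp: dist_real_def)
   qed
  qed simp
  then obtain D where D: "!!b. b \<in> Basis ==> ((%s. (f (x + s *\<^sub>R b) - f x) / s) \<longlongrightarrow> D b) (at 0)" by metis
  \<comment> \<open>The first summand is the constant of \<open>rademacher_approx\<close>, the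
    second leaves room for replacing the rational slopes by the partial derivatives.\<close>
  define M where "M = real DIM('a) * ((1 + 2 * L * (real DIM('a) + 1))) + 2 * real DIM('a)"
  have M: "M >= 0" unfolding M_def using L by auto
  have app: "EX delta>0. ALL h. norm h < delta --> \<bar>f (x + h) - f x - (\<Sum>b\<in>Basis. D b * (h \<bullet> b))\<bar> <= M * e j * norm h" for j
  proof -
   have "EX c:\<rat>. \<bar>c - D b\<bar> < e j / 2" for b
    using Rats_dense_in_real[of "D b - e j / 2" "D b"] e[of j] by force
   then obtain c where c: "!!b. c b \<in> \<rat>" "!!b. \<bar>c b - D b\<bar> < e j / 2" by metis
   define c' where "c' = restrict c Basis"
   have c'Q: "c' \<in> Q" unfolding c'_def Q_def using c by auto
   have "\<forall>\<^sub>F s in at 0. ALL b:Basis. dist ((f (x + s *\<^sub>R b) - f x) / s) (D b) < e j / 2"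
    using D e[of j] by (intro eventually_ball_finite ballI tendstoD) auto
   then obtain rho where rho: "rho > 0" "!!s b. s ~= 0 ==> \<bar>s\<bar> < rho ==> b \<in> Basis ==> \<bar>(f (x + s *\<^sub>R b) - f x) / s - D b\<bar> < e j / 2"
    unfolding eventually_at by (auto simp: dist_real_def)
   obtain k where k: "e k < rho" unfolding e_def using nat_approx_posE[OF rho(1)] by metis
   have xA: "x \<in> A c' (e j) (e k)"
    unfolding A_def
   proof (intro INT_I CollectI)
    fix b :: 'a and s assume b: "b \<in> Basis" and s: "s \<in> {- e k..e k}"
    show "\<bar>f (x + s *\<^sub>R b) - f x - c' b * s\<bar> <= e j * \<bar>s\<bar>"
    proof (cases "s = 0")
     case False
     have "\<bar>(f (x + s *\<^sub>R b) - f x) / s - c b\<bar> <= e j"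
     proof -
      have "\<bar>s\<bar> < rho" using s k by (auto simp: abs_le_iff)
      from rho(2)[OF False this b] c(2)[of b] show ?thesis by linarith
     qed
     then have "\<bar>(f (x + s *\<^sub>R b) - f x) / s - c b\<bar> * \<bar>s\<bar> <= e j * \<bar>s\<bar>" by (intro mult_right_mono) auto
     also have "\<bar>(f (x + s *\<^sub>R b) - f x) / s - c b\<bar> * \<bar>s\<bar> = \<bar>((f (x + s *\<^sub>R b) - f x) / s - c b) * s\<bar>" by (simp only: abs_mult)
     also have "((f (x + s *\<^sub>R b) - f x) / s - c b) * s = f (x + s *\<^sub>R b) - f x - c b * s"
      using False by (simp add: left_diff_distrib[of _ "c b"])
     finally show ?thesis using b by (simp add: c'_def)
    qed simp
   qed
   then have "x ~: P (A c' (e j) (e k)) (e j)" using x(2) c'Q unfolding G2_def by blast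
   then obtain n where n: "!!d y. 0 < d ==> d < 1 / real (Suc n) ==> y \<in> ball x d ==> ball y (e j * d) Int A c' (e j) (e k) ~= {}"
    unfolding P_def by blast
   have Ap: "\<bar>f (x + s *\<^sub>R b) - f x - c' b * s\<bar> <= e j * \<bar>s\<bar>" if "x \<in> A c' (e j) (e k)" "b \<in> Basis" "\<bar>s\<bar> <= e k" for x b s
    using that unfolding A_def by (auto simp: abs_le_iff minus_le_iff)
   have "1 / real (Suc n) > 0" by simp
   from rademacher_approx[OF lip L e(1)[of j] e(2)[of j] e(1)[of k] Ap this n]
   obtain delta where delta: "delta > 0" "!!h. norm h < delta ==>
    \<bar>f (x + h) - f x - (\<Sum>b\<in>Basis. c' b * (h \<bullet> b))\<bar> <= real DIM('a) * ((1 + 2 * L * (real DIM('a) + 1)) * e j * norm h)"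
    by blast
   have "\<bar>f (x + h) - f x - (\<Sum>b\<in>Basis. D b * (h \<bullet> b))\<bar> <= M * e j * norm h" if "norm h < delta" for h
   proof -
    have "\<bar>(\<Sum>b\<in>Basis. c' b * (h \<bullet> b)) - (\<Sum>b\<in>Basis. D b * (h \<bullet> b))\<bar> = \<bar>\<Sum>b\<in>Basis. (c' b - D b) * (h \<bullet> b)\<bar>"
     by (simp add: sum_subtractf left_diff_distrib)
    also have "... <= (\<Sum>b\<in>(Basis::'a set). e j * norm h)"
    proof (rule order_trans[OF sum_abs sum_mono])
     fix b :: 'a assume b: "b \<in> Basis"
     have "\<bar>c' b - D b\<bar> * \<bar>h \<bullet> b\<bar> <= e j * norm h"
      using b c(2)[of b] e[of j] Basis_le_norm[OF b, of h] by (intro mult_mono) (auto simp: c'_def)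
     then show "\<bar>(c' b - D b) * (h \<bullet> b)\<bar> <= e j * norm h" by (simp add: abs_mult)
    qed
    also have "... = real DIM('a) * (e j * norm h)" by simp
    finally have 1: "\<bar>(\<Sum>b\<in>Basis. c' b * (h \<bullet> b)) - (\<Sum>b\<in>Basis. D b * (h \<bullet> b))\<bar> <= real DIM('a) * (e j * norm h)" .
    have "0 <= real DIM('a) * (e j * norm h)" using e[of j] by auto
    moreover have "M * e j * norm h = real DIM('a) * ((1 + 2 * L * (real DIM('a) + 1)) * e j * norm h) + 2 * (real DIM('a) * (e j * norm h))"
     unfolding M_def by (simp add: algebra_simps)
    ultimately show ?thesis using 1 delta(2)[OF that] by linarith
   qed
   with delta(1) show ?thesis by blast
  qed
  have "(f has_derivative (%h. \<Sum>b\<in>Basis. D b * (h \<bullet> b))) (at x)"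
   unfolding has_derivative_at_alt
  proof (intro conjI allI impI)
   show "bounded_linear (%h. \<Sum>b\<in>Basis. D b * (h \<bullet> b))"
    by (intro bounded_linear_sum bounded_linear_const_mult bounded_linear_inner_left)
   fix eps :: real assume "eps > 0"
   then have "eps / (M + 1) > 0" using M by simp
   then obtain j where j: "e j < eps / (M+1)" unfolding e_def using nat_approx_posE by metis
   have "M * e j <= (M + 1) * e j" using e[of j] by simp
   also have "... <= eps" using j M by (simp add: field_simps)
   finally have Me: "M * e j <= eps" .
   obtain delta where delta: "delta > 0" "!!h. norm h < delta ==> \<bar>f (x + h) - f x - (\<Sum>b\<in>Basis. D b * (h \<bullet> b))\<bar> <= M * e j * norm h"
    using app[of j] by blast
   have "norm (f y - f x - (\<Sum>b\<in>Basis. D b * ((y - x) \<bullet> b))) <= eps * norm (y - x)" if "norm (y - x) < delta" for y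
    using delta(2)[OF that] mult_right_mono[OF Me, of "norm (y - x)"] by simp
   with delta(1) show "EX d>0. ALL y. norm (y - x) < d --> norm (f y - f x - (\<Sum>b\<in>Basis. D b * ((y - x) \<bullet> b))) <= eps * norm (y - x)" by blast
  qed
  then show ?thesis unfolding differentiable_def by blast
 qed
 then have "{x. ~ f differentiable (at x)} <= G1 Un G2" by blast
 moreover have "negligible (G1 Un G2)"
  using G1 G2 by (intro negligible_Un) (auto intro: negligible_iff_null_sets[THEN iffD2] null_sets_completionI)
 ultimately show ?thesis by (rule negligible_subset[rotated])
qed

theorem rademacher:
 fixes f :: "'a::euclidean_space => 'b::euclidean_space"
 assumes lip: "!!x y. norm (f x - f y) <= L * norm (x - y)" and L: "0 <= L"
 shows "negligible {x. ~ f differentiable (at x)}"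
proof (rule negligible_subset)
 show "negligible (\<Union>b\<in>Basis. {x. ~ (%x. f x \<bullet> b) differentiable (at x)})"
 proof (intro negligible_Union; clarsimp?)
  fix b :: 'b assume "b \<in> Basis"
  show "negligible {x. ~ (%x. f x \<bullet> b) differentiable (at x)}"
  proof (rule rademacher_real[OF _ L])
   fix x y
   show "\<bar>f x \<bullet> b - f y \<bullet> b\<bar> <= L * norm (x - y)"
    using Basis_le_norm[OF \<open>b \<in> Basis\<close>, of "f x - f y"] lip[of x y] by (simp add: inner_diff_left)
  qed
 qed
 show "{x. ~ f differentiable (at x)} <= (\<Union>b\<in>Basis. {x. ~ (%x. f x \<bullet> b) differentiable (at x)})"
  using differentiable_componentwise_within[of f _ UNIV] by auto
qed

subsection \<open>Second-order expansions of convex functions\<close>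

text \<open>A Peano expansion at the single point \<open>Z\<close>: no derivative is asserted to
  exist elsewhere, and only the quadratic form of \<open>B\<close> enters, so \<open>B\<close> need
  not be self-adjoint.\<close>

definition second_order_at :: "('a::euclidean_space => real) => 'a => 'a => ('a => 'a) => bool" where
 "second_order_at g Z p B \<longleftrightarrow> linear B &
  (ALL e>0. EX delta>0. ALL H. norm H < delta --> \<bar>g (Z + H) - g Z - p \<bullet> H - (B H \<bullet> H) / 2\<bar> <= e * (norm H)^2)"

definition subgradient :: "('a::euclidean_space => real) => 'a => 'a => bool" where
 "subgradient g Z xi \<longleftrightarrow> (ALL Y. g Z + xi \<bullet> (Y - Z) <= g Y)"

lemma subgradients_imp_convex:
 fixes g :: "'a::euclidean_space => real"
 assumes "!!Z. EX xi. subgradient g Z xi"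
 shows "convex_on UNIV g"
proof (rule convex_onI)
 fix t :: real and x y :: 'a assume t: "0 < t" "t < 1"
 let ?m = "(1 - t) *\<^sub>R x + t *\<^sub>R y"
 obtain xi where xi: "!!Y. g ?m + xi \<bullet> (Y - ?m) <= g Y" using assms unfolding subgradient_def by metis
 have "(1-t) * (g ?m + xi \<bullet> (x - ?m)) + t * (g ?m + xi \<bullet> (y - ?m)) <= (1-t) * g x + t * g y"
  using xi t by (intro add_mono mult_left_mono) auto
 moreover have "(1-t) * (g ?m + xi \<bullet> (x - ?m)) + t * (g ?m + xi \<bullet> (y - ?m)) = g ?m + xi \<bullet> ((1-t) *\<^sub>R (x - ?m) + t *\<^sub>R (y - ?m))"
  by (simp add: inner_add_right algebra_simps)
 moreover have "(1-t) *\<^sub>R (x - ?m) + t *\<^sub>R (y - ?m) = 0" by (simp add: algebra_simps)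
 ultimately show "g ?m <= (1-t) * g x + t * g y" by simp
qed simp

section \<open>The proximal map and expansions at contact points\<close>

text \<open>\<open>y\<close> is the proximal point of \<open>x\<close>, the minimiser of
  \<open>g Y + (norm (Y - x))^2 / 2\<close>. Comparing it with points on segments towards
  \<open>Y\<close>, to first order in the step, turns minimality into the subgradient
  inequality.\<close>

lemma prox_exists:
 fixes g :: "'a::euclidean_space => real"
 assumes sub: "!!Z. EX xi. subgradient g Z xi"
 shows "EX y. subgradient g y (x - y)"
proof -
 have cvx: "convex_on UNIV g" by (rule subgradients_imp_convex[OF sub])
 have cont: "continuous_on UNIV g" by (rule convex_on_continuous[OF open_UNIV cvx])
 obtain xi where xi: "!!Y. g x + xi \<bullet> (Y - x) <= g Y" using sub[of x] unfolding subgradient_def by metis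
 let ?k = "%Y. g Y + (norm (Y - x))^2 / 2"
 \<comment> \<open>Beyond this distance the affine minorant at \<open>x\<close> cannot undo the
   quadratic term, so a minimum over the ball is a global one.\<close>
 let ?R = "2 * norm xi"
 have "EX y:cball x ?R. ALL Y:cball x ?R. ?k y <= ?k Y"
  by (intro continuous_attains_inf continuous_intros continuous_on_subset[OF cont]) auto
 then obtain y where y: "!!Y. Y \<in> cball x ?R ==> ?k y <= ?k Y" by blast
 have min: "?k y <= ?k Y" for Y
 proof (cases "Y \<in> cball x ?R")
  case False
  then have d: "?R < norm (Y - x)" by (simp add: dist_norm norm_minus_commute)
  have "?k y <= g x" using y[of x] by simp
  also have "xi \<bullet> (x - Y) <= norm xi * norm (Y - x)" using norm_cauchy_schwarz[of xi "x - Y"] by (simp add: norm_minus_commute)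
  then have "g x <= g Y + norm xi * norm (Y - x)" using xi[of Y] by (simp add: inner_diff_right)
  also have "norm xi * norm (Y - x) <= (norm (Y - x) / 2) * norm (Y - x)" using d by (intro mult_right_mono) auto
  finally show ?thesis by (simp add: power2_eq_square)
 qed (rule y)
 have "g y + (x - y) \<bullet> (Y - y) <= g Y" for Y
 proof -
  let ?v = "Y - y"
  have "(x - y) \<bullet> ?v <= g Y - g y + t * ((norm ?v)^2 / 2)" if t: "0 < t" "t < 1" for t
  proof -
   have "g (y + t *\<^sub>R ?v) <= (1 - t) * g y + t * g Y"
    using convex_onD[OF cvx, of t y Y] t by (simp add: algebra_simps)
   moreover have "(norm (y + t *\<^sub>R ?v - x))^2 = (norm (y - x))^2 - 2 * t * ((x - y) \<bullet> ?v) + t^2 * (norm ?v)^2"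
    unfolding power2_norm_eq_inner by (simp add: inner_diff inner_add algebra_simps power2_eq_square inner_commute)
   ultimately have "t * ((x - y) \<bullet> ?v) <= t * (g Y - g y) + t * (t * ((norm ?v)^2 / 2))"
    using min[of "y + t *\<^sub>R ?v"] by (simp add: algebra_simps power2_eq_square)
   then have "t * ((x - y) \<bullet> ?v) <= t * (g Y - g y + t * ((norm ?v)^2 / 2))" by (simp add: algebra_simps)
   then show ?thesis using t by simp
  qed
  then have "eventually (%t. (x - y) \<bullet> ?v <= g Y - g y + t * ((norm ?v)^2 / 2)) (at_right 0)"
   unfolding eventually_at_right_field by (intro exI[of _ 1]) auto
  moreover have "((%t. g Y - g y + t * ((norm ?v)^2 / 2)) \<longlongrightarrow> g Y - g y + 0 * ((norm ?v)^2 / 2)) (at_right 0)"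
   by (intro tendsto_intros)
  ultimately have "(x - y) \<bullet> ?v <= g Y - g y + 0 * ((norm ?v)^2 / 2)"
   by (intro tendsto_lowerbound[of _ _ "at_right 0"]) auto
  then show ?thesis by simp
 qed
 then show ?thesis unfolding subgradient_def by blast
qed

text \<open>Monotonicity of the subdifferential, followed by Cauchy-Schwarz.\<close>

lemma prox_nonexpansive:
 assumes "subgradient g y (x - y)" "subgradient g y' (x' - y')"
 shows "norm (y - y') <= norm (x - x')"
proof -
 have "g y + (x - y) \<bullet> (y' - y) <= g y'" "g y' + (x' - y') \<bullet> (y - y') <= g y"
  using assms unfolding subgradient_def by auto
 then have "(x - y) \<bullet> (y' - y) + (x' - y') \<bullet> (y - y') <= 0" by linarith
 then have "(y - y') \<bullet> (y - y') <= (x - x') \<bullet> (y - y')"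
  by (simp add: inner_diff algebra_simps inner_commute)
 also have "... <= norm (x - x') * norm (y - y')" by (rule norm_cauchy_schwarz)
 finally have "norm (y - y') * norm (y - y') <= norm (x - x') * norm (y - y')" by (simp add: power2_norm_eq_inner[symmetric] power2_eq_square)
 then show ?thesis by (cases "norm (y - y') = 0") (auto simp: mult_le_cancel_right)
qed

text \<open>Integrates the expansion of the subgradients along a segment without choosing them
  measurably: on each of finitely many equal pieces the increment of \<open>g\<close> lies between
  the slopes at the two ends. The excess error of a piece is quadratic in its length, so it
  disappears as the pieces shrink.\<close>

lemma second_order_from_gradient_expansion:
 fixes g :: "'a::euclidean_space => real"
 assumes lin: "linear B" and sub: "!!Z. EX xi. subgradient g Z xi"
  and expd: "!!e. e > 0 ==> EX delta>0. ALL Y xi. norm (Y - Z) < delta --> subgradient g Y xi --> norm (xi - p - B (Y - Z)) <= e * norm (Y - Z)"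
 shows "second_order_at g Z p B"
 unfolding second_order_at_def
proof (intro conjI allI impI lin)
 fix e :: real assume "e > 0"
 obtain delta where delta: "delta > 0" "!!Y xi. norm (Y - Z) < delta ==> subgradient g Y xi ==> norm (xi - p - B (Y - Z)) <= e * norm (Y - Z)"
  using expd[OF \<open>e > 0\<close>] by blast
 have "\<bar>g (Z + H) - g Z - p \<bullet> H - (B H \<bullet> H) / 2\<bar> <= e * (norm H)^2" if H: "norm H < delta" for H
 proof -
  define beta where "beta = B H \<bullet> H"
  define r where "r t = g (Z + t *\<^sub>R H) - t * (p \<bullet> H) - t^2 * beta / 2" for t
  have "ALL t. EX xi. subgradient g (Z + t *\<^sub>R H) xi" using sub by blast
  then obtain xi where xi: "!!t. subgradient g (Z + t *\<^sub>R H) (xi t)" by metis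
  have err: "\<bar>xi t \<bullet> H - p \<bullet> H - t * beta\<bar> <= e * (norm H)^2" if t: "0 <= t" "t <= 1" for t
  proof -
   have tH: "norm (t *\<^sub>R H) <= norm H" using t by (simp add: mult_left_le_one_le)
   have "norm (xi t - p - B (t *\<^sub>R H)) <= e * norm (t *\<^sub>R H)"
    using delta(2)[of "Z + t *\<^sub>R H" "xi t"] xi tH H by simp
   also have "... <= e * norm H" using tH \<open>e > 0\<close> by simp
   finally have "norm (xi t - p - B (t *\<^sub>R H)) * norm H <= e * norm H * norm H" by (rule mult_right_mono) simp
   moreover have "\<bar>(xi t - p - B (t *\<^sub>R H)) \<bullet> H\<bar> <= norm (xi t - p - B (t *\<^sub>R H)) * norm H" by (rule Cauchy_Schwarz_ineq2)
   moreover have "(xi t - p - B (t *\<^sub>R H)) \<bullet> H = xi t \<bullet> H - p \<bullet> H - t * beta"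
    unfolding beta_def using lin by (simp add: inner_diff_left linear_cmul)
   ultimately show ?thesis by (simp add: power2_eq_square)
  qed
  have step: "\<bar>r b - r a\<bar> <= (b - a) * (e * (norm H)^2 + (b - a) * \<bar>beta\<bar> / 2)" if ab: "0 <= a" "a <= b" "b <= 1" for a b
  proof -
   have u: "g (Z + b *\<^sub>R H) - g (Z + a *\<^sub>R H) <= (b - a) * (xi b \<bullet> H)"
    using xi[of b] unfolding subgradient_def by (auto dest!: spec[of _ "Z + a *\<^sub>R H"] simp: algebra_simps inner_diff_right)
   have l: "(b - a) * (xi a \<bullet> H) <= g (Z + b *\<^sub>R H) - g (Z + a *\<^sub>R H)"
    using xi[of a] unfolding subgradient_def by (auto dest!: spec[of _ "Z + b *\<^sub>R H"] simp: algebra_simps inner_diff_right)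
   have "(b - a) * (xi b \<bullet> H - p \<bullet> H - b * beta) <= (b - a) * (e * (norm H)^2)"
    using err[of b] ab by (intro mult_left_mono) (auto simp: abs_le_iff)
   moreover have "(b - a) * (- (e * (norm H)^2)) <= (b - a) * (xi a \<bullet> H - p \<bullet> H - a * beta)"
    using err[of a] ab by (intro mult_left_mono) (auto simp: abs_le_iff)
   moreover have "(b-a)^2 * beta <= (b-a)^2 * \<bar>beta\<bar>" "(b-a)^2 * (-beta) <= (b-a)^2 * \<bar>beta\<bar>" by (intro mult_left_mono; simp)+
   ultimately show ?thesis using u l unfolding r_def abs_le_iff
    by (simp add: algebra_simps power2_eq_square) (argo)
  qed
  have "\<bar>r 1 - r 0\<bar> <= e * (norm H)^2 + (\<bar>beta\<bar> / 2) / real (Suc n)" for n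
  proof -
   let ?N = "real (Suc n)"
   have "r 1 - r 0 = (\<Sum>i<Suc n. r (real (Suc i) / ?N) - r (real i / ?N))"
    by (subst sum_lessThan_telescope) auto
   also have "\<bar>...\<bar> <= (\<Sum>i<Suc n. (1 / ?N) * (e * (norm H)^2 + (1 / ?N) * \<bar>beta\<bar> / 2))"
   proof (rule order_trans[OF sum_abs sum_mono])
    fix i assume "i \<in> {..<Suc n}"
    then have i: "real (Suc i) <= ?N" by auto
    have "real (Suc i) / ?N - real i / ?N = 1 / ?N" by (simp add: diff_divide_distrib[symmetric])
    then show "\<bar>r (real (Suc i) / ?N) - r (real i / ?N)\<bar> <= (1 / ?N) * (e * (norm H)^2 + (1 / ?N) * \<bar>beta\<bar> / 2)"
     using step[of "real i / ?N" "real (Suc i) / ?N"] i by (simp add: divide_right_mono)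
   qed
   also have "... = ?N * ((1 / ?N) * (e * (norm H)^2 + (1 / ?N) * \<bar>beta\<bar> / 2))" by simp
   also have "... = e * (norm H)^2 + (\<bar>beta\<bar> / 2) / ?N"
   proof -
    have "?N * ((1 / ?N) * A) = A" for A by simp
    then show ?thesis by simp
   qed
   finally show ?thesis .
  qed
  moreover have "(%n. e * (norm H)^2 + (\<bar>beta\<bar> / 2) / real (Suc n)) \<longlonglongrightarrow> e * (norm H)^2 + 0"
   by (intro tendsto_intros LIMSEQ_Suc[OF lim_const_over_n])
  ultimately have "\<bar>r 1 - r 0\<bar> <= e * (norm H)^2"
   by (intro LIMSEQ_le_const[where a="\<bar>r 1 - r 0\<bar>"]) auto
  then show ?thesis unfolding r_def beta_def by simp
 qed
 with delta(1) show "EX delta>0. ALL H. norm H < delta --> \<bar>g (Z + H) - g Z - p \<bullet> H - (B H \<bullet> H) / 2\<bar> <= e * (norm H)^2" by blast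
qed

text \<open>\<open>xi\<close> is tested at the point \<open>W\<close> at distance
  \<open>norm (Y - Z)\<close> from \<open>Y\<close> in the direction of \<open>xi - p\<close>. That
  point is within \<open>2 * norm (Y - Z)\<close> of \<open>Z\<close>, where the paraboloid above
  \<open>g\<close> applies; the square of this factor is the 4.\<close>

lemma subgradient_lipschitz_at_contact:
 fixes g :: "'a::euclidean_space => real"
 assumes C: "0 <= C" and r: "0 < r" and up: "!!H. norm H <= r ==> g (Z + H) <= g Z + p \<bullet> H + C * (norm H)^2"
  and p: "subgradient g Z p" and xi: "subgradient g Y xi" and Y: "norm (Y - Z) <= r / 2" "Y ~= Z"
 shows "norm (xi - p) <= 4 * C * norm (Y - Z)"
proof (cases "xi = p")
 case False
 let ?rho = "norm (Y - Z)"
 define u where "u = (xi - p) /\<^sub>R norm (xi - p)"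
 have u: "norm u = 1" using False unfolding u_def by simp
 have u': "(xi - p) \<bullet> u = norm (xi - p)" using False unfolding u_def by (simp add: power2_norm_eq_inner[symmetric] power2_eq_square)
 define W where "W = Y + ?rho *\<^sub>R u"
 have WZ: "norm (W - Z) <= 2 * ?rho"
  using norm_triangle_ineq[of "Y - Z" "?rho *\<^sub>R u"] u unfolding W_def by (simp add: algebra_simps)
 then have "g W <= g Z + p \<bullet> (W - Z) + C * (norm (W - Z))^2" using up[of "W - Z"] Y by simp
 also have "C * (norm (W - Z))^2 <= C * (2 * ?rho)^2" using WZ C by (intro mult_left_mono power_mono) auto
 finally have 1: "g W <= g Z + p \<bullet> (W - Z) + C * (2 * ?rho)^2" by simp
 have 2: "g Y + xi \<bullet> (W - Y) <= g W" "g Z + p \<bullet> (Y - Z) <= g Y" using xi p unfolding subgradient_def by auto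
 have "(xi - p) \<bullet> (W - Y) <= C * (2 * ?rho)^2" using 1 2 by (simp add: inner_diff algebra_simps)
 moreover have "(xi - p) \<bullet> (W - Y) = ?rho * norm (xi - p)"
  unfolding W_def using u' by simp
 ultimately have "?rho * norm (xi - p) <= ?rho * (4 * C * ?rho)" by (simp add: power2_eq_square algebra_simps)
 then show ?thesis using Y(2) by simp
qed (use C in simp)

text \<open>Jensen's lemma and Alexandrov's theorem in one. At a maximum \<open>Z\<close> of
  \<open>g - psi\<close> minus the linear function given by \<open>q\<close>, the point
  \<open>x = Z + D Z + q\<close> has \<open>P x = Z\<close> and \<open>T x = q\<close>. Since
  \<open>T\<close> is locally Lipschitz, it maps the null set where \<open>P\<close> is not
  differentiable to a null set, and a small \<open>q\<close> is chosen outside. As \<open>P\<close>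
  inverts the identity plus the subdifferential, its derivative at \<open>x\<close>, once shown to
  be invertible, gives the first-order expansion of the subgradients at \<open>Z\<close>.\<close>

theorem jensen_alexandrov:
 fixes g psi :: "'a::euclidean_space => real" and D :: "'a => 'a"
 assumes sub: "!!Z. EX xi. subgradient g Z xi"
  and psi: "!!Z. EX C r. 0 < r & (ALL H. norm H <= r --> psi (Z + H) <= psi Z + D Z \<bullet> H + C * (norm H)^2)"
  and D: "!!Z. D differentiable (at Z)" and "rho > 0"
 obtains q where "norm q < rho" "!!Z. (!!Y. g Y - psi Y - q \<bullet> Y <= g Z - psi Z - q \<bullet> Z) ==> EX B. second_order_at g Z (D Z + q) B"
proof -
 obtain P where P: "!!x. subgradient g (P x) (x - P x)" using prox_exists[OF sub] by metis
 have Plip: "norm (P x - P y) <= norm (x - y)" for x y by (rule prox_nonexpansive[OF P P])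
 define T where "T x = x - P x - D (P x)" for x
 define N where "N = {x. ~ P differentiable (at x)}"
 have N: "negligible N" unfolding N_def by (rule rademacher[of P 1]) (use Plip in auto)
 have "negligible (T ` N)"
 proof (rule negligible_locally_Lipschitz_image[OF order_refl N])
  fix x
  obtain D' where D': "(D has_derivative D') (at (P x))" using D unfolding differentiable_def by blast
  obtain K where K: "!!h. norm (D' h) <= norm h * K" "K >= 0"
   using bounded_linear.nonneg_bounded[OF has_derivative_bounded_linear[OF D']] by blast
  obtain d where d: "d > 0" "!!y. norm (y - P x) < d ==> norm (D y - D (P x) - D' (y - P x)) <= norm (y - P x)"
   using D' unfolding has_derivative_at_alt by (metis mult_1 zero_less_one)
  have "norm (T y - T x) <= (3 + K) * norm (y - x)" if "y \<in> ball x d" for y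
  proof -
   have py: "norm (P y - P x) <= norm (y - x)" by (rule Plip)
   then have "norm (D (P y) - D (P x) - D' (P y - P x)) <= norm (P y - P x)" using that d(2)[of "P y"] by (simp add: dist_norm norm_minus_commute)
   moreover have "norm (D' (P y - P x)) <= norm (y - x) * K" using K py by (meson order_trans mult_right_mono)
   ultimately have "norm (D (P y) - D (P x)) <= norm (y - x) + norm (y - x) * K"
    using py norm_triangle_ineq[of "D (P y) - D (P x) - D' (P y - P x)" "D' (P y - P x)"] by simp
   moreover have T: "T y - T x = (y - x) - (P y - P x) - (D (P y) - D (P x))" unfolding T_def by simp
   have "norm (T y - T x) <= norm (y - x) + norm (P y - P x) + norm (D (P y) - D (P x))"
    unfolding T using norm_triangle_ineq4[of "(y - x) - (P y - P x)" "D (P y) - D (P x)"]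
     norm_triangle_ineq4[of "y - x" "P y - P x"] by linarith
   ultimately show ?thesis using py by (simp add: algebra_simps)
  qed
  then show "EX S B. open S & x \<in> S & (ALL y:N Int S. norm (T y - T x) <= B * norm (y - x))"
   using d(1) by (intro exI[of _ "ball x d"] exI[of _ "3 + K"]) auto
 qed
 moreover have "~ negligible (ball (0::'a) rho)" using \<open>rho > 0\<close> by (intro open_not_negligible) auto
 ultimately have "~ ball 0 rho <= T ` N" using negligible_subset by blast
 then obtain q where "q \<in> ball 0 rho" and q2: "q ~: T ` N" by blast
 then have q: "norm q < rho" "q ~: T ` N" by (simp_all add: dist_norm)
 show ?thesis
 proof (rule that[OF q(1)])
  fix Z assume max: "!!Y. g Y - psi Y - q \<bullet> Y <= g Z - psi Z - q \<bullet> Z"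
  define p where "p = D Z + q"
  obtain C0 r where r: "0 < r" "!!H. norm H <= r ==> psi (Z + H) <= psi Z + D Z \<bullet> H + C0 * (norm H)^2" using psi[of Z] by blast
  define C where "C = max C0 0"
  have C: "C >= 0" unfolding C_def by simp
  have up: "g (Z + H) <= g Z + p \<bullet> H + C * (norm H)^2" if "norm H <= r" for H
  proof -
   have "C0 * (norm H)^2 <= C * (norm H)^2" unfolding C_def by (intro mult_right_mono) auto
   then show ?thesis using max[of "Z + H"] r(2)[OF that] unfolding p_def by (simp add: inner_add_left inner_add_right)
  qed
  \<comment> \<open>The paraboloid touching from above at \<open>Z\<close> has slope
    \<open>p\<close>; another subgradient would lift \<open>g\<close> above it after a short step
    along \<open>xi - p\<close>.\<close>
  have sub_unique: "xi = p" if xi: "subgradient g Z xi" for xi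
  proof (rule ccontr)
   assume "xi ~= p"
   define v where "v = xi - p"
   have v: "norm v > 0" using \<open>xi ~= p\<close> unfolding v_def by simp
   define t where "t = min (r / norm v) (1 / (2 * (C + 1)))"
   have t: "t > 0" unfolding t_def using v r C by auto
   have "norm (t *\<^sub>R v) <= r" using t v unfolding t_def by (simp add: min_def field_simps)
   then have "g Z + xi \<bullet> (t *\<^sub>R v) <= g Z + p \<bullet> (t *\<^sub>R v) + C * (norm (t *\<^sub>R v))^2"
    using up[of "t *\<^sub>R v"] xi unfolding subgradient_def by (metis add_diff_cancel_left' order_trans)
   moreover have "xi \<bullet> (t *\<^sub>R v) - p \<bullet> (t *\<^sub>R v) = t * (v \<bullet> v)" unfolding v_def by (simp add: inner_diff_left algebra_simps)
   moreover have "(norm (t *\<^sub>R v))^2 = t^2 * (norm v)^2" by (simp add: power_mult_distrib)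
   ultimately have "t * (v \<bullet> v) <= C * (t^2 * (norm v)^2)" by simp
   then have "t * (norm v)^2 <= t * (C * t) * (norm v)^2" by (simp add: dot_square_norm power2_eq_square algebra_simps)
   then have "1 <= C * t" using t v by (simp add: mult_le_cancel_right)
   moreover have "C * t <= C * (1 / (2 * (C + 1)))" using C unfolding t_def by (intro mult_left_mono) auto
   moreover have "C * (1 / (2 * (C + 1))) < 1" using C by (simp add: field_simps)
   ultimately show False by linarith
  qed
  have pZ: "subgradient g Z p" using sub[of Z] sub_unique by blast
  define x where "x = Z + p"
  have Peq: "P w = y" if "subgradient g y (w - y)" for w y
   using prox_nonexpansive[OF P[of w] that] by simp
  have PxZ: "P x = Z" using Peq[of Z x] pZ unfolding x_def by simp
  then have "T x = q" unfolding T_def x_def p_def by simp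
  then have "P differentiable (at x)" using q(2) unfolding N_def by auto
  then obtain L where L: "(P has_derivative L) (at x)" unfolding differentiable_def by blast
  have linL: "linear L" using L by (rule has_derivative_linear)
  define K where "K = 1 + 4 * C"
  have K: "K >= 1" unfolding K_def using C by simp
  have dx: "norm (Y + xi - x) <= K * norm (Y - Z)" if "norm (Y - Z) <= r / 2" "subgradient g Y xi" for Y xi
  proof (cases "Y = Z")
   case True
   then show ?thesis using sub_unique that(2) unfolding x_def by simp
  next
   case False
   have "norm (xi - p) <= 4 * C * norm (Y - Z)"
    by (rule subgradient_lipschitz_at_contact[OF C r(1) up pZ that(2,1) False])
   then show ?thesis using norm_triangle_ineq[of "Y - Z" "xi - p"] unfolding x_def K_def by (simp add: algebra_simps)
  qed
  have app: "EX delta>0. ALL Y xi. norm (Y - Z) < delta --> subgradient g Y xi --> norm (Y - Z - L (Y + xi - x)) <= e * norm (Y - Z)"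
   if "e > 0" for e
  proof -
   have "e / K > 0" using that K by simp
   then obtain d where d: "d > 0" "!!w. norm (w - x) < d ==> norm (P w - P x - L (w - x)) <= e / K * norm (w - x)"
    using L unfolding has_derivative_at_alt by metis
   have "norm (Y - Z - L (Y + xi - x)) <= e * norm (Y - Z)" if Y: "norm (Y - Z) < min (r/2) (d / K)" and xi: "subgradient g Y xi" for Y xi
   proof -
    have 1: "norm (Y + xi - x) <= K * norm (Y - Z)" using dx[OF _ xi] Y by simp
    also have "... < d" using Y K by (simp add: field_simps)
    finally have "norm (P (Y + xi) - P x - L (Y + xi - x)) <= e / K * norm (Y + xi - x)" by (rule d(2))
    also have "... <= e / K * (K * norm (Y - Z))" using 1 \<open>e / K > 0\<close> by (intro mult_left_mono) auto
    also have "... = e * norm (Y - Z)" using K by simp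
    finally show ?thesis using Peq[of Y "Y + xi"] xi PxZ by simp
   qed
   moreover have "min (r/2) (d / K) > 0" using r d K by simp
   ultimately show ?thesis by blast
  qed
  \<comment> \<open>For any direction \<open>h\<close>, a subgradient at
    \<open>Z + t *\<^sub>R h\<close> yields a preimage of \<open>t *\<^sub>R h\<close> up to an
    arbitrarily small multiple of \<open>t\<close>. So the range of \<open>L\<close> is dense, and
    as a subspace it is closed.\<close>
  have "surj L"
  proof -
   have "h \<in> range L" for h
   proof (cases "h = 0")
    case True then show ?thesis using linear_0[OF linL] by (metis rangeI)
   next
    case False
    have "h \<in> closure (range L)"
     unfolding closure_approachable
    proof (intro allI impI)
     fix e :: real assume "e > 0"
     then have "e / (2 * norm h) > 0" using False by simp
     then obtain delta where delta: "delta > 0" "!!Y xi. norm (Y - Z) < delta ==> subgradient g Y xi ==> norm (Y - Z - L (Y + xi - x)) <= e / (2 * norm h) * norm (Y - Z)"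
      using app by blast
     define t where "t = delta / (2 * norm h)"
     have t: "t > 0" "norm (t *\<^sub>R h) < delta" unfolding t_def using delta(1) False by auto
     obtain xi where xi: "subgradient g (Z + t *\<^sub>R h) xi" using sub by blast
     let ?w = "Z + t *\<^sub>R h + xi - x"
     have "norm (t *\<^sub>R h - L ?w) <= e / (2 * norm h) * norm (t *\<^sub>R h)" using delta(2)[OF _ xi] t by simp
     also have "... = t * (e / 2)" using t False by simp
     also have "t *\<^sub>R h - L ?w = t *\<^sub>R (h - L (?w /\<^sub>R t))"
     proof -
      have "t *\<^sub>R h - L w = t *\<^sub>R (h - L (w /\<^sub>R t))" for w
       using linear_cmul[OF linL, of "inverse t" w] t by (simp add: scaleR_diff_right)
      then show ?thesis .
     qed
     finally have "norm (h - L (?w /\<^sub>R t)) <= e / 2" using t by simp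
     then show "EX y:range L. dist y h < e" using \<open>e > 0\<close> by (intro bexI[of _ "L (?w /\<^sub>R t)"]) (auto simp: dist_norm norm_minus_commute)
    qed
    moreover have "closed (range L)" by (intro closed_subspace linear_subspace_image linL subspace_UNIV)
    ultimately show ?thesis by simp
   qed
   then show ?thesis by auto
  qed
  then obtain L' where L': "linear L'" "!!h. L' (L h) = h" "!!h. L (L' h) = h"
   using linear_surjective_isomorphism[OF linL] by metis
  obtain M where M: "M > 0" "!!h. norm (L' h) <= M * norm h" using linear_bounded_pos[OF L'(1)] by blast
  \<comment> \<open>The inverse of \<open>P\<close> is the identity plus the subdifferential, so the
    Hessian is the inverse of \<open>L\<close> minus the identity.\<close>
  define B where "B h = L' h - h" for h
  have "linear B" unfolding B_def by (intro linear_compose_sub L'(1) linear_id[unfolded id_def])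
  then have "second_order_at g Z p B"
  proof (rule second_order_from_gradient_expansion[OF _ sub])
   fix e :: real assume "e > 0"
   then obtain delta where delta: "delta > 0" "!!Y xi. norm (Y - Z) < delta ==> subgradient g Y xi ==> norm (Y - Z - L (Y + xi - x)) <= e / M * norm (Y - Z)"
    using app[of "e / M"] M by (metis divide_pos_pos)
   have "norm (xi - p - B (Y - Z)) <= e * norm (Y - Z)" if Y: "norm (Y - Z) < delta" and xi: "subgradient g Y xi" for Y xi
   proof -
    have "xi - p - B (Y - Z) = - L' (Y - Z - L (Y + xi - x))"
    proof -
     have "L' (a - L w) = L' a - w" for a w by (simp add: linear_diff[OF L'(1)] L'(2))
     then show ?thesis unfolding B_def x_def by simp
    qed
    then have "norm (xi - p - B (Y - Z)) <= M * norm (Y - Z - L (Y + xi - x))" using M(2) by simp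
    also have "... <= M * (e / M * norm (Y - Z))" using delta(2)[OF Y xi] M by (intro mult_left_mono) auto
    finally show ?thesis using M by simp
   qed
   with delta(1) show "EX delta>0. ALL Y xi. norm (Y - Z) < delta --> subgradient g Y xi --> norm (xi - p - B (Y - Z)) <= e * norm (Y - Z)" by blast
  qed
  then show "EX B. second_order_at g Z (D Z + q) B" unfolding p_def by blast
 qed
qed

subsection \<open>Eigenvalues of a quadratic form on a hyperplane\<close>

definition orthonormal :: "'a::real_inner set => bool" where
 "orthonormal B \<longleftrightarrow> finite B & pairwise orthogonal B & (ALL b:B. norm b = 1)"

lemma orthonormal_subset: "orthonormal B ==> A <= B ==> orthonormal A"
 unfolding orthonormal_def by (auto intro: finite_subset pairwise_subset)

lemma orthonormal_inner:
 assumes "orthonormal B" "a \<in> B" "b \<in> B"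
 shows "a \<bullet> b = (if a = b then 1 else 0)"
 using assms unfolding orthonormal_def pairwise_def orthogonal_def by (auto simp: norm_eq_1)

lemma orthonormal_expand:
 fixes x :: "'a::euclidean_space"
 assumes "orthonormal B" "x \<in> span B"
 shows "(\<Sum>b\<in>B. (x \<bullet> b) *\<^sub>R b) = x"
 using assms unfolding orthonormal_def by (intro orthonormal_basis_expand) auto

lemma orthonormal_independent: "orthonormal B ==> independent (B :: 'a::euclidean_space set)"
 unfolding orthonormal_def by (intro pairwise_orthogonal_independent) auto

lemma orthonormal_insert:
 assumes "orthonormal B" "norm e = 1" "!!b. b \<in> B ==> b \<bullet> e = 0"
 shows "orthonormal (insert e B)"
 using assms unfolding orthonormal_def pairwise_insert by (auto simp: orthogonal_def inner_commute)

lemma orthonormal_parseval: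
 fixes x :: "'a::euclidean_space"
 assumes B: "orthonormal B" and x: "x \<in> span B"
 shows "(\<Sum>b\<in>B. (x \<bullet> b)^2) = (norm x)^2"
proof -
 have "x \<bullet> x = x \<bullet> (\<Sum>b\<in>B. (x \<bullet> b) *\<^sub>R b)" by (simp only: orthonormal_expand[OF B x])
 then show ?thesis by (simp add: inner_sum_right dot_square_norm power2_eq_square)
qed

lemma orthonormal_bessel:
 fixes x :: "'a::euclidean_space"
 assumes B: "orthonormal B"
 shows "(\<Sum>b\<in>B. (x \<bullet> b)^2) <= (norm x)^2"
proof -
 let ?y = "\<Sum>b\<in>B. (x \<bullet> b) *\<^sub>R b"
 have yb: "?y \<bullet> b = x \<bullet> b" if "b \<in> B" for b
 proof -
  have "?y \<bullet> b = (\<Sum>a\<in>B. (x \<bullet> a) * (a \<bullet> b))" by (simp add: inner_sum_left)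
  also have "... = (\<Sum>a\<in>B. if a = b then x \<bullet> b else 0)"
   using orthonormal_inner[OF B] that by (intro sum.cong) auto
  finally show ?thesis using that B unfolding orthonormal_def by simp
 qed
 have "?y \<bullet> ?y = (\<Sum>b\<in>B. (x \<bullet> b) * (?y \<bullet> b))" by (simp only: inner_sum_right inner_scaleR_right)
 also have "... = (\<Sum>b\<in>B. (x \<bullet> b)^2)" using yb by (intro sum.cong) (auto simp: power2_eq_square)
 finally have yy: "?y \<bullet> ?y = (\<Sum>b\<in>B. (x \<bullet> b)^2)" .
 have "x \<bullet> ?y = (\<Sum>b\<in>B. (x \<bullet> b)^2)" by (simp add: inner_sum_right power2_eq_square)
 moreover have "0 <= (x - ?y) \<bullet> (x - ?y)" by simp
 ultimately show ?thesis using yy by (simp add: inner_diff inner_commute power2_norm_eq_inner)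
qed

text \<open>\<open>f\<close> need not map \<open>V\<close> into itself, so the eigenvector equation
  is tested against \<open>V\<close> only: it is the compression of \<open>f\<close> to
  \<open>V\<close> that is diagonalised. The vector with the largest quadratic form on the unit
  sphere of \<open>V\<close> splits off, and the induction continues on its orthogonal complement in
  \<open>V\<close>.\<close>

lemma selfadjoint_eigenbasis:
 fixes f :: "'a::euclidean_space => 'a"
 assumes lin: "linear f" and sa: "!!x y. f x \<bullet> y = x \<bullet> f y" and V: "subspace V"
 shows "EX B l. orthonormal B & span B = V & (ALL b:B. ALL w:V. f b \<bullet> w = l b * (b \<bullet> w))"
 using V
proof (induction "dim V" arbitrary: V)
 case 0
 then have "V = {0}" using dim_eq_0[of V] subspace_0 by auto
 then show ?case by (intro exI[of _ "{}"]) (auto simp: orthonormal_def)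
next
 case (Suc n)
 obtain x0 where x0: "x0 \<in> V" "x0 ~= 0"
  using Suc.hyps(2) dim_eq_0[of V] by (metis Suc_neq_Zero singletonI subsetI)
 let ?S = "V Int sphere 0 1"
 have cf: "continuous_on UNIV f" using lin by (simp add: linear_continuous_on linear_conv_bounded_linear)
 have "compact ?S" using Suc.prems by (intro closed_Int_compact closed_subspace) auto
 moreover have "x0 /\<^sub>R norm x0 \<in> ?S" using x0 Suc.prems by (auto intro: subspace_scale)
 ultimately have "EX v:?S. ALL x:?S. f x \<bullet> x <= f v \<bullet> v"
  by (intro continuous_attains_sup) (auto intro!: continuous_intros continuous_on_subset[OF cf])
 then obtain v where v: "v \<in> V" "norm v = 1" and vmax: "!!x. x \<in> V ==> norm x = 1 ==> f x \<bullet> x <= f v \<bullet> v" by auto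
 define mu where "mu = f v \<bullet> v"
 have vv: "v \<bullet> v = 1" using v by (simp add: dot_square_norm)
 have quad: "f x \<bullet> x <= mu * (x \<bullet> x)" if "x \<in> V" for x
 proof (cases "x = 0")
  case False
  have "f (x /\<^sub>R norm x) \<bullet> (x /\<^sub>R norm x) <= mu" unfolding mu_def using that False Suc.prems
   by (intro vmax) (auto intro: subspace_scale)
  moreover have "f (x /\<^sub>R norm x) \<bullet> (x /\<^sub>R norm x) = (f x \<bullet> x) / (norm x)^2"
   by (simp add: linear_cmul[OF lin] power2_eq_square field_simps)
  ultimately show ?thesis using False by (simp add: pos_divide_le_eq dot_square_norm)
 qed (simp add: linear_0[OF lin])
 have orth: "f v \<bullet> w = 0" if w: "w \<in> V" "w \<bullet> v = 0" for w
 proof (rule ccontr)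
  assume ne: "f v \<bullet> w ~= 0"
  define c where "c = f v \<bullet> w"
  define d where "d = mu * (w \<bullet> w) - f w \<bullet> w"
  have ineq: "2 * t * c <= t^2 * d" for t
  proof -
   have "v + t *\<^sub>R w \<in> V" using v w Suc.prems by (auto intro: subspace_add subspace_scale)
   from quad[OF this] show ?thesis unfolding c_def d_def mu_def using w(2) vv sa[of w v]
    by (simp add: linear_add[OF lin] linear_cmul[OF lin] inner_add inner_commute[of v w] inner_commute[of w "f v"] algebra_simps power2_eq_square)
  qed
  have d0: "d >= 0" unfolding d_def using quad[OF w(1)] by simp
  \<comment> \<open>With this \<open>t\<close> the left side of \<open>ineq\<close> is
    \<open>2 * c^2 / (d + 1)\<close>, while the right side is at most half of that.\<close>
  define t where "t = c / (d + 1)"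
  have "2 * t * c = 2 * c^2 / (d + 1)" unfolding t_def by (simp add: power2_eq_square)
  moreover have "t^2 * d <= c^2 / (d+1)"
  proof -
   have "t^2 * d = (c^2 / (d+1)) * (d / (d+1))" unfolding t_def by (simp add: power2_eq_square)
   also have "... <= (c^2 / (d+1)) * 1" using d0 by (intro mult_left_mono) auto
   finally show ?thesis by simp
  qed
  moreover have "c^2 / (d+1) > 0" using ne d0 unfolding c_def by simp
  ultimately show False using ineq[of t] by simp
 qed
 define W where "W = {w \<in> V. w \<bullet> v = 0}"
 have sW: "subspace W" unfolding W_def using Suc.prems
  by (auto simp: subspace_def inner_add_left)
 have span_ins: "V = span (insert v W)"
 proof
  show "V <= span (insert v W)"
  proof
   fix x assume x: "x \<in> V"
   have "x - (x \<bullet> v) *\<^sub>R v \<in> W" unfolding W_def using x v Suc.prems vv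
    by (auto simp: inner_diff_left subspace_diff subspace_scale)
   then have "x - (x \<bullet> v) *\<^sub>R v \<in> span (insert v W)" by (simp add: span_base)
   moreover have "(x \<bullet> v) *\<^sub>R v \<in> span (insert v W)" by (simp add: span_base span_scale)
   ultimately show "x \<in> span (insert v W)" by (metis span_add diff_add_cancel)
  qed
  show "span (insert v W) <= V" using v Suc.prems unfolding W_def by (intro span_minimal) auto
 qed
 have vW: "v ~: span W" using sW vv unfolding W_def by (simp add: span_eq_iff[THEN iffD2])
 have "dim V = Suc (dim W)" unfolding span_ins dim_span dim_insert using vW by simp
 then have "n = dim W" using Suc.hyps(2) by simp
 from Suc.hyps(1)[OF this sW] obtain B l where B: "orthonormal B" "span B = W" "!!b w. b \<in> B ==> w \<in> W ==> f b \<bullet> w = l b * (b \<bullet> w)" by blast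
 have BW: "B <= W" using B(2) span_superset by blast
 have vB: "v ~: B" using vW B(2) span_base sW by (metis span_eq_iff)
 let ?B = "insert v B" and ?l = "%b. if b = v then mu else l b"
 have 1: "orthonormal ?B" using B(1) v BW unfolding W_def by (intro orthonormal_insert) auto
 have 2: "span ?B = V"
 proof -
  have "span W = span B" using B(2) by (metis span_span)
  then have "span (insert v W) = span ?B" unfolding span_insert by simp
  then show ?thesis using span_ins by simp
 qed
 have 3: "f b \<bullet> w = ?l b * (b \<bullet> w)" if b: "b \<in> ?B" and w: "w \<in> V" for b w
 proof -
  define w' where "w' = w - (w \<bullet> v) *\<^sub>R v"
  have w': "w' \<in> W" unfolding w'_def W_def using w v Suc.prems vv
   by (auto simp: inner_diff_left subspace_diff subspace_scale)
  have weq: "w = w' + (w \<bullet> v) *\<^sub>R v" unfolding w'_def by simp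
  show ?thesis
  proof (cases "b = v")
   case True
   have "f v \<bullet> w' = 0" using orth w' unfolding W_def by auto
   then have "f v \<bullet> w = (w \<bullet> v) * mu" by (subst weq) (simp add: inner_add_right mu_def)
   then show ?thesis using True by (simp add: inner_commute)
  next
   case False
   then have bB: "b \<in> B" using b by simp
   then have bW: "b \<in> W" using BW by auto
   have "f b \<bullet> v = 0" using orth[of b] bW sa[of b v] unfolding W_def by (simp add: inner_commute)
   then have "f b \<bullet> w = f b \<bullet> w'" by (subst weq) (simp add: inner_add_right)
   also have "... = l b * (b \<bullet> w')" by (rule B(3)[OF bB w'])
   also have "b \<bullet> w' = b \<bullet> w" using bW unfolding w'_def W_def by (simp add: inner_diff_right)
   finally show ?thesis using False by simp
  qed
 qed
 show ?case by (intro exI[of _ ?B] exI[of _ ?l] conjI ballI 1 2 3)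
qed

lemma symmetric_matrix_inner:
 fixes M :: "real^'m^'m"
 assumes "transpose M = M"
 shows "(M *v x) \<bullet> y = x \<bullet> (M *v y)"
proof -
 have "(M *v x) \<bullet> y = (transpose M *v x) \<bullet> y" using assms by simp
 also have "... = (x v* M) \<bullet> y" by (simp only: transpose_matrix_vector)
 also have "... = x \<bullet> (M *v y)" by (rule dot_lmul_matrix)
 finally show ?thesis .
qed

lemma rev_sort_key_map: "map l (rev (sort_key l xs)) = rev (sorted_list_of_multiset (image_mset l (mset xs)))"
proof -
 have "sort (map l xs) = map l (sort_key l xs)"
  by (rule properties_for_sort) (auto simp: sorted_sort_key)
 then have "sorted_list_of_multiset (mset (map l xs)) = map l (sort_key l xs)"
  by (simp only: sorted_list_of_multiset_mset)
 then show ?thesis by (simp add: rev_map)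
qed

section \<open>Ordered eigenbases and Ky Fan's maximum principle\<close>

definition eigenbasis :: "real^'m^'m => real^'m => (real^'m) list => (real^'m => real) => bool" where
 "eigenbasis M p bs l \<longleftrightarrow> distinct bs & length bs = CARD('m) - 1 & orthonormal (set bs) & span (set bs) = {v. v \<bullet> p = 0} &
  (ALL b:set bs. ALL w. w \<bullet> p = 0 --> (M *v b) \<bullet> w = l b * (b \<bullet> w)) & sorted_wrt (%a b. l b <= l a) bs &
  (ALL k. curv_op k M p = (\<Sum>b\<leftarrow>take k bs. l b))"

text \<open>Connects the multiset \<open>restricted_eigenvalues\<close> with an orthonormal
  eigenbasis: by symmetry of \<open>M\<close> an eigenvector has no component along basis vectors
  with another eigenvalue, so the dimension of an eigenspace is the number of basis vectors with
  that eigenvalue.\<close>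

lemma eigenbasis_exists:
 fixes M :: "real^'m^'m"
 assumes sym: "transpose M = M" and p: "p ~= 0"
 shows "EX bs l. eigenbasis M p bs l"
proof -
 let ?V = "{v. v \<bullet> p = 0}"
 have V: "subspace ?V" by (auto simp: subspace_def inner_add_left)
 have dimV: "dim ?V = CARD('m) - 1" using dim_hyperplane[OF p] by (simp add: inner_commute)
 obtain B l where B: "orthonormal B" "span B = ?V" "!!b w. b \<in> B ==> w \<in> ?V ==> (M *v b) \<bullet> w = l b * (b \<bullet> w)"
  using selfadjoint_eigenbasis[OF matrix_vector_mul_linear[of M] symmetric_matrix_inner[OF sym] V] by blast
 have fB: "finite B" using B(1) unfolding orthonormal_def by auto
 have cardB: "card B = CARD('m) - 1"
  using dim_eq_card_independent[OF orthonormal_independent[OF B(1)]] B(2) dimV by (metis dim_span)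
 have BV: "b \<bullet> p = 0" if "b \<in> B" for b using B(2) span_base[OF that] by auto
 obtain xs where xs: "set xs = B" "distinct xs" using finite_distinct_list[OF fB] by blast
 define bs where "bs = rev (sort_key l xs)"
 have bs: "set bs = B" "distinct bs" unfolding bs_def using xs by auto
 have mset: "mset bs = mset_set B" unfolding bs_def using xs by (metis mset_rev mset_set_set mset_sort)
 have space: "restricted_eigenspace M p c = span {b\<in>B. l b = c}" for c
 proof
  show "restricted_eigenspace M p c <= span {b\<in>B. l b = c}"
  proof
   fix v assume "v \<in> restricted_eigenspace M p c"
   then have v: "v \<bullet> p = 0" "!!w. w \<bullet> p = 0 ==> (M *v v) \<bullet> w = c * (v \<bullet> w)" unfolding restricted_eigenspace_def by auto
   have "v = (\<Sum>b\<in>B. (v \<bullet> b) *\<^sub>R b)" using orthonormal_expand[OF B(1), of v] B(2) v(1) by simp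
   moreover have "(v \<bullet> b) *\<^sub>R b \<in> span {b\<in>B. l b = c}" if b: "b \<in> B" for b
   proof (cases "l b = c")
    case True then show ?thesis using b by (simp add: span_base span_scale)
   next
    case False
    have "(M *v v) \<bullet> b = c * (v \<bullet> b)" using v(2) BV[OF b] by auto
    moreover have "(M *v v) \<bullet> b = l b * (v \<bullet> b)" using B(3)[OF b, of v] v(1) symmetric_matrix_inner[OF sym, of v b] by (simp add: inner_commute)
    ultimately have "v \<bullet> b = 0" using False by simp
    then show ?thesis by (simp add: span_zero)
   qed
   ultimately show "v \<in> span {b\<in>B. l b = c}" using span_sum[of B "%b. (v \<bullet> b) *\<^sub>R b"] by simp
  qed
  have sub: "subspace (restricted_eigenspace M p c)" unfolding restricted_eigenspace_def
   by (auto simp: subspace_def inner_add_left matrix_vector_right_distrib matrix_vector_mult_scaleR algebra_simps)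
  show "span {b\<in>B. l b = c} <= restricted_eigenspace M p c"
   by (rule span_minimal[OF _ sub]) (auto simp: restricted_eigenspace_def BV B(3))
 qed
 have dimE: "dim (restricted_eigenspace M p c) = card {b\<in>B. l b = c}" for c
  unfolding space dim_span using orthonormal_subset[OF B(1), of "{b\<in>B. l b = c}"]
  by (intro dim_eq_card_independent orthonormal_independent) auto
 have ne: "restricted_eigenspace M p c ~= {0} \<longleftrightarrow> c \<in> l ` B" for c
 proof -
  have "restricted_eigenspace M p c = {0} \<longleftrightarrow> dim (restricted_eigenspace M p c) = 0"
  proof -
   have "0 \<in> restricted_eigenspace M p c" unfolding space by (rule span_zero)
   then show ?thesis unfolding dim_eq_0 by auto
  qed
  also have "... \<longleftrightarrow> {b\<in>B. l b = c} = {}" unfolding dimE using fB by simp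
  finally show ?thesis by auto
 qed
 have mul: "restricted_eigenvalues M p = image_mset l (mset bs)"
 proof (rule multiset_eqI)
  fix c
  have "count (restricted_eigenvalues M p) c = (\<Sum>x\<in>l ` B. count (replicate_mset (card {b\<in>B. l b = x}) x) c)"
   unfolding restricted_eigenvalues_def ne dimE by (simp add: count_sum)
  also have "... = (\<Sum>x\<in>l ` B. if x = c then card {b\<in>B. l b = c} else 0)" by (intro sum.cong) auto
  also have "... = card {b\<in>B. l b = c}" using fB by (cases "c \<in> l ` B") auto
  also have "... = count (image_mset l (mset bs)) c"
  proof -
   have "{x. x \<in># mset_set B & c = l x} = {b\<in>B. l b = c}" using fB by auto
   then show ?thesis unfolding mset using fB by (simp add: count_image_mset')
  qed
  finally show "count (restricted_eigenvalues M p) c = count (image_mset l (mset bs)) c" .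
 qed
 have "eigenbasis M p bs l" unfolding eigenbasis_def
 proof (intro conjI ballI allI impI)
  show "distinct bs" by (rule bs)
  show "length bs = CARD('m) - 1" using cardB bs distinct_card by metis
  show "orthonormal (set bs)" using B bs by simp
  show "span (set bs) = ?V" using B bs by simp
  show "(M *v b) \<bullet> w = l b * (b \<bullet> w)" if "b \<in> set bs" "w \<bullet> p = 0" for b w using that bs B(3) by auto
  show "sorted_wrt (%a b. l b <= l a) bs"
   unfolding bs_def sorted_wrt_rev using sorted_sort_key[of l xs] by (simp add: sorted_map)
  fix k
  have "rev (sorted_list_of_multiset (restricted_eigenvalues M p)) = map l bs"
   unfolding mul using rev_sort_key_map[of l xs] unfolding bs_def by simp
  then show "curv_op k M p = (\<Sum>b\<leftarrow>take k bs. l b)" unfolding curv_op_def by (simp add: take_map)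
 qed
 then show ?thesis by blast
qed

lemma top_sum_bound:
 fixes l :: "'a => real"
 assumes bs: "distinct bs" "sorted_wrt (%a b. l b <= l a) bs" and c: "!!b. b \<in> set bs ==> 0 <= c b & c b <= 1"
  and k: "k <= length bs" and sum: "(\<Sum>b\<in>set bs. c b) = real k | ((\<Sum>b\<in>set bs. c b) <= real k & (ALL b:set bs. 0 <= l b))"
 shows "(\<Sum>b\<in>set bs. c b * l b) <= (\<Sum>b\<leftarrow>take k bs. l b)"
proof (cases k)
 case 0
 then have "(\<Sum>b\<in>set bs. c b) = 0" using sum c by (metis order_antisym of_nat_0 sum_nonneg)
 then have "ALL b:set bs. c b = 0" using c by (simp add: sum_nonneg_eq_0_iff)
 then show ?thesis using 0 by simp
next
 case (Suc j)
 define theta where "theta = l (bs ! j)"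
 have j: "j < length bs" using Suc k by simp
 let ?T = "set (take k bs)" and ?R = "set (drop k bs)"
 have TR: "?T Un ?R = set bs" "?T Int ?R = {}" "card ?T = k"
  using bs(1) k set_take_disj_set_drop_if_distinct[of bs k k] by (auto simp: distinct_card set_append[symmetric] simp del: set_append)
 have T: "theta <= l b" if b: "b \<in> ?T" for b
 proof -
  obtain i where i: "i < k" "i < length bs" "b = bs ! i" using b by (auto simp: in_set_conv_nth)
  then show ?thesis unfolding theta_def using bs(2) j Suc by (cases "i = j") (auto simp: sorted_wrt_iff_nth_less less_Suc_eq)
 qed
 have R: "l b <= theta" if b: "b \<in> ?R" for b
 proof -
  obtain i where i: "i < length (drop k bs)" "b = drop k bs ! i" using b unfolding in_set_conv_nth by blast
  then have i: "k + i < length bs" "b = bs ! (k + i)" by auto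
  then show ?thesis unfolding theta_def using bs(2) j Suc by (auto simp: sorted_wrt_iff_nth_less)
 qed
 have th: "theta * (\<Sum>b\<in>set bs. c b) <= theta * real k"
 proof -
  have "theta >= 0" if "ALL b:set bs. 0 <= l b" using that j unfolding theta_def by auto
  then show ?thesis using sum by (auto intro: mult_left_mono)
 qed
 have "(\<Sum>b\<in>set bs. c b * l b) - theta * (\<Sum>b\<in>set bs. c b) = (\<Sum>b\<in>set bs. c b * (l b - theta))"
  by (simp add: sum_subtractf sum_distrib_left right_diff_distrib mult.commute)
 also have "... = (\<Sum>b\<in>?T. c b * (l b - theta)) + (\<Sum>b\<in>?R. c b * (l b - theta))"
  unfolding TR(1)[symmetric] by (rule sum.union_disjoint) (use TR in auto)
 also have "... <= (\<Sum>b\<in>?T. 1 * (l b - theta)) + 0"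
 proof (intro add_mono sum_mono mult_right_mono sum_nonpos)
  fix b assume "b \<in> ?T"
  then show "c b <= 1" "0 <= l b - theta" using c TR T by auto
 next
  fix b assume "b \<in> ?R"
  then show "c b * (l b - theta) <= 0" using c[of b] TR(1) R[of b] by (intro mult_nonneg_nonpos) auto
 qed
 also have "... = (\<Sum>b\<in>?T. l b) - theta * real k" using TR(3) by (simp add: sum_subtractf)
 finally have "(\<Sum>b\<in>set bs. c b * l b) <= (\<Sum>b\<in>?T. l b)" using th by linarith
 also have "... = (\<Sum>b\<leftarrow>take k bs. l b)" using bs(1) by (simp add: sum_list_distinct_conv_sum_set)
 finally show ?thesis .
qed

lemma orthonormal_weights:
 fixes U :: "'a::euclidean_space set"
 assumes U: "orthonormal U" and B: "orthonormal B" and sp: "U <= span B"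
 shows "(\<Sum>u\<in>U. (u \<bullet> b)^2) >= 0" "b \<in> B ==> (\<Sum>u\<in>U. (u \<bullet> b)^2) <= 1" "(\<Sum>b\<in>B. \<Sum>u\<in>U. (u \<bullet> b)^2) = real (card U)"
proof -
 show "(\<Sum>u\<in>U. (u \<bullet> b)^2) >= 0" by (intro sum_nonneg) auto
 show "(\<Sum>u\<in>U. (u \<bullet> b)^2) <= 1" if "b \<in> B"
  using orthonormal_bessel[OF U, of b] that B unfolding orthonormal_def by (simp add: inner_commute)
 have "(\<Sum>b\<in>B. \<Sum>u\<in>U. (u \<bullet> b)^2) = (\<Sum>u\<in>U. \<Sum>b\<in>B. (u \<bullet> b)^2)" by (rule sum.swap)
 also have "... = (\<Sum>u\<in>U. 1)"
  using orthonormal_parseval[OF B] sp U unfolding orthonormal_def by (intro sum.cong) auto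
 finally show "(\<Sum>b\<in>B. \<Sum>u\<in>U. (u \<bullet> b)^2) = real (card U)" by simp
qed

lemma eigenbasis_quadratic:
 fixes M :: "real^'m^'m"
 assumes E: "eigenbasis M p bs l" and x: "x \<bullet> p = 0"
 shows "(M *v x) \<bullet> x = (\<Sum>b\<in>set bs. l b * (x \<bullet> b)^2)"
proof -
 have o: "orthonormal (set bs)" and sp: "span (set bs) = {v. v \<bullet> p = 0}"
  and ev: "!!b w. b \<in> set bs ==> w \<bullet> p = 0 ==> (M *v b) \<bullet> w = l b * (b \<bullet> w)"
  using E unfolding eigenbasis_def by auto
 have "M *v x = (\<Sum>b\<in>set bs. (x \<bullet> b) *\<^sub>R (M *v b))"
  using orthonormal_expand[OF o, of x] x sp
   linear_sum[OF matrix_vector_mul_linear[of M], of "%b. (x \<bullet> b) *\<^sub>R b" "set bs"]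
  by (simp add: matrix_vector_mult_scaleR)
 then have "(M *v x) \<bullet> x = (\<Sum>b\<in>set bs. (x \<bullet> b) * ((M *v b) \<bullet> x))" by (simp add: inner_sum_left)
 also have "... = (\<Sum>b\<in>set bs. l b * (x \<bullet> b)^2)"
  using ev[OF _ x] by (intro sum.cong) (auto simp: power2_eq_square inner_commute)
 finally show ?thesis .
qed

text \<open>The inequality in Ky Fan's maximum principle: expanding a frame in the eigenbasis gives
  the eigenvalues weights between 0 and 1 with total \<open>card U\<close>.\<close>

lemma curv_op_upper_bound:
 fixes M :: "real^'m^'m"
 assumes sym: "transpose M = M" and p: "p ~= 0" and U: "orthonormal U" "!!u. u \<in> U ==> u \<bullet> p = 0"
 shows "(\<Sum>u\<in>U. (M *v u) \<bullet> u) <= curv_op (card U) M p"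
proof -
 obtain bs l where E: "eigenbasis M p bs l" using eigenbasis_exists[OF sym p] by blast
 then have o: "orthonormal (set bs)" and sp: "span (set bs) = {v. v \<bullet> p = 0}" and d: "distinct bs" "length bs = CARD('m) - 1"
  and s: "sorted_wrt (%a b. l b <= l a) bs" and F: "!!k. curv_op k M p = (\<Sum>b\<leftarrow>take k bs. l b)"
  unfolding eigenbasis_def by auto
 have Usp: "U <= span (set bs)" using U sp by auto
 have "card U <= card (set bs)"
  using independent_card_le_dim[OF Usp orthonormal_independent[OF U(1)]]
   dim_eq_card_independent[OF orthonormal_independent[OF o]] by simp
 then have k: "card U <= length bs" using distinct_card[OF d(1)] by simp
 have "(\<Sum>u\<in>U. (M *v u) \<bullet> u) = (\<Sum>u\<in>U. \<Sum>b\<in>set bs. l b * (u \<bullet> b)^2)"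
  using eigenbasis_quadratic[OF E] U by (intro sum.cong) auto
 also have "... = (\<Sum>b\<in>set bs. (\<Sum>u\<in>U. (u \<bullet> b)^2) * l b)"
  by (subst sum.swap) (simp add: sum_distrib_left mult.commute)
 also have "... <= (\<Sum>b\<leftarrow>take (card U) bs. l b)"
  by (rule top_sum_bound[OF d(1) s _ k]) (use orthonormal_weights[OF U(1) o Usp] in auto)
 finally show ?thesis using F by simp
qed

text \<open>Equality in Ky Fan's principle. The frame also diagonalises \<open>M\<close>; therefore,
  when its vectors are the columns of the maximising player, the quadratic form of a signed sum is
  the same for all signs.\<close>

lemma curv_op_attained:
 fixes M :: "real^'m^'m"
 assumes sym: "transpose M = M" and p: "p ~= 0" and k: "k <= CARD('m) - 1"
 shows "EX U. orthonormal U & card U = k & (ALL u:U. u \<bullet> p = 0) & (\<Sum>u\<in>U. (M *v u) \<bullet> u) = curv_op k M p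
  & (ALL u:U. ALL w:U. u ~= w --> (M *v u) \<bullet> w = 0)"
proof -
 obtain bs l where E: "eigenbasis M p bs l" using eigenbasis_exists[OF sym p] by blast
 then have o: "orthonormal (set bs)" and sp: "span (set bs) = {v. v \<bullet> p = 0}" and d: "distinct bs" "length bs = CARD('m) - 1"
  and ev: "!!b w. b \<in> set bs ==> w \<bullet> p = 0 ==> (M *v b) \<bullet> w = l b * (b \<bullet> w)"
  and F: "!!k. curv_op k M p = (\<Sum>b\<leftarrow>take k bs. l b)"
  unfolding eigenbasis_def by auto
 let ?U = "set (take k bs)"
 have sub: "?U <= set bs" by (rule set_take_subset)
 have oU: "orthonormal ?U" by (rule orthonormal_subset[OF o sub])
 have Up: "u \<bullet> p = 0" if "u \<in> ?U" for u using sp span_base[of u "set bs"] sub that by auto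
 have "(M *v u) \<bullet> w = l u * (if u = w then 1 else 0)" if "u \<in> ?U" "w \<in> ?U" for u w
 proof -
  have "u \<in> set bs" using that sub by blast
  from ev[OF this Up[OF that(2)]] show ?thesis by (simp only: orthonormal_inner[OF oU that])
 qed
 moreover from this have "(\<Sum>u\<in>?U. (M *v u) \<bullet> u) = (\<Sum>u\<in>?U. l u)" by (intro sum.cong) auto
 moreover have "(\<Sum>u\<in>?U. l u) = curv_op k M p" using F d by (simp add: sum_list_distinct_conv_sum_set)
 moreover have "card ?U = k" using d k by (simp add: distinct_card)
 ultimately show ?thesis using oU Up by (intro exI[of _ ?U]) auto
qed

section \<open>Dependence of eigenvalue sums on matrix and direction\<close>

text \<open>\<open>J = {k}\<close> gives the operator of the flow, \<open>J = {..k}\<close> that of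
  the game, in which the maximising player may leave columns zero. The common form lets one
  comparison theorem serve both.\<close>

definition curv_max :: "nat set => real^'m^'m => real^'m => real" where
 "curv_max J M p = Max ((%j. curv_op j M p) ` J)"

definition index_set :: "'m::finite itself => nat set => bool" where
 "index_set m J \<longleftrightarrow> finite J & J ~= {} & (ALL j:J. j <= CARD('m) - 1)"

lemma curv_max_single: "curv_max {k} M p = curv_op k M p"
 unfolding curv_max_def by simp

lemma curv_max_frame:
 fixes M :: "real^'m^'m"
 assumes J: "index_set TYPE('m) J" and sym: "transpose M = M" and p: "p ~= 0"
 obtains U where "orthonormal U" "card U \<in> J" "card U <= CARD('m)" "!!u. u \<in> U ==> u \<bullet> p = 0" "(\<Sum>u\<in>U. (M *v u) \<bullet> u) = curv_max J M p"
  "!!u w. u \<in> U ==> w \<in> U ==> u ~= w ==> (M *v u) \<bullet> w = 0"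
proof -
 have "curv_max J M p \<in> (%j. curv_op j M p) ` J" unfolding curv_max_def using J unfolding index_set_def by (intro Max_in) auto
 then obtain j where j: "j \<in> J" "curv_max J M p = curv_op j M p" by auto
 then have "j <= CARD('m) - 1" using J unfolding index_set_def by auto
 from curv_op_attained[OF sym p this] obtain U where U: "orthonormal U" "card U = j" "ALL u:U. u \<bullet> p = 0"
  "(\<Sum>u\<in>U. (M *v u) \<bullet> u) = curv_op j M p" "ALL u:U. ALL w:U. u ~= w --> (M *v u) \<bullet> w = 0" by blast
 show ?thesis by (rule that[of U]) (use U j \<open>j <= CARD('m) - 1\<close> in auto)
qed

lemma curv_max_ge:
 fixes M :: "real^'m^'m"
 assumes J: "index_set TYPE('m) J" and sym: "transpose M = M" and p: "p ~= 0" and U: "orthonormal U" "card U \<in> J" "!!u. u \<in> U ==> u \<bullet> p = 0"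
 shows "(\<Sum>u\<in>U. (M *v u) \<bullet> u) <= curv_max J M p"
proof -
 have "(\<Sum>u\<in>U. (M *v u) \<bullet> u) <= curv_op (card U) M p" by (rule curv_op_upper_bound[OF sym p U(1,3)])
 also have "... <= curv_max J M p" unfolding curv_max_def using J U unfolding index_set_def by (intro Max_ge) auto
 finally show ?thesis .
qed

text \<open>A frame that is optimal for \<open>M\<close> is admissible for \<open>N1\<close> and
  \<open>N2\<close>. The slack \<open>c\<close> is paid once for each of the at most
  \<open>CARD('m)\<close> frame vectors.\<close>

lemma curv_max_convex:
 fixes M N1 N2 :: "real^'m^'m"
 assumes J: "index_set TYPE('m) J" and sym: "transpose M = M" "transpose N1 = N1" "transpose N2 = N2" and p: "p ~= 0" and c: "0 <= c"
  and le: "!!h. h \<bullet> p = 0 ==> 2 * ((M *v h) \<bullet> h) <= (N1 *v h) \<bullet> h + (N2 *v h) \<bullet> h + c * (h \<bullet> h)"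
 shows "2 * curv_max J M p <= curv_max J N1 p + curv_max J N2 p + real CARD('m) * c"
proof -
 obtain U where U: "orthonormal U" "card U \<in> J" "card U <= CARD('m)" "!!u. u \<in> U ==> u \<bullet> p = 0" "(\<Sum>u\<in>U. (M *v u) \<bullet> u) = curv_max J M p"
  by (rule curv_max_frame[OF J sym(1) p]) (rule that)
 have "2 * curv_max J M p = (\<Sum>u\<in>U. 2 * ((M *v u) \<bullet> u))" unfolding U(5)[symmetric] by (simp add: sum_distrib_left)
 also have "... <= (\<Sum>u\<in>U. (N1 *v u) \<bullet> u + (N2 *v u) \<bullet> u + c)"
 proof (intro sum_mono)
  fix u assume "u \<in> U"
  then show "2 * ((M *v u) \<bullet> u) <= (N1 *v u) \<bullet> u + (N2 *v u) \<bullet> u + c"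
   using le[of u] U(1,4) unfolding orthonormal_def by (simp add: dot_square_norm)
 qed
 also have "... = (\<Sum>u\<in>U. (N1 *v u) \<bullet> u) + (\<Sum>u\<in>U. (N2 *v u) \<bullet> u) + real (card U) * c" by (simp add: sum.distrib)
 also have "... <= curv_max J N1 p + curv_max J N2 p + real CARD('m) * c"
  using U c by (intro add_mono curv_max_ge J sym p mult_right_mono) auto
 finally show ?thesis .
qed

lemma curv_max_mono:
 fixes M N :: "real^'m^'m"
 assumes "index_set TYPE('m) J" "transpose M = M" "transpose N = N" "p ~= 0" "0 <= c"
  and le: "!!h. h \<bullet> p = 0 ==> (M *v h) \<bullet> h <= (N *v h) \<bullet> h + c * (h \<bullet> h)"
 shows "curv_max J M p <= curv_max J N p + real CARD('m) * c"
proof -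
 have "2 * ((M *v h) \<bullet> h) <= (N *v h) \<bullet> h + (N *v h) \<bullet> h + (2 * c) * (h \<bullet> h)" if "h \<bullet> p = 0" for h
  using le[OF that] by simp
 from curv_max_convex[OF assms(1,2,3,3,4) _ this] assms(5) show ?thesis by simp
qed

lemma curv_max_le:
 fixes M :: "real^'m^'m"
 assumes J: "index_set TYPE('m) J" and sym: "transpose M = M" and p: "p ~= 0" and c: "0 <= c"
  and le: "!!h. h \<bullet> p = 0 ==> (M *v h) \<bullet> h <= c * (h \<bullet> h)"
 shows "curv_max J M p <= real CARD('m) * c"
proof -
 obtain U where U: "orthonormal U" "card U <= CARD('m)" "!!u. u \<in> U ==> u \<bullet> p = 0" "(\<Sum>u\<in>U. (M *v u) \<bullet> u) = curv_max J M p"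
  by (rule curv_max_frame[OF J sym p]) (rule that)
 have "curv_max J M p <= (\<Sum>u\<in>U. c)" unfolding U(4)[symmetric]
 proof (intro sum_mono)
  fix u assume "u \<in> U"
  then show "(M *v u) \<bullet> u <= c" using le[of u] U(1,3) unfolding orthonormal_def by (simp add: dot_square_norm)
 qed
 also have "... <= real CARD('m) * c" using U(2) c by (simp add: mult_right_mono)
 finally show ?thesis .
qed

lemma curv_max_ge_neg:
 fixes M :: "real^'m^'m"
 assumes J: "index_set TYPE('m) J" and sym: "transpose M = M" and p: "p ~= 0" and c: "0 <= c"
  and le: "!!h. h \<bullet> p = 0 ==> - (c * (h \<bullet> h)) <= (M *v h) \<bullet> h"
 shows "- (real CARD('m) * c) <= curv_max J M p"
proof -
 have "curv_max J 0 p <= curv_max J M p + real CARD('m) * c"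
 proof (rule curv_max_mono[OF J _ sym p c])
  show "(0 *v h) \<bullet> h <= (M *v h) \<bullet> h + c * (h \<bullet> h)" if "h \<bullet> p = 0" for h using le[OF that] by simp
 qed (simp add: transpose_def vec_eq_iff)
 moreover have "0 <= curv_max J (0::real^'m^'m) p"
 proof -
  have "transpose (0::real^'m^'m) = 0" by (simp add: transpose_def vec_eq_iff)
  then obtain U where "orthonormal U" "(\<Sum>u\<in>U. ((0::real^'m^'m) *v u) \<bullet> u) = curv_max J 0 p"
   by (rule curv_max_frame[OF J _ p]) (rule that)
  then show ?thesis by simp
 qed
 ultimately show ?thesis by linarith
qed

text \<open>The rotation of the plane of \<open>e\<close> and \<open>e'\<close> taking \<open>e\<close> to \<open>e'\<close> maps \<open>v\<close> to \<open>v'\<close>.\<close>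

lemma curv_max_direction:
 fixes M :: "real^'m^'m"
 assumes J: "index_set TYPE('m) J" and sym: "transpose M = M" and e: "norm e = 1" "norm e' = 1" "norm (e - e') <= 1"
  and L: "!!h. norm (M *v h) <= L * norm h" "0 <= L"
 shows "curv_max J M e <= curv_max J M e' + real CARD('m) * (4 * L * norm (e - e'))"
proof -
 have e0: "e ~= 0" "e' ~= 0" using e by auto
 have ee: "e \<bullet> e = 1" "e' \<bullet> e' = 1" using e by (simp_all add: dot_square_norm)
 have "(norm (e - e'))^2 <= 1" using e(3) by (simp add: power_le_one)
 moreover have "(norm (e - e'))^2 = 2 - 2 * (e \<bullet> e')" unfolding power2_norm_eq_inner using ee by (simp add: inner_diff inner_commute)
 ultimately have dot: "e \<bullet> e' >= 1/2" by simp
 obtain U where U: "orthonormal U" "card U \<in> J" "card U <= CARD('m)" "!!u. u \<in> U ==> u \<bullet> e = 0" "(\<Sum>u\<in>U. (M *v u) \<bullet> u) = curv_max J M e"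
  by (rule curv_max_frame[OF J sym e0(1)]) (rule that)
 define a where "a = e + e'"
 define s where "s = 1 + e \<bullet> e'"
 have s: "s >= 3/2" unfolding s_def using dot by simp
 \<comment> \<open>On vectors orthogonal to \<open>e\<close> the rotation is given by this
   formula.\<close>
 define R where "R v = v - ((v \<bullet> e') / s) *\<^sub>R a" for v
 have aa: "a \<bullet> a = 2 * s" unfolding a_def s_def using ee by (simp add: inner_add inner_commute)
 have va: "v \<bullet> a = v \<bullet> e'" if "v \<bullet> e = 0" for v unfolding a_def using that by (simp add: inner_add_right)
 have Riso: "R v \<bullet> R w = v \<bullet> w" if "v \<bullet> e = 0" "w \<bullet> e = 0" for v w
 proof -
  have "R v \<bullet> R w = v \<bullet> w - ((w \<bullet> e') / s) * (v \<bullet> a) - ((v \<bullet> e') / s) * (w \<bullet> a) + ((v \<bullet> e') / s) * ((w \<bullet> e') / s) * (a \<bullet> a)"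
   unfolding R_def by (simp add: inner_diff inner_commute algebra_simps)
  also have "... = v \<bullet> w" unfolding va[OF that(1)] va[OF that(2)] aa using s by (simp add: field_simps)
  finally show ?thesis .
 qed
 have Re': "R v \<bullet> e' = 0" for v
 proof -
  have "a \<bullet> e' = s" unfolding a_def s_def using ee by (simp add: inner_add_left)
  then show ?thesis unfolding R_def using s by (simp add: inner_diff_left)
 qed
 have Rn: "norm (R u) = 1" "norm u = 1" if "u \<in> U" for u
  using Riso[OF U(4) U(4), OF that that] U(1) that unfolding orthonormal_def by (simp_all add: norm_eq_1)
 have Rclose: "norm (R u - u) <= 2 * norm (e - e')" if u: "u \<in> U" for u
 proof -
  have "u \<bullet> e' = u \<bullet> (e' - e)" using U(4)[OF u] by (simp add: inner_diff_right)
  then have 1: "\<bar>u \<bullet> e'\<bar> <= norm (e - e')" using Cauchy_Schwarz_ineq2[of u "e' - e"] Rn(2)[OF u] by (simp add: norm_minus_commute)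
  have "norm a <= 2" unfolding a_def using norm_triangle_ineq[of e e'] e by simp
  have "norm (R u - u) = \<bar>u \<bullet> e'\<bar> / s * norm a" unfolding R_def using s by simp
  also have "... <= norm (e - e') * 2"
  proof (rule mult_mono)
   have "\<bar>u \<bullet> e'\<bar> / s <= \<bar>u \<bullet> e'\<bar> / 1" using s by (intro divide_left_mono) auto
   then show "\<bar>u \<bullet> e'\<bar> / s <= norm (e - e')" using 1 by simp
  qed (use \<open>norm a <= 2\<close> in auto)
  finally show ?thesis by simp
 qed
 have inj: "inj_on R U"
 proof (rule inj_onI)
  fix u w assume uw: "u \<in> U" "w \<in> U" "R u = R w"
  then have "u \<bullet> w = 1" using Riso[OF U(4) U(4), OF uw(1,2)] Rn(1)[OF uw(1)] by (simp add: norm_eq_1)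
  then show "u = w" using orthonormal_inner[OF U(1) uw(1,2)] by (auto split: if_splits)
 qed
 have oRU: "orthonormal (R ` U)"
  unfolding orthonormal_def
 proof (intro conjI ballI)
  show "finite (R ` U)" using U(1) unfolding orthonormal_def by simp
  show "pairwise orthogonal (R ` U)"
  proof (rule pairwise_imageI)
   fix u w assume "u \<in> U" "w \<in> U" "u ~= w"
   then show "orthogonal (R u) (R w)" using Riso[OF U(4) U(4)] orthonormal_inner[OF U(1)] by (simp add: orthogonal_def)
  qed
  show "norm b = 1" if "b \<in> R ` U" for b using that Rn by auto
 qed
 have diff: "(M *v u) \<bullet> u <= (M *v R u) \<bullet> R u + 4 * L * norm (e - e')" if u: "u \<in> U" for u
 proof -
  have "(M *v u) \<bullet> u - (M *v R u) \<bullet> R u = (M *v (u + R u)) \<bullet> (u - R u)"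
   using symmetric_matrix_inner[OF sym, of u "R u"]
   by (simp add: matrix_vector_right_distrib inner_add_left inner_diff_right inner_commute[of "M *v R u" u])
  also have "... <= norm (M *v (u + R u)) * norm (u - R u)" by (rule norm_cauchy_schwarz)
  also have "... <= (L * 2) * (2 * norm (e - e'))"
  proof (rule mult_mono)
   have "norm (u + R u) <= 2" using norm_triangle_ineq[of u "R u"] Rn[OF u] by simp
   then show "norm (M *v (u + R u)) <= L * 2" using L by (meson mult_left_mono order_trans)
  qed (use Rclose[OF u] L in "auto simp: norm_minus_commute")
  finally show ?thesis by simp
 qed
 have "curv_max J M e <= (\<Sum>u\<in>U. (M *v R u) \<bullet> R u + 4 * L * norm (e - e'))"
  unfolding U(5)[symmetric] using diff by (intro sum_mono) auto
 also have "... = (\<Sum>u\<in>R ` U. (M *v u) \<bullet> u) + real (card U) * (4 * L * norm (e - e'))"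
  by (simp add: sum.distrib sum.reindex[OF inj])
 also have "... <= curv_max J M e' + real CARD('m) * (4 * L * norm (e - e'))"
  using U(2,3) L oRU Re' card_image[OF inj]
  by (intro add_mono curv_max_ge J sym e0 mult_right_mono) auto
 finally show ?thesis .
qed

lemma curv_op_scale:
 assumes "c ~= 0" shows "curv_op k M (c *\<^sub>R p) = curv_op k M p"
proof -
 have "restricted_eigenspace M (c *\<^sub>R p) = restricted_eigenspace M p"
  unfolding restricted_eigenspace_def using assms by (intro ext) auto
 then show ?thesis unfolding curv_op_def restricted_eigenvalues_def by simp
qed

lemma curv_max_scale: "c ~= 0 ==> curv_max J M (c *\<^sub>R p) = curv_max J M p"
 unfolding curv_max_def by (simp add: curv_op_scale)

text \<open>The operator depends on the direction of \<open>p\<close> only; normalising both vectors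
  costs the factor 2 that turns the 4 of \<open>curv_max_direction\<close> into 8.\<close>

lemma curv_max_near:
 fixes M :: "real^'m^'m"
 assumes J: "index_set TYPE('m) J" and sym: "transpose M = M" and p: "p ~= 0" and q: "norm (q - p) <= norm p / 2"
  and L: "!!h. norm (M *v h) <= L * norm h" "0 <= L"
 shows "\<bar>curv_max J M p - curv_max J M q\<bar> <= real CARD('m) * (8 * L * norm (q - p) / norm p)"
proof -
 have np: "norm p > 0" using p by simp
 have nq: "norm q >= norm p / 2" using q norm_triangle_ineq2[of p q] by (simp add: norm_minus_commute)
 then have q0: "q ~= 0" using np by auto
 let ?e = "p /\<^sub>R norm p" and ?e' = "q /\<^sub>R norm q"
 have "norm (?e - ?e') <= 2 * norm (q - p) / norm p"
 proof -
  have "?e - ?e' = (p - q) /\<^sub>R norm p + (inverse (norm p) - inverse (norm q)) *\<^sub>R q" by (simp add: algebra_simps)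
  also have "norm ... <= norm ((p - q) /\<^sub>R norm p) + norm ((inverse (norm p) - inverse (norm q)) *\<^sub>R q)" by (rule norm_triangle_ineq)
  also have "norm ((inverse (norm p) - inverse (norm q)) *\<^sub>R q) = \<bar>norm q - norm p\<bar> / norm p"
  proof -
   have "norm ((inverse (norm p) - inverse (norm q)) *\<^sub>R q) = \<bar>(inverse (norm p) - inverse (norm q)) * norm q\<bar>" by (simp add: abs_mult)
   also have "(inverse (norm p) - inverse (norm q)) * norm q = (norm q - norm p) / norm p" using np q0 by (simp add: field_simps)
   finally show ?thesis using np by simp
  qed
  also have "... <= norm (q - p) / norm p" using norm_triangle_ineq3[of q p] by (intro divide_right_mono) auto
  also have "norm ((p - q) /\<^sub>R norm p) = norm (q - p) / norm p" by (simp add: norm_minus_commute divide_inverse mult.commute)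
  finally show ?thesis by simp
 qed
 moreover have "2 * norm (q - p) / norm p <= 1" using q np by (simp add: pos_divide_le_eq)
 ultimately have ee: "norm (?e - ?e') <= 1" and ee2: "norm (?e - ?e') <= 2 * norm (q - p) / norm p" by auto
 have n1: "norm ?e = 1" "norm ?e' = 1" using p q0 by auto
 have s: "curv_max J M ?e = curv_max J M p" "curv_max J M ?e' = curv_max J M q" using p q0 by (auto intro: curv_max_scale)
 have 1: "curv_max J M p <= curv_max J M q + real CARD('m) * (4 * L * norm (?e - ?e'))"
  using curv_max_direction[OF J sym n1 ee L] unfolding s .
 have 2: "curv_max J M q <= curv_max J M p + real CARD('m) * (4 * L * norm (?e - ?e'))"
  using curv_max_direction[OF J sym n1(2,1) _ L] ee unfolding s by (simp add: norm_minus_commute)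
 have "real CARD('m) * (4 * L * norm (?e - ?e')) <= real CARD('m) * (4 * L * (2 * norm (q - p) / norm p))"
  using ee2 L by (intro mult_left_mono) auto
 then show ?thesis using 1 2 by (simp add: abs_le_iff)
qed

section \<open>Positive parts and the operator of the game\<close>

text \<open>In a decreasing list the positive entries come first, so \<open>j\<close> counts those
  among the first \<open>k\<close>. Hence a sum of positive parts never exceeds the maximum of the
  eigenvalue sums over \<open>j <= k\<close>.\<close>

lemma take_sum_max_zero:
 fixes l :: "'a => real"
 assumes "sorted_wrt (%a b. l b <= l a) bs"
 shows "EX j<=k. (\<Sum>b\<leftarrow>take k bs. max (l b) 0) = (\<Sum>b\<leftarrow>take j bs. l b)"
 using assms
proof (induction bs arbitrary: k)
 case (Cons a bs)
 show ?case
 proof (cases "k = 0 | l a <= 0")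
  case True
  have "ALL b:set (take k (a # bs)). max (l b) 0 = 0" if "l a <= 0" using Cons.prems that by (fastforce dest!: in_set_takeD simp: max_def)
  then have "map (%b. max (l b) 0) (take k (a # bs)) = map (%b. 0) (take k (a # bs))" if "l a <= 0" using that by simp
  then have "(\<Sum>b\<leftarrow>take k (a # bs). max (l b) 0) = 0"
  proof (cases "k = 0")
   case False
   then have "map (%b. max (l b) 0) (take k (a # bs)) = map (%b. 0) (take k (a # bs))"
    using True \<open>l a <= 0 ==> map _ _ = _\<close> by blast
   then show ?thesis by (simp only: sum_list_0)
  qed simp
  then show ?thesis by (intro exI[of _ 0]) auto
 next
  case False
  then obtain k' where k: "k = Suc k'" by (cases k) auto
  obtain j where "j <= k'" "(\<Sum>b\<leftarrow>take k' bs. max (l b) 0) = (\<Sum>b\<leftarrow>take j bs. l b)"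
   using Cons.IH[of k'] Cons.prems by auto
  then show ?thesis using False k by (intro exI[of _ "Suc j"]) auto
 qed
qed auto

text \<open>\<open>B\<close> and \<open>mu\<close> describe the positive part of the form on the
  hyperplane. Vector balancing needs a nonnegative form, and passing to the positive part costs
  nothing because the operator of the game already discards negative eigenvalues.\<close>

lemma psd_majorant:
 fixes M :: "real^'m^'m"
 assumes sym: "transpose M = M" and p: "p ~= 0" and k: "k <= CARD('m) - 1"
 obtains B mu where "finite B" "!!b. b \<in> B ==> 0 <= mu b"
  "!!x. x \<bullet> p = 0 ==> (M *v x) \<bullet> x <= (\<Sum>b\<in>B. mu b * (b \<bullet> x)^2)"
  "!!U. orthonormal U ==> (!!u. u \<in> U ==> u \<bullet> p = 0) ==> card U <= k ==> (\<Sum>u\<in>U. \<Sum>b\<in>B. mu b * (b \<bullet> u)^2) <= curv_max {..k} M p"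
proof -
 obtain bs l where E: "eigenbasis M p bs l" using eigenbasis_exists[OF sym p] by blast
 then have o: "orthonormal (set bs)" and sp: "span (set bs) = {v. v \<bullet> p = 0}" and d: "distinct bs" "length bs = CARD('m) - 1"
  and s: "sorted_wrt (%a b. l b <= l a) bs" and F: "!!k. curv_op k M p = (\<Sum>b\<leftarrow>take k bs. l b)"
  unfolding eigenbasis_def by auto
 show ?thesis
 proof (rule that[of "set bs" "%b. max (l b) 0"])
  show "(M *v x) \<bullet> x <= (\<Sum>b\<in>set bs. max (l b) 0 * (b \<bullet> x)^2)" if "x \<bullet> p = 0" for x
   unfolding eigenbasis_quadratic[OF E that] by (intro sum_mono) (auto simp: inner_commute intro!: mult_right_mono)
  fix U assume U: "orthonormal U" "!!u. u \<in> U ==> u \<bullet> p = 0" "card U <= k"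
  have Usp: "U <= span (set bs)" using U sp by auto
  have "(\<Sum>u\<in>U. \<Sum>b\<in>set bs. max (l b) 0 * (b \<bullet> u)^2) = (\<Sum>b\<in>set bs. (\<Sum>u\<in>U. (u \<bullet> b)^2) * max (l b) 0)"
   by (subst sum.swap) (simp add: sum_distrib_left mult.commute inner_commute)
  also have "... <= (\<Sum>b\<leftarrow>take k bs. max (l b) 0)"
  proof (rule top_sum_bound[OF d(1)])
   show "sorted_wrt (%a b. max (l b) 0 <= max (l a) 0) bs" using s by (rule sorted_wrt_mono_rel[rotated]) auto
  qed (use orthonormal_weights[OF U(1) o Usp] U k d in auto)
  also obtain j where "j <= k" "(\<Sum>b\<leftarrow>take k bs. max (l b) 0) = curv_op j M p"
   using take_sum_max_zero[OF s, of k] F by auto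
  then have "(\<Sum>b\<leftarrow>take k bs. max (l b) 0) <= curv_max {..k} M p" unfolding curv_max_def by (auto intro: Max_ge)
  finally show "(\<Sum>u\<in>U. \<Sum>b\<in>set bs. max (l b) 0 * (b \<bullet> u)^2) <= curv_max {..k} M p" .
 qed auto
qed

text \<open>For a nonnegative matrix every further eigenvalue can only add, so game and flow have
  the same operator. It is applied to test functions touching the convex limit from above.\<close>

lemma curv_max_psd:
 fixes M :: "real^'m^'m"
 assumes sym: "transpose M = M" and p: "p ~= 0" and k: "k <= CARD('m) - 1" and psd: "!!h. 0 <= (M *v h) \<bullet> h"
 shows "curv_max {..k} M p = curv_op k M p"
proof -
 obtain bs l where E: "eigenbasis M p bs l" using eigenbasis_exists[OF sym p] by blast
 then have o: "orthonormal (set bs)" and sp: "span (set bs) = {v. v \<bullet> p = 0}" and d: "distinct bs" "length bs = CARD('m) - 1"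
  and ev: "!!b w. b \<in> set bs ==> w \<bullet> p = 0 ==> (M *v b) \<bullet> w = l b * (b \<bullet> w)"
  and F: "!!k. curv_op k M p = (\<Sum>b\<leftarrow>take k bs. l b)"
  unfolding eigenbasis_def by auto
 have l: "0 <= l b" if b: "b \<in> set bs" for b
  using ev[OF b, of b] sp span_base[OF b] orthonormal_inner[OF o b b] psd[of b] by auto
 have "curv_op j M p <= curv_op k M p" if "j <= k" for j
 proof -
  have "(\<Sum>b\<leftarrow>take k bs. l b) = (\<Sum>b\<leftarrow>take j bs. l b) + (\<Sum>b\<leftarrow>take (k - j) (drop j bs). l b)"
   using take_add[of j "k - j" bs] that by simp
  moreover have "0 <= (\<Sum>b\<leftarrow>take (k - j) (drop j bs). l b)"
   by (intro sum_list_nonneg) (auto dest!: in_set_takeD in_set_dropD intro: l)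
  ultimately show ?thesis using F by simp
 qed
 then show ?thesis unfolding curv_max_def by (intro Max_eqI) auto
qed

subsection \<open>Vector balancing\<close>

lemma span_image_coeffs:
 fixes a :: "'n => 'a::real_vector"
 assumes "finite T" "x \<in> span (a ` T)"
 shows "EX c. x = (\<Sum>j\<in>T. c j *\<^sub>R a j)"
 using assms
proof (induction T arbitrary: x rule: finite_induct)
 case (insert i T)
 from insert.prems obtain k where "x - k *\<^sub>R a i \<in> span (a ` T)" by (auto simp: span_breakdown_eq)
 then obtain c where c: "x - k *\<^sub>R a i = (\<Sum>j\<in>T. c j *\<^sub>R a j)" using insert.IH by blast
 have "(\<Sum>j\<in>insert i T. (c(i := k)) j *\<^sub>R a j) = k *\<^sub>R a i + (\<Sum>j\<in>T. (c(i := k)) j *\<^sub>R a j)" using insert.hyps by simp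
 also have "(\<Sum>j\<in>T. (c(i := k)) j *\<^sub>R a j) = (\<Sum>j\<in>T. c j *\<^sub>R a j)" using insert.hyps by (intro sum.cong) auto
 finally have "x = (\<Sum>j\<in>insert i T. (c(i := k)) j *\<^sub>R a j)" using c by (simp add: algebra_simps)
 then show ?case by blast
qed simp

lemma orthogonal_to_span_image:
 fixes w :: "'a::real_inner"
 assumes "!!j. j \<in> T ==> w \<bullet> a j = 0" "v \<in> span (a ` T)"
 shows "w \<bullet> v = 0"
proof -
 have "subspace {v. w \<bullet> v = 0}" by (auto simp: subspace_def inner_add_right)
 then have "span (a ` T) <= {v. w \<bullet> v = 0}" using assms(1) by (intro span_minimal) auto
 then show ?thesis using assms(2) by auto
qed

lemma hit_boundary:
 fixes x u :: "'n => real"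
 assumes "finite S" "p \<in> S" "u p ~= 0" "!!j. j \<in> S ==> \<bar>x j\<bar> < 1"
 obtains delta j where "delta > 0" "j \<in> S" "\<bar>x j + delta * u j\<bar> = 1" "!!i. i \<in> S ==> \<bar>x i + delta * u i\<bar> <= 1"
proof -
 let ?S = "{j\<in>S. u j ~= 0}"
 \<comment> \<open>The time at which coordinate \<open>j\<close> reaches the face of the cube
   towards which it moves; the smallest one is taken.\<close>
 let ?d = "%j. (1 - x j * sgn (u j)) / \<bar>u j\<bar>"
 have fin: "finite (?d ` ?S)" "?d ` ?S ~= {}" using assms by auto
 define delta where "delta = Min (?d ` ?S)"
 have "delta \<in> ?d ` ?S" unfolding delta_def by (rule Min_in[OF fin])
 then obtain j where j: "j \<in> S" "u j ~= 0" "delta = ?d j" by auto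
 have pos: "0 < ?d i" if "i \<in> S" "u i ~= 0" for i
  using assms(4)[OF that(1)] that(2) by (auto simp: sgn_if abs_less_iff)
 have "x j + delta * u j = sgn (u j)" using j by (auto simp: sgn_if field_simps)
 then have 1: "\<bar>x j + delta * u j\<bar> = 1" using j(2) by (simp add: abs_sgn_eq)
 have 2: "\<bar>x i + delta * u i\<bar> <= 1" if i: "i \<in> S" for i
 proof (cases "u i = 0")
  case True then show ?thesis using assms(4)[OF i] by simp
 next
  case False
  have "delta <= ?d i" unfolding delta_def using i False fin by (intro Min_le) auto
  moreover have "0 < delta" using pos j by auto
  ultimately have "delta * \<bar>u i\<bar> <= 1 - x i * sgn (u i)" "0 <= delta * \<bar>u i\<bar>" using False by (auto simp: pos_le_divide_eq)
  then show ?thesis using False assms(4)[OF i] by (cases "u i > 0") (auto simp: sgn_if abs_le_iff abs_less_iff)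
 qed
 show ?thesis using that[OF _ j(1) 1 2] pos[OF j(1,2)] j(3) by simp
qed

definition diag_form :: "'b set => ('b => real) => ('b => 'a) => 'a::real_inner => real" where
 "diag_form B mu e x = (\<Sum>b\<in>B. mu b * (e b \<bullet> x)^2)"

lemma diag_form_nonneg: "(!!b. b \<in> B ==> 0 <= mu b) ==> 0 <= diag_form B mu e x"
 unfolding diag_form_def by (intro sum_nonneg) auto

text \<open>Moving by \<open>s\<close> with weight \<open>t\<close> and by \<open>- t\<close> with
  weight \<open>s\<close> keeps the mean and adds \<open>s * t\<close> times the form of the
  direction: the variance of a two-point martingale step.\<close>

lemma diag_form_average:
 "t * diag_form B mu e (x + s *\<^sub>R r) + s * diag_form B mu e (x + (- t) *\<^sub>R r) = (s + t) * (diag_form B mu e x + s * t * diag_form B mu e r)"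
 unfolding diag_form_def sum_distrib_left sum.distrib[symmetric]
 by (intro sum.cong) (auto simp: inner_add_right power2_eq_square algebra_simps)

text \<open>By Cauchy-Schwarz and Bessel, each square \<open>(e b \<bullet> r)^2\<close> is at most
  the sum of the corresponding squares over \<open>W\<close>.\<close>

lemma diag_form_span_bound:
 fixes r :: "'a::euclidean_space"
 assumes mu: "!!b. b \<in> B ==> 0 <= mu b" and W: "orthonormal W" and r: "r \<in> span W" "norm r <= 1"
 shows "diag_form B mu e r <= (\<Sum>w\<in>W. diag_form B mu e w)"
proof -
 have "(e b \<bullet> r)^2 <= (\<Sum>w\<in>W. (e b \<bullet> w)^2)" for b
 proof -
  have "e b \<bullet> r = e b \<bullet> (\<Sum>w\<in>W. (r \<bullet> w) *\<^sub>R w)" by (simp only: orthonormal_expand[OF W r(1)])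
  also have "... = (\<Sum>w\<in>W. (r \<bullet> w) * (e b \<bullet> w))" by (simp add: inner_sum_right)
  finally have "(e b \<bullet> r)^2 = (\<Sum>w\<in>W. (r \<bullet> w) * (e b \<bullet> w))^2" by simp
  also have "... <= (\<Sum>w\<in>W. (r \<bullet> w)^2) * (\<Sum>w\<in>W. (e b \<bullet> w)^2)" by (rule Cauchy_Schwarz_ineq_sum)
  also have "... <= 1 * (\<Sum>w\<in>W. (e b \<bullet> w)^2)"
   using orthonormal_bessel[OF W, of r] r(2) by (intro mult_right_mono sum_nonneg) (auto simp: power_le_one intro: order_trans)
  finally show ?thesis by simp
 qed
 then have "diag_form B mu e r <= (\<Sum>b\<in>B. mu b * (\<Sum>w\<in>W. (e b \<bullet> w)^2))"
  unfolding diag_form_def using mu by (intro sum_mono mult_left_mono) auto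
 also have "... = (\<Sum>w\<in>W. diag_form B mu e w)" unfolding diag_form_def sum_distrib_left by (rule sum.swap)
 finally show ?thesis .
qed

text \<open>A derandomised Gram--Schmidt walk.  The fractional signing \<open>x\<close> is moved in a direction that
 changes the pivot coordinate at unit speed and the vector sum by the residual of the pivot vector with
 respect to the other alive vectors, until a coordinate hits \<open>1\<close> or \<open>-1\<close>.  The orthonormal set \<open>W\<close> collects
 the directions which the residual has acquired since the current pivot was chosen; the factor
 \<open>1 - (x p)^2\<close> in the potential pays for all moves of the current pivot phase.\<close>

context
 fixes B :: "'b set" and mu :: "'b => real" and e :: "'b => 'a::euclidean_space" and a :: "'n::finite => 'a"
 assumes mu: "!!b. b \<in> B ==> 0 <= mu b" and a: "!!j. norm (a j) <= 1"
begin

private abbreviation "q == diag_form B mu e"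

text \<open>\<open>S\<close> holds the coordinates still to be rounded, \<open>U\<close> is the
  frame that pays for the rounding, taken from the span of the vectors indexed by \<open>T\<close>,
  and \<open>c\<close> is an additional budget. In a pivot phase \<open>T\<close> is
  \<open>S - {p}\<close>, because the directions in \<open>W\<close> are paid out of
  \<open>c\<close>.\<close>

private definition rounding :: "'n set => 'n set => ('n => real) => real => bool" where
 "rounding S T x c \<longleftrightarrow> (EX y U. (ALL j. j ~: S --> y j = x j) & (ALL j:S. \<bar>y j\<bar> = 1) & orthonormal U & U <= span (a ` T) &
  card U <= card T & q (\<Sum>j\<in>UNIV. y j *\<^sub>R a j) <= q (\<Sum>j\<in>UNIV. x j *\<^sub>R a j) + (\<Sum>u\<in>U. q u) + c)"

text \<open>Since \<open>W\<close> is orthogonal to the other alive vectors and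
  \<open>a p - r\<close> lies in their span, \<open>r\<close> is the component of \<open>a p\<close>
  orthogonal to them.\<close>

private definition pivot_state :: "'n set => 'n => 'a set => 'a => bool" where
 "pivot_state S p W r \<longleftrightarrow> p \<in> S & orthonormal W & (ALL w:W. ALL j:S-{p}. w \<bullet> a j = 0) & r \<in> span W & norm r <= 1 &
  a p - r \<in> span (a ` (S - {p}))"

private lemma q_nonneg: "0 <= q x" by (rule diag_form_nonneg) (rule mu)

text \<open>Freezing a coordinate other than the pivot may change the residual by a multiple of
  \<open>f\<close>, the normalised part of \<open>a j\<close> orthogonal to the remaining vectors.
  \<open>f\<close> joins \<open>W\<close>, and its cost, at most \<open>q f\<close>, is finally
  charged to the frame, which may grow by one vector because one index has left.\<close>

private lemma freeze_other:
 assumes C1: "!!W r. pivot_state (S - {j}) p W r ==> rounding (S - {j}) (S - {j} - {p}) x ((1 - (x p)^2) * (\<Sum>w\<in>W. q w))"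
  and x: "!!j. j \<in> S ==> \<bar>x j\<bar> <= 1" and P: "pivot_state S p W r" and j: "j \<in> S" "j ~= p" "\<bar>x j\<bar> = 1"
 shows "rounding S (S - {p}) x ((1 - (x p)^2) * (\<Sum>w\<in>W. q w))"
proof -
 let ?S' = "S - {j}"
 let ?V = "span (a ` (?S' - {p}))"
 have S': "S - {p} = insert j (?S' - {p})" using j by auto
 have pS: "p \<in> S" and oW: "orthonormal W" and Wa: "!!w i. w \<in> W ==> i \<in> S - {p} ==> w \<bullet> a i = 0" and rW: "r \<in> span W"
  and r1: "norm r <= 1" and rV: "a p - r \<in> span (a ` (S - {p}))" using P unfolding pivot_state_def by auto
 have card: "card (S - {p}) = Suc (card (?S' - {p}))" unfolding S' by simp
 have xp: "0 <= 1 - (x p)^2" "1 - (x p)^2 <= 1" using x[OF pS] by (auto simp: power_le_one_iff abs_square_le_1)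
 have sub: "?V <= span (a ` (S - {p}))" by (intro span_mono) auto
 obtain v z where vz: "v \<in> ?V" "!!w. w \<in> ?V ==> orthogonal z w" "a j = v + z"
  using orthogonal_subspace_decomp_exists[of "a ` (?S' - {p})" "a j"] by blast
 obtain k where k: "a p - r - k *\<^sub>R a j \<in> ?V" using rV unfolding S' by (auto simp: span_breakdown_eq)
 have rz: "a p - (r + k *\<^sub>R z) \<in> ?V"
 proof -
  have "a p - (r + k *\<^sub>R z) = (a p - r - k *\<^sub>R a j) + k *\<^sub>R v" unfolding vz(3) by (simp add: algebra_simps)
  moreover have "(a p - r - k *\<^sub>R a j) + k *\<^sub>R v \<in> ?V" by (intro span_add span_scale k vz(1))
  ultimately show ?thesis by (simp only:)
 qed
 have zs: "z \<in> span (a ` (S - {p}))"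
 proof -
  have "z = a j - v" using vz(3) by simp
  moreover have "a j \<in> span (a ` (S - {p}))" using j by (intro span_base) auto
  ultimately show ?thesis using vz(1) sub by (auto intro: span_diff)
 qed
 have WV: "w \<bullet> u = 0" if "w \<in> W" "u \<in> span (a ` (S - {p}))" for w u
  using orthogonal_to_span_image[of "S - {p}" w a u] Wa that by blast
 show ?thesis
 proof (cases "z = 0")
  case True
  then have "pivot_state ?S' p W r" unfolding pivot_state_def using pS oW Wa rW r1 rz j by auto
  from C1[OF this] obtain y U where yU: "!!i. i ~: ?S' ==> y i = x i" "!!i. i \<in> ?S' ==> \<bar>y i\<bar> = 1" "orthonormal U" "U <= ?V"
   "card U <= card (?S' - {p})"
   "q (\<Sum>j\<in>UNIV. y j *\<^sub>R a j) <= q (\<Sum>j\<in>UNIV. x j *\<^sub>R a j) + (\<Sum>u\<in>U. q u) + (1 - (x p)^2) * (\<Sum>w\<in>W. q w)"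
   unfolding rounding_def by blast
  show ?thesis unfolding rounding_def
  proof (intro exI[of _ y] exI[of _ U] conjI allI ballI impI)
   show "\<bar>y i\<bar> = 1" if "i \<in> S" for i using yU(1)[of j] yU(2)[of i] j(3) that by (cases "i = j") auto
  qed (use yU sub card in auto)
 next
  case False
  define f where "f = z /\<^sub>R norm z"
  have f1: "norm f = 1" using False unfolding f_def by simp
  have fs: "f \<in> span (a ` (S - {p}))" unfolding f_def using zs by (rule span_scale)
  have fV: "f \<bullet> u = 0" if "u \<in> ?V" for u using vz(2)[OF that] unfolding f_def orthogonal_def by simp
  have zf: "z = norm z *\<^sub>R f" unfolding f_def using False by simp
  have oW': "orthonormal (insert f W)" using oW f1 WV[OF _ fs] by (intro orthonormal_insert) auto
  have fW: "f ~: W" using WV[OF _ fs, of f] f1 by (auto simp: dot_square_norm)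
  let ?r = "r + k *\<^sub>R z"
  have "?r \<in> span (insert f W)"
  proof -
   have "k *\<^sub>R z \<in> span (insert f W)" by (subst zf) (intro span_scale span_base insertI1)
   then show ?thesis using rW span_mono[of W "insert f W"] by (intro span_add) auto
  qed
  moreover have "norm ?r <= 1"
  proof -
   have "r \<bullet> u = 0" if "u \<in> ?V" for u
   proof -
    have "subspace {r. r \<bullet> u = 0}" by (auto simp: subspace_def inner_add_left)
    then have "span W <= {r. r \<bullet> u = 0}" using WV that sub by (intro span_minimal) auto
    then show ?thesis using rW by auto
   qed
   then have "orthogonal ?r (a p - ?r)" using rz vz(2) unfolding orthogonal_def by (simp add: inner_add_left)
   then have "(norm (?r + (a p - ?r)))^2 = (norm ?r)^2 + (norm (a p - ?r))^2" by (rule norm_add_Pythagorean)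
   then have "(norm ?r)^2 <= (norm (a p))^2" by simp
   then have "norm ?r <= norm (a p)" by (rule power2_le_imp_le) simp
   then show ?thesis using a[of p] by simp
  qed
  moreover have "w \<bullet> a i = 0" if "w \<in> insert f W" "i \<in> ?S' - {p}" for w i
   using that Wa fV[of "a i"] by (auto intro: span_base)
  ultimately have "pivot_state ?S' p (insert f W) ?r" unfolding pivot_state_def using pS oW' rz j by auto
  from C1[OF this] obtain y U where yU: "!!i. i ~: ?S' ==> y i = x i" "!!i. i \<in> ?S' ==> \<bar>y i\<bar> = 1" "orthonormal U" "U <= ?V"
   "card U <= card (?S' - {p})"
   "q (\<Sum>j\<in>UNIV. y j *\<^sub>R a j) <= q (\<Sum>j\<in>UNIV. x j *\<^sub>R a j) + (\<Sum>u\<in>U. q u) + (1 - (x p)^2) * (\<Sum>w\<in>insert f W. q w)"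
   unfolding rounding_def by blast
  have finU: "finite U" "finite W" using yU(3) oW unfolding orthonormal_def by auto
  have fU: "f ~: U" using fV[of f] yU(4) f1 by (auto simp: dot_square_norm)
  have "(1 - (x p)^2) * q f <= q f" using xp q_nonneg[of f] by (simp add: mult_left_le_one_le)
  then have "(\<Sum>u\<in>U. q u) + (1 - (x p)^2) * (\<Sum>w\<in>insert f W. q w) <= (\<Sum>u\<in>insert f U. q u) + (1 - (x p)^2) * (\<Sum>w\<in>W. q w)"
   using finU fU fW by (simp add: algebra_simps)
  then have fin: "q (\<Sum>j\<in>UNIV. y j *\<^sub>R a j) <= q (\<Sum>j\<in>UNIV. x j *\<^sub>R a j) + (\<Sum>u\<in>insert f U. q u) + (1 - (x p)^2) * (\<Sum>w\<in>W. q w)"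
   using yU(6) by linarith
  show ?thesis unfolding rounding_def
  proof (intro exI[of _ y] exI[of _ "insert f U"] conjI allI ballI impI)
   show "\<bar>y i\<bar> = 1" if "i \<in> S" for i using yU(1)[of j] yU(2)[of i] j(3) that by (cases "i = j") auto
   show "orthonormal (insert f U)" using yU(3,4) f1 fV by (intro orthonormal_insert) (auto simp: inner_commute)
   show "insert f U <= span (a ` (S - {p}))" using fs yU(4) sub by auto
   show "card (insert f U) <= card (S - {p})" using yU(5) card finU fU by simp
  qed (use yU(1) fin in auto)
 qed
qed

private lemma freeze_some:
 assumes C0: "!!x. (!!j. j \<in> S - {p} ==> \<bar>x j\<bar> <= 1) ==> rounding (S - {p}) (S - {p}) x 0"
  and C1: "!!j x W r. j \<in> S ==> (!!i. i \<in> S - {j} ==> \<bar>x i\<bar> <= 1) ==> pivot_state (S - {j}) p W r ==> rounding (S - {j}) (S - {j} - {p}) x ((1 - (x p)^2) * (\<Sum>w\<in>W. q w))"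
  and x: "!!j. j \<in> S ==> \<bar>x j\<bar> <= 1" and P: "pivot_state S p W r" and j: "j \<in> S" "\<bar>x j\<bar> = 1"
 shows "rounding S (S - {p}) x ((1 - (x p)^2) * (\<Sum>w\<in>W. q w))"
proof (cases "j = p")
 case True
 have "rounding (S - {p}) (S - {p}) x 0" using x by (intro C0) auto
 then obtain y U where yU: "!!i. i ~: S - {p} ==> y i = x i" "!!i. i \<in> S - {p} ==> \<bar>y i\<bar> = 1" "orthonormal U" "U <= span (a ` (S - {p}))"
   "card U <= card (S - {p})" "q (\<Sum>j\<in>UNIV. y j *\<^sub>R a j) <= q (\<Sum>j\<in>UNIV. x j *\<^sub>R a j) + (\<Sum>u\<in>U. q u) + 0"
  unfolding rounding_def by blast
 have "(x p)^2 = 1" using True j(2) by (metis power2_abs one_power2)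
 then have "(1 - (x p)^2) * (\<Sum>w\<in>W. q w) = 0" by simp
 then show ?thesis unfolding rounding_def
 proof (intro exI[of _ y] exI[of _ U] conjI allI ballI impI)
  show "\<bar>y i\<bar> = 1" if "i \<in> S" for i using yU(1)[of p] yU(2)[of i] j(2) True that by (cases "i = p") auto
 qed (use yU in auto)
next
 case False
 show ?thesis
 proof (rule freeze_other[where S=S and j=j and p=p and x=x and W=W and r=r])
  show "rounding (S - {j}) (S - {j} - {p}) x ((1 - (x p)^2) * (\<Sum>w\<in>W. q w))" if "pivot_state (S - {j}) p W r" for W r
   using x by (intro C1[OF j(1) _ that]) auto
 qed (use x P j False in auto)
qed

text \<open>The walk is followed in both directions until a coordinate freezes, by \<open>s\<close>
  forwards and by \<open>t\<close> backwards. In the weighted mean the form gains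
  \<open>s * t * q r\<close> while \<open>1 - (x p)^2\<close> loses \<open>s * t\<close>, and
  \<open>q r\<close> is at most the sum over \<open>W\<close>. So the mean of the potentials does
  not increase and one of the two end points is good.\<close>

private lemma pivot_rounding:
 assumes C0: "!!x. (!!j. j \<in> S - {p} ==> \<bar>x j\<bar> <= 1) ==> rounding (S - {p}) (S - {p}) x 0"
  and C1: "!!j x W r. j \<in> S ==> (!!i. i \<in> S - {j} ==> \<bar>x i\<bar> <= 1) ==> pivot_state (S - {j}) p W r ==> rounding (S - {j}) (S - {j} - {p}) x ((1 - (x p)^2) * (\<Sum>w\<in>W. q w))"
  and x: "!!j. j \<in> S ==> \<bar>x j\<bar> <= 1" and P: "pivot_state S p W r"
 shows "rounding S (S - {p}) x ((1 - (x p)^2) * (\<Sum>w\<in>W. q w))"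
proof (cases "EX j:S. \<bar>x j\<bar> = 1")
 case True
 then obtain j where j: "j \<in> S" "\<bar>x j\<bar> = 1" by blast
 show ?thesis by (rule freeze_some[where S=S and j=j and p=p and x=x and W=W and r=r]) (fact C0 C1 x P j)+
next
 case False
 then have lt: "\<bar>x j\<bar> < 1" if "j \<in> S" for j using x[OF that] that by fastforce
 have pS: "p \<in> S" and oW: "orthonormal W" and rW: "r \<in> span W" and r1: "norm r <= 1" and rV: "a p - r \<in> span (a ` (S - {p}))"
  using P unfolding pivot_state_def by auto
 obtain c where c: "a p - r = (\<Sum>j\<in>S - {p}. c j *\<^sub>R a j)" using span_image_coeffs[OF finite rV] by blast
 \<comment> \<open>The pivot moves at unit speed and the other alive coordinates compensate, so that
   the vector sum moves exactly along \<open>r\<close>.\<close>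
 define u where "u j = (if j = p then 1 else if j \<in> S then - c j else 0)" for j
 have usum: "(\<Sum>j\<in>UNIV. u j *\<^sub>R a j) = r"
 proof -
  have "(\<Sum>j\<in>UNIV. u j *\<^sub>R a j) = (\<Sum>j\<in>S. u j *\<^sub>R a j)"
   unfolding u_def using pS by (intro sum.mono_neutral_right) auto
  also have "... = a p + (\<Sum>j\<in>S-{p}. u j *\<^sub>R a j)" using pS by (simp add: sum.remove[of S p] u_def)
  also have "(\<Sum>j\<in>S-{p}. u j *\<^sub>R a j) = - (\<Sum>j\<in>S - {p}. c j *\<^sub>R a j)"
   unfolding u_def sum_negf[symmetric] by (intro sum.cong) auto
  finally show ?thesis using c[symmetric] by simp
 qed
 have step: "EX y U. (ALL j. j ~: S --> y j = x j) & (ALL j:S. \<bar>y j\<bar> = 1) & orthonormal U & U <= span (a ` (S - {p})) &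
  card U <= card (S - {p}) & q (\<Sum>j\<in>UNIV. y j *\<^sub>R a j) <= q ((\<Sum>j\<in>UNIV. x j *\<^sub>R a j) + delta *\<^sub>R r) + (\<Sum>u\<in>U. q u) + (1 - (x p + delta)^2) * (\<Sum>w\<in>W. q w)"
  if delta: "!!i. i \<in> S ==> \<bar>x i + delta * u i\<bar> <= 1" and j: "j \<in> S" "\<bar>x j + delta * u j\<bar> = 1" for delta j
 proof -
  let ?x = "%j. x j + delta * u j"
  have R: "rounding S (S - {p}) ?x ((1 - (?x p)^2) * (\<Sum>w\<in>W. q w))"
   by (rule freeze_some[where S=S and j=j and p=p and x="?x" and W=W and r=r]) (fact C0 C1 delta P j)+
  have X: "(\<Sum>j\<in>UNIV. ?x j *\<^sub>R a j) = (\<Sum>j\<in>UNIV. x j *\<^sub>R a j) + delta *\<^sub>R r"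
   unfolding usum[symmetric] by (simp add: scaleR_sum_right sum.distrib scaleR_add_left)
  have xp: "?x p = x p + delta" by (simp add: u_def)
  obtain y U where yU: "ALL j. j ~: S --> y j = ?x j" "ALL j:S. \<bar>y j\<bar> = 1" "orthonormal U" "U <= span (a ` (S - {p}))" "card U <= card (S - {p})"
   "q (\<Sum>j\<in>UNIV. y j *\<^sub>R a j) <= q ((\<Sum>j\<in>UNIV. x j *\<^sub>R a j) + delta *\<^sub>R r) + (\<Sum>u\<in>U. q u) + (1 - (x p + delta)^2) * (\<Sum>w\<in>W. q w)"
   using R unfolding rounding_def X xp by blast
  moreover have "ALL j. j ~: S --> y j = x j" using yU(1) pS by (auto simp: u_def)
  ultimately show ?thesis by blast
 qed
 obtain s j where s: "s > 0" "j \<in> S" "\<bar>x j + s * u j\<bar> = 1" "!!i. i \<in> S ==> \<bar>x i + s * u i\<bar> <= 1"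
  using hit_boundary[of S p u x] lt pS by (auto simp: u_def)
 obtain t i where t: "t > 0" "i \<in> S" "\<bar>x i + t * (- u i)\<bar> = 1" "!!i. i \<in> S ==> \<bar>x i + t * (- u i)\<bar> <= 1"
  using hit_boundary[of S p "%j. - u j" x] lt pS by (auto simp: u_def)
 let ?X = "\<Sum>j\<in>UNIV. x j *\<^sub>R a j" and ?Q = "\<Sum>w\<in>W. q w"
 obtain y1 U1 where 1: "ALL j. j ~: S --> y1 j = x j" "ALL j:S. \<bar>y1 j\<bar> = 1" "orthonormal U1" "U1 <= span (a ` (S - {p}))" "card U1 <= card (S - {p})"
  "q (\<Sum>j\<in>UNIV. y1 j *\<^sub>R a j) <= q (?X + s *\<^sub>R r) + (\<Sum>u\<in>U1. q u) + (1 - (x p + s)^2) * ?Q"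
  using step[OF s(4,2,3)] by blast
 have t': "\<bar>x i + (- t) * u i\<bar> = 1" "!!i. i \<in> S ==> \<bar>x i + (- t) * u i\<bar> <= 1" using t by auto
 obtain y2 U2 where 2: "ALL j. j ~: S --> y2 j = x j" "ALL j:S. \<bar>y2 j\<bar> = 1" "orthonormal U2" "U2 <= span (a ` (S - {p}))" "card U2 <= card (S - {p})"
  "q (\<Sum>j\<in>UNIV. y2 j *\<^sub>R a j) <= q (?X + (- t) *\<^sub>R r) + (\<Sum>u\<in>U2. q u) + (1 - (x p + (- t))^2) * ?Q"
  using step[OF t'(2) t(2) t'(1)] by blast
 define E1 where "E1 = q (\<Sum>j\<in>UNIV. y1 j *\<^sub>R a j) - (\<Sum>u\<in>U1. q u)"
 define E2 where "E2 = q (\<Sum>j\<in>UNIV. y2 j *\<^sub>R a j) - (\<Sum>u\<in>U2. q u)"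
 let ?R = "q ?X + (1 - (x p)^2) * ?Q"
 have "t * E1 + s * E2 <= t * (q (?X + s *\<^sub>R r) + (1 - (x p + s)^2) * ?Q) + s * (q (?X + (- t) *\<^sub>R r) + (1 - (x p + (- t))^2) * ?Q)"
  using 1(6) 2(6) s(1) t(1) unfolding E1_def E2_def by (intro add_mono mult_left_mono) auto
 also have "... = (s + t) * (q ?X + s * t * q r) + (s + t) * (1 - (x p)^2 - s * t) * ?Q"
  unfolding diag_form_average[symmetric] by (simp add: algebra_simps power2_eq_square)
 also have "... <= (s + t) * (q ?X + s * t * ?Q) + (s + t) * (1 - (x p)^2 - s * t) * ?Q"
 proof -
  have "q r <= ?Q" by (rule diag_form_span_bound[OF _ oW rW r1]) (rule mu)
  then have "(s + t) * (q ?X + s * t * q r) <= (s + t) * (q ?X + s * t * ?Q)"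
   using s(1) t(1) by (intro add_left_mono mult_left_mono) auto
  then show ?thesis by simp
 qed
 also have "... = t * ?R + s * ?R" by (simp add: algebra_simps)
 finally have le: "t * E1 + s * E2 <= t * ?R + s * ?R" .
 have "E1 <= ?R | E2 <= ?R"
 proof -
  have "t * ?R + s * ?R < t * E1 + s * E2" if "?R < E1" "?R < E2"
   using s(1) t(1) that by (intro add_strict_mono mult_strict_left_mono)
  with le show ?thesis by (meson not_le)
 qed
 then show ?thesis
 proof
  assume "E1 <= ?R"
  then show ?thesis unfolding rounding_def E1_def using 1 by (intro exI[of _ y1] exI[of _ U1]) auto
 next
  assume "E2 <= ?R"
  then show ?thesis unfolding rounding_def E2_def using 2 by (intro exI[of _ y2] exI[of _ U2]) auto
 qed
qed

text \<open>A phase begins with any alive pivot and with the direction of its residual in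
  \<open>W\<close>. This direction is orthogonal to the span of the other alive vectors, so it can
  afterwards be added to the frame, its budget factor being at most 1.\<close>

private lemma start_rounding:
 assumes C1: "!!p W r. pivot_state S p W r ==> rounding S (S - {p}) x ((1 - (x p)^2) * (\<Sum>w\<in>W. q w))"
  and x: "!!j. j \<in> S ==> \<bar>x j\<bar> <= 1"
 shows "rounding S S x 0"
proof (cases "S = {}")
 case True
 then show ?thesis unfolding rounding_def by (intro exI[of _ x] exI[of _ "{}"]) (auto simp: orthonormal_def)
next
 case False
 then obtain p where p: "p \<in> S" by blast
 obtain v r where vr: "v \<in> span (a ` (S - {p}))" "!!w. w \<in> span (a ` (S - {p})) ==> orthogonal r w" "a p = v + r"
  using orthogonal_subspace_decomp_exists[of "a ` (S - {p})" "a p"] by blast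
 define W where "W = (if r = 0 then {} else {r /\<^sub>R norm r})"
 have oW: "orthonormal W" unfolding W_def orthonormal_def by auto
 have rW: "r \<in> span W"
 proof (cases "r = 0")
  case False
  then have "r = norm r *\<^sub>R (r /\<^sub>R norm r)" by simp
  then show ?thesis using False unfolding W_def by (metis insertI1 span_base span_scale)
 qed (simp add: W_def)
 have rp: "r \<in> span (a ` S)"
 proof -
  have "r = a p - v" using vr(3) by simp
  moreover have "a p \<in> span (a ` S)" using p by (intro span_base) auto
  moreover have "v \<in> span (a ` S)" using vr(1) span_mono[of "a ` (S - {p})" "a ` S"] by auto
  ultimately show ?thesis by (auto intro: span_diff)
 qed
 have "(norm (v + r))^2 = (norm v)^2 + (norm r)^2"
  using vr(2)[OF vr(1)] by (intro norm_add_Pythagorean) (simp add: orthogonal_commute)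
 then have "(norm r)^2 <= (norm (a p))^2" unfolding vr(3) by simp
 then have "norm r <= norm (a p)" by (rule power2_le_imp_le) simp
 then have r1: "norm r <= 1" using a[of p] by simp
 have "pivot_state S p W r" unfolding pivot_state_def
 proof (intro conjI ballI p oW rW r1)
  fix w j assume "w \<in> W" "j \<in> S - {p}"
  then show "w \<bullet> a j = 0" using vr(2)[of "a j"] unfolding W_def orthogonal_def by (auto split: if_splits intro: span_base)
  next show "a p - r \<in> span (a ` (S - {p}))" using vr by simp
 qed
 from C1[OF this] obtain y U where yU: "ALL j. j ~: S --> y j = x j" "ALL j:S. \<bar>y j\<bar> = 1" "orthonormal U" "U <= span (a ` (S - {p}))" "card U <= card (S - {p})"
  "q (\<Sum>j\<in>UNIV. y j *\<^sub>R a j) <= q (\<Sum>j\<in>UNIV. x j *\<^sub>R a j) + (\<Sum>u\<in>U. q u) + (1 - (x p)^2) * (\<Sum>w\<in>W. q w)"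
  unfolding rounding_def by blast
 have fin: "finite U" "finite W" using yU(3) oW unfolding orthonormal_def by auto
 have WU: "w \<bullet> u = 0" if "w \<in> W" "u \<in> U" for w u
  using that vr(2)[of u] yU(4) unfolding W_def orthogonal_def by (auto split: if_splits)
 have dis: "U Int W = {}"
  using WU oW unfolding orthonormal_def by (metis disjoint_iff inner_eq_zero_iff norm_zero zero_neq_one)
 have oUW: "orthonormal (U Un W)"
 proof -
  have UW: "u \<bullet> w = 0" if "w \<in> W" "u \<in> U" for w u using WU[OF that] by (simp add: inner_commute)
  show ?thesis using yU(3) oW WU UW unfolding orthonormal_def pairwise_def orthogonal_def by blast
 qed
 have "(1 - (x p)^2) * (\<Sum>w\<in>W. q w) <= 1 * (\<Sum>w\<in>W. q w)" by (intro mult_right_mono sum_nonneg q_nonneg) auto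
 then have b: "q (\<Sum>j\<in>UNIV. y j *\<^sub>R a j) <= q (\<Sum>j\<in>UNIV. x j *\<^sub>R a j) + (\<Sum>u\<in>U Un W. q u) + 0"
  using yU(6) sum.union_disjoint[OF fin dis, of q] by simp
 have sub: "U Un W <= span (a ` S)"
  using yU(4) span_mono[of "a ` (S - {p})" "a ` S"] rp unfolding W_def by (auto intro: span_scale)
 have cW: "card W <= 1" unfolding W_def by (cases "r = 0") simp_all
 have "card S = Suc (card (S - {p}))" by (rule card.remove[OF finite p])
 with cW have c: "card (U Un W) <= card S" using card_Un_le[of U W] yU(5) by linarith
 show ?thesis unfolding rounding_def
  by (rule exI[of _ y], rule exI[of _ "U Un W"]) (intro conjI yU(1,2) oUW sub c b)
qed

text \<open>Freezing leads to smaller sets, while the first claim for \<open>S\<close> rests on the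
  second one for the same \<open>S\<close>; hence the joint induction.\<close>

private lemma walk:
 "(ALL x. (ALL j:S. \<bar>x j\<bar> <= 1) --> rounding S S x 0) &
 (ALL x p W r. (ALL j:S. \<bar>x j\<bar> <= 1) --> pivot_state S p W r --> rounding S (S - {p}) x ((1 - (x p)^2) * (\<Sum>w\<in>W. q w)))"
proof (induction "card S" arbitrary: S rule: less_induct)
 case less
 have C1: "rounding S (S - {p}) x ((1 - (x p)^2) * (\<Sum>w\<in>W. q w))" if x: "ALL j:S. \<bar>x j\<bar> <= 1" and P: "pivot_state S p W r" for x p W r
 proof (rule pivot_rounding[OF _ _ _ P])
  have pS: "p \<in> S" using P unfolding pivot_state_def by auto
  have sm: "card (S - {j}) < card S" if "j \<in> S" for j using that by (rule card_Diff1_less[OF finite])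
  show "rounding (S - {p}) (S - {p}) x 0" if "!!j. j \<in> S - {p} ==> \<bar>x j\<bar> <= 1" for x
   using less[OF sm[OF pS]] that by blast
  show "rounding (S - {j}) (S - {j} - {p}) x ((1 - (x p)^2) * (\<Sum>w\<in>W. q w))"
   if "j \<in> S" "!!i. i \<in> S - {j} ==> \<bar>x i\<bar> <= 1" "pivot_state (S - {j}) p W r" for j x W r
   using less[OF sm[OF that(1)]] that(2,3) by blast
 qed (use x in auto)
 then show ?case using start_rounding by blast
qed

text \<open>The signed sum is compared with the trace of the form over at most as many orthonormal
  vectors as there are columns. This is what later limits the loss of the minimising player to a sum
  of at most \<open>k\<close> eigenvalues.\<close>

theorem balance_diag_form:
 obtains y U where "!!j. y j \<in> {-1, 1}" "orthonormal U" "U <= span (range a)" "card U <= CARD('n)"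
  "q (\<Sum>j\<in>UNIV. y j *\<^sub>R a j) <= (\<Sum>u\<in>U. q u)"
proof -
 have "rounding UNIV UNIV (%_. 0) 0" using walk[of UNIV] by simp
 then obtain y U where "ALL j. \<bar>y j\<bar> = 1" "orthonormal U" "U <= span (range a)" "card U <= CARD('n)"
  "q (\<Sum>j\<in>UNIV. y j *\<^sub>R a j) <= q (\<Sum>j\<in>UNIV. (%_. 0) j *\<^sub>R a j) + (\<Sum>u\<in>U. q u) + 0" unfolding rounding_def by auto
 moreover have "q (\<Sum>j\<in>UNIV. (%_. 0) j *\<^sub>R a j) = 0" by (simp add: diag_form_def)
 ultimately show ?thesis using that[of y U] by (auto simp: abs_eq_iff) (metis abs_1 abs_eq_iff)
qed

end

subsection \<open>Test functions and weak subsolutions\<close>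

lemma norm_matrix_vector_mult_le:
 fixes A :: "real^'m^'n"
 shows "norm (A *v h) <= norm A * norm h"
proof -
 have "norm (A *v h) <= L2_set (%i. norm (A $ i) * norm h) UNIV"
  unfolding norm_vec_def[of "A *v h"]
 proof (rule L2_set_mono)
  fix i show "norm ((A *v h) $ i) <= norm (A $ i) * norm h"
   using Cauchy_Schwarz_ineq2[of "A $ i" h] by (simp add: matrix_vector_mul_component)
 qed simp
 also have "... = norm A * norm h" unfolding norm_vec_def[of A] by (simp add: L2_set_left_distrib)
 finally show ?thesis .
qed

lemma quadratic_form_le:
 fixes A :: "real^'m^'m"
 shows "\<bar>(A *v h) \<bullet> h\<bar> <= norm A * (norm h)^2"
proof -
 have "\<bar>(A *v h) \<bullet> h\<bar> <= norm (A *v h) * norm h" by (rule Cauchy_Schwarz_ineq2)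
 also have "... <= (norm A * norm h) * norm h" by (intro mult_right_mono norm_matrix_vector_mult_le) simp
 finally show ?thesis by (simp add: power2_eq_square mult.assoc)
qed

text \<open>The mean value inequality is applied to \<open>P\<close>, the increment of
  \<open>f\<close> over \<open>t *\<^sub>R k\<close> minus its expected linear part, so
  differentiability of \<open>g\<close> at the single point \<open>x\<close> suffices. The second
  difference itself is symmetric in \<open>h\<close> and \<open>k\<close>, which yields the symmetry
  of the Hessian.\<close>

lemma gradient_second_difference:
 fixes f :: "'a::euclidean_space => real"
 assumes f: "!!y. (f has_derivative (%h. g y \<bullet> h)) (at y)" and g: "(g has_derivative D) (at x)" and e: "e > 0"
 shows "EX d>0. ALL t. 0 < t & t < d --> \<bar>f (x + t *\<^sub>R h + t *\<^sub>R k) - f (x + t *\<^sub>R h) - f (x + t *\<^sub>R k) + f x - t^2 * (D k \<bullet> h)\<bar> <= e * t^2"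
proof -
 define c where "c = (2 * norm h + norm k) * norm h + 1"
 have c: "c > 0" unfolding c_def by (intro add_nonneg_pos) auto
 have lin: "linear D" using g by (rule has_derivative_linear)
 obtain d where d: "d > 0" "!!y. norm (y - x) < d ==> norm (g y - g x - D (y - x)) <= (e / c) * norm (y - x)"
  using g e c unfolding has_derivative_at_alt by (metis divide_pos_pos)
 have n: "norm h + norm k + 1 > 0" by (intro add_nonneg_pos) auto
 have "\<bar>f (x + t *\<^sub>R h + t *\<^sub>R k) - f (x + t *\<^sub>R h) - f (x + t *\<^sub>R k) + f x - t^2 * (D k \<bullet> h)\<bar> <= e * t^2"
  if t: "0 < t" "t < d / (norm h + norm k + 1)" for t
 proof -
  define P where "P y = f (y + t *\<^sub>R k) - f y - t * (D k \<bullet> y)" for y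
  have td: "t * norm h + t * norm k + t < d" "0 <= t * norm k" using t n by (simp_all add: pos_less_divide_eq distrib_left)
  have "norm (P (x + t *\<^sub>R h) - P x) <= (e / c * (t * (2 * norm h + norm k))) * norm (x + t *\<^sub>R h - x)"
  proof (rule differentiable_bound[OF convex_cball[of x "t * norm h"]])
   fix y assume y: "y \<in> cball x (t * norm h)"
   have "((%y. f (y + t *\<^sub>R k)) has_derivative (%v. g (y + t *\<^sub>R k) \<bullet> v)) (at y)"
    by (rule has_derivative_compose[OF _ f]) (auto intro!: derivative_eq_intros)
   then have "(P has_derivative (%v. g (y + t *\<^sub>R k) \<bullet> v - g y \<bullet> v - t * (D k \<bullet> v))) (at y)"
    unfolding P_def by (auto intro!: derivative_intros f)
   then show "(P has_derivative (%v. (g (y + t *\<^sub>R k) - g y - t *\<^sub>R D k) \<bullet> v)) (at y within cball x (t * norm h))"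
    unfolding inner_diff_left inner_scaleR_left by (rule has_derivative_at_withinI)
   have ny: "norm (y - x) <= t * norm h" using y unfolding mem_cball dist_norm norm_minus_commute[of x] .
   have "y + t *\<^sub>R k - x = (y - x) + t *\<^sub>R k" by simp
   then have "norm (y + t *\<^sub>R k - x) <= norm (y - x) + norm (t *\<^sub>R k)" by (simp only: norm_triangle_ineq)
   moreover have "norm (t *\<^sub>R k) = t * norm k" using t by simp
   ultimately have nyk: "norm (y + t *\<^sub>R k - x) <= t * norm h + t * norm k" using ny by linarith
   have dk: "t * norm h + t * norm k < d" "t * norm h < d" using td t(1) by linarith+
   have ec: "0 <= e / c" using e c by simp
   have n: "norm (g (y + t *\<^sub>R k) - g x - D (y + t *\<^sub>R k - x)) <= e / c * (t * norm h + t * norm k)"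
    by (rule order_trans[OF d(2)[OF le_less_trans[OF nyk dk(1)]] mult_left_mono[OF nyk ec]])
   have n': "norm (g y - g x - D (y - x)) <= e / c * (t * norm h)"
    by (rule order_trans[OF d(2)[OF le_less_trans[OF ny dk(2)]] mult_left_mono[OF ny ec]])
   have "g (y + t *\<^sub>R k) - g y - t *\<^sub>R D k = (g (y + t *\<^sub>R k) - g x - D (y + t *\<^sub>R k - x)) - (g y - g x - D (y - x))"
    using linear_add[OF lin, of "y - x" "t *\<^sub>R k"] by (simp add: linear_cmul[OF lin] algebra_simps)
   then have "norm (g (y + t *\<^sub>R k) - g y - t *\<^sub>R D k) <= e / c * (t * norm h + t * norm k) + e / c * (t * norm h)"
    by (simp only:) (rule order_trans[OF norm_triangle_ineq4 add_mono[OF n n']])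
   also have "... = e / c * (t * (2 * norm h + norm k))" by (simp add: algebra_simps)
   finally show "onorm (%v. (g (y + t *\<^sub>R k) - g y - t *\<^sub>R D k) \<bullet> v) <= e / c * (t * (2 * norm h + norm k))"
    by (intro onorm_le order_trans[OF Cauchy_Schwarz_ineq2[folded real_norm_def] mult_right_mono]) auto
  qed (use t in "auto simp: dist_norm")
  also have "... = e * t^2 * ((2 * norm h + norm k) * norm h / c)" using t by (simp add: power2_eq_square)
  also have "... <= e * t^2 * 1" using e c by (intro mult_left_mono) (auto simp: c_def)
  finally show ?thesis unfolding P_def by (simp add: inner_add_right power2_eq_square algebra_simps)
 qed
 then show ?thesis using d(1) n by (intro exI[of _ "d / (norm h + norm k + 1)"]) simp
qed

lemma gradient_derivative_symmetric:
 fixes f :: "'a::euclidean_space => real"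
 assumes "!!y. (f has_derivative (%h. g y \<bullet> h)) (at y)" "(g has_derivative D) (at x)"
 shows "D k \<bullet> h = D h \<bullet> k"
proof -
 have "\<bar>D k \<bullet> h - D h \<bullet> k\<bar> <= 0 + e" if "e > 0" for e
 proof -
  have e: "e / 2 > 0" using that by simp
  obtain d1 d2 where 1: "d1 > 0" "!!t. 0 < t & t < d1 ==> \<bar>f (x + t *\<^sub>R h + t *\<^sub>R k) - f (x + t *\<^sub>R h) - f (x + t *\<^sub>R k) + f x - t^2 * (D k \<bullet> h)\<bar> <= e / 2 * t^2"
   and 2: "d2 > 0" "!!t. 0 < t & t < d2 ==> \<bar>f (x + t *\<^sub>R k + t *\<^sub>R h) - f (x + t *\<^sub>R k) - f (x + t *\<^sub>R h) + f x - t^2 * (D h \<bullet> k)\<bar> <= e / 2 * t^2"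
   using gradient_second_difference[OF assms e, of h k] gradient_second_difference[OF assms e, of k h] by blast
  obtain t where t: "0 < t" "t < min d1 d2" using dense[of 0 "min d1 d2"] 1 2 by auto
  have c: "x + t *\<^sub>R k + t *\<^sub>R h = x + t *\<^sub>R h + t *\<^sub>R k" by simp
  have "\<bar>t^2 * (D k \<bullet> h) - t^2 * (D h \<bullet> k)\<bar> <= e / 2 * t^2 + e / 2 * t^2"
   using 1(2)[of t] 2(2)[of t, unfolded c] t unfolding min_less_iff_conj by linarith
  also have "... = t^2 * e" by simp
  finally have "t^2 * \<bar>D k \<bullet> h - D h \<bullet> k\<bar> <= t^2 * e" by (simp only: right_diff_distrib[symmetric] abs_mult abs_power2)
  then show ?thesis using t by simp
 qed
 then show ?thesis using field_le_epsilon[of "\<bar>D k \<bullet> h - D h \<bullet> k\<bar>" 0] by simp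
qed

lemma symmetric_matrixI:
 fixes A :: "real^'m^'m"
 assumes "!!h k. (A *v k) \<bullet> h = (A *v h) \<bullet> k"
 shows "transpose A = A"
proof -
 have "A $ i $ j = A $ j $ i" for i j
  using assms[of "axis j 1" "axis i 1"] by (simp add: matrix_vector_mult_basis inner_axis column_def)
 then show ?thesis by (simp add: transpose_def vec_eq_iff)
qed

lemma test_function_symmetric:
 assumes "test_function phi phit g H" "t < 0"
 shows "transpose (H (x, t)) = H (x, t)"
proof (rule symmetric_matrixI)
 fix h k
 show "(H (x, t) *v k) \<bullet> h = (H (x, t) *v h) \<bullet> k"
  using assms by (intro gradient_derivative_symmetric[of "%y. phi (y, t)" "%y. g (y, t)" "%h. H (x, t) *v h" x])
   (auto simp: test_function_def)
qed

lemma test_function_isCont: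
 assumes tf: "test_function phi phit g H" and t: "t < 0"
 shows "isCont phit (x, t)" "isCont g (x, t)" "isCont H (x, t)"
proof -
 have op: "open ((UNIV :: (real^'m) set) \<times> {..<0::real})" by (intro open_Times) auto
 show "isCont phit (x, t)" "isCont g (x, t)" "isCont H (x, t)"
  using tf t continuous_on_eq_continuous_at[OF op] unfolding test_function_def by auto
qed

lemma test_function_taylor_exact:
 assumes tf: "test_function phi phit g H" and t: "t < 0"
 shows "EX theta:{0..1}. phi (y + h, t) = phi (y, t) + g (y, t) \<bullet> h + ((H (y + theta *\<^sub>R h, t) *v h) \<bullet> h) / 2"
proof -
 define k where "k m s = (if m = 0 then phi (y + s *\<^sub>R h, t) else if m = 1 then g (y + s *\<^sub>R h, t) \<bullet> h else (H (y + s *\<^sub>R h, t) *v h) \<bullet> h)" for m :: nat and s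
 have d0: "((%s. phi (y + s *\<^sub>R h, t)) has_real_derivative g (y + s *\<^sub>R h, t) \<bullet> h) (at s)" for s
 proof -
  have "((%y. phi (y, t)) has_derivative (%h. g (z, t) \<bullet> h)) (at z)" for z using tf t unfolding test_function_def by auto
  then have "((%s. phi (y + s *\<^sub>R h, t)) has_derivative (%r. g (y + s *\<^sub>R h, t) \<bullet> (r *\<^sub>R h))) (at s)"
   by (rule has_derivative_compose[of "%s. y + s *\<^sub>R h", rotated]) (auto intro!: derivative_eq_intros)
  then show ?thesis unfolding has_field_derivative_def by (rule has_derivative_eq_rhs) (auto simp: mult.commute)
 qed
 have d1: "((%s. g (y + s *\<^sub>R h, t) \<bullet> h) has_real_derivative (H (y + s *\<^sub>R h, t) *v h) \<bullet> h) (at s)" for s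
 proof -
  have "((%y. g (y, t)) has_derivative (%h. H (z, t) *v h)) (at z)" for z using tf t unfolding test_function_def by auto
  then have "((%s. g (y + s *\<^sub>R h, t)) has_derivative (%r. H (y + s *\<^sub>R h, t) *v (r *\<^sub>R h))) (at s)"
   by (rule has_derivative_compose[of "%s. y + s *\<^sub>R h", rotated]) (auto intro!: derivative_eq_intros)
  then have "((%s. g (y + s *\<^sub>R h, t) \<bullet> h) has_derivative (%r. (H (y + s *\<^sub>R h, t) *v (r *\<^sub>R h)) \<bullet> h)) (at s)"
   by (rule has_derivative_inner_left)
  then show ?thesis unfolding has_field_derivative_def by (rule has_derivative_eq_rhs) (auto simp: matrix_vector_mult_scaleR mult.commute)
 qed
 have "EX s>0. s < 1 & k 0 1 = (\<Sum>m<2. (k m 0 / fact m) * 1 ^ m) + (k 2 s / fact 2) * 1 ^ 2"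
 proof (rule Maclaurin)
  show "ALL m s. m < 2 & 0 <= s & s <= 1 --> DERIV (k m) s :> k (Suc m) s"
  proof (intro allI impI)
   fix m :: nat and s :: real assume "m < 2 & 0 <= s & s <= 1"
   then have "m = 0 | m = 1" by auto
   then show "DERIV (k m) s :> k (Suc m) s" using d0 d1 unfolding k_def by auto
  qed
 qed auto
 then obtain s where s: "0 < s" "s < 1" "k 0 1 = k 0 0 + k 1 0 + k 2 s / 2" by (auto simp: numeral_2_eq_2)
 then show ?thesis unfolding k_def by (intro bexI[of _ s]) auto
qed

text \<open>The estimate is uniform in the base point and uses the derivatives there, because the
  positions of the game only lie near \<open>(x0, t0)\<close>. The spatial step is made at fixed
  time, the time step afterwards at fixed position.\<close>

lemma test_function_taylor:
 fixes x0 :: "real^'m"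
 assumes tf: "test_function phi phit g H" and t0: "t0 < 0" and omega: "omega > 0"
 shows "EX r>0. ALL y t h s. dist (y, t) (x0, t0) < r --> norm h < r --> \<bar>s\<bar> < r --> t < 0 & t + s < 0 &
  phi (y + h, t + s) <= phi (y, t) + phit (y, t) * s + g (y, t) \<bullet> h + ((H (y, t) *v h) \<bullet> h) / 2 + omega * ((norm h)^2 + \<bar>s\<bar>)"
proof -
 obtain d1 where d1: "d1 > 0" "!!z. dist z (x0, t0) < d1 ==> dist (phit z) (phit (x0, t0)) < omega / 2"
  using test_function_isCont(1)[OF tf t0] omega unfolding continuous_at_eps_delta by (metis half_gt_zero)
 obtain d2 where d2: "d2 > 0" "!!z. dist z (x0, t0) < d2 ==> dist (H z) (H (x0, t0)) < omega / 2"
  using test_function_isCont(3)[OF tf t0] omega unfolding continuous_at_eps_delta by (metis half_gt_zero)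
 define r where "r = Min {d1, d2, - t0} / 4"
 have r: "r > 0" "4 * r <= d1" "4 * r <= d2" "4 * r <= - t0" unfolding r_def using d1 d2 t0 by auto
 have "t < 0 & t + s < 0 &
  phi (y + h, t + s) <= phi (y, t) + phit (y, t) * s + g (y, t) \<bullet> h + ((H (y, t) *v h) \<bullet> h) / 2 + omega * ((norm h)^2 + \<bar>s\<bar>)"
  if yt: "dist (y, t) (x0, t0) < r" and h: "norm h < r" and s: "\<bar>s\<bar> < r" for y t h s
 proof -
  have dt: "\<bar>t - t0\<bar> < r" using yt dist_snd_le[of "(y,t)" "(x0,t0)"] by (simp add: dist_real_def)
  have tl: "t < 0" "t + s < 0" using dt s r by linarith+
  have near: "dist (y + h', t + s') (x0, t0) < 4 * r" if "norm h' <= norm h" "\<bar>s'\<bar> <= \<bar>s\<bar>" for h' s'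
  proof -
   have "dist (y + h', t + s') (y, t) <= norm h' + \<bar>s'\<bar>"
    unfolding dist_Pair_Pair using sqrt_sum_squares_le_sum_abs[of "norm h'" s'] by (simp add: dist_norm)
   then show ?thesis using that h s yt dist_triangle[of "(y + h', t + s')" "(x0, t0)" "(y, t)"] r by linarith
  qed
  have yt4: "dist (y, t) (x0, t0) < 4 * r" using yt r by linarith
  obtain theta where theta: "theta \<in> {0..1}" "phi (y + h, t) = phi (y, t) + g (y, t) \<bullet> h + ((H (y + theta *\<^sub>R h, t) *v h) \<bullet> h) / 2"
   using test_function_taylor_exact[OF tf tl(1)] by blast
  have th: "norm (theta *\<^sub>R h) <= norm h" using theta(1) by (simp add: mult_left_le_one_le)
  have "dist (H (y + theta *\<^sub>R h, t)) (H (y, t)) < omega"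
   using d2(2)[of "(y + theta *\<^sub>R h, t)"] d2(2)[of "(y, t)"] near[OF th, of 0] yt4 r
    dist_triangle2[of "H (y + theta *\<^sub>R h, t)" "H (y, t)" "H (x0, t0)"] by simp
  then have nH: "norm (H (y + theta *\<^sub>R h, t) - H (y, t)) <= omega" by (simp add: dist_norm)
  have "((H (y + theta *\<^sub>R h, t) *v h) \<bullet> h) - ((H (y, t) *v h) \<bullet> h) = ((H (y + theta *\<^sub>R h, t) - H (y, t)) *v h) \<bullet> h"
   by (simp add: matrix_vector_mult_diff_rdistrib inner_diff_left)
  also have "... <= norm (H (y + theta *\<^sub>R h, t) - H (y, t)) * (norm h)^2" using quadratic_form_le by (rule order_trans[OF abs_ge_self])
  also have "... <= omega * (norm h)^2" using nH by (rule mult_right_mono) simp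
  finally have Hle: "((H (y + theta *\<^sub>R h, t) *v h) \<bullet> h) - ((H (y, t) *v h) \<bullet> h) <= omega * (norm h)^2" .
  have 1: "phi (y + h, t) <= phi (y, t) + g (y, t) \<bullet> h + ((H (y, t) *v h) \<bullet> h) / 2 + omega * (norm h)^2"
  proof -
   have "0 <= omega * (norm h)^2" using omega by simp
   then show ?thesis using theta(2) Hle by linarith
  qed
  have tder: "((%s. phi (y + h, s)) has_real_derivative phit (y + h, u)) (at u)" if "u < 0" for u
   using tf that unfolding test_function_def by auto
  have 2: "phi (y + h, t + s) - phi (y + h, t) <= phit (y, t) * s + omega * \<bar>s\<bar>"
  proof (cases "s = 0")
   case False
   obtain u where u: "u \<in> {min t (t+s)..max t (t+s)}" "phi (y + h, t + s) - phi (y + h, t) = s * phit (y + h, u)"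
   proof (cases "s > 0")
    case True
    then obtain u where "t < u" "u < t + s" "phi (y + h, t + s) - phi (y + h, t) = (t + s - t) * phit (y + h, u)"
     using MVT2[of t "t+s" "%s. phi (y + h, s)" "%u. phit (y + h, u)"] tder tl by force
    then show ?thesis using that[of u] by auto
   next
    case False
    with \<open>s ~= 0\<close> have "s < 0" by simp
    then obtain u where "t + s < u" "u < t" "phi (y + h, t) - phi (y + h, t + s) = (t - (t + s)) * phit (y + h, u)"
     using MVT2[of "t+s" t "%s. phi (y + h, s)" "%u. phit (y + h, u)"] tder tl by force
    then show ?thesis using that[of u] by auto
   qed
   have us: "\<bar>u - t\<bar> <= \<bar>s\<bar>" using u(1) by auto
   have "dist (phit (y + h, u)) (phit (y, t)) < omega"
    using d1(2)[of "(y + h, u)"] d1(2)[of "(y, t)"] near[of h "u - t"] us yt4 r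
     dist_triangle2[of "phit (y + h, u)" "phit (y, t)" "phit (x0, t0)"] by simp
   then have "\<bar>s * (phit (y + h, u) - phit (y, t))\<bar> <= \<bar>s\<bar> * omega" unfolding abs_mult by (intro mult_left_mono) (auto simp: dist_real_def)
   then show ?thesis unfolding u(2) by (simp add: algebra_simps abs_le_iff)
  qed simp
  from 1 2 tl show ?thesis by (simp add: algebra_simps)
 qed
 with r(1) show ?thesis by blast
qed

section \<open>Sums, shifts and explicit test functions\<close>

lemma test_function_add:
 assumes 1: "test_function phi phit g H" and 2: "test_function phi' phit' g' H'"
 shows "test_function (%z. phi z + phi' z) (%z. phit z + phit' z) (%z. g z + g' z) (%z. H z + H' z)"
 unfolding test_function_def
proof (intro conjI allI impI)
 fix x t assume t: "t < (0::real)"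
 show "((%s. phi (x, s) + phi' (x, s)) has_real_derivative phit (x, t) + phit' (x, t)) (at t)"
  using 1 2 t unfolding test_function_def by (intro DERIV_add) auto
 have "((%y. phi (y, t) + phi' (y, t)) has_derivative (%h. g (x, t) \<bullet> h + g' (x, t) \<bullet> h)) (at x)"
  using 1 2 t unfolding test_function_def by (intro has_derivative_add) auto
 then show "((%y. phi (y, t) + phi' (y, t)) has_derivative (%h. (g (x, t) + g' (x, t)) \<bullet> h)) (at x)" by (simp add: inner_add_left)
 have "((%y. g (y, t) + g' (y, t)) has_derivative (%h. H (x, t) *v h + H' (x, t) *v h)) (at x)"
  using 1 2 t unfolding test_function_def by (intro has_derivative_add) auto
 then show "((%y. g (y, t) + g' (y, t)) has_derivative (%h. (H (x, t) + H' (x, t)) *v h)) (at x)" by (simp add: matrix_vector_mult_add_rdistrib)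
qed (use 1 2 in "auto simp: test_function_def intro!: continuous_intros")

lemma test_function_time:
 assumes "!!t. t < 0 ==> (kappa has_real_derivative kappa' t) (at t)" "continuous_on {..<0} kappa'"
 shows "test_function (%z. kappa (snd z)) (%z. kappa' (snd z)) (%z. 0) (%z. 0)"
 unfolding test_function_def
 using assms by (auto intro!: derivative_eq_intros continuous_intros continuous_on_compose2[OF assms(2)])

lemma test_function_section:
 assumes tf: "test_function phi phit g H"
 shows "test_function (%z. phi (y0, snd z)) (%z. phit (y0, snd z)) (%z. 0) (%z. 0)"
proof (rule test_function_time)
 show "((%t. phi (y0, t)) has_real_derivative phit (y0, t)) (at t)" if "t < 0" for t
  using tf that unfolding test_function_def by auto
 have "continuous_on (UNIV \<times> {..<0}) phit" using tf unfolding test_function_def by auto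
 then show "continuous_on {..<0} (%t. phit (y0, t))"
  by (rule continuous_on_compose2) (auto intro!: continuous_intros)
qed

lemma test_function_shift:
 assumes tf: "test_function phi phit g H"
 shows "test_function (%z. phi (fst z - a, snd z)) (%z. phit (fst z - a, snd z)) (%z. g (fst z - a, snd z)) (%z. H (fst z - a, snd z))"
 unfolding test_function_def fst_conv snd_conv
proof (intro conjI allI impI)
 fix x t assume t: "t < (0::real)"
 show "((%s. phi (x - a, s)) has_real_derivative phit (x - a, t)) (at t)"
  using tf t unfolding test_function_def by auto
 have sh: "((%y. y - a) has_derivative (%h. h)) (at x)" by (auto intro!: derivative_eq_intros)
 have 1: "((%y. phi (y, t)) has_derivative (%h. g (x - a, t) \<bullet> h)) (at (x - a))"
  and 2: "((%y. g (y, t)) has_derivative (%h. H (x - a, t) *v h)) (at (x - a))"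
  using tf t unfolding test_function_def by auto
 show "((%y. phi (y - a, t)) has_derivative (%h. g (x - a, t) \<bullet> h)) (at x)" by (rule has_derivative_compose[OF sh 1])
 show "((%y. g (y - a, t)) has_derivative (%h. H (x - a, t) *v h)) (at x)" by (rule has_derivative_compose[OF sh 2])
next
 have c: "continuous_on (UNIV \<times> {..<0}) (%z::(real^'a)\<times>real. (fst z - a, snd z))" by (intro continuous_intros)
 show "continuous_on (UNIV \<times> {..<0}) (%z. phit (fst z - a, snd z))" "continuous_on (UNIV \<times> {..<0}) (%z. g (fst z - a, snd z))"
  "continuous_on (UNIV \<times> {..<0}) (%z. H (fst z - a, snd z))"
  by (rule continuous_on_compose2[OF _ c, of "UNIV \<times> {..<0}"]; use tf in "auto simp: test_function_def")+
qed

lemma test_function_quadratic: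
 fixes M :: "real^'m^'m"
 assumes sym: "transpose M = M"
 shows "test_function (%z. p \<bullet> (fst z - x0) + ((M *v (fst z - x0)) \<bullet> (fst z - x0)) / 2) (%z. 0) (%z. p + M *v (fst z - x0)) (%z. M)"
proof -
 have symi: "(M *v x) \<bullet> y = x \<bullet> (M *v y)" for x y
  by (metis sym dot_lmul_matrix transpose_matrix_vector)
 have lin: "((%y. M *v (y - x0)) has_derivative (%h. M *v h)) (at x)" for x
 proof -
  have "((*v) M has_derivative (*v) M) (at (x - x0))"
   by (rule bounded_linear_imp_has_derivative) (simp add: linear_conv_bounded_linear[symmetric])
  then show ?thesis by (rule has_derivative_compose[of "%y. y - x0", rotated]) (auto intro!: derivative_eq_intros)
 qed
 have q: "((%y. p \<bullet> (y - x0) + ((M *v (y - x0)) \<bullet> (y - x0)) / 2) has_derivative (%h. (p + M *v (x - x0)) \<bullet> h)) (at x)" for x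
 proof -
  have "((%y. p \<bullet> (y - x0) + ((M *v (y - x0)) \<bullet> (y - x0)) / 2) has_derivative
   (%h. p \<bullet> h + ((M *v (x - x0)) \<bullet> h + (M *v h) \<bullet> (x - x0)) / 2)) (at x)"
   by (auto intro!: derivative_eq_intros lin)
  then show ?thesis by (rule has_derivative_eq_rhs) (auto simp: symi inner_add_left inner_add_right inner_commute)
 qed
 have c: "continuous_on S (%z. M *v (fst z - x0))" for S :: "((real^'m) \<times> real) set"
  by (intro linear_continuous_on_compose[OF _ matrix_vector_mul_linear] continuous_intros)
 have l: "((%y. p + M *v (y - x0)) has_derivative (%h. M *v h)) (at x)" for x
  using has_derivative_add[OF has_derivative_const[of p] lin[of x]] by simp
 show ?thesis unfolding test_function_def fst_conv snd_conv
  by (intro conjI allI impI q l DERIV_const continuous_on_const continuous_on_add c)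
qed

definition outer_matrix :: "real^'m => real^'m^'m" where
 "outer_matrix v = (\<chi> i j. v $ i * v $ j)"

lemma outer_matrix_mult: "outer_matrix v *v h = (v \<bullet> h) *\<^sub>R v"
proof (rule vec_eq_iff[THEN iffD2], rule allI)
 fix i
 have "(outer_matrix v *v h) $ i = (\<Sum>j\<in>UNIV. v $ i * (v $ j * h $ j))"
  by (simp add: outer_matrix_def matrix_vector_mult_def mult.assoc)
 also have "... = v $ i * (v \<bullet> h)" by (simp add: inner_vec_def sum_distrib_left)
 finally show "(outer_matrix v *v h) $ i = ((v \<bullet> h) *\<^sub>R v) $ i" by (simp add: mult.commute)
qed

lemma test_function_quartic:
 fixes x0 :: "real^'m"
 shows "test_function (%z. a * ((fst z - x0) \<bullet> (fst z - x0))^2) (%z. 0)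
  (%z. (4 * a * ((fst z - x0) \<bullet> (fst z - x0))) *\<^sub>R (fst z - x0))
  (%z. (4 * a * ((fst z - x0) \<bullet> (fst z - x0))) *\<^sub>R mat 1 + (8 * a) *\<^sub>R outer_matrix (fst z - x0))"
proof -
 have 1: "((%y. a * ((y - x0) \<bullet> (y - x0))^2) has_derivative (%h. ((4 * a * ((x - x0) \<bullet> (x - x0))) *\<^sub>R (x - x0)) \<bullet> h)) (at x)" for x
  by (auto intro!: derivative_eq_intros simp: inner_commute algebra_simps)
 have 2: "((%y. (4 * a * ((y - x0) \<bullet> (y - x0))) *\<^sub>R (y - x0)) has_derivative
   (%h. ((4 * a * ((x - x0) \<bullet> (x - x0))) *\<^sub>R mat 1 + (8 * a) *\<^sub>R outer_matrix (x - x0)) *v h)) (at x)" for x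
 proof -
  have "((%y. (4 * a * ((y - x0) \<bullet> (y - x0))) *\<^sub>R (y - x0)) has_derivative
   (%h. (4 * a * ((x - x0) \<bullet> (x - x0))) *\<^sub>R h + (8 * a * ((x - x0) \<bullet> h)) *\<^sub>R (x - x0))) (at x)"
   by (auto intro!: derivative_eq_intros simp: inner_commute algebra_simps)
  moreover have "(%h. ((4 * a * ((x - x0) \<bullet> (x - x0))) *\<^sub>R mat 1 + (8 * a) *\<^sub>R outer_matrix (x - x0)) *v h) =
   (%h. (4 * a * ((x - x0) \<bullet> (x - x0))) *\<^sub>R h + (8 * a * ((x - x0) \<bullet> h)) *\<^sub>R (x - x0))"
   by (simp add: matrix_vector_mult_add_rdistrib scaleR_matrix_vector_assoc[symmetric] outer_matrix_mult fun_eq_iff)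
  ultimately show ?thesis by simp
 qed
 have c: "continuous_on S (%z::(real^'m)\<times>real. outer_matrix (fst z - x0))" for S
  unfolding outer_matrix_def by (intro continuous_intros)
 show ?thesis unfolding test_function_def fst_conv snd_conv
  by (intro conjI allI impI 1 2) (auto intro!: continuous_intros c)
qed

lemma test_function_const_time: "test_function (%z. b * (snd z - t0)^2) (%z. 2 * b * (snd z - t0)) (%z. 0) (%z. 0)"
 by (rule test_function_time[of "%t. b * (t - t0)^2" "%t. 2 * b * (t - t0)"]) (auto intro!: derivative_eq_intros continuous_intros)

lemma test_function_scaled_time: "test_function (%z. b * (snd z - t0)) (%z. b) (%z. 0) (%z. 0)"
 by (rule test_function_time[of "%t. b * (t - t0)" "%t. b"]) (auto intro!: derivative_eq_intros continuous_intros)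

text \<open>Where the gradient of the test function vanishes, only a crude bound in terms of an upper bound \<open>l\<close>
 of its Hessian is required. This survives the passage to the limit in the game and suffices for comparison.\<close>

definition weak_sub :: "(real^'m^'m => real^'m => real) => real => ((real^'m) \<times> real => real) => bool" where
 "weak_sub F K u \<longleftrightarrow> usc_on (UNIV \<times> {..0}) u &
  (ALL phi phit g H x t.
    test_function phi phit g H & t < 0 & (\<forall>\<^sub>F z in nhds (x, t). u z - phi z <= u (x, t) - phi (x, t)) -->
    (g (x, t) ~= 0 --> 0 <= phit (x, t) + F (H (x, t)) (g (x, t))) &
    (ALL l>=0. (ALL h. (H (x, t) *v h) \<bullet> h <= l * (h \<bullet> h)) --> 0 <= phit (x, t) + K * l))"

text \<open>The fourth power in space and the square in time leave gradient, Hessian and time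
  derivative of a test function unchanged at \<open>z0\<close>.\<close>

definition strict_bump :: "(real^'m) \<times> real => (real^'m) \<times> real => real" where
 "strict_bump z0 z = ((fst z - fst z0) \<bullet> (fst z - fst z0))^2 + (snd z - snd z0)^2"

lemma strict_bump_pos: "z ~= z0 ==> 0 < strict_bump z0 z"
 unfolding strict_bump_def by (cases z; cases z0) (auto simp: add_nonneg_pos add_pos_nonneg)

lemma strict_bump_nonneg: "0 <= strict_bump z0 z" unfolding strict_bump_def by simp

lemma strict_bump_self [simp]: "strict_bump z0 z0 = 0" unfolding strict_bump_def by simp

lemma continuous_on_strict_bump [continuous_intros]: "continuous_on S (strict_bump z0)"
 unfolding strict_bump_def by (intro continuous_intros)

lemma strictify_test_function:
 fixes x0 :: "real^'m"
 assumes tf: "test_function phi phit g H" and t0: "t0 < 0"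
  and max: "\<forall>\<^sub>F z in nhds (x0, t0). u z - phi z <= u (x0, t0) - phi (x0, t0)"
 obtains phi' phit' g' H' r where "test_function phi' phit' g' H'" "phit' (x0, t0) = phit (x0, t0)" "g' (x0, t0) = g (x0, t0)" "H' (x0, t0) = H (x0, t0)"
  "phi' (x0, t0) = phi (x0, t0)" "r > 0" "!!z. dist z (x0, t0) < r ==> u z - phi' z <= u (x0, t0) - phi' (x0, t0) - strict_bump (x0, t0) z"
proof -
 obtain r where r: "r > 0" "!!z. dist z (x0, t0) < r ==> u z - phi z <= u (x0, t0) - phi (x0, t0)"
  using max unfolding eventually_nhds_metric by blast
 note tf' = test_function_add[OF test_function_add[OF tf test_function_quartic[of 1 x0]] test_function_const_time[of 1 t0]]
 show ?thesis
  by (rule that[OF tf' _ _ _ _ r(1)]) (use r(2) in "auto simp: strict_bump_def outer_matrix_def vec_eq_iff algebra_simps")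
qed

definition violated :: "(real^'m^'m => real^'m => real) => real => real => real^'m^'m => real^'m => bool" where
 "violated F K a M p \<longleftrightarrow> (p ~= 0 & a + F M p < 0) | (EX l>=0. (ALL h. (M *v h) \<bullet> h <= l * (h \<bullet> h)) & a + K * l < 0)"

lemma weak_subI:
 fixes u :: "(real^'m) \<times> real => real"
 assumes "usc_on (UNIV \<times> {..0}) u"
  and "!!phi phit g H x t r. test_function phi phit g H ==> t < 0 ==> r > 0 ==>
   (!!z. dist z (x, t) < r ==> u z - phi z <= u (x, t) - phi (x, t) - strict_bump (x, t) z) ==>
   ~ violated F K (phit (x, t)) (H (x, t)) (g (x, t))"
 shows "weak_sub F K u"
 unfolding weak_sub_def
proof (rule conjI[OF assms(1)], intro allI, rule impI)
 fix phi phit g H x and t :: real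
 assume a: "test_function phi phit g H & t < 0 & (\<forall>\<^sub>F z in nhds (x, t). u z - phi z <= u (x, t) - phi (x, t))"
 then obtain phi' phit' g' H' r where n: "test_function phi' phit' g' H'" "phit' (x, t) = phit (x, t)" "g' (x, t) = g (x, t)" "H' (x, t) = H (x, t)"
  "phi' (x, t) = phi (x, t)" "r > 0" "!!z. dist z (x, t) < r ==> u z - phi' z <= u (x, t) - phi' (x, t) - strict_bump (x, t) z"
  by (elim conjE) (rule strictify_test_function, assumption+, rule that)
 have "t < 0" using a by simp
 from assms(2)[OF n(1) this n(6,7)]
 show "(g (x, t) ~= 0 --> 0 <= phit (x, t) + F (H (x, t)) (g (x, t))) &
    (ALL l>=0. (ALL h. (H (x, t) *v h) \<bullet> h <= l * (h \<bullet> h)) --> 0 <= phit (x, t) + K * l)"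
  unfolding violated_def n(2-4) by force
qed

lemma weak_subD:
 assumes "weak_sub F K u" "test_function phi phit g H" "t < 0" "\<forall>\<^sub>F z in nhds (x, t). u z - phi z <= u (x, t) - phi (x, t)"
 shows "g (x, t) ~= 0 ==> 0 <= phit (x, t) + F (H (x, t)) (g (x, t))"
  "0 <= l ==> (!!h. (H (x, t) *v h) \<bullet> h <= l * (h \<bullet> h)) ==> 0 <= phit (x, t) + K * l"
 using assms unfolding weak_sub_def by blast+

lemma weak_sub_mono_const:
 assumes "weak_sub F K u" "K <= K'" shows "weak_sub F K' u"
proof -
 have "0 <= a + K * l ==> 0 <= l ==> 0 <= a + K' * l" for a l :: real
  using mult_right_mono[OF assms(2), of l] by linarith
 then show ?thesis using assms(1) unfolding weak_sub_def by blast
qed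

text \<open>Only the first time derivative enters the equation, so an arbitrary quadratic error in
  time is allowed.\<close>

lemma weak_sub_quadratic:
 fixes u :: "(real^'m) \<times> real => real"
 assumes W: "weak_sub F K u" and t: "t < 0" and sym: "transpose M = M" and r: "r > 0"
  and le: "!!h s. norm h < r ==> \<bar>s\<bar> < r ==> u (x + h, t + s) <= u (x, t) + a * s + p \<bullet> h + ((M *v h) \<bullet> h) / 2 + C * s^2"
 shows "p ~= 0 ==> 0 <= a + F M p" "0 <= l ==> (!!h. (M *v h) \<bullet> h <= l * (h \<bullet> h)) ==> 0 <= a + K * l"
proof -
 note tf = test_function_add[OF test_function_add[OF test_function_quadratic[OF sym, of p x] test_function_scaled_time[of a t]] test_function_const_time[of C t]]
 have "\<forall>\<^sub>F z in nhds (x, t). u z - ((p \<bullet> (fst z - x) + ((M *v (fst z - x)) \<bullet> (fst z - x)) / 2) + a * (snd z - t) + C * (snd z - t)^2) <= u (x, t)"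
  unfolding eventually_nhds_metric
 proof (intro exI[of _ r] conjI r allI impI)
  fix z assume z: "dist z (x, t) < r"
  obtain y s where zy: "z = (y, s)" by (cases z)
  have "norm (y - x) < r" "\<bar>s - t\<bar> < r" using z dist_fst_le[of z "(x,t)"] dist_snd_le[of z "(x,t)"] zy by (auto simp: dist_norm)
  from le[OF this] show "u z - ((p \<bullet> (fst z - x) + ((M *v (fst z - x)) \<bullet> (fst z - x)) / 2) + a * (snd z - t) + C * (snd z - t)^2) <= u (x, t)"
   unfolding zy by simp
 qed
 then have ev: "\<forall>\<^sub>F z in nhds (x, t). u z - ((p \<bullet> (fst z - x) + ((M *v (fst z - x)) \<bullet> (fst z - x)) / 2) + a * (snd z - t) + C * (snd z - t)^2)
   <= u (x, t) - ((p \<bullet> (fst (x, t) - x) + ((M *v (fst (x, t) - x)) \<bullet> (fst (x, t) - x)) / 2) + a * (snd (x, t) - t) + C * (snd (x, t) - t)^2)"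
  by simp
 show "p ~= 0 ==> 0 <= a + F M p" using weak_subD(1)[OF W tf t ev] by simp
 show "0 <= l ==> (!!h. (M *v h) \<bullet> h <= l * (h \<bullet> h)) ==> 0 <= a + K * l" using weak_subD(2)[OF W tf t ev, of l] by simp
qed

subsection \<open>The game\<close>

lemma body_norm_set_bdd: "bdd_below {r. 0 < r & x \<in> (%y. r *\<^sub>R y) ` E}"
 by (rule bdd_belowI[of _ 0]) auto

lemma sym_convex_body_ball:
 fixes E :: "(real^'m) set"
 assumes "sym_convex_body E"
 obtains r where "r > 0" "cball 0 r <= E"
proof -
 have E: "convex E" "interior E ~= {}" "E = uminus ` E" using assms unfolding sym_convex_body_def by auto
 obtain x r where r: "r > 0" "cball x r <= E" using E(2) by (metis ex_in_conv mem_interior_cball)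
 have "cball 0 r <= E"
 proof
  fix y :: "real^'m" assume y: "y \<in> cball 0 r"
  have "x + y \<in> E" "x - y \<in> E" using r y by (auto simp: dist_norm)
  moreover from this have "- (x - y) \<in> uminus ` E" by blast
  ultimately have "x + y \<in> E" "- (x - y) \<in> E" using E(3) by simp_all
  then have "(1/2) *\<^sub>R (x + y) + (1/2) *\<^sub>R (- (x - y)) \<in> E" using E(1) by (intro convexD) auto
  then show "y \<in> E" by (simp add: algebra_simps flip: scaleR_left.add)
 qed
 with r(1) that show ?thesis by blast
qed

lemma body_norm_le:
 assumes "0 < r" "x \<in> (%y. r *\<^sub>R y) ` E" shows "body_norm E x <= r"
 unfolding body_norm_def using assms by (intro cInf_lower body_norm_set_bdd) auto

lemma body_norm_upper:
 fixes E :: "(real^'m) set"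
 assumes r: "r > 0" "cball 0 r <= E"
 shows "{s. 0 < s & x \<in> (%y. s *\<^sub>R y) ` E} ~= {}" "body_norm E x <= norm x / r"
proof -
 have in': "x \<in> (%y. s *\<^sub>R y) ` E" if "s > 0" "norm x <= r * s" for s
 proof -
  have "x /\<^sub>R s \<in> E" using r(2) that by (intro subsetD[OF r(2)]) (simp add: field_simps)
  then show ?thesis using that by (intro image_eqI[of _ _ "x /\<^sub>R s"]) auto
 qed
 have n: "norm x <= r * (norm x / r + e)" if "e > 0" for e using r that by (simp add: field_simps)
 have p: "norm x / r + e > 0" if "e > 0" for e using r that by (simp add: add_nonneg_pos)
 show "{s. 0 < s & x \<in> (%y. s *\<^sub>R y) ` E} ~= {}"
 proof -
  have "x \<in> (%y. (norm x / r + 1) *\<^sub>R y) ` E" by (rule in'[OF p n]) auto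
  then show ?thesis using p[of 1] by (auto intro!: exI[of _ "norm x / r + 1"])
 qed
 have "body_norm E x <= norm x / r + e" if "e > 0" for e
  using that by (intro body_norm_le in' p n)
 then show "body_norm E x <= norm x / r" by (rule field_le_epsilon)
qed

definition norm_like :: "real => real => (real^'m => real) => bool" where
 "norm_like c L h \<longleftrightarrow> 0 < c & 0 < L & (ALL x y. h (x + y) <= h x + h y) & (ALL x. h (- x) = h x) &
  (ALL x. c * norm x <= h x) & (ALL x. h x <= L * norm x) & (ALL x t. 0 < t --> h (t *\<^sub>R x) = t * h x)"

lemma body_norm_norm_like:
 fixes E :: "(real^'m) set"
 assumes E: "sym_convex_body E"
 shows "EX c L. norm_like c L (body_norm E)"
proof -
 obtain r where r: "r > 0" "cball 0 r <= E" by (rule sym_convex_body_ball[OF E])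
 have cE: "convex E" and "bounded E" and sE: "E = uminus ` E" using E unfolding sym_convex_body_def by (auto simp: compact_imp_bounded)
 then obtain R where R: "R > 0" "!!x. x \<in> E ==> norm x <= R" unfolding bounded_pos by auto
 let ?S = "%x. {s. 0 < s & x \<in> (%y. s *\<^sub>R y) ` E}"
 note ne = body_norm_upper(1)[OF r]
 have approx: "EX s:?S x. s < body_norm E x + e" if "e > 0" for x e
  using cInf_lessD[OF ne, of x "body_norm E x + e"] that unfolding body_norm_def by auto
 have sub: "body_norm E (x + y) <= body_norm E x + body_norm E y" for x y
 proof (rule field_le_epsilon)
  fix e :: real assume "e > 0"
  then have "e/2 > 0" by simp
  obtain s where s: "0 < s" "x \<in> (%y. s *\<^sub>R y) ` E" "s < body_norm E x + e/2" using approx[OF \<open>e/2 > 0\<close>, of x] by blast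
  obtain t where t: "0 < t" "y \<in> (%y. t *\<^sub>R y) ` E" "t < body_norm E y + e/2" using approx[OF \<open>e/2 > 0\<close>, of y] by blast
  obtain a b where ab: "a \<in> E" "b \<in> E" "x = s *\<^sub>R a" "y = t *\<^sub>R b" using s t by blast
  have "(s/(s+t)) *\<^sub>R a + (t/(s+t)) *\<^sub>R b \<in> E"
   using cE ab s t by (intro convexD) (auto simp: add_divide_distrib[symmetric])
  moreover have "x + y = (s + t) *\<^sub>R ((s/(s+t)) *\<^sub>R a + (t/(s+t)) *\<^sub>R b)"
   using ab s t by (simp add: scaleR_add_right)
  ultimately have "x + y \<in> (%y. (s+t) *\<^sub>R y) ` E" by blast
  then have "body_norm E (x + y) <= s + t" using s t by (intro body_norm_le) auto
  then show "body_norm E (x + y) <= body_norm E x + body_norm E y + e" using s t by linarith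
 qed
 have even: "body_norm E (- x) = body_norm E x" for x
 proof -
  have "- x \<in> (%y. s *\<^sub>R y) ` E \<longleftrightarrow> x \<in> (%y. s *\<^sub>R y) ` E" for s x
  proof -
   have "- x \<in> (%y. s *\<^sub>R y) ` E" if "x \<in> (%y. s *\<^sub>R y) ` E" for x
   proof -
    from that obtain a where "a \<in> E" "x = s *\<^sub>R a" by blast
    then have "- a \<in> E" "- x = s *\<^sub>R (- a)" using sE by auto
    then show ?thesis by blast
   qed
   from this[of x] this[of "- x"] show ?thesis by auto
  qed
  then show ?thesis unfolding body_norm_def by simp
 qed
 have low: "(1 / R) * norm x <= body_norm E x" for x
  unfolding body_norm_def
 proof (rule cInf_greatest[OF ne])
  fix s assume "s \<in> ?S x"
  then obtain a where "0 < s" "a \<in> E" "x = s *\<^sub>R a" by blast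
  then show "(1 / R) * norm x <= s" using R by (simp add: pos_divide_le_eq)
 qed
 have scale_le: "body_norm E (t *\<^sub>R x) <= t * body_norm E x" if "t > 0" for t x
 proof (rule field_le_epsilon)
  fix e :: real assume "e > 0"
  then have "e / t > 0" using that by simp
  then obtain s where s: "0 < s" "x \<in> (%y. s *\<^sub>R y) ` E" "s < body_norm E x + e / t" using approx[OF _, of "e/t" x] by blast
  have "t *\<^sub>R x \<in> (%y. (t * s) *\<^sub>R y) ` E" using s(2) by auto
  then have "body_norm E (t *\<^sub>R x) <= t * s" using s that by (intro body_norm_le) auto
  also have "... <= t * (body_norm E x + e / t)" using s that by (intro mult_left_mono) auto
  also have "... = t * body_norm E x + e" using that by (simp add: algebra_simps)
  finally show "body_norm E (t *\<^sub>R x) <= t * body_norm E x + e" .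
 qed
 have scale: "body_norm E (t *\<^sub>R x) = t * body_norm E x" if "t > 0" for t x
 proof (rule antisym[OF scale_le[OF that]])
  have "body_norm E ((1/t) *\<^sub>R (t *\<^sub>R x)) <= (1/t) * body_norm E (t *\<^sub>R x)" using that by (intro scale_le) auto
  then show "t * body_norm E x <= body_norm E (t *\<^sub>R x)" using that by (simp add: field_simps)
 qed
 have upp: "body_norm E x <= (1 / r) * norm x" for x using body_norm_upper(2)[OF r, of x] by simp
 have "norm_like (1 / R) (1 / r) (body_norm E)"
  unfolding norm_like_def using r(1) R(1) sub even low upp scale by auto
 then show ?thesis by blast
qed

lemma norm_like_lipschitz:
 assumes "norm_like c L h" shows "h x <= h y + L * norm (x - y)"
proof -
 have "h x <= h y + h (x - y)" using assms unfolding norm_like_def by (metis add_diff_cancel_left' add.commute diff_add_cancel)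
 then show ?thesis using assms unfolding norm_like_def by (meson add_left_mono order_trans)
qed

lemma norm_like_midpoint:
 assumes "norm_like c L h" shows "2 * h ((1/2) *\<^sub>R (x + y)) <= h x + h y"
proof -
 have "h ((1/2) *\<^sub>R (x + y)) = (1/2) * h (x + y)" "h (x + y) <= h x + h y" using assms unfolding norm_like_def by auto
 then show ?thesis by simp
qed

lemma sign_vectors_finite: "finite (sign_vectors :: (real^'n) set)" "(sign_vectors :: (real^'n) set) ~= {}"
proof -
 have "(sign_vectors :: (real^'n) set) <= (%f. \<chi> j. f j) ` (PiE UNIV (%_. {-1, 1}))"
 proof
  fix s :: "real^'n" assume "s \<in> sign_vectors"
  then show "s \<in> (%f. \<chi> j. f j) ` (PiE UNIV (%_. {-1, 1}))"
   unfolding sign_vectors_def by (intro image_eqI[of _ _ "%j. s $ j"]) (auto simp: vec_eq_iff)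
 qed
 then show "finite (sign_vectors :: (real^'n) set)" by (rule finite_subset) (auto intro!: finite_imageI finite_PiE)
 have "(\<chi> j. 1) \<in> (sign_vectors :: (real^'n) set)" unfolding sign_vectors_def by simp
 then show "(sign_vectors :: (real^'n) set) ~= {}" by blast
qed

lemma sign_vectors_uminus: "s \<in> sign_vectors ==> - s \<in> sign_vectors"
 unfolding sign_vectors_def by auto

lemma matrix_vector_mult_columns: "(A :: real^'n^'m) *v s = (\<Sum>j\<in>UNIV. s $ j *\<^sub>R column j A)"
 by (simp add: matrix_mult_sum[of A s] scalar_mult_eq_scaleR)

lemma unit_step_norm:
 assumes "A \<in> (unit_column_matrices :: (real^'n^'m) set)" "s \<in> sign_vectors"
 shows "norm (A *v s) <= real CARD('n)"
proof -
 have "norm (A *v s) <= (\<Sum>j\<in>(UNIV::'n set). 1)" unfolding matrix_vector_mult_columns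
 proof (rule sum_norm_le)
  fix j
  have "\<bar>s $ j\<bar> = 1" using assms(2) unfolding sign_vectors_def by (auto simp: abs_if dest: spec[of _ j])
  then show "norm (s $ j *\<^sub>R column j A) <= 1" using assms(1) unfolding unit_column_matrices_def by auto
 qed
 then show ?thesis by simp
qed

lemma zero_in_unit_column_matrices: "0 \<in> unit_column_matrices"
 unfolding unit_column_matrices_def by (simp add: column_def zero_vec_def[symmetric])

section \<open>Growth bounds for the value of the game\<close>

context
 fixes E :: "(real^'m) set" and c L :: real
 assumes h: "norm_like c L (body_norm E)"
begin

text \<open>One of the signs \<open>s\<close> and \<open>- s\<close> gives a step with nonpositive
  inner product with \<open>x - x0\<close>, so the squared distance to \<open>x0\<close> grows in a
  round by at most the squared step length, which is at most \<open>n^2\<close>.\<close>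

lemma game_value_upper:
 "game_value_from TYPE('n::finite) E k x <= body_norm E x0 + L * sqrt ((norm (x - x0))^2 + real k * (real CARD('n))^2)"
proof (induction k arbitrary: x)
 case 0
 show ?case using norm_like_lipschitz[OF h, of x x0] by simp
next
 case (Suc k)
 let ?G = "game_value_from TYPE('n) E"
 have L: "L > 0" using h unfolding norm_like_def by auto
 have "(MIN s\<in>sign_vectors. ?G k (x + A *v s)) <= body_norm E x0 + L * sqrt ((norm (x - x0))^2 + real (Suc k) * (real CARD('n))^2)"
  if A: "A \<in> (unit_column_matrices :: (real^'n^'m) set)" for A
 proof -
  obtain s0 :: "real^'n" where s0: "s0 \<in> sign_vectors" using sign_vectors_finite(2) by blast
  obtain s where s: "s \<in> sign_vectors" "(x - x0) \<bullet> (A *v s) <= 0"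
  proof (cases "(x - x0) \<bullet> (A *v s0) <= 0")
   case False
   have "A *v (- s0) = - (A *v s0)" using matrix_vector_mult_scaleR[of A "-1" s0] by simp
   then show ?thesis using that[of "- s0"] s0 sign_vectors_uminus False by auto
  qed (use s0 that in auto)
  have "(norm (x + A *v s - x0))^2 = (norm (x - x0))^2 + 2 * ((x - x0) \<bullet> (A *v s)) + (norm (A *v s))^2"
   unfolding power2_norm_eq_inner by (simp add: inner_add inner_diff inner_commute)
  also have "... <= (norm (x - x0))^2 + (real CARD('n))^2"
  proof -
   have "(norm (A *v s))^2 <= (real CARD('n))^2" by (rule power_mono[OF unit_step_norm[OF A s(1)]]) simp
   then show ?thesis using s(2) by linarith
  qed
  finally have n: "(norm (x + A *v s - x0))^2 + real k * (real CARD('n))^2 <= (norm (x - x0))^2 + real (Suc k) * (real CARD('n))^2"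
   by (simp add: algebra_simps)
  have "(MIN s\<in>sign_vectors. ?G k (x + A *v s)) <= ?G k (x + A *v s)"
   using s(1) sign_vectors_finite by (intro Min_le) auto
  also have "... <= body_norm E x0 + L * sqrt ((norm (x + A *v s - x0))^2 + real k * (real CARD('n))^2)" by (rule Suc.IH)
  also have "... <= body_norm E x0 + L * sqrt ((norm (x - x0))^2 + real (Suc k) * (real CARD('n))^2)"
   using n L by (intro add_left_mono mult_left_mono real_sqrt_le_mono) auto
  finally show ?thesis .
 qed
 then show ?case using zero_in_unit_column_matrices unfolding game_value_from.simps by (intro cSUP_least) auto
qed

lemma game_min_bdd:
 "bdd_above ((%A. MIN s\<in>sign_vectors. game_value_from TYPE('n::finite) E k (x + A *v s)) ` (unit_column_matrices :: (real^'n^'m) set))"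
proof (rule bdd_aboveI2)
 fix A assume A: "A \<in> (unit_column_matrices :: (real^'n^'m) set)"
 obtain s :: "real^'n" where s: "s \<in> sign_vectors" using sign_vectors_finite(2) by blast
 have "(MIN s\<in>sign_vectors. game_value_from TYPE('n::finite) E k (x + A *v s)) <= game_value_from TYPE('n::finite) E k (x + A *v s)"
  using s sign_vectors_finite by (intro Min_le) auto
 also have "... <= body_norm E x + L * sqrt ((norm (x + A *v s - x))^2 + real k * (real CARD('n))^2)" by (rule game_value_upper)
 also have "... <= body_norm E x + L * sqrt ((real CARD('n))^2 + real k * (real CARD('n))^2)"
  using h power_mono[OF unit_step_norm[OF A s], of 2] unfolding norm_like_def
  by (intro add_left_mono mult_left_mono real_sqrt_le_mono add_right_mono) auto
 finally show "(MIN s\<in>sign_vectors. game_value_from TYPE('n::finite) E k (x + A *v s)) <= ..." .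
qed

lemma game_value_max_step:
 assumes A: "A \<in> (unit_column_matrices :: (real^'n^'m) set)"
 shows "EX s:sign_vectors. game_value_from TYPE('n::finite) E k (x + A *v s) <= game_value_from TYPE('n) E (Suc k) x"
proof -
 have "(MIN s\<in>sign_vectors. game_value_from TYPE('n::finite) E k (x + A *v s)) \<in> (%s. game_value_from TYPE('n) E k (x + A *v s)) ` sign_vectors"
  using sign_vectors_finite by (intro Min_in) auto
 then obtain s where s: "s \<in> sign_vectors" "(MIN s\<in>sign_vectors. game_value_from TYPE('n::finite) E k (x + A *v s)) = game_value_from TYPE('n) E k (x + A *v s)" by auto
 have "(MIN s\<in>sign_vectors. game_value_from TYPE('n::finite) E k (x + A *v s)) <= game_value_from TYPE('n) E (Suc k) x"
  unfolding game_value_from.simps by (rule cSUP_upper[OF A game_min_bdd])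
 with s show ?thesis by auto
qed

text \<open>A near-optimal matrix takes the place of a maximiser; after rescaling its loss
  \<open>e\<close> is negligible against the gain of one round.\<close>

lemma game_value_min_step:
 assumes "e > 0"
 shows "EX A:(unit_column_matrices :: (real^'n^'m) set). ALL s:sign_vectors. game_value_from TYPE('n::finite) E (Suc k) x <= game_value_from TYPE('n) E k (x + A *v s) + e"
proof -
 have "game_value_from TYPE('n) E (Suc k) x - e < game_value_from TYPE('n) E (Suc k) x" using assms by simp
 then obtain A where A: "A \<in> (unit_column_matrices :: (real^'n^'m) set)"
  "game_value_from TYPE('n) E (Suc k) x - e < (MIN s\<in>sign_vectors. game_value_from TYPE('n) E k (x + A *v s))"
  unfolding game_value_from.simps(2)[of "TYPE('n)"] using less_cSUP_iff[OF _ game_min_bdd] zero_in_unit_column_matrices by blast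
 have "game_value_from TYPE('n) E (Suc k) x <= game_value_from TYPE('n) E k (x + A *v s) + e" if "s \<in> sign_vectors" for s
 proof -
  have "(MIN s\<in>sign_vectors. game_value_from TYPE('n) E k (x + A *v s)) <= game_value_from TYPE('n) E k (x + A *v s)"
   using that sign_vectors_finite by (intro Min_le) auto
  with A(2) show ?thesis by linarith
 qed
 with A(1) show ?thesis by blast
qed

lemma game_value_ge_norm: "body_norm E x <= game_value_from TYPE('n::finite) E k x"
proof (induction k arbitrary: x)
 case (Suc k)
 from game_value_max_step[OF zero_in_unit_column_matrices, where 'n='n, of k x] Suc[of x] show ?case by auto
qed simp

lemma game_value_even: "game_value_from TYPE('n::finite) E k (- x) = game_value_from TYPE('n) E k x"
proof (induction k arbitrary: x)
 case 0
 then show ?case using h unfolding norm_like_def by simp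
next
 case (Suc k)
 have "(MIN s\<in>sign_vectors. game_value_from TYPE('n) E k (- x + A *v s)) = (MIN s\<in>sign_vectors. game_value_from TYPE('n) E k (x + A *v s))"
  for A :: "real^'n^'m"
 proof -
  have "(%s. game_value_from TYPE('n) E k (- x + A *v s)) ` sign_vectors = (%s. game_value_from TYPE('n) E k (x + A *v s)) ` sign_vectors"
  proof -
   have "game_value_from TYPE('n) E k (- x + A *v s) = game_value_from TYPE('n) E k (x + A *v (- s))" for s
    using Suc.IH[of "x + A *v (- s)"] matrix_vector_mult_scaleR[of A "-1" s] by (simp add: algebra_simps)
   then have "(%s. game_value_from TYPE('n) E k (- x + A *v s)) ` sign_vectors = (%s. game_value_from TYPE('n) E k (x + A *v s)) ` (uminus ` sign_vectors)"
    by (simp add: image_image)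
   also have "uminus ` sign_vectors = (sign_vectors :: (real^'n) set)"
    using sign_vectors_uminus by (force simp: image_iff intro: bexI[of _ "- _"])
   finally show ?thesis .
  qed
  then show ?thesis by simp
 qed
 then show ?case by simp
qed

text \<open>The maximising player uses a single unit column orthogonal to the current position,
  which exists in dimension at least 2: each round then adds exactly 1 to the squared norm, whatever
  the sign. This bound makes the limit positive.\<close>

lemma game_value_growth:
 assumes m: "CARD('m) >= 2"
 shows "c * sqrt ((norm x)^2 + real k) <= game_value_from TYPE('n::finite) E k x"
proof (induction k arbitrary: x)
 case 0
 then show ?case using h unfolding norm_like_def by simp
next
 case (Suc k)
 have "EX v. v ~= 0 & orthogonal x v"
  using orthogonal_to_vector_exists[of x] m by auto
 then obtain v0 where v0: "v0 ~= 0" "orthogonal x v0" by blast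
 define v where "v = v0 /\<^sub>R norm v0"
 have v: "norm v = 1" "x \<bullet> v = 0" using v0 unfolding v_def orthogonal_def by auto
 obtain j0 :: 'n where True by blast
 define A :: "real^'n^'m" where "A = (\<chi> i j. if j = j0 then v $ i else 0)"
 have col: "column j A = (if j = j0 then v else 0)" for j unfolding A_def column_def by (auto simp: vec_eq_iff)
 have Au: "A \<in> unit_column_matrices" unfolding unit_column_matrices_def using col v by auto
 obtain s where s: "s \<in> sign_vectors" "game_value_from TYPE('n) E k (x + A *v s) <= game_value_from TYPE('n) E (Suc k) x"
  using game_value_max_step[OF Au] by blast
 have "A *v s = s $ j0 *\<^sub>R v" unfolding matrix_vector_mult_columns col by (simp add: if_distrib cong: if_cong)
 moreover have "(s $ j0)^2 = 1" using s(1) unfolding sign_vectors_def by (auto dest: spec[of _ j0])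
 moreover have "v \<bullet> v = 1" using v(1) by (simp add: dot_square_norm)
 ultimately have "(norm (x + A *v s))^2 = (norm x)^2 + 1"
  using v(2) unfolding power2_norm_eq_inner by (simp add: inner_add inner_commute power2_eq_square)
 then have "c * sqrt ((norm x)^2 + real (Suc k)) = c * sqrt ((norm (x + A *v s))^2 + real k)" by (simp add: algebra_simps)
 also have "... <= game_value_from TYPE('n) E k (x + A *v s)" by (rule Suc.IH)
 finally show ?case using s(2) by linarith
qed

end

subsection \<open>Upper relaxed limits\<close>

text \<open>A family \<open>W c n y\<close> is the rescaled value of a game with \<open>n\<close> rounds of step size \<open>1 / c\<close>; it is
 regarded as a value at the point \<open>y\<close> and the time \<open>- n / (2 c^2)\<close>.\<close>

definition grid_time :: "real => nat => real" where
 "grid_time c n = - (real n / (2 * c^2))"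

definition near_set :: "real => (real^'m) \<times> real => (real \<times> nat \<times> (real^'m)) set" where
 "near_set rho z = {(c, n, y). 1 / rho < c & dist (y, grid_time c n) z < rho}"

text \<open>The half-relaxed limit of Barles and Perthame: the upper limit as the step size
  \<open>1 / c\<close> tends to 0 and the space-time point tends to \<open>z\<close>
  simultaneously.\<close>

definition upper_limit :: "(real => nat => real^'m => real) => (real^'m) \<times> real => real" where
 "upper_limit W z = Inf {a. EX rho>0. ALL (c, n, y):near_set rho z. W c n y <= a}"

definition locally_bounded :: "(real => nat => real^'m => real) => bool" where
 "locally_bounded W \<longleftrightarrow> (ALL z. EX rho>0. EX B. ALL (c, n, y):near_set rho z. \<bar>W c n y\<bar> <= B)"

lemma near_set_mono:
 assumes "0 < rho" "rho + dist z z' <= rho'" shows "near_set rho z <= near_set rho' z'"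
proof -
 have "rho <= rho'" using assms zero_le_dist[of z z'] by linarith
 then have "1 / rho' <= 1 / rho" using assms(1) by (intro divide_left_mono mult_pos_pos) auto
 moreover have "dist p z' < rho'" if "dist p z < rho" for p using that assms dist_triangle[of p z' z] by linarith
 ultimately show ?thesis unfolding near_set_def by (auto intro: order_le_less_trans)
qed

lemma grid_time_approx:
 assumes "t <= 0" "0 < c" shows "EX n. grid_time c n <= 0 & t <= grid_time c n & grid_time c n < t + 1 / (2 * c^2)"
proof -
 define n where "n = nat \<lfloor>- t * (2 * c^2)\<rfloor>"
 have p: "0 <= - t * (2 * c^2)" using assms by (intro mult_nonneg_nonneg) auto
 then have n: "real n <= - t * (2 * c^2)" "- t * (2 * c^2) < real n + 1" unfolding n_def by linarith+
 have c2: "2 * c^2 > 0" using assms by simp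
 have "real n / (2 * c^2) <= - t" using n(1) c2 by (simp add: pos_divide_le_eq)
 moreover have "- t < (real n + 1) / (2 * c^2)" using n(2) c2 by (simp add: pos_less_divide_eq)
 ultimately show ?thesis unfolding grid_time_def by (intro exI[of _ n]) (auto simp: add_divide_distrib)
qed

lemma near_set_nonempty:
 assumes "0 < rho" "snd z <= 0" shows "near_set rho z ~= {}"
proof -
 define c where "c = 1 / rho + 1"
 have c: "c > 1 / rho" "c >= 1" unfolding c_def using assms by auto
 obtain n where n: "snd z <= grid_time c n" "grid_time c n < snd z + 1 / (2 * c^2)" using grid_time_approx[OF assms(2), of c] c by auto
 have "1 / (2 * c^2) <= 1 / c" using c(2) by (intro divide_left_mono) (auto simp: power2_eq_square)
 also have "1 / c < rho" using c assms(1) by (simp add: field_simps)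
 finally have "dist (grid_time c n) (snd z) < rho" using n by (simp add: dist_real_def)
 then have "(c, n, fst z) \<in> near_set rho z" unfolding near_set_def using c by (cases z) (auto simp: dist_Pair_Pair)
 then show ?thesis by blast
qed

lemma upper_limit_set:
 assumes W: "locally_bounded W" and z: "snd z <= 0"
 shows "{a. EX rho>0. ALL (c, n, y):near_set rho z. W c n y <= a} ~= {}" "bdd_below {a. EX rho>0. ALL (c, n, y):near_set rho z. W c n y <= a}"
proof -
 obtain rho B where B: "rho > 0" "!!c n y. (c, n, y) \<in> near_set rho z ==> \<bar>W c n y\<bar> <= B" using W unfolding locally_bounded_def by blast
 have "ALL (c, n, y):near_set rho z. W c n y <= B" using B(2) by (auto simp: abs_le_iff)
 with B(1) show "{a. EX rho>0. ALL (c, n, y):near_set rho z. W c n y <= a} ~= {}" by blast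
 show "bdd_below {a. EX rho>0. ALL (c, n, y):near_set rho z. W c n y <= a}"
 proof (rule bdd_belowI[of _ "- B"])
  fix a assume "a \<in> {a. EX rho>0. ALL (c, n, y):near_set rho z. W c n y <= a}"
  then obtain rho' where rho': "rho' > 0" "!!c n y. (c, n, y) \<in> near_set rho' z ==> W c n y <= a" by blast
  have "min rho rho' > 0" using B(1) rho'(1) by simp
  then obtain c n y where "(c, n, y) \<in> near_set (min rho rho') z" using near_set_nonempty[OF _ z] by (metis ex_in_conv prod_cases3)
  then have "(c, n, y) \<in> near_set rho z" "(c, n, y) \<in> near_set rho' z"
   using near_set_mono[of "min rho rho'" z z rho] near_set_mono[of "min rho rho'" z z rho'] \<open>min rho rho' > 0\<close> by auto
  then show "- B <= a" using B(2) rho'(2) by (meson abs_le_iff minus_le_iff order_trans)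
 qed
qed

lemma upper_limit_above:
 assumes W: "locally_bounded W" and z: "snd z <= 0" and e: "e > 0"
 obtains rho where "rho > 0" "!!c n y. (c, n, y) \<in> near_set rho z ==> W c n y <= upper_limit W z + e"
proof -
 have "EX a:{a. EX rho>0. ALL (c, n, y):near_set rho z. W c n y <= a}. a < upper_limit W z + e"
  using cInf_lessD[OF upper_limit_set(1)[OF W z], of "upper_limit W z + e"] e unfolding upper_limit_def by auto
 then obtain a rho where a: "a < upper_limit W z + e" "rho > 0" "!!c n y. (c, n, y) \<in> near_set rho z ==> W c n y <= a" by blast
 show ?thesis by (rule that[OF a(2)]) (use a(1) a(3) in \<open>meson less_imp_le order_trans\<close>)
qed

lemma upper_limit_below:
 assumes W: "locally_bounded W" and z: "snd z <= 0" and e: "e > 0" and rho: "rho > 0"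
 obtains c n y where "(c, n, y) \<in> near_set rho z" "upper_limit W z - e < W c n y"
proof -
 have "~ (ALL (c, n, y):near_set rho z. W c n y <= upper_limit W z - e)"
 proof
  assume "ALL (c, n, y):near_set rho z. W c n y <= upper_limit W z - e"
  then have "upper_limit W z <= upper_limit W z - e"
   unfolding upper_limit_def[of W z] using rho by (intro cInf_lower upper_limit_set[OF W z]) auto
  with e show False by simp
 qed
 with that show ?thesis by force
qed

lemma upper_limit_le:
 assumes W: "locally_bounded W" and z: "snd z <= 0" and psi: "isCont psi z"
  and le: "!!c n y. 0 < c ==> W c n y <= psi (y, grid_time c n)"
 shows "upper_limit W z <= psi z"
proof (rule field_le_epsilon)
 fix e :: real assume e: "e > 0"
 then have e2: "e/2 > 0" by simp
 obtain rho where rho: "rho > 0" "!!z'. dist z' z < rho ==> dist (psi z') (psi z) < e/2" using psi e2 unfolding continuous_at_eps_delta by blast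
 obtain c n y where c: "(c, n, y) \<in> near_set rho z" "upper_limit W z - e/2 < W c n y" using upper_limit_below[OF W z e2 rho(1)] by blast
 have "0 < c"
 proof -
  have "0 < 1 / rho" using rho(1) by simp
  also have "1 / rho < c" using c(1) unfolding near_set_def by auto
  finally show ?thesis .
 qed
 then have "W c n y <= psi (y, grid_time c n)" "dist (psi (y, grid_time c n)) (psi z) < e/2"
  using le[of c n y] rho(2) c(1) unfolding near_set_def by auto
 then show "upper_limit W z <= psi z + e" using c(2) unfolding dist_real_def abs_less_iff by linarith
qed

lemma upper_limit_ge:
 assumes W: "locally_bounded W" and z: "snd z <= 0" and psi: "isCont psi z"
  and le: "!!c n y. 0 < c ==> psi (y, grid_time c n) <= W c n y"
 shows "psi z <= upper_limit W z"
proof (rule field_le_epsilon)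
 fix e :: real assume e: "e > 0"
 then have e2: "e/2 > 0" by simp
 obtain rho where rho: "rho > 0" "!!z'. dist z' z < rho ==> dist (psi z') (psi z) < e/2" using psi e2 unfolding continuous_at_eps_delta by blast
 obtain rho1 where rho1: "rho1 > 0" "!!c n y. (c, n, y) \<in> near_set rho1 z ==> W c n y <= upper_limit W z + e/2" by (rule upper_limit_above[OF W z e2]) (rule that)
 have m: "min rho rho1 > 0" using rho rho1 by simp
 then obtain c n y where cn: "(c, n, y) \<in> near_set (min rho rho1) z" using near_set_nonempty[OF _ z] by (metis ex_in_conv prod_cases3)
 then have "(c, n, y) \<in> near_set rho z" "(c, n, y) \<in> near_set rho1 z"
  using near_set_mono[of "min rho rho1" z z rho] near_set_mono[of "min rho rho1" z z rho1] m by auto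
 moreover have "0 < c"
 proof -
  have "0 < 1 / rho" using rho(1) by simp
  also have "1 / rho < c" using \<open>(c, n, y) \<in> near_set rho z\<close> unfolding near_set_def by auto
  finally show ?thesis .
 qed
 ultimately have "psi (y, grid_time c n) <= W c n y" "dist (psi (y, grid_time c n)) (psi z) < e/2" "W c n y <= upper_limit W z + e/2"
  using le[of c y n] rho(2) rho1(2) unfolding near_set_def by auto
 then show "psi z <= upper_limit W z + e" unfolding dist_real_def abs_less_iff by linarith
qed

lemma upper_limit_usc:
 assumes W: "locally_bounded W"
 shows "usc_on (UNIV \<times> {..0}) (upper_limit W)"
 unfolding usc_on_def
proof (intro ballI allI impI)
 fix z :: "(real^'a) \<times> real" and a assume z: "z \<in> UNIV \<times> {..0}" and a: "upper_limit W z < a"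
 define e where "e = (a - upper_limit W z) / 3"
 have e: "e > 0" unfolding e_def using a by simp
 have z0: "snd z <= 0" using z by auto
 obtain rho where rho: "rho > 0" "!!c n y. (c, n, y) \<in> near_set rho z ==> W c n y <= upper_limit W z + e" by (rule upper_limit_above[OF W z0 e]) (rule that)
 have "upper_limit W z' < a" if z': "z' \<in> UNIV \<times> {..0}" "dist z' z < rho/2" for z'
 proof -
  have z'0: "snd z' <= 0" using z' by auto
  have r2: "rho/2 > 0" using rho(1) by simp
  obtain c n y where c: "(c, n, y) \<in> near_set (rho/2) z'" "upper_limit W z' - e < W c n y"
   by (rule upper_limit_below[OF W z'0 e r2]) (rule that)
  have "(c, n, y) \<in> near_set rho z" using c(1) near_set_mono[of "rho/2" z' z rho] r2 z'(2) by auto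
  then have "W c n y <= upper_limit W z + e" by (rule rho(2))
  moreover have "3 * e = a - upper_limit W z" unfolding e_def by simp
  ultimately show ?thesis using c(2) e by linarith
 qed
 then show "\<forall>\<^sub>F y in at z within UNIV \<times> {..0}. upper_limit W y < a"
  unfolding eventually_at using rho(1) by (intro exI[of _ "rho/2"]) auto
qed

text \<open>By compactness the pointwise bound on the relaxed limit passes to the family itself,
  uniformly once the step is small.\<close>

lemma upper_limit_compact:
 fixes K :: "((real^'m) \<times> real) set"
 assumes W: "locally_bounded W" and K: "compact K" "!!z. z \<in> K ==> snd z <= 0" and psi: "continuous_on K psi"
  and le: "!!z. z \<in> K ==> upper_limit W z <= psi z" and e: "e > 0"
 obtains C where "C > 0" "!!c n y. C <= c ==> (y, grid_time c n) \<in> K ==> W c n y <= psi (y, grid_time c n) + e"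
proof -
 have e3: "e/3 > 0" using e by simp
 have "EX rho>0. (ALL c n y. (c, n, y) \<in> near_set rho z --> W c n y <= upper_limit W z + e/3) & (ALL z':K. dist z' z < rho --> dist (psi z') (psi z) < e/3)"
  if z: "z \<in> K" for z
 proof -
  obtain rho1 where 1: "rho1 > 0" "!!c n y. (c, n, y) \<in> near_set rho1 z ==> W c n y <= upper_limit W z + e/3" by (rule upper_limit_above[OF W K(2)[OF z] e3]) (rule that)
  obtain rho2 where 2: "rho2 > 0" "!!z'. z' \<in> K ==> dist z' z < rho2 ==> dist (psi z') (psi z) < e/3"
   using psi z e3 unfolding continuous_on_iff by metis
  show ?thesis using 1 2 near_set_mono[of "min rho1 rho2" z z rho1] by (intro exI[of _ "min rho1 rho2"]) auto
 qed
 then obtain rho where rho: "!!z. z \<in> K ==> rho z > 0" "!!z c n y. z \<in> K ==> (c, n, y) \<in> near_set (rho z) z ==> W c n y <= upper_limit W z + e/3"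
  "!!z z'. z \<in> K ==> z' \<in> K ==> dist z' z < rho z ==> dist (psi z') (psi z) < e/3" by metis
 have cov: "K <= (\<Union>z\<in>K. ball z (rho z))" using rho(1) by (fastforce)
 obtain D where D: "D <= K" "finite D" "K <= (\<Union>z\<in>D. ball z (rho z))"
  by (rule compactE_image[OF K(1) _ cov]) auto
 define C where "C = (\<Sum>z\<in>D. 1 / rho z) + 1"
 have C: "1 / rho z < C" if "z \<in> D" for z
 proof -
  have "1 / rho z <= (\<Sum>z\<in>D. 1 / rho z)" using that D rho(1) by (intro member_le_sum divide_nonneg_nonneg less_imp_le[OF rho(1)]) auto
  then show ?thesis unfolding C_def by simp
 qed
 have "0 <= (\<Sum>z\<in>D. 1 / rho z)" using D rho(1) by (intro sum_nonneg divide_nonneg_nonneg less_imp_le[OF rho(1)]) auto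
 then have "C > 0" unfolding C_def by simp
 then show ?thesis
 proof (rule that)
  fix c n y assume c: "C <= c" and y: "(y, grid_time c n) \<in> K"
  obtain z where z: "z \<in> D" "dist (y, grid_time c n) z < rho z" using D(3) y by (auto simp: dist_commute)
  have zK: "z \<in> K" using z D by auto
  have "(c, n, y) \<in> near_set (rho z) z" unfolding near_set_def using C[OF z(1)] c z(2) by auto
  then have "W c n y <= upper_limit W z + e/3" by (rule rho(2)[OF zK])
  moreover have "dist (psi (y, grid_time c n)) (psi z) < e/3" by (rule rho(3)[OF zK y z(2)])
  ultimately show "W c n y <= psi (y, grid_time c n) + e" using le[OF zK] e3 unfolding dist_real_def abs_less_iff by linarith
 qed
qed

text \<open>\<open>test_function\<close> speaks of the derivatives; joint continuity of
  \<open>phi\<close> combines continuity in space at one time with a local bound on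
  \<open>phit\<close>.\<close>

lemma test_function_continuous:
 assumes tf: "test_function phi phit g H"
 shows "continuous_on (UNIV \<times> {..<0}) (phi :: (real^'m) \<times> real => real)"
proof -
 have "isCont phi (x, t)" if t: "t < 0" for x t
  unfolding continuous_at_eps_delta
 proof (intro allI impI)
  fix e :: real assume e: "e > 0"
  obtain r1 where r1: "r1 > 0" "!!z. dist z (x,t) < r1 ==> dist (phit z) (phit (x, t)) < 1"
   using test_function_isCont(1)[OF tf t] unfolding continuous_at_eps_delta using zero_less_one by blast
  have "((%y. phi (y, t)) has_derivative (%h. g (x, t) \<bullet> h)) (at x)" using tf t unfolding test_function_def by auto
  then have "isCont (%y. phi (y, t)) x" by (rule has_derivative_continuous)
  then obtain r2 where r2: "r2 > 0" "!!y. dist y x < r2 ==> dist (phi (y, t)) (phi (x, t)) < e/2"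
   unfolding continuous_at_eps_delta using e by (metis half_gt_zero)
  define C where "C = \<bar>phit (x,t)\<bar> + 1"
  have C: "C > 0" unfolding C_def by simp
  define r where "r = Min {r1/2, r2, - t, e / (2*C)}"
  have r: "r > 0" "r <= r1/2" "r <= r2" "r <= - t" "r <= e / (2*C)" unfolding r_def using r1 r2 t e C by auto
  have "dist (phi (y, s)) (phi (x, t)) < e" if ys: "dist (y, s) (x, t) < r" for y s
  proof -
   have dy: "dist y x < r" and ds: "\<bar>s - t\<bar> < r" using ys dist_fst_le[of "(y,s)" "(x,t)"] dist_snd_le[of "(y,s)" "(x,t)"] by (auto simp: dist_real_def)
   have "\<bar>phi (y, s) - phi (y, t)\<bar> <= C * \<bar>s - t\<bar>"
   proof -
    have der: "((%s. phi (y, s)) has_real_derivative phit (y, u)) (at u)" if "u < 0" for u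
     using tf that unfolding test_function_def by auto
    have bd: "norm (phit (y, u)) <= C" if u: "u \<in> ball t r" for u
    proof -
     have "dist (y, u) (x, t) <= dist y x + \<bar>u - t\<bar>"
      unfolding dist_Pair_Pair using sqrt_sum_squares_le_sum_abs[of "dist y x" "u - t"] by (simp add: dist_real_def)
     also have "... < r1" using dy u r by (simp add: dist_real_def abs_minus_commute)
     finally show ?thesis using r1(2)[of "(y,u)"] unfolding C_def dist_real_def by simp
    qed
    have "norm (phi (y, s) - phi (y, t)) <= C * norm (s - t)"
    proof (rule field_differentiable_bound[of "ball t r" "%s. phi (y, s)" "%u. phit (y, u)"])
     fix u assume u: "u \<in> ball t r"
     then have "u < 0" using r by (simp add: dist_real_def)
     then show "((%s. phi (y, s)) has_real_derivative phit (y, u)) (at u within ball t r)" by (rule has_field_derivative_at_within[OF der])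
     show "norm (phit (y, u)) <= C" by (rule bd[OF u])
    qed (use ds r in "auto simp: dist_real_def")
    then show ?thesis by simp
   qed
   also have "C * \<bar>s - t\<bar> < C * (e / (2*C))" using ds r C by (intro mult_strict_left_mono) auto
   also have "... = e/2" using C by simp
   finally have "\<bar>phi (y, s) - phi (y, t)\<bar> < e/2" .
   moreover have "dist (phi (y, t)) (phi (x, t)) < e/2" using r2(2)[of y] dy r by simp
   ultimately show ?thesis unfolding dist_real_def by linarith
  qed
  with r(1) show "EX d>0. ALL x'. dist x' (x, t) < d --> dist (phi x') (phi (x, t)) < e" by (metis surj_pair)
 qed
 then show ?thesis by (intro continuous_at_imp_continuous_on ballI) auto
qed

text \<open>The family need not attain its suprema, so a point within \<open>1 / c^3\<close> of the
  supremum of \<open>W - phi\<close> is used; the strict bump keeps it near \<open>(x0, t0)\<close>.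
  In one round \<open>W\<close> loses at most \<open>1 / c^3\<close> while \<open>phi\<close> drops
  by \<open>e / c^2\<close>, so for large \<open>c\<close> the supremum would be exceeded.\<close>

lemma upper_limit_touching:
 fixes W :: "real => nat => real^'m => real"
 assumes W: "locally_bounded W" and tf: "test_function phi phit g H" and t0: "t0 < 0" and r: "r > 0"
  and max: "!!z. dist z (x0, t0) < r ==> upper_limit W z - phi z <= upper_limit W (x0, t0) - phi (x0, t0) - strict_bump (x0, t0) z"
  and r1: "r1 > 0" and e: "e > 0"
  and step: "!!c n y. C1 <= c ==> dist (y, grid_time c (Suc n)) (x0, t0) < r1 ==>
   EX h. norm h <= R & W c (Suc n) y <= W c n (y + h /\<^sub>R c) + 1 / c^3 &
     phi (y + h /\<^sub>R c, grid_time c n) <= phi (y, grid_time c (Suc n)) - e / c^2"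
 shows False
proof -
 have cphi: "continuous_on (UNIV \<times> {..<0}) phi" by (rule test_function_continuous[OF tf])
 let ?z0 = "(x0, t0)" and ?u = "upper_limit W"
 define r2 where "r2 = Min {r, r1, - t0} / 2"
 have r2: "r2 > 0" "r2 < r" "r2 < r1" "r2 < - t0" unfolding r2_def using r r1 t0 by auto
 have neg: "snd z < 0" if "dist z ?z0 <= r2" for z
  using that r2 dist_snd_le[of z ?z0] by (simp add: dist_real_def)
 define K where "K = cball ?z0 r2"
 define K' where "K' = K - ball ?z0 (r2/2)"
 have K: "compact K" "compact K'" unfolding K_def K'_def by (auto intro: compact_diff)
 have Kneg: "snd z <= 0" if "z \<in> K" for z using neg[of z] that unfolding K_def by (auto simp: dist_commute)
 have ck: "continuous_on K phi"
 proof (rule continuous_on_subset[OF cphi])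
  show "K <= UNIV \<times> {..<0}"
  proof
   fix z assume "z \<in> K"
   then show "z \<in> UNIV \<times> {..<0}" using neg[of z] unfolding K_def by (cases z) (auto simp: dist_commute)
  qed
 qed
 have "EX m>0. ALL z:K'. m <= strict_bump ?z0 z"
 proof (cases "K' = {}")
  case False
  obtain w where w: "w \<in> K'" "!!z. z \<in> K' ==> strict_bump ?z0 w <= strict_bump ?z0 z"
   using continuous_attains_inf[OF K(2) False continuous_on_strict_bump[of K' ?z0]] by blast
  have "w ~= ?z0" using w(1) r2 unfolding K'_def by auto
  then show ?thesis using w strict_bump_pos by blast
 qed (auto intro: exI[of _ 1])
 then obtain m where m: "m > 0" "!!z. z \<in> K' ==> m <= strict_bump ?z0 z" by blast
 define a0 where "a0 = ?u ?z0 - phi ?z0"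
 have le1: "?u z <= phi z + a0" if "z \<in> K" for z
  using max[of z] that r2 strict_bump_nonneg[of ?z0 z] unfolding K_def a0_def by (simp add: dist_commute)
 have le2: "?u z <= phi z + (a0 - m)" if "z \<in> K'" for z
  using max[of z] that r2 m(2)[OF that] unfolding K'_def K_def a0_def by (simp add: dist_commute)
 have K'K: "K' <= K" unfolding K'_def by blast
 obtain Ca where Ca: "Ca > 0" "!!c n y. Ca <= c ==> (y, grid_time c n) \<in> K ==> W c n y <= phi (y, grid_time c n) + a0 + 1"
  by (rule upper_limit_compact[OF W K(1) Kneg _ le1, of 1]) (auto intro!: continuous_intros ck that)
 have m2: "m/2 > 0" using m by simp
 have ck': "continuous_on K' (%z. phi z + (a0 - m))" using continuous_on_subset[OF ck K'K] by (intro continuous_intros)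
 obtain Cb where Cb: "Cb > 0" "!!c n y. Cb <= c ==> (y, grid_time c n) \<in> K' ==> W c n y <= phi (y, grid_time c n) + (a0 - m) + m/2"
  by (rule upper_limit_compact[OF W K(2) _ ck' le2 m2]) (use Kneg K'K in "auto intro: that")
 have "isCont phi ?z0"
  using cphi t0 continuous_on_eq_continuous_at[of "UNIV \<times> {..<0}" phi] open_Times[OF open_UNIV open_lessThan] by auto
 then obtain rho0 where rho0: "rho0 > 0" "!!z. dist z ?z0 < rho0 ==> dist (phi z) (phi ?z0) < m/8"
  unfolding continuous_at_eps_delta using m(1) by (metis divide_pos_pos zero_less_numeral)
 \<comment> \<open>Large \<open>c\<close> is needed for the two uniform bounds and the step
   (\<open>Ca\<close>, \<open>Cb\<close>, \<open>C1\<close>), to make \<open>1 / c^3\<close> at most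
   \<open>m / 8\<close>, to keep one step inside \<open>K\<close>, and for the final contradiction,
   where \<open>2 / e\<close> enters.\<close>
 define B where "B = Max {Ca, Cb, C1, 8/m, 2/e, 1, (\<bar>R\<bar> + 1) / (r2/2)} + 1"
 have B: "Ca < B" "Cb < B" "C1 < B" "8/m < B" "2/e < B" "1 < B" "(\<bar>R\<bar> + 1) / (r2/2) < B"
  unfolding B_def by (rule order_le_less_trans[OF Max_ge less_add_one]; simp)+
 define rho where "rho = Min {rho0, r2, 1/B}"
 have rho: "rho > 0" "rho <= rho0" "rho <= r2" "rho <= 1/B" unfolding rho_def using rho0 r2 B by auto
 have m8: "m/8 > 0" using m by simp
 obtain c n y where c: "(c, n, y) \<in> near_set rho ?z0" "?u ?z0 - m/8 < W c n y"
  by (rule upper_limit_below[OF W _ m8 rho(1), of ?z0]) (use t0 in "auto intro: that")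
 have cB: "c > B"
 proof -
  have "B <= 1 / rho" using rho(1,4) B(6) by (simp add: field_simps)
  then show ?thesis using c(1) unfolding near_set_def by auto
 qed
 have c0: "c > 1" using cB B by simp
 have yn: "dist (y, grid_time c n) ?z0 < rho" using c(1) unfolding near_set_def by auto
 let ?f = "%(n, y). W c n y - phi (y, grid_time c n)"
 let ?S = "{(n, y). (y, grid_time c n) \<in> K}"
 have S1: "(n, y) \<in> ?S" using yn rho unfolding K_def by (auto simp: dist_commute)
 have bdd: "bdd_above (?f ` ?S)"
 proof (rule bdd_aboveI2[where M="a0 + 1"])
  fix p assume p: "p \<in> ?S"
  then show "?f p <= a0 + 1" using Ca(2)[of c] cB B by (cases p) fastforce
 qed
 define s where "s = Sup (?f ` ?S)"
 have sge: "?f p <= s" if "p \<in> ?S" for p unfolding s_def using that bdd by (rule cSUP_upper)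
 have "dist (phi (y, grid_time c n)) (phi ?z0) < m/8" using rho0(2) yn rho by simp
 then have "a0 - m/4 < ?f (n, y)" using c(2) unfolding a0_def dist_real_def abs_less_iff by simp
 then have s1: "a0 - m/4 < s" using sge[OF S1] by linarith
 have c3: "0 < 1 / c^3" using c0 by simp
 have "EX p:?S. s - 1 / c^3 < ?f p" using less_cSUP_iff[OF _ bdd, of "s - 1/c^3"] S1 c3 unfolding s_def by auto
 then obtain n' y' where n': "(y', grid_time c n') \<in> K" "s - 1 / c^3 < W c n' y' - phi (y', grid_time c n')" by auto
 have "1 / c^3 <= 1 / c" using c0 by (intro divide_left_mono) (auto simp: power3_eq_cube intro: less_imp_le less_1_mult)
 also have "1 / c <= m/8"
 proof -
  have "8 / m < c" using cB B(4) by linarith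
  then have "8 < c * m" using m(1) by (simp add: pos_divide_less_eq)
  then show ?thesis using c0 by (simp add: pos_divide_le_eq mult.commute)
 qed
 finally have c3m: "1 / c^3 <= m/8" .
 have "(y', grid_time c n') ~: K'"
 proof
  assume "(y', grid_time c n') \<in> K'"
  then have "W c n' y' <= phi (y', grid_time c n') + (a0 - m) + m/2" using Cb(2) cB B by auto
  then show False using n'(2) s1 c3m m by linarith
 qed
 then have near: "dist (y', grid_time c n') ?z0 < r2/2" using n'(1) unfolding K'_def by (auto simp: dist_commute)
 have "grid_time c n' < 0" using neg[of "(y', grid_time c n')"] near r2 by simp
 \<comment> \<open>The time is negative, so at least one round remains to be played.\<close>
 then have "n' ~= 0" unfolding grid_time_def by (cases n') auto
 then obtain k where k: "n' = Suc k" by (cases n') auto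
 obtain h where h: "norm h <= R" "W c (Suc k) y' <= W c k (y' + h /\<^sub>R c) + 1 / c^3"
   "phi (y' + h /\<^sub>R c, grid_time c k) <= phi (y', grid_time c (Suc k)) - e / c^2"
  using step[of c y' k] near r2 cB B k by auto
 have "dist (y' + h /\<^sub>R c, grid_time c k) (y', grid_time c (Suc k)) <= norm (h /\<^sub>R c) + \<bar>grid_time c k - grid_time c (Suc k)\<bar>"
  unfolding dist_Pair_Pair using sqrt_sum_squares_le_sum_abs[of "norm (h /\<^sub>R c)" "grid_time c k - grid_time c (Suc k)"]
  by (simp add: dist_norm)
 also have "grid_time c k - grid_time c (Suc k) = 1 / (2 * c^2)" unfolding grid_time_def by (simp add: add_divide_distrib)
 also have "norm (h /\<^sub>R c) + \<bar>1 / (2 * c^2)\<bar> <= \<bar>R\<bar> / c + 1 / c"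
 proof (rule add_mono)
  show "norm (h /\<^sub>R c) <= \<bar>R\<bar> / c" using h(1) c0 by (simp add: divide_inverse mult.commute mult_left_mono)
  show "\<bar>1 / (2 * c^2)\<bar> <= 1 / c" using c0 by (simp add: power2_eq_square field_simps)
 qed
 also have "... <= r2/2"
 proof -
  have "(\<bar>R\<bar> + 1) / (r2/2) < c" using cB B(7) by linarith
  then have "\<bar>R\<bar> + 1 < c * (r2/2)" using r2(1) by (subst (asm) pos_divide_less_eq) auto
  then show ?thesis using c0 by (simp add: add_divide_distrib[symmetric] pos_divide_le_eq mult.commute)
 qed
 finally have "dist (y' + h /\<^sub>R c, grid_time c k) ?z0 <= r2"
  using near k dist_triangle[of "(y' + h /\<^sub>R c, grid_time c k)" ?z0 "(y', grid_time c (Suc k))"] by simp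
 then have "(k, y' + h /\<^sub>R c) \<in> ?S" unfolding K_def by (simp add: dist_commute)
 from sge[OF this] have "W c k (y' + h /\<^sub>R c) - phi (y' + h /\<^sub>R c, grid_time c k) <= s" by simp
 then have "e / c^2 < 2 / c^3" using h(2,3) n'(2) k by simp
 then have "e * c < 2" using c0 by (simp add: field_simps power3_eq_cube power2_eq_square)
 moreover have "2 < e * c"
 proof -
  have "2 / e < c" using cB B(5) by linarith
  then show ?thesis using e by (simp add: pos_divide_less_eq mult.commute)
 qed
 ultimately show False by simp
qed

subsection \<open>Consistency of the game\<close>

lemma curv_max_continuous:
 fixes M :: "real^'m^'m"
 assumes J: "index_set TYPE('m) J" and sym: "transpose M = M" and p: "p ~= 0" and e: "e > 0"
 obtains d where "d > 0" "!!M' p'. transpose M' = M' ==> norm (M' - M) < d ==> norm (p' - p) < d ==>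
  \<bar>curv_max J M' p' - curv_max J M p\<bar> <= e & p' ~= 0"
proof -
 let ?m = "real CARD('m)"
 define K where "K = ?m + ?m * (8 * norm M / norm p) + 1"
 have K: "K > 0" unfolding K_def using p by (intro add_nonneg_pos add_nonneg_nonneg mult_nonneg_nonneg divide_nonneg_nonneg) auto
 define d where "d = min (norm p / 2) (e / K)"
 have d: "d > 0" unfolding d_def using p e K by simp
 have "\<bar>curv_max J M' p' - curv_max J M p\<bar> <= e & p' ~= 0"
  if s: "transpose M' = M'" and nM: "norm (M' - M) < d" and np: "norm (p' - p) < d" for M' p'
 proof -
  have np2: "norm (p' - p) <= norm p / 2" using np unfolding d_def by simp
  then have p': "p' ~= 0" using p by (auto simp: norm_minus_commute)
  have q: "(A *v h) \<bullet> h <= (B *v h) \<bullet> h + norm (A - B) * (h \<bullet> h)" for A B :: "real^'m^'m" and h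
  proof -
   have "(A *v h) \<bullet> h - (B *v h) \<bullet> h = ((A - B) *v h) \<bullet> h" by (simp add: matrix_vector_mult_diff_rdistrib inner_diff_left)
   then show ?thesis using quadratic_form_le[of "A - B" h] by (simp add: power2_norm_eq_inner abs_le_iff)
  qed
  have 1: "curv_max J M' p' <= curv_max J M p' + ?m * norm (M' - M)"
   by (rule curv_max_mono[OF J s sym p' norm_ge_zero]) (rule q)
  have 2: "curv_max J M p' <= curv_max J M' p' + ?m * norm (M' - M)"
   using curv_max_mono[OF J sym s p' norm_ge_zero, of "M - M'"] q by (simp add: norm_minus_commute)
  have 3: "\<bar>curv_max J M p - curv_max J M p'\<bar> <= ?m * (8 * norm M * norm (p' - p) / norm p)"
   by (rule curv_max_near[OF J sym p np2 norm_matrix_vector_mult_le norm_ge_zero])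
  have 4: "?m * norm (M' - M) <= ?m * d" using nM by (intro mult_left_mono) auto
  have 5: "?m * (8 * norm M * norm (p' - p) / norm p) <= ?m * (8 * norm M / norm p) * d"
  proof -
   have "?m * (8 * norm M / norm p) * norm (p' - p) <= ?m * (8 * norm M / norm p) * d" using np by (intro mult_left_mono) auto
   then show ?thesis by (simp add: mult_ac)
  qed
  have "K * d <= e" using K unfolding d_def by (simp add: min_def field_simps)
  then have "?m * d + ?m * (8 * norm M / norm p) * d <= e" using d unfolding K_def by (simp add: algebra_simps)
  then have "\<bar>curv_max J M' p' - curv_max J M p\<bar> <= e" using 1 2 3 4 5 unfolding abs_le_iff by linarith
  with p' show ?thesis by simp
 qed
 with d that show ?thesis by blast
qed

text \<open>The columns are projected to the hyperplane orthogonal to \<open>p\<close> and balanced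
  there; a global sign then makes the component along \<open>p\<close> nonpositive. The error of the
  projection in the quadratic form is proportional to that component, and for large \<open>c\<close>
  the first-order term absorbs it.\<close>

lemma balance_step:
 fixes M :: "real^'m^'m" and A :: "real^'n^'m"
 assumes m: "CARD('m) >= 2" and sym: "transpose M = M" and p: "p ~= 0" and A: "A \<in> unit_column_matrices"
  and c: "norm M * real CARD('n) <= c * norm p"
 shows "EX s:sign_vectors. c * (p \<bullet> (A *v s)) + ((M *v (A *v s)) \<bullet> (A *v s)) / 2 <= curv_max {..min CARD('n) (CARD('m) - 1)} M p / 2"
proof -
 let ?k = "min CARD('n) (CARD('m) - 1)"
 obtain B mu where B: "finite B" "!!b. b \<in> B ==> 0 <= mu b"
  "!!x. x \<bullet> p = 0 ==> (M *v x) \<bullet> x <= (\<Sum>b\<in>B. mu b * (b \<bullet> x)^2)"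
  "!!U. orthonormal U ==> (!!u. u \<in> U ==> u \<bullet> p = 0) ==> card U <= ?k ==> (\<Sum>u\<in>U. \<Sum>b\<in>B. mu b * (b \<bullet> u)^2) <= curv_max {..?k} M p"
  by (rule psd_majorant[OF sym p, of ?k]) (auto intro: that)
 define P where "P v = v - ((v \<bullet> p) / (p \<bullet> p)) *\<^sub>R p" for v
 have Pp: "P v \<bullet> p = 0" for v unfolding P_def using p by (simp add: inner_diff_left)
 have Pn: "norm (P v) <= norm v" for v
 proof -
  have "orthogonal (P v) (((v \<bullet> p) / (p \<bullet> p)) *\<^sub>R p)" using Pp unfolding orthogonal_def by simp
  then have "(norm (P v + ((v \<bullet> p) / (p \<bullet> p)) *\<^sub>R p))^2 = (norm (P v))^2 + (norm (((v \<bullet> p) / (p \<bullet> p)) *\<^sub>R p))^2"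
   by (rule norm_add_Pythagorean)
  then have "(norm (P v))^2 <= (norm v)^2" by (simp add: P_def)
  then show ?thesis by (rule power2_le_imp_le) simp
 qed
 have linP: "linear P" unfolding P_def
  by (auto intro!: linearI simp: inner_add_left add_divide_distrib algebra_simps)
 let ?a = "%j. P (column j A)"
 have a1: "norm (?a j) <= 1" for j using Pn[of "column j A"] A unfolding unit_column_matrices_def by (auto intro: order_trans)
 obtain y U where y: "!!j. y j \<in> {-1, 1::real}" and U: "orthonormal U" "U <= span (range ?a)" "card U <= CARD('n)"
  "diag_form B mu (%b. b) (\<Sum>j\<in>UNIV. y j *\<^sub>R ?a j) <= (\<Sum>u\<in>U. diag_form B mu (%b. b) u)"
  by (rule balance_diag_form[where B=B and mu=mu and e="%b. b" and a="?a"]) (use B(2) a1 in "auto intro: that")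
 define s0 :: "real^'n" where "s0 = (\<chi> j. y j)"
 have s0: "s0 \<in> sign_vectors" unfolding s0_def sign_vectors_def using y by auto
 have sub: "span (range ?a) <= {v. v \<bullet> p = 0}"
  by (rule span_minimal) (auto simp: Pp subspace_def inner_add_left)
 have Up: "u \<bullet> p = 0" if "u \<in> U" for u using that U(2) sub by auto
 have "card U <= dim {v. v \<bullet> p = 0}"
  using U(2) sub orthonormal_independent[OF U(1)] by (intro independent_card_le_dim) auto
 also have "... = CARD('m) - 1" using dim_hyperplane[OF p] by (simp add: inner_commute)
 finally have cU: "card U <= ?k" using U(3) by simp
 have Ph0: "P (A *v s0) = (\<Sum>j\<in>UNIV. y j *\<^sub>R ?a j)"
  unfolding matrix_vector_mult_columns by (simp add: linear_sum[OF linP] linear_cmul[OF linP] s0_def)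
 have q0: "(M *v P (A *v s0)) \<bullet> P (A *v s0) <= curv_max {..?k} M p"
  using B(3)[OF Pp, of "A *v s0"] U(4) B(4)[OF U(1) Up cU] unfolding diag_form_def Ph0 by linarith
 obtain s where s: "s \<in> sign_vectors" "p \<bullet> (A *v s) <= 0" "(M *v P (A *v s)) \<bullet> P (A *v s) <= curv_max {..?k} M p"
 proof (cases "p \<bullet> (A *v s0) <= 0")
  case False
  have neg: "A *v (- s0) = - (A *v s0)" using matrix_vector_mult_scaleR[of A "-1" s0] by simp
  have "P (- v) = - P v" for v using linear_neg[OF linP] by blast
  moreover have "M *v (- v) = - (M *v v)" for v using matrix_vector_mult_scaleR[of M "-1" v] by simp
  ultimately show ?thesis using that[of "- s0"] sign_vectors_uminus[OF s0] False q0 unfolding neg by simp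
 qed (use s0 q0 that in auto)
 let ?h = "A *v s"
 have hn: "norm ?h <= real CARD('n)" by (rule unit_step_norm[OF A s(1)])
 have symi: "(M *v x) \<bullet> y = x \<bullet> (M *v y)" for x y by (rule symmetric_matrix_inner[OF sym])
 have "(M *v ?h) \<bullet> ?h - (M *v P ?h) \<bullet> P ?h = (M *v (?h + P ?h)) \<bullet> (?h - P ?h)"
  using symi[of ?h "P ?h"] by (simp add: matrix_vector_right_distrib inner_add_left inner_diff_right inner_commute[of "M *v P ?h" ?h])
 also have "... <= norm (M *v (?h + P ?h)) * norm (?h - P ?h)" by (rule norm_cauchy_schwarz)
 also have "... <= (norm M * (2 * real CARD('n))) * (\<bar>p \<bullet> ?h\<bar> / norm p)"
 proof (rule mult_mono)
  have "norm (?h + P ?h) <= 2 * real CARD('n)" using norm_triangle_ineq[of ?h "P ?h"] Pn[of ?h] hn by linarith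
  then show "norm (M *v (?h + P ?h)) <= norm M * (2 * real CARD('n))"
   using norm_matrix_vector_mult_le[of M "?h + P ?h"] by (meson mult_left_mono norm_ge_zero order_trans)
  have "norm (?h - P ?h) = \<bar>p \<bullet> ?h\<bar> / (p \<bullet> p) * norm p" unfolding P_def by (simp add: inner_commute)
  also have "... = \<bar>p \<bullet> ?h\<bar> / norm p" using p by (simp add: dot_square_norm power2_eq_square)
  finally show "norm (?h - P ?h) <= \<bar>p \<bullet> ?h\<bar> / norm p" by simp
 qed auto
 also have "... <= 2 * (c * \<bar>p \<bullet> ?h\<bar>)"
 proof -
  have "norm M * real CARD('n) / norm p <= c" using c p by (simp add: pos_divide_le_eq)
  then have "(norm M * real CARD('n) / norm p) * \<bar>p \<bullet> ?h\<bar> <= c * \<bar>p \<bullet> ?h\<bar>" by (rule mult_right_mono) simp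
  moreover have "norm M * (2 * real CARD('n)) * (\<bar>p \<bullet> ?h\<bar> / norm p) = 2 * ((norm M * real CARD('n) / norm p) * \<bar>p \<bullet> ?h\<bar>)" by simp
  ultimately show ?thesis by linarith
 qed
 finally have "(M *v ?h) \<bullet> ?h <= curv_max {..?k} M p + 2 * (c * \<bar>p \<bullet> ?h\<bar>)" using s(3) by linarith
 moreover have "\<bar>p \<bullet> ?h\<bar> = - (p \<bullet> ?h)" using s(2) by simp
 ultimately have "c * (p \<bullet> ?h) + ((M *v ?h) \<bullet> ?h) / 2 <= curv_max {..?k} M p / 2" by (simp add: algebra_simps)
 with s(1) show ?thesis by blast
qed

text \<open>\<open>c^2\<close> times the second-order Taylor change of a test function in one round,
  with displacement \<open>h\<close> divided by \<open>c\<close> and time step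
  \<open>1 / (2 * c^2)\<close>. This time step gives the operator and the time derivative the same
  factor 1/2.\<close>

definition increment where
 "increment g H phit c z h = c * (g z \<bullet> h) + ((H z *v h) \<bullet> h) / 2 + phit z / 2" for H :: "_ => real^'m^'m"

lemma taylor_step:
 fixes x0 :: "real^'m"
 assumes tf: "test_function phi phit g H" and t0: "t0 < 0" and omega: "omega > 0" and N: "N >= 0"
 obtains r C where "r > 0" "C > 0" "!!c y t h. C <= c ==> dist (y, t) (x0, t0) < r ==> norm h <= N ==>
  increment g H phit c (y, t) h <= - 2 * omega ==> phi (y + h /\<^sub>R c, t + 1 / (2 * c^2)) <= phi (y, t) - omega / c^2"
proof -
 define omega' where "omega' = omega / (N^2 + 1)"
 have N1: "N^2 + 1 > 0" by (simp add: add_nonneg_pos)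
 have w': "omega' > 0" unfolding omega'_def using omega N1 by simp
 obtain r where r: "r > 0" "!!y t h s. dist (y, t) (x0, t0) < r ==> norm h < r ==> \<bar>s\<bar> < r ==> t < 0 & t + s < 0 &
  phi (y + h, t + s) <= phi (y, t) + phit (y, t) * s + g (y, t) \<bullet> h + ((H (y, t) *v h) \<bullet> h) / 2 + omega' * ((norm h)^2 + \<bar>s\<bar>)"
  using test_function_taylor[OF tf t0 w', of x0] by blast
 define C where "C = (N + 1) / r + 1"
 have C: "C >= 1" unfolding C_def using r N by simp
 have "phi (y + h /\<^sub>R c, t + 1 / (2 * c^2)) <= phi (y, t) + (c * (g (y, t) \<bullet> h) + ((H (y, t) *v h) \<bullet> h) / 2 + phit (y, t) / 2 + omega) / c^2"
  if c: "C <= c" and yt: "dist (y, t) (x0, t0) < r" and h: "norm h <= N" for c y t h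
 proof -
  have c1: "c >= 1" using c C by linarith
  have "(N + 1) / r < c" using c unfolding C_def by linarith
  then have Nr: "(N + 1) / c < r" using r c1 by (simp add: field_simps)
  have hr: "norm (h /\<^sub>R c) < r"
  proof -
   have "norm (h /\<^sub>R c) = norm h / c" using c1 by (simp add: divide_inverse mult.commute)
   also have "... <= (N + 1) / c" using h c1 by (intro divide_right_mono) auto
   finally show ?thesis using Nr by simp
  qed
  have sr: "\<bar>1 / (2 * c^2)\<bar> < r"
  proof -
   have "1 / (2 * c^2) <= 1 / c" using c1 by (simp add: power2_eq_square field_simps)
   also have "... <= (N + 1) / c" using N c1 by (intro divide_right_mono) auto
   finally show ?thesis using Nr by simp
  qed
  from r(2)[OF yt hr sr] have t: "t < 0" and le: "phi (y + h /\<^sub>R c, t + 1 / (2 * c^2)) <= phi (y, t) + phit (y, t) * (1 / (2 * c^2)) + g (y, t) \<bullet> (h /\<^sub>R c)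
   + ((H (y, t) *v (h /\<^sub>R c)) \<bullet> (h /\<^sub>R c)) / 2 + omega' * ((norm (h /\<^sub>R c))^2 + \<bar>1 / (2 * c^2)\<bar>)" by auto
  have "(norm (h /\<^sub>R c))^2 + \<bar>1 / (2 * c^2)\<bar> = ((norm h)^2 + 1/2) / c^2"
   using c1 by (simp add: power_mult_distrib field_simps)
  also have "... <= (N^2 + 1) / c^2" using h power_mono[OF h, of 2] by (intro divide_right_mono) auto
  finally have "omega' * ((norm (h /\<^sub>R c))^2 + \<bar>1 / (2 * c^2)\<bar>) <= omega' * ((N^2 + 1) / c^2)" using w' by (intro mult_left_mono) auto
  also have "... = omega / c^2" unfolding omega'_def using N1 by simp
  finally have 1: "omega' * ((norm (h /\<^sub>R c))^2 + \<bar>1 / (2 * c^2)\<bar>) <= omega / c^2" .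
  have 2: "g (y, t) \<bullet> (h /\<^sub>R c) = (c * (g (y, t) \<bullet> h)) / c^2" using c1 by (simp add: power2_eq_square field_simps)
  have 3: "(H (y, t) *v (h /\<^sub>R c)) \<bullet> (h /\<^sub>R c) = ((H (y, t) *v h) \<bullet> h) / c^2"
   using c1 by (simp add: matrix_vector_mult_scaleR power2_eq_square field_simps)
  have 4: "phit (y, t) * (1 / (2 * c^2)) = (phit (y, t) / 2) / c^2" by simp
  show ?thesis using le 1 t unfolding 2 3 4 by (simp add: add_divide_distrib)
 qed
 then have "phi (y + h /\<^sub>R c, t + 1 / (2 * c^2)) <= phi (y, t) + (increment g H phit c (y, t) h + omega) / c^2"
  if "C <= c" "dist (y, t) (x0, t0) < r" "norm h <= N" for c y t h
  using that unfolding increment_def by blast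
 moreover have "(i + omega) / c^2 <= - (omega / c^2)" if "i <= - 2 * omega" for i c
  using divide_right_mono[of "i + omega" "- omega" "c^2"] that by simp
 ultimately have "phi (y + h /\<^sub>R c, t + 1 / (2 * c^2)) <= phi (y, t) - omega / c^2"
  if "C <= c" "dist (y, t) (x0, t0) < r" "norm h <= N" "increment g H phit c (y, t) h <= - 2 * omega" for c y t h
  using that by (smt (verit))
 then show ?thesis using that[of r C] r(1) C by simp
qed

lemma test_function_near:
 fixes x0 :: "real^'m"
 assumes tf: "test_function phi phit g H" and t0: "t0 < 0" and e: "e > 0"
 obtains r where "r > 0" "!!z. dist z (x0, t0) < r ==> snd z < 0 & transpose (H z) = H z & \<bar>phit z - phit (x0, t0)\<bar> < e & norm (g z - g (x0, t0)) < e & norm (H z - H (x0, t0)) < e"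
proof -
 obtain r1 where 1: "r1 > 0" "!!z. dist z (x0, t0) < r1 ==> dist (phit z) (phit (x0, t0)) < e"
  using test_function_isCont(1)[OF tf t0] e unfolding continuous_at_eps_delta by blast
 obtain r2 where 2: "r2 > 0" "!!z. dist z (x0, t0) < r2 ==> dist (g z) (g (x0, t0)) < e"
  using test_function_isCont(2)[OF tf t0] e unfolding continuous_at_eps_delta by blast
 obtain r3 where 3: "r3 > 0" "!!z. dist z (x0, t0) < r3 ==> dist (H z) (H (x0, t0)) < e"
  using test_function_isCont(3)[OF tf t0] e unfolding continuous_at_eps_delta by blast
 define r where "r = Min {r1, r2, r3, - t0}"
 have r: "r > 0" "r <= r1" "r <= r2" "r <= r3" "r <= - t0" unfolding r_def using 1 2 3 t0 by auto
 show ?thesis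
 proof (rule that[OF r(1)])
  fix z assume z: "dist z (x0, t0) < r"
  have "snd z < 0" using z r(5) dist_snd_le[of z "(x0, t0)"] by (simp add: dist_real_def)
  moreover from this have "transpose (H z) = H z" using test_function_symmetric[OF tf, of "snd z" "fst z"] by simp
  ultimately show "snd z < 0 & transpose (H z) = H z & \<bar>phit z - phit (x0, t0)\<bar> < e & norm (g z - g (x0, t0)) < e & norm (H z - H (x0, t0)) < e"
   using 1(2)[of z] 2(2)[of z] 3(2)[of z] z r by (auto simp: dist_norm)
 qed
qed

text \<open>Away from zero gradient the answer comes from \<open>balance_step\<close>. In the other
  case a sign with nonpositive first-order term is enough, and \<open>norm (A *v s)\<close> is at
  most \<open>n\<close>; this is the origin of the constant \<open>n^2\<close>.\<close>

lemma upper_consistency: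
 fixes x0 :: "real^'m"
 assumes m: "CARD('m) >= 2" and tf: "test_function phi phit g H" and t0: "t0 < 0"
  and viol: "violated (curv_max {..min CARD('n) (CARD('m) - 1)}) ((real CARD('n))^2) (phit (x0, t0)) (H (x0, t0)) (g (x0, t0))"
 obtains r C e where "r > 0" "C > 0" "e > 0" "!!c y t A. C <= c ==> dist (y, t) (x0, t0) < r ==> A \<in> (unit_column_matrices :: (real^'n^'m) set) ==>
  EX s:sign_vectors. phi (y + (A *v s) /\<^sub>R c, t + 1 / (2 * c^2)) <= phi (y, t) - e / c^2"
proof -
 let ?zo = "(x0, t0)" and ?N = "real CARD('n)" and ?k = "min CARD('n) (CARD('m) - 1)"
 have J: "index_set TYPE('m) {..?k}" unfolding index_set_def by auto
 have main: "EX r C e. r > 0 & C > 0 & e > 0 & (ALL c y t. ALL A:(unit_column_matrices :: (real^'n^'m) set). C <= c --> dist (y, t) ?zo < r -->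
  (EX s:sign_vectors. increment g H phit c (y, t) (A *v s) <= - 2 * e))"
  using viol unfolding violated_def
 proof
  assume v: "g ?zo ~= 0 & phit ?zo + curv_max {..?k} (H ?zo) (g ?zo) < 0"
  \<comment> \<open>The violation is \<open>8 * e\<close>: half of it absorbs the variation of the
    data near the point, and the factor 1/2 in \<open>increment\<close> leaves
    \<open>2 * e\<close>.\<close>
  define e where "e = - (phit ?zo + curv_max {..?k} (H ?zo) (g ?zo)) / 8"
  have e: "e > 0" unfolding e_def using v by simp
  have s0: "transpose (H ?zo) = H ?zo" by (rule test_function_symmetric[OF tf t0])
  obtain d where d: "d > 0" "!!M' p'. transpose M' = M' ==> norm (M' - H ?zo) < d ==> norm (p' - g ?zo) < d ==>
   \<bar>curv_max {..?k} M' p' - curv_max {..?k} (H ?zo) (g ?zo)\<bar> <= 2 * e & p' ~= 0"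
   by (rule curv_max_continuous[OF J s0, of "g ?zo" "2 * e"]) (use v e in "auto intro: that")
  define d' where "d' = Min {d, 2 * e, norm (g ?zo) / 2}"
  have d': "d' > 0" "d' <= d" "d' <= 2 * e" "d' <= norm (g ?zo) / 2" unfolding d'_def using d e v by auto
  obtain r where r: "r > 0" "!!z. dist z ?zo < r ==> snd z < 0 & transpose (H z) = H z & \<bar>phit z - phit ?zo\<bar> < d' & norm (g z - g ?zo) < d' & norm (H z - H ?zo) < d'"
   by (rule test_function_near[OF tf t0 d'(1), of x0]) (rule that)
  \<comment> \<open>Guarantees the hypothesis of \<open>balance_step\<close> relating
    \<open>c\<close> to Hessian and gradient in the whole neighbourhood.\<close>
  define C where "C = (norm (H ?zo) + d') * ?N / (norm (g ?zo) / 2) + 1"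
  have g0: "norm (g ?zo) > 0" using v by simp
  have C: "C > 0" unfolding C_def using d'(1) g0 by (intro add_nonneg_pos divide_nonneg_pos mult_nonneg_nonneg) auto
  have "EX s:sign_vectors. increment g H phit c (y, t) (A *v s) <= - 2 * e"
   if A: "A \<in> (unit_column_matrices :: (real^'n^'m) set)" and c: "C <= c" and yt: "dist (y, t) ?zo < r" for c y t A
  proof -
   let ?z = "(y, t)"
   have z: "transpose (H ?z) = H ?z" "\<bar>phit ?z - phit ?zo\<bar> < d'" "norm (g ?z - g ?zo) < d'" "norm (H ?z - H ?zo) < d'" using r(2)[OF yt] by auto
   have cm: "\<bar>curv_max {..?k} (H ?z) (g ?z) - curv_max {..?k} (H ?zo) (g ?zo)\<bar> <= 2 * e" "g ?z ~= 0"
    using d(2)[OF z(1), of "g ?z"] z d' by auto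
   have nH: "norm (H ?z) <= norm (H ?zo) + d'" using z(4) norm_triangle_ineq2[of "H ?z" "H ?zo"] by linarith
   have ng: "norm (g ?zo) / 2 <= norm (g ?z)" using z(3) d'(4) norm_triangle_ineq2[of "g ?zo" "g ?z"] by (simp add: norm_minus_commute)
   have "norm (H ?z) * ?N <= (norm (H ?zo) + d') * ?N" using nH by (rule mult_right_mono) simp
   also have "... <= c * (norm (g ?zo) / 2)"
   proof -
    have "(norm (H ?zo) + d') * ?N / (norm (g ?zo) / 2) <= c" using c unfolding C_def by linarith
    then show ?thesis using g0 by (subst (asm) pos_divide_le_eq) auto
   qed
   also have "... <= c * norm (g ?z)" using ng c C by (intro mult_left_mono) auto
   finally have "norm (H ?z) * ?N <= c * norm (g ?z)" .
   from balance_step[OF m z(1) cm(2) A this] obtain s where s: "s \<in> sign_vectors"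
    "c * (g ?z \<bullet> (A *v s)) + ((H ?z *v (A *v s)) \<bullet> (A *v s)) / 2 <= curv_max {..?k} (H ?z) (g ?z) / 2" by blast
   have "curv_max {..?k} (H ?z) (g ?z) + phit ?z <= - 4 * e"
   proof -
    have "phit ?zo + curv_max {..?k} (H ?zo) (g ?zo) = - 8 * e" unfolding e_def by simp
    then show ?thesis using cm(1) z(2) d'(3) by linarith
   qed
   then show ?thesis using s unfolding increment_def by (intro bexI[of _ s]) auto
  qed
  with r(1) C e show ?thesis by blast
 next
  assume "EX l>=0. (ALL h. (H ?zo *v h) \<bullet> h <= l * (h \<bullet> h)) & phit ?zo + ?N^2 * l < 0"
  then obtain l where l: "l >= 0" "!!h. (H ?zo *v h) \<bullet> h <= l * (h \<bullet> h)" "phit ?zo + ?N^2 * l < 0" by blast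
  define e where "e = - (phit ?zo + ?N^2 * l) / 8"
  have e: "e > 0" unfolding e_def using l by simp
  define d where "d = 4 * e / (?N^2 + 1)"
  have N1: "?N^2 + 1 > 0" by (simp add: add_nonneg_pos)
  have d: "d > 0" "d * (?N^2 + 1) = 4 * e" unfolding d_def using e N1 by auto
  obtain r where r: "r > 0" "!!z. dist z ?zo < r ==> snd z < 0 & transpose (H z) = H z & \<bar>phit z - phit ?zo\<bar> < d & norm (g z - g ?zo) < d & norm (H z - H ?zo) < d"
   by (rule test_function_near[OF tf t0 d(1), of x0]) (rule that)
  have "EX s:sign_vectors. increment g H phit c (y, t) (A *v s) <= - 2 * e"
   if A: "A \<in> (unit_column_matrices :: (real^'n^'m) set)" and c: "1 <= c" and yt: "dist (y, t) ?zo < r" for c y t A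
  proof -
   let ?z = "(y, t)"
   have z: "\<bar>phit ?z - phit ?zo\<bar> < d" "norm (H ?z - H ?zo) < d" using r(2)[OF yt] by auto
   obtain s0 :: "real^'n" where s0: "s0 \<in> sign_vectors" using sign_vectors_finite(2) by blast
   obtain s where s: "s \<in> sign_vectors" "g ?z \<bullet> (A *v s) <= 0"
   proof (cases "g ?z \<bullet> (A *v s0) <= 0")
    case False
    have "A *v (- s0) = - (A *v s0)" using matrix_vector_mult_scaleR[of A "-1" s0] by simp
    then show ?thesis using that[of "- s0"] s0 sign_vectors_uminus False by auto
   qed (use s0 that in auto)
   let ?h = "A *v s"
   have h2: "(norm ?h)^2 <= ?N^2" by (rule power_mono[OF unit_step_norm[OF A s(1)]]) simp
   have "(H ?z *v ?h) \<bullet> ?h = (H ?zo *v ?h) \<bullet> ?h + ((H ?z - H ?zo) *v ?h) \<bullet> ?h" by (simp add: matrix_vector_mult_diff_rdistrib inner_diff_left)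
   also have "... <= l * (norm ?h)^2 + norm (H ?z - H ?zo) * (norm ?h)^2"
    using l(2)[of ?h] quadratic_form_le[of "H ?z - H ?zo" ?h] by (intro add_mono) (auto simp: dot_square_norm abs_le_iff)
   also have "... <= l * ?N^2 + d * ?N^2" using h2 l(1) z(2) d(1) by (intro add_mono mult_mono) auto
   finally have 1: "(H ?z *v ?h) \<bullet> ?h <= l * ?N^2 + d * ?N^2" .
   have 2: "c * (g ?z \<bullet> ?h) <= 0" using s(2) c by (intro mult_nonneg_nonpos) auto
   have "phit ?zo + ?N^2 * l = - 8 * e" unfolding e_def by simp
   then have "increment g H phit c ?z ?h <= - 2 * e"
    using 1 2 z(1) d(2) unfolding increment_def abs_less_iff by (simp add: algebra_simps)
   with s(1) show ?thesis by blast
  qed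
  with r(1) e show ?thesis by (intro exI[of _ r] exI[of _ 1] exI[of _ e]) auto
 qed
 then obtain r1 C1 e where 1: "r1 > 0" "C1 > 0" "e > 0" "!!c y t A. A \<in> (unit_column_matrices :: (real^'n^'m) set) ==> C1 <= c ==> dist (y, t) ?zo < r1 ==>
  EX s:sign_vectors. increment g H phit c (y, t) (A *v s) <= - 2 * e" by blast
 obtain r2 C2 where 2: "r2 > 0" "C2 > 0" "!!c y t h. C2 <= c ==> dist (y, t) ?zo < r2 ==> norm h <= ?N ==>
  increment g H phit c (y, t) h <= - 2 * e ==> phi (y + h /\<^sub>R c, t + 1 / (2 * c^2)) <= phi (y, t) - e / c^2"
  by (rule taylor_step[OF tf t0 1(3), of ?N x0]) (auto intro: that)
 show ?thesis
 proof (rule that[of "min r1 r2" "max C1 C2" e])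
  fix c y t and A :: "real^'n^'m" assume c: "max C1 C2 <= c" and yt: "dist (y, t) ?zo < min r1 r2" and A: "A \<in> unit_column_matrices"
  obtain s where s: "s \<in> sign_vectors" "increment g H phit c (y, t) (A *v s) <= - 2 * e"
   using 1(4)[OF A, of c y t] c yt by auto
  then show "EX s:sign_vectors. phi (y + (A *v s) /\<^sub>R c, t + 1 / (2 * c^2)) <= phi (y, t) - e / c^2"
   using 2(3)[of c y t "A *v s"] c yt unit_step_norm[OF A s(1)] by auto
 qed (use 1 2 in auto)
qed

text \<open>Fewer than \<open>n\<close> vectors are completed by zero columns, which is how the
  maximising player reaches sums of fewer than \<open>k\<close> eigenvalues.\<close>

lemma frame_matrix:
 fixes U :: "(real^'m) set"
 assumes U: "orthonormal U" "card U <= CARD('n)"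
 obtains A :: "real^'n^'m" and f where "A \<in> unit_column_matrices" "inj_on f U" "!!s. A *v s = (\<Sum>u\<in>U. s $ (f u) *\<^sub>R u)"
proof -
 have "finite U" using U unfolding orthonormal_def by auto
 then obtain f :: "real^'m => 'n" where f: "inj_on f U" using card_le_inj[of U "UNIV :: 'n set"] U by auto
 define a where "a j = (if j \<in> f ` U then inv_into U f j else 0)" for j
 define A :: "real^'n^'m" where "A = (\<chi> i j. a j $ i)"
 have col: "column j A = a j" for j unfolding A_def column_def by (simp add: vec_eq_iff)
 have "norm (a j) <= 1" for j
  using U(1) inv_into_into[of j f U] unfolding a_def orthonormal_def by auto
 then have 1: "A \<in> unit_column_matrices" unfolding unit_column_matrices_def by (simp add: col)
 have "A *v s = (\<Sum>u\<in>U. s $ (f u) *\<^sub>R u)" for s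
 proof -
  have "A *v s = (\<Sum>j\<in>f ` U. s $ j *\<^sub>R a j)"
   unfolding matrix_vector_mult_columns[of A] col by (rule sum.mono_neutral_right) (auto simp: a_def)
  also have "... = (\<Sum>u\<in>U. s $ (f u) *\<^sub>R a (f u))" by (rule sum.reindex_cong[OF f]) auto
  also have "... = (\<Sum>u\<in>U. s $ (f u) *\<^sub>R u)" using f by (intro sum.cong) (auto simp: a_def inv_into_f_f)
  finally show ?thesis .
 qed
 with 1 f that show ?thesis by blast
qed

text \<open>Here \<open>phi\<close> touches the negative of the value, so the player who maximises
  the value wants \<open>phi\<close> small. The columns form a frame orthogonal to the gradient in
  which the Hessian is diagonal, so the increment depends neither on the signs nor on
  \<open>c\<close>. In the second case \<open>phit\<close> is negative and the zero matrix
  serves.\<close>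

lemma lower_consistency:
 fixes x0 :: "real^'m"
 assumes tf: "test_function phi phit g H" and t0: "t0 < 0"
  and viol: "violated (%M p. - curv_max {..min CARD('n) (CARD('m) - 1)} (- M) p) ((real CARD('n))^2) (phit (x0, t0)) (H (x0, t0)) (g (x0, t0))"
 obtains r C e where "r > 0" "C > 0" "e > 0" "!!c y t. C <= c ==> dist (y, t) (x0, t0) < r ==> EX A:(unit_column_matrices :: (real^'n^'m) set).
  ALL s:sign_vectors. phi (y + (A *v s) /\<^sub>R c, t + 1 / (2 * c^2)) <= phi (y, t) - e / c^2"
proof -
 let ?zo = "(x0, t0)" and ?N = "real CARD('n)" and ?k = "min CARD('n) (CARD('m) - 1)"
 have J: "index_set TYPE('m) {..?k}" unfolding index_set_def by auto
 have main: "EX r e. r > 0 & e > 0 & (ALL y t. dist (y, t) ?zo < r --> (EX A:(unit_column_matrices :: (real^'n^'m) set).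
  ALL s:sign_vectors. ALL c. increment g H phit c (y, t) (A *v s) <= - 2 * e))"
  using viol unfolding violated_def
 proof
  assume v: "g ?zo ~= 0 & phit ?zo + - curv_max {..?k} (- H ?zo) (g ?zo) < 0"
  define e where "e = - (phit ?zo + - curv_max {..?k} (- H ?zo) (g ?zo)) / 8"
  have e: "e > 0" unfolding e_def using v by simp
  have tneg: "transpose (- B) = - B" if "transpose B = B" for B :: "real^'m^'m"
   using that by (simp add: transpose_def vec_eq_iff)
  have s0: "transpose (- H ?zo) = - H ?zo" by (intro tneg test_function_symmetric[OF tf t0])
  obtain d where d: "d > 0" "!!M' p'. transpose M' = M' ==> norm (M' - (- H ?zo)) < d ==> norm (p' - g ?zo) < d ==>
   \<bar>curv_max {..?k} M' p' - curv_max {..?k} (- H ?zo) (g ?zo)\<bar> <= 2 * e & p' ~= 0"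
   by (rule curv_max_continuous[OF J s0, of "g ?zo" "2 * e"]) (use v e in "auto intro: that")
  define d' where "d' = min d (2 * e)"
  have d': "d' > 0" "d' <= d" "d' <= 2 * e" unfolding d'_def using d e by auto
  obtain r where r: "r > 0" "!!z. dist z ?zo < r ==> snd z < 0 & transpose (H z) = H z & \<bar>phit z - phit ?zo\<bar> < d' & norm (g z - g ?zo) < d' & norm (H z - H ?zo) < d'"
   by (rule test_function_near[OF tf t0 d'(1), of x0]) (rule that)
  have "EX A:(unit_column_matrices :: (real^'n^'m) set). ALL s:sign_vectors. ALL c.
   increment g H phit c (y, t) (A *v s) <= - 2 * e"
   if yt: "dist (y, t) ?zo < r" for y t
  proof -
   let ?z = "(y, t)"
   have z: "transpose (H ?z) = H ?z" "\<bar>phit ?z - phit ?zo\<bar> < d'" "norm (g ?z - g ?zo) < d'" "norm (H ?z - H ?zo) < d'" using r(2)[OF yt] by auto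
   have n': "norm (- H ?z - (- H ?zo)) < d" using z(4) d' by (simp add: norm_minus_commute)
   have cm: "\<bar>curv_max {..?k} (- H ?z) (g ?z) - curv_max {..?k} (- H ?zo) (g ?zo)\<bar> <= 2 * e" "g ?z ~= 0"
    using d(2)[OF tneg[OF z(1)] n', of "g ?z"] z(3) d' by auto
   obtain U where U: "orthonormal U" "card U \<in> {..?k}" "!!u. u \<in> U ==> u \<bullet> g ?z = 0"
    "(\<Sum>u\<in>U. (- H ?z *v u) \<bullet> u) = curv_max {..?k} (- H ?z) (g ?z)" "!!u w. u \<in> U ==> w \<in> U ==> u ~= w ==> (- H ?z *v u) \<bullet> w = 0"
    by (rule curv_max_frame[OF J tneg[OF z(1)] cm(2)]) (rule that)
   have cU: "card U <= CARD('n)" using U(2) by simp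
   obtain A :: "real^'n^'m" and f where A: "A \<in> unit_column_matrices" "inj_on f U" "!!s. A *v s = (\<Sum>u\<in>U. s $ (f u) *\<^sub>R u)"
    by (rule frame_matrix[OF U(1) cU]) (rule that)
   have neg: "(- H ?z) *v v = - (H ?z *v v)" for v
    by (simp add: matrix_vector_mult_def vec_eq_iff sum_negf)
   have finU: "finite U" using U(1) unfolding orthonormal_def by simp
   have bound: "increment g H phit c ?z (A *v s) <= - 2 * e" if s: "s \<in> sign_vectors" for s c
   proof -
    have "g ?z \<bullet> (A *v s) = 0" unfolding A(3) using U(3) by (simp add: inner_sum_right inner_commute)
    moreover have "(H ?z *v (A *v s)) \<bullet> (A *v s) = - curv_max {..?k} (- H ?z) (g ?z)"
    proof -
     have s2: "s $ j * s $ j = 1" for j using s unfolding sign_vectors_def by (auto dest: spec[of _ j])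
     have off: "(H ?z *v u) \<bullet> w = (if u = w then (H ?z *v u) \<bullet> u else 0)" if "u \<in> U" "w \<in> U" for u w using U(5)[OF that] unfolding neg by auto
     have "H ?z *v (A *v s) = (\<Sum>u\<in>U. s $ (f u) *\<^sub>R (H ?z *v u))"
      unfolding A(3) using linear_sum[OF matrix_vector_mul_linear[of "H ?z"], of "%u. s $ (f u) *\<^sub>R u" U] by (simp add: matrix_vector_mult_scaleR)
     then have "(H ?z *v (A *v s)) \<bullet> (A *v s) = (\<Sum>u\<in>U. \<Sum>w\<in>U. s $ (f u) * (s $ (f w) * ((H ?z *v u) \<bullet> w)))"
      unfolding A(3) by (simp only: inner_sum_left inner_sum_right sum_distrib_left inner_scaleR_left inner_scaleR_right)
       (subst sum.swap, simp only: mult.left_commute)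
     also have "... = (\<Sum>u\<in>U. \<Sum>w\<in>U. if u = w then (H ?z *v u) \<bullet> u else 0)"
     proof (intro sum.cong refl)
      fix u w assume "u \<in> U" "w \<in> U"
      then show "s $ (f u) * (s $ (f w) * ((H ?z *v u) \<bullet> w)) = (if u = w then (H ?z *v u) \<bullet> u else 0)"
       using off[of u w] s2[of "f u"] by (cases "u = w") (auto simp: mult.assoc[symmetric])
     qed
     also have "... = (\<Sum>u\<in>U. (H ?z *v u) \<bullet> u)" using finU by simp
     also have "... = - curv_max {..?k} (- H ?z) (g ?z)" unfolding U(4)[symmetric] neg by (simp add: sum_negf)
     finally show ?thesis .
    qed
    ultimately show ?thesis using cm(1) z(2) d'(3) unfolding abs_le_iff abs_less_iff e_def increment_def by (simp add: field_simps)
   qed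
   then show ?thesis using A(1) by blast
  qed
  with r(1) e show ?thesis by blast
 next
  assume "EX l>=0. (ALL h. (H ?zo *v h) \<bullet> h <= l * (h \<bullet> h)) & phit ?zo + ?N^2 * l < 0"
  then obtain l where l: "l >= 0" "phit ?zo + ?N^2 * l < 0" by blast
  have "0 <= ?N^2 * l" using l(1) by simp
  then have neg: "phit ?zo < 0" using l(2) by linarith
  define e where "e = - phit ?zo / 8"
  have e: "e > 0" unfolding e_def using neg by simp
  obtain r where r: "r > 0" "!!z. dist z ?zo < r ==> snd z < 0 & transpose (H z) = H z & \<bar>phit z - phit ?zo\<bar> < e & norm (g z - g ?zo) < e & norm (H z - H ?zo) < e"
   by (rule test_function_near[OF tf t0 e, of x0]) (rule that)
  have "ALL s:sign_vectors. ALL c. increment g H phit c (y, t) ((0::real^'n^'m) *v s) <= - 2 * e"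
   if "dist (y, t) ?zo < r" for y t
   using r(2)[OF that] unfolding e_def increment_def by (auto simp: abs_less_iff)
  then show ?thesis using r(1) e zero_in_unit_column_matrices by blast
 qed
 then obtain r1 e where 1: "r1 > 0" "e > 0" "!!y t. dist (y, t) ?zo < r1 ==> EX A:(unit_column_matrices :: (real^'n^'m) set).
  ALL s:sign_vectors. ALL c. increment g H phit c (y, t) (A *v s) <= - 2 * e" by blast
 obtain r2 C2 where 2: "r2 > 0" "C2 > 0" "!!c y t h. C2 <= c ==> dist (y, t) ?zo < r2 ==> norm h <= ?N ==>
  increment g H phit c (y, t) h <= - 2 * e ==> phi (y + h /\<^sub>R c, t + 1 / (2 * c^2)) <= phi (y, t) - e / c^2"
  by (rule taylor_step[OF tf t0 1(2), of ?N x0]) (auto intro: that)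
 show ?thesis
 proof (rule that[of "min r1 r2" C2 e])
  fix c y t assume c: "C2 <= c" and yt: "dist (y, t) ?zo < min r1 r2"
  obtain A where A: "A \<in> (unit_column_matrices :: (real^'n^'m) set)"
   "!!s. s \<in> sign_vectors ==> increment g H phit c (y, t) (A *v s) <= - 2 * e"
   using 1(3)[of y t] yt by auto
  then show "EX A:(unit_column_matrices :: (real^'n^'m) set). ALL s:sign_vectors. phi (y + (A *v s) /\<^sub>R c, t + 1 / (2 * c^2)) <= phi (y, t) - e / c^2"
   using 2(3)[OF c] yt unit_step_norm[OF A(1)] by (intro bexI[OF _ A(1)]) auto
 qed (use 1 2 in auto)
qed

section \<open>Relaxed limits of the rescaled game\<close>

lemma locally_bounded_between:
 fixes psi1 psi2 :: "(real^'m) \<times> real => real"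
 assumes "continuous_on UNIV psi1" "continuous_on UNIV psi2"
  and le: "!!c n y. 0 < c ==> psi1 (y, grid_time c n) <= W c n y & W c n y <= psi2 (y, grid_time c n)"
 shows "locally_bounded W"
 unfolding locally_bounded_def
proof
 fix z :: "(real^'m) \<times> real"
 have "bounded ((%w. (psi1 w, psi2 w)) ` cball z 1)"
  using assms(1,2) by (intro compact_imp_bounded compact_continuous_image continuous_on_Pair) (auto intro: continuous_on_subset)
 then obtain B where B: "!!w. w \<in> cball z 1 ==> norm (psi1 w, psi2 w) <= B" unfolding bounded_iff by blast
 have "\<bar>W c n y\<bar> <= B" if p: "(c, n, y) \<in> near_set 1 z" for c n y
 proof -
  have "norm (psi1 (y, grid_time c n), psi2 (y, grid_time c n)) <= B" using p B[of "(y, grid_time c n)"] unfolding near_set_def by (auto simp: dist_commute)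
  then have "\<bar>psi1 (y, grid_time c n)\<bar> <= B" "\<bar>psi2 (y, grid_time c n)\<bar> <= B"
   using norm_fst_le[of "psi1 (y, grid_time c n)" "psi2 (y, grid_time c n)"] norm_snd_le[of "psi2 (y, grid_time c n)" "psi1 (y, grid_time c n)"] by auto
  then show ?thesis using le[of c y n] p unfolding near_set_def by auto
 qed
 then show "EX rho>0. EX B. ALL (c, n, y):near_set rho z. \<bar>W c n y\<bar> <= B" by (intro exI[of _ 1]) auto
qed

definition scaled_game :: "'n::finite itself => (real^'m) set => real => nat => real^'m => real" where
 "scaled_game N E c n y = game_value_from N E n (c *\<^sub>R y) / c"

lemma grid_time_Suc: "grid_time c n = grid_time c (Suc n) + 1 / (2 * c^2)"
 unfolding grid_time_def by (simp add: add_divide_distrib)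

context
 fixes E :: "(real^'m) set" and b L :: real
 assumes h: "norm_like b L (body_norm E)" and m: "CARD('m) >= 2"
begin

private lemma step_eq: "0 < c ==> c *\<^sub>R y + v = c *\<^sub>R (y + v /\<^sub>R c)" for y v :: "real^'m"
 by (simp add: scaleR_add_right)

lemma scaled_game_ge: "0 < c ==> body_norm E y <= scaled_game TYPE('n::finite) E c n y"
 unfolding scaled_game_def using game_value_ge_norm[OF h, where 'n='n, of "c *\<^sub>R y" n] h
 by (simp add: pos_le_divide_eq norm_like_def mult.commute)

lemma scaled_game_le:
 assumes c: "0 < c"
 shows "scaled_game TYPE('n::finite) E c n y <= body_norm E y + L * real CARD('n) * sqrt (2 * (- grid_time c n))"
proof -
 have "game_value_from TYPE('n) E n (c *\<^sub>R y) <= c * body_norm E y + L * real CARD('n) * sqrt (real n)"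
  using game_value_upper[OF h, where 'n='n, of n "c *\<^sub>R y" "c *\<^sub>R y"] h c
  by (simp add: real_sqrt_mult norm_like_def mult_ac)
 then have "scaled_game TYPE('n) E c n y <= (c * body_norm E y + L * real CARD('n) * sqrt (real n)) / c"
  unfolding scaled_game_def using c by (intro divide_right_mono) auto
 also have "... = body_norm E y + L * real CARD('n) * (sqrt (real n) / c)" using c by (simp add: add_divide_distrib)
 also have "sqrt (real n) / c = sqrt (2 * (- grid_time c n))"
  unfolding grid_time_def using c by (simp add: real_sqrt_divide)
 finally show ?thesis .
qed

private lemma bn_cont: "continuous_on UNIV (%z::(real^'m)\<times>real. body_norm E (fst z))"
proof -
 have L: "L > 0" using h unfolding norm_like_def by auto
 have "\<bar>body_norm E x - body_norm E y\<bar> <= L * norm (x - y)" for x y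
  using norm_like_lipschitz[OF h, of x y] norm_like_lipschitz[OF h, of y x] by (simp add: norm_minus_commute abs_le_iff)
 then have "L-lipschitz_on UNIV (body_norm E)" using L by (auto simp: lipschitz_on_def dist_real_def dist_norm)
 then have "continuous_on UNIV (body_norm E)" by (rule lipschitz_on_continuous_on)
 then show ?thesis by (rule continuous_on_compose2) (auto intro: continuous_intros)
qed

private lemma upp_cont: "continuous_on UNIV (%z::(real^'m)\<times>real. body_norm E (fst z) + L * K * sqrt (2 * (- snd z)))"
 by (intro continuous_intros bn_cont)

lemma scaled_game_bounded:
 "locally_bounded (scaled_game TYPE('n::finite) E)" "locally_bounded (%c n y. - scaled_game TYPE('n::finite) E c n y)"
proof -
 show "locally_bounded (scaled_game TYPE('n) E)"
  by (rule locally_bounded_between[OF bn_cont upp_cont[of "real CARD('n)"]]) (use scaled_game_ge scaled_game_le in auto)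
 then show "locally_bounded (%c n y. - scaled_game TYPE('n) E c n y)" unfolding locally_bounded_def by simp
qed

private lemma isCont_any: "continuous_on UNIV f ==> isCont f z" for f :: "(real^'m) \<times> real => real"
 using continuous_on_eq_continuous_at[OF open_UNIV, of f] by blast

lemma game_limit_bounds:
 assumes "t <= 0"
 shows "body_norm E x <= upper_limit (scaled_game TYPE('n::finite) E) (x, t)"
  "upper_limit (scaled_game TYPE('n) E) (x, t) <= body_norm E x + L * real CARD('n) * sqrt (2 * (- t))"
  "upper_limit (%c n y. - scaled_game TYPE('n) E c n y) (x, t) <= - body_norm E x"
  "- (body_norm E x + L * real CARD('n) * sqrt (2 * (- t))) <= upper_limit (%c n y. - scaled_game TYPE('n) E c n y) (x, t)"
proof -
 have t: "snd (x, t) <= 0" using assms by simp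
 note b1 = scaled_game_bounded(1)[where 'n='n] and b2 = scaled_game_bounded(2)[where 'n='n]
 show "body_norm E x <= upper_limit (scaled_game TYPE('n) E) (x, t)"
  using upper_limit_ge[OF b1 t isCont_any[OF bn_cont]] scaled_game_ge[where 'n='n] by simp
 show "upper_limit (scaled_game TYPE('n) E) (x, t) <= body_norm E x + L * real CARD('n) * sqrt (2 * (- t))"
  using upper_limit_le[OF b1 t isCont_any[OF upp_cont[of "real CARD('n)"]]] scaled_game_le[where 'n='n] by simp
 show "upper_limit (%c n y. - scaled_game TYPE('n) E c n y) (x, t) <= - body_norm E x"
  using upper_limit_le[OF b2 t isCont_minus[OF isCont_any[OF bn_cont]]] scaled_game_ge[where 'n='n] by simp
 show "- (body_norm E x + L * real CARD('n) * sqrt (2 * (- t))) <= upper_limit (%c n y. - scaled_game TYPE('n) E c n y) (x, t)"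
 proof -
  have "- (body_norm E y + L * real CARD('n) * sqrt (2 * (- grid_time c n))) <= - scaled_game TYPE('n) E c n y" if "0 < c" for c n y
   using scaled_game_le[where 'n='n, OF that, of n y] by (simp only: neg_le_iff_le)
  then show ?thesis
   using upper_limit_ge[OF b2 t isCont_minus[OF isCont_any[OF upp_cont[of "real CARD('n)"]]]] by simp
 qed
qed

theorem game_upper_limit_weak_sub:
 "weak_sub (curv_max {..min CARD('n) (CARD('m) - 1)}) ((real CARD('n))^2) (upper_limit (scaled_game TYPE('n::finite) E))"
proof (rule weak_subI)
 show "usc_on (UNIV \<times> {..0}) (upper_limit (scaled_game TYPE('n) E))"
  by (rule upper_limit_usc[OF scaled_game_bounded(1)])
next
 let ?W = "scaled_game TYPE('n) E"
 fix phi phit g H x t and r :: real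
 assume tf: "test_function phi phit g H" and t: "t < 0" and r: "r > 0"
  and max: "!!z. dist z (x, t) < r ==> upper_limit ?W z - phi z <= upper_limit ?W (x, t) - phi (x, t) - strict_bump (x, t) z"
 show "~ violated (curv_max {..min CARD('n) (CARD('m) - 1)}) ((real CARD('n))^2) (phit (x, t)) (H (x, t)) (g (x, t))"
 proof
 assume viol: "violated (curv_max {..min CARD('n) (CARD('m) - 1)}) ((real CARD('n))^2) (phit (x, t)) (H (x, t)) (g (x, t))"
 obtain r1 C e where c: "r1 > 0" "C > 0" "e > 0" "!!c y t' A. C <= c ==> dist (y, t') (x, t) < r1 ==> A \<in> (unit_column_matrices :: (real^'n^'m) set) ==>
  EX s:sign_vectors. phi (y + (A *v s) /\<^sub>R c, t' + 1 / (2 * c^2)) <= phi (y, t') - e / c^2"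
  by (rule upper_consistency[OF m tf t viol]) (rule that)
 show False
 proof (rule upper_limit_touching[OF scaled_game_bounded(1)[where 'n='n] tf t r max c(1,3)])
  fix c' n y assume C: "C <= c'" and d: "dist (y, grid_time c' (Suc n)) (x, t) < r1"
  have c0: "c' > 0" using C c(2) by simp
  \<comment> \<open>Precision \<open>1 / c'^2\<close> in the unscaled game becomes the
    \<open>1 / c'^3\<close> allowed by \<open>upper_limit_touching\<close>.\<close>
  then have "1 / c'^2 > 0" by simp
  from game_value_min_step[OF h this, where 'n='n] obtain A where A: "A \<in> (unit_column_matrices :: (real^'n^'m) set)"
   "!!s. s \<in> sign_vectors ==> game_value_from TYPE('n) E (Suc n) (c' *\<^sub>R y) <= game_value_from TYPE('n) E n (c' *\<^sub>R y + A *v s) + 1 / c'^2" by blast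
  obtain s where s: "s \<in> sign_vectors" "phi (y + (A *v s) /\<^sub>R c', grid_time c' n) <= phi (y, grid_time c' (Suc n)) - e / c'^2"
   using c(4)[OF C d A(1)] unfolding grid_time_Suc[of c' n] by blast
  have "game_value_from TYPE('n) E (Suc n) (c' *\<^sub>R y) / c' <= (game_value_from TYPE('n) E n (c' *\<^sub>R (y + (A *v s) /\<^sub>R c')) + 1 / c'^2) / c'"
   using A(2)[OF s(1)] c0 unfolding step_eq[OF c0] by (intro divide_right_mono) auto
  then have "?W c' (Suc n) y <= ?W c' n (y + (A *v s) /\<^sub>R c') + 1 / c' ^ 3"
   unfolding scaled_game_def by (simp add: add_divide_distrib power3_eq_cube power2_eq_square)
  then show "EX h. norm h <= real CARD('n) & ?W c' (Suc n) y <= ?W c' n (y + h /\<^sub>R c') + 1 / c' ^ 3 &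
    phi (y + h /\<^sub>R c', grid_time c' n) <= phi (y, grid_time c' (Suc n)) - e / c'^2"
   using s unit_step_norm[OF A(1) s(1)] by blast
 qed
 qed
qed

theorem game_lower_limit_weak_sub:
 "weak_sub (%M p. - curv_max {..min CARD('n) (CARD('m) - 1)} (- M) p) ((real CARD('n))^2) (upper_limit (%c n y. - scaled_game TYPE('n::finite) E c n y))"
proof (rule weak_subI)
 show "usc_on (UNIV \<times> {..0}) (upper_limit (%c n y. - scaled_game TYPE('n) E c n y))"
  by (rule upper_limit_usc[OF scaled_game_bounded(2)])
next
 let ?W = "%c n y. - scaled_game TYPE('n) E c n y"
 fix phi phit g H x t and r :: real
 assume tf: "test_function phi phit g H" and t: "t < 0" and r: "r > 0"
  and max: "!!z. dist z (x, t) < r ==> upper_limit ?W z - phi z <= upper_limit ?W (x, t) - phi (x, t) - strict_bump (x, t) z"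
 show "~ violated (%M p. - curv_max {..min CARD('n) (CARD('m) - 1)} (- M) p) ((real CARD('n))^2) (phit (x, t)) (H (x, t)) (g (x, t))"
 proof
 assume viol: "violated (%M p. - curv_max {..min CARD('n) (CARD('m) - 1)} (- M) p) ((real CARD('n))^2) (phit (x, t)) (H (x, t)) (g (x, t))"
 obtain r1 C e where c: "r1 > 0" "C > 0" "e > 0" "!!c y t'. C <= c ==> dist (y, t') (x, t) < r1 ==> EX A:(unit_column_matrices :: (real^'n^'m) set).
  ALL s:sign_vectors. phi (y + (A *v s) /\<^sub>R c, t' + 1 / (2 * c^2)) <= phi (y, t') - e / c^2"
  by (rule lower_consistency[OF tf t viol]) (rule that)
 show False
 proof (rule upper_limit_touching[OF scaled_game_bounded(2)[where 'n='n] tf t r max c(1,3)])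
  fix c' n y assume C: "C <= c'" and d: "dist (y, grid_time c' (Suc n)) (x, t) < r1"
  have c0: "c' > 0" using C c(2) by simp
  obtain A where A: "A \<in> (unit_column_matrices :: (real^'n^'m) set)"
   "!!s. s \<in> sign_vectors ==> phi (y + (A *v s) /\<^sub>R c', grid_time c' n) <= phi (y, grid_time c' (Suc n)) - e / c'^2"
   using c(4)[OF C d] unfolding grid_time_Suc[of c' n] by blast
  obtain s where s: "s \<in> sign_vectors" "game_value_from TYPE('n) E n (c' *\<^sub>R y + A *v s) <= game_value_from TYPE('n) E (Suc n) (c' *\<^sub>R y)"
   using game_value_max_step[OF h A(1)] by blast
  have S1: "scaled_game TYPE('n) E c' n (y + (A *v s) /\<^sub>R c') <= scaled_game TYPE('n) E c' (Suc n) y"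
   unfolding scaled_game_def using s(2) c0 unfolding step_eq[OF c0] by (intro divide_right_mono) auto
  have "0 <= 1 / c' ^ 3" using c0 by simp
  with S1 have "?W c' (Suc n) y <= ?W c' n (y + (A *v s) /\<^sub>R c') + 1 / c' ^ 3" by linarith
  then show "EX h. norm h <= real CARD('n) & ?W c' (Suc n) y <= ?W c' n (y + h /\<^sub>R c') + 1 / c' ^ 3 &
    phi (y + h /\<^sub>R c', grid_time c' n) <= phi (y, grid_time c' (Suc n)) - e / c'^2"
   using s A(2)[OF s(1)] unit_step_norm[OF A(1) s(1)] by blast
 qed
 qed
qed

end

subsection \<open>Barriers and sup-convolutions\<close>

lemma usc_attains_max:
 fixes f :: "'a::metric_space => real"
 assumes K: "compact K" "K ~= {}" and usc: "usc_on S f" "K <= S"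
 shows "EX x:K. ALL y:K. f y <= f x"
proof (rule ccontr)
 assume "~ ?thesis"
 then have "ALL x:K. EX y:K. f x < f y" by (meson not_le)
 then obtain Y where Y: "!!x. x \<in> K ==> Y x \<in> K" "!!x. x \<in> K ==> f x < f (Y x)" by metis
 have "EX d>0. ALL y:K. dist y x < d --> f y < f (Y x)" if x: "x \<in> K" for x
 proof -
  have "\<forall>\<^sub>F y in at x within S. f y < f (Y x)" using usc x Y(2)[OF x] unfolding usc_on_def by blast
  then obtain d where d: "d > 0" "!!y. y \<in> S ==> y ~= x ==> dist y x < d ==> f y < f (Y x)" unfolding eventually_at by auto
  have "f y < f (Y x)" if "y \<in> K" "dist y x < d" for y
   using d(2)[of y] that usc(2) Y(2)[OF x] by (cases "y = x") auto
  with d(1) show ?thesis by blast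
 qed
 then obtain d where d: "!!x. x \<in> K ==> d x > 0" "!!x y. x \<in> K ==> y \<in> K ==> dist y x < d x ==> f y < f (Y x)" by metis
 have "K <= (\<Union>x\<in>K. ball x (d x))"
 proof
  fix x assume "x \<in> K"
  then show "x \<in> (\<Union>x\<in>K. ball x (d x))" using d(1) by (intro UN_I[of x]) auto
 qed
 then obtain D where D: "D <= K" "finite D" "K <= (\<Union>x\<in>D. ball x (d x))"
  by (rule compactE_image[OF K(1), rotated]) auto
 then have "D ~= {}" using K(2) by auto
 let ?m = "Max ((%x. f (Y x)) ` D)"
 have "?m \<in> (%x. f (Y x)) ` D" using D \<open>D ~= {}\<close> by (intro Max_in) auto
 then obtain x where x: "x \<in> D" "f (Y x) = ?m" by auto
 have "Y x \<in> K" using x D Y by auto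
 then obtain x' where x': "x' \<in> D" "dist (Y x) x' < d x'" using D(3) by (auto simp: dist_commute)
 then have "f (Y x) < f (Y x')" using d(2) \<open>Y x \<in> K\<close> D by auto
 moreover have "f (Y x') <= ?m" using D x' by (intro Max_ge) auto
 ultimately show False using x by simp
qed

lemma usc_on_subset: "usc_on S f ==> T <= S ==> usc_on T f"
 unfolding usc_on_def by (blast intro: filter_leD[OF at_le])

lemma usc_on_diff_continuous:
 fixes f :: "'a::metric_space => real"
 assumes "usc_on S f" "continuous_on S g" "0 < a"
 shows "usc_on S (%x. a * f x - g x)"
 unfolding usc_on_def
proof (intro ballI allI impI)
 fix x c assume x: "x \<in> S" and c: "a * f x - g x < c"
 define e where "e = (c - (a * f x - g x)) / 2"
 have e: "e > 0" unfolding e_def using c by simp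
 have "f x < f x + e / a" using e assms(3) by simp
 then have 1: "\<forall>\<^sub>F y in at x within S. f y < f x + e / a" using assms(1) x unfolding usc_on_def by blast
 have "(g \<longlongrightarrow> g x) (at x within S)" using assms(2) x by (simp add: continuous_on_def)
 then have 2: "\<forall>\<^sub>F y in at x within S. g x - e < g y" using e by (intro order_tendstoD(1)) auto
 show "\<forall>\<^sub>F y in at x within S. a * f y - g y < c"
  using 1 2
 proof eventually_elim
  case (elim y)
  have "a * f y < a * (f x + e / a)" using elim(1) assms(3) by (intro mult_strict_left_mono) auto
  also have "... = a * f x + e" using assms(3) by (simp add: distrib_left)
  moreover have "2 * e = c - (a * f x - g x)" unfolding e_def by simp
  ultimately show ?case using elim(2) by linarith
 qed
qed

lemma usc_coercive_max:
 fixes f :: "'a::euclidean_space => real"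
 assumes S: "closed S" "y0 \<in> S" and usc: "usc_on S f" and co: "!!y. y \<in> S ==> R < norm y ==> f y <= f y0"
 shows "EX x:S. ALL y:S. f y <= f x"
proof -
 let ?K = "S Int cball 0 (max R (norm y0))"
 have "compact ?K" using S by (intro closed_Int_compact) auto
 moreover have "?K ~= {}" using S by auto
 ultimately obtain x where x: "x \<in> ?K" "!!y. y \<in> ?K ==> f y <= f x"
  using usc_attains_max[OF _ _ usc, of ?K] by blast
 have "f y0 <= f x" using S by (intro x(2)) auto
 then have "f y <= f x" if "y \<in> S" for y
  using co[OF that] x(2)[of y] that by (cases "R < norm y") auto
 with x show ?thesis by auto
qed

lemma quadratic_dominates:
 fixes A B C :: real
 assumes "A > 0" shows "EX R>=0. ALL r>R. B + C * r - A * r^2 < 0"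
proof (intro exI[of _ "(\<bar>B\<bar> + \<bar>C\<bar>) / A + 1"] conjI allI impI)
 show "0 <= (\<bar>B\<bar> + \<bar>C\<bar>) / A + 1" using assms by simp
 fix r assume r: "(\<bar>B\<bar> + \<bar>C\<bar>) / A + 1 < r"
 have r1: "1 < r" using r assms by (smt (verit) divide_nonneg_pos abs_ge_zero)
 have "(\<bar>B\<bar> + \<bar>C\<bar>) / A < r" using r by simp
 then have "\<bar>B\<bar> + \<bar>C\<bar> < A * r" using assms by (simp add: pos_divide_less_eq mult.commute)
 then have "(\<bar>B\<bar> + \<bar>C\<bar>) * r < A * r * r" using r1 by (intro mult_strict_right_mono) auto
 moreover have "\<bar>B\<bar> * 1 <= \<bar>B\<bar> * r" using r1 by (intro mult_left_mono) auto
 moreover have "C * r <= \<bar>C\<bar> * r" using r1 by (intro mult_right_mono) auto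
 ultimately show "B + C * r - A * r^2 < 0" by (simp add: power2_eq_square algebra_simps)
qed

definition upper_growth :: "((real^'m) \<times> real => real) => bool" where
 "upper_growth u \<longleftrightarrow> (ALL S>0. EX C. ALL x. ALL t:{-S..0}. u (x, t) <= C * (1 + norm x))"

text \<open>The barrier is a paraboloid with vertex \<open>x0\<close> that dominates the initial value and moves upwards
 with a speed exceeding the curvature term; the exponential keeps the contact point away from the artificial final time \<open>2 t1\<close>.\<close>

lemma weak_sub_barrier:
 fixes f :: "(real^'m) \<times> real => real"
 assumes W: "weak_sub F K f" and K: "K >= 0" and gr: "upper_growth f" and init: "!!x. f (x, 0) <= h0 x"
  and L: "L > 0" "!!x y. h0 x <= h0 y + L * norm (x - y)" and eta: "eta > 0" and t1: "t1 <= 0"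
 shows "f (x0, t1) <= h0 x0 + L * eta / 2 + (K * L / eta) * (- t1)"
proof (cases "t1 = 0")
 case True then show ?thesis using init[of x0] L(1) eta by (simp add: add_increasing2)
next
 case False
 then have t1: "t1 < 0" using t1 by simp
 show ?thesis
 proof (rule ccontr)
  assume "~ ?thesis"
  then have neg: "0 < f (x0, t1) - (h0 x0 + L * eta / 2 + (K * L / eta) * (- t1))" by simp
  define X where "X = f (x0, t1) - (h0 x0 + L * eta / 2 + (K * L / eta) * (- t1))"
  \<comment> \<open>Half of the excess \<open>X\<close> is split into an additive constant
    \<open>eps\<close> and an additional speed \<open>eps\<close>.\<close>
  define eps where "eps = X / (2 * (1 - t1))"
  have eps: "eps > 0" unfolding eps_def using neg t1 unfolding X_def by simp
  have "X = eps * (2 * (1 - t1))" unfolding eps_def using t1 by simp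
  then have eps2: "f (x0, t1) - (h0 x0 + L * eta / 2 + (K * L / eta) * (- t1)) = 2 * (eps + eps * (- t1))" unfolding X_def by (simp add: algebra_simps)
  \<comment> \<open>With this curvature the paraboloid raised by \<open>L * eta / 2\<close> touches
    the cone of slope \<open>L\<close> from above at distance \<open>eta\<close>.\<close>
  define a where "a = L / (2 * eta)"
  have a: "a > 0" unfolding a_def using L eta by simp
  define A where "A = K * L / eta + eps"
  have A: "A >= 0" unfolding A_def using K L eta eps by simp
  define c where "c = h0 x0 + L * eta / 2"
  obtain C where C: "!!x t. t \<in> {- (- 2 * t1)..0} ==> f (x, t) <= C * (1 + norm x)" using gr t1 unfolding upper_growth_def by (metis mult_neg_neg neg_less_0_iff_less zero_less_numeral)
  have C': "f (x, t) <= \<bar>C\<bar> * (1 + norm x0) + \<bar>C\<bar> * norm (x - x0)" if "2 * t1 <= t" "t <= 0" for x t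
  proof -
   have "f (x, t) <= C * (1 + norm x)" using that by (intro C) auto
   also have "... <= \<bar>C\<bar> * (1 + norm x)" by (intro mult_right_mono) auto
   also have "... <= \<bar>C\<bar> * ((1 + norm x0) + norm (x - x0))" using norm_triangle_ineq[of x0 "x - x0"] by (intro mult_left_mono) auto
   finally show ?thesis by (simp add: distrib_left)
  qed
  obtain R where R: "R >= 0" "!!r. r > R ==> (\<bar>C\<bar> * (1 + norm x0) - c) + \<bar>C\<bar> * r - a * r^2 < 0" using quadratic_dominates[OF a] by metis
  define Q where "Q = \<bar>C\<bar> * (1 + norm x0) + \<bar>C\<bar> * (R + 1) + \<bar>c\<bar> + 1"
  have Q: "Q > 0" unfolding Q_def using R by (auto intro!: add_nonneg_pos)
  \<comment> \<open>A rate for which \<open>kappa\<close> is at least \<open>Q\<close> at time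
    \<open>2 * t1\<close>, so that no contact is possible there, while
    \<open>kappa t1 = eps\<close>.\<close>
  define j where "j = Q / (eps * (- t1))"
  have j: "j > 0" unfolding j_def using Q eps t1 by (intro divide_pos_pos mult_pos_pos) auto
  define kappa where "kappa t = eps * exp (j * (t1 - t))" for t
  have kappa0: "kappa t > 0" for t unfolding kappa_def using eps by simp
  define psi where "psi z = a * ((fst z - x0) \<bullet> (fst z - x0)) + c + A * (- snd z) + kappa (snd z)" for z :: "(real^'m) \<times> real"
  have cpsi: "continuous_on S psi" for S unfolding psi_def kappa_def by (intro continuous_intros)
  let ?K = "cball x0 (R + 1) \<times> {2 * t1..0}"
  have K1: "compact ?K" "?K ~= {}" "(x0, t1) \<in> ?K" using R t1 by (auto intro: compact_Times)
  have "usc_on ?K f" using W unfolding weak_sub_def by (auto intro: usc_on_subset)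
  then have "usc_on ?K (%z. 1 * f z - psi z)" by (rule usc_on_diff_continuous[OF _ cpsi]) simp
  from usc_attains_max[OF K1(1,2) this order_refl] obtain z where "z \<in> ?K" "ALL y:?K. 1 * f y - psi y <= 1 * f z - psi z" by blast
  then have z: "z \<in> ?K" "!!y. y \<in> ?K ==> f y - psi y <= f z - psi z" by auto
  have psix: "psi (x, t) = a * (norm (x - x0))^2 + c + A * (- t) + kappa t" for x t unfolding psi_def by (simp add: dot_square_norm)
  have "psi (x0, t1) = c + A * (- t1) + eps" unfolding psix kappa_def by simp
  then have "f (x0, t1) - psi (x0, t1) > 0" using eps2 eps t1 mult_pos_pos[of eps "- t1"] unfolding c_def A_def by (simp add: algebra_simps)
  then have pos: "f z - psi z > 0" using z(2)[OF K1(3)] by linarith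
  obtain x t where zx: "z = (x, t)" by (cases z)
  have xt: "norm (x - x0) <= R + 1" "2 * t1 <= t" "t <= 0" using z(1) unfolding zx by (auto simp: dist_norm norm_minus_commute)
  have At: "0 <= A * (- t)" using A xt(3) by (intro mult_nonneg_nonneg) auto
  have "norm (x - x0) <= R"
  proof (rule ccontr)
   assume "~ norm (x - x0) <= R"
   then have "(\<bar>C\<bar> * (1 + norm x0) - c) + \<bar>C\<bar> * norm (x - x0) - a * (norm (x - x0))^2 < 0" by (intro R(2)) simp
   then show False using pos C'[OF xt(2,3), of x] At kappa0[of t] unfolding zx psix by linarith
  qed
  moreover have "t ~= 0"
  proof
   assume "t = 0"
   have "L * norm (x - x0) <= a * (norm (x - x0))^2 + L * eta / 2"
   proof -
    have "0 <= a * (norm (x - x0) - eta)^2" using a by simp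
    also have "... = a * (norm (x - x0))^2 + L * eta / 2 - L * norm (x - x0)" unfolding a_def using eta by (simp add: power2_eq_square field_simps)
    finally show ?thesis by simp
   qed
   then have "f (x, 0) <= a * (norm (x - x0))^2 + c" using init[of x] L(2)[of x x0] unfolding c_def by linarith
   then show False using pos kappa0[of t] unfolding zx psix \<open>t = 0\<close> by simp
  qed
  moreover have "t ~= 2 * t1"
  proof
   assume "t = 2 * t1"
   then have "kappa t = eps * exp (j * (- t1))" unfolding kappa_def by simp
   moreover have "j * (- t1) <= exp (j * (- t1))" using exp_ge_add_one_self[of "j * (- t1)"] by linarith
   then have "eps * (j * (- t1)) <= eps * exp (j * (- t1))" using eps by (intro mult_left_mono) auto
   ultimately have "eps * (j * (- t1)) <= kappa t" by simp
   moreover have "eps * (j * (- t1)) = Q" unfolding j_def using eps t1 by simp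
   moreover have "\<bar>C\<bar> * norm (x - x0) <= \<bar>C\<bar> * (R + 1)" using xt by (intro mult_left_mono) auto
   moreover have "0 <= a * (norm (x - x0))^2" using a by simp
   ultimately show False using pos C'[OF xt(2,3), of x] At unfolding zx psix Q_def by linarith
  qed
  ultimately have int: "norm (x - x0) < R + 1" "2 * t1 < t" "t < 0" using xt by auto
  note tf = test_function_add[OF test_function_quadratic[of "(2 * a) *\<^sub>R mat 1" 0 x0]
    test_function_time[of "%t. c + A * (- t) + kappa t" "%t. - A - j * kappa t"]]
  have "test_function (%z. (0 \<bullet> (fst z - x0) + ((((2 * a) *\<^sub>R mat 1) *v (fst z - x0)) \<bullet> (fst z - x0)) / 2) + (c + A * (- snd z) + kappa (snd z)))
   (%z. 0 + (- A - j * kappa (snd z))) (%z. (0 + ((2 * a) *\<^sub>R mat 1) *v (fst z - x0)) + 0) (%z. (2 * a) *\<^sub>R mat 1 + 0)"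
  proof (rule tf)
   show "transpose ((2 * a) *\<^sub>R mat 1 :: real^'m^'m) = (2 * a) *\<^sub>R mat 1" by (auto simp: transpose_def vec_eq_iff mat_def)
   show "((%t. c + A * (- t) + kappa t) has_real_derivative - A - j * kappa t) (at t)" for t
    unfolding kappa_def by (auto intro!: derivative_eq_intros)
   show "continuous_on {..<0} (%t. - A - j * kappa t)" unfolding kappa_def by (intro continuous_intros)
  qed
  moreover have "(%z. (0 \<bullet> (fst z - x0) + ((((2 * a) *\<^sub>R mat 1) *v (fst z - x0)) \<bullet> (fst z - x0)) / 2) + (c + A * (- snd z) + kappa (snd z))) = psi"
   unfolding psi_def by (simp add: fun_eq_iff scaleR_matrix_vector_assoc[symmetric])
  ultimately have tf: "test_function psi (%z. 0 + (- A - j * kappa (snd z))) (%z. (0 + ((2 * a) *\<^sub>R mat 1) *v (fst z - x0)) + 0) (%z. (2 * a) *\<^sub>R mat 1 + 0)" by simp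
  have "open (ball x0 (R + 1) \<times> {2 * t1<..<0})" by (intro open_Times) auto
  moreover have "(x, t) \<in> ball x0 (R + 1) \<times> {2 * t1<..<0}" using int by (simp add: dist_norm norm_minus_commute)
  moreover have "f y - psi y <= f (x, t) - psi (x, t)" if "y \<in> ball x0 (R + 1) \<times> {2 * t1<..<0}" for y using that z(2)[of y] unfolding zx by auto
  ultimately have "\<forall>\<^sub>F y in nhds (x, t). f y - psi y <= f (x, t) - psi (x, t)" unfolding eventually_nhds by blast
  from weak_subD(2)[OF W tf int(3) this, of "2 * a"] a have "0 <= - A - j * kappa t + K * (2 * a)"
   by (simp add: scaleR_matrix_vector_assoc[symmetric])
  moreover have "K * (2 * a) = K * L / eta" unfolding a_def using eta by simp
  moreover have "0 <= j * kappa t" using j kappa0[of t] by simp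
  ultimately show False using eps unfolding A_def by linarith
 qed
qed

section \<open>Sup-convolutions and their jets\<close>

definition is_supconv :: "'a::euclidean_space set => ('a => real) => real => ('a => 'a) => bool" where
 "is_supconv S a N Y \<longleftrightarrow> (ALL Z. Y Z \<in> S & (ALL y:S. a y - N * (norm (Z - y))^2 <= a (Y Z) - N * (norm (Z - Y Z))^2))"

lemma supconv_exists:
 fixes a :: "'a::euclidean_space => real"
 assumes S: "closed S" "y0 \<in> S" and usc: "usc_on S a" and gr: "!!y. y \<in> S ==> a y <= C * (1 + norm y)" and N: "N > 0"
 shows "EX Y. is_supconv S a N Y"
proof -
 have "EX x:S. ALL y:S. a y - N * (norm (Z - y))^2 <= a x - N * (norm (Z - x))^2" for Z
 proof -
  let ?f = "%y. 1 * a y - N * (norm (Z - y))^2"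
  have u: "usc_on S ?f" by (rule usc_on_diff_continuous[OF usc]) (auto intro!: continuous_intros)
  obtain R where R: "R >= 0" "!!r. r > R ==> (\<bar>C\<bar> * (1 + norm Z) - ?f y0) + \<bar>C\<bar> * r - N * r^2 < 0" using quadratic_dominates[OF N] by metis
  have "?f y <= ?f y0" if y: "y \<in> S" "R + norm Z < norm y" for y
  proof -
   have "norm (Z - y) > R" using y(2) norm_triangle_ineq2[of y Z] by (simp add: norm_minus_commute)
   from R(2)[OF this] have 1: "(\<bar>C\<bar> * (1 + norm Z) - ?f y0) + \<bar>C\<bar> * norm (Z - y) - N * (norm (Z - y))^2 < 0" .
   have "a y <= \<bar>C\<bar> * (1 + norm y)" using gr[OF y(1)] by (rule order_trans) (intro mult_right_mono, auto)
   also have "... <= \<bar>C\<bar> * ((1 + norm Z) + norm (Z - y))" using norm_triangle_ineq4[of Z "Z - y"] by (intro mult_left_mono) auto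
   finally show ?thesis using 1 by (simp add: distrib_left)
  qed
  from usc_coercive_max[OF S u this] show ?thesis by simp
 qed
 then show ?thesis unfolding is_supconv_def by metis
qed

text \<open>The sup-convolution plus \<open>N * (norm Z)^2\<close>: a supremum over \<open>y\<close>
  of functions affine in \<open>Z\<close>, hence convex.\<close>

definition supconv_convex :: "('a::euclidean_space => real) => real => ('a => 'a) => 'a => real" where
 "supconv_convex a N Y Z = a (Y Z) - N * (norm (Z - Y Z))^2 + N * (norm Z)^2"

lemma supconv_convex_ge:
 assumes "is_supconv S a N Y" "y \<in> S"
 shows "a y - N * (norm (Z - y))^2 + N * (norm Z)^2 <= supconv_convex a N Y Z"
 using assms unfolding is_supconv_def supconv_convex_def by auto

lemma supconv_subgradient:
 assumes "is_supconv S a N Y"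
 shows "subgradient (supconv_convex a N Y) Z ((2 * N) *\<^sub>R Y Z)"
 unfolding subgradient_def
proof
 fix Z'
 have YS: "Y Z \<in> S" using assms unfolding is_supconv_def by blast
 have "supconv_convex a N Y Z + ((2 * N) *\<^sub>R Y Z) \<bullet> (Z' - Z) = a (Y Z) - N * (norm (Z' - Y Z))^2 + N * (norm Z')^2"
  unfolding supconv_convex_def power2_norm_eq_inner by (simp add: inner_diff inner_commute algebra_simps)
 also have "... <= supconv_convex a N Y Z'" by (rule supconv_convex_ge[OF assms YS])
 finally show "supconv_convex a N Y Z + ((2 * N) *\<^sub>R Y Z) \<bullet> (Z' - Z) <= supconv_convex a N Y Z'" .
qed

text \<open>Symmetrising leaves the quadratic form on purely spatial vectors unchanged and gives a
  matrix to which the operator applies.\<close>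

definition spatial_matrix :: "((real^'m) \<times> real => (real^'m) \<times> real) => real^'m^'m" where
 "spatial_matrix B = (\<chi> i j. (B (axis i 1, 0) \<bullet> (axis j 1, 0) + B (axis j 1, 0) \<bullet> (axis i 1, 0)) / 2)"

lemma spatial_matrix:
 fixes B :: "(real^'m) \<times> real => (real^'m) \<times> real"
 assumes B: "linear B"
 shows "transpose (spatial_matrix B) = spatial_matrix B" "(spatial_matrix B *v h) \<bullet> h = B (h, 0) \<bullet> (h, 0)"
proof -
 show "transpose (spatial_matrix B) = spatial_matrix B"
  unfolding spatial_matrix_def transpose_def by (simp add: vec_eq_iff add.commute)
 have hx: "(h, 0::real) = (\<Sum>i\<in>UNIV. h $ i *\<^sub>R (axis i 1, 0))"
  by (simp add: prod_eq_iff fst_sum snd_sum basis_expansion scalar_mult_eq_scaleR[symmetric])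
 have Bsum: "B (h, 0) = (\<Sum>i\<in>UNIV. h $ i *\<^sub>R B (axis i 1, 0))"
  by (subst hx) (simp only: linear_sum[OF B] linear_cmul[OF B])
 have r: "w \<bullet> (h, 0) = (\<Sum>j\<in>UNIV. h $ j * (w \<bullet> (axis j 1, 0)))" for w :: "(real^'m) \<times> real"
  by (subst hx) (simp only: inner_sum_right inner_scaleR_right)
 have Bh: "B (h, 0) \<bullet> (h, 0) = (\<Sum>i\<in>UNIV. \<Sum>j\<in>UNIV. h $ i * h $ j * (B (axis i 1, 0) \<bullet> (axis j 1, 0)))"
  unfolding Bsum inner_sum_left inner_scaleR_left r by (simp add: sum_distrib_left mult.assoc del: inner_Pair)
   (subst sum.swap, simp add: mult.left_commute del: inner_Pair)
 have "(spatial_matrix B *v h) \<bullet> h = (\<Sum>i\<in>UNIV. \<Sum>j\<in>UNIV. h $ i * h $ j * ((B (axis i 1, 0) \<bullet> (axis j 1, 0) + B (axis j 1, 0) \<bullet> (axis i 1, 0)) / 2))"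
  by (simp add: spatial_matrix_def matrix_vector_mult_def inner_vec_def sum_distrib_right sum_distrib_left mult_ac del: inner_Pair)
 also have "... = (\<Sum>i\<in>UNIV. \<Sum>j\<in>UNIV. h $ i * h $ j * (B (axis i 1, 0) \<bullet> (axis j 1, 0))) / 2
  + (\<Sum>i\<in>UNIV. \<Sum>j\<in>UNIV. h $ i * h $ j * (B (axis j 1, 0) \<bullet> (axis i 1, 0))) / 2"
  by (simp add: sum_divide_distrib sum.distrib[symmetric] add_divide_distrib distrib_left del: inner_Pair)
 also have "(\<Sum>i\<in>UNIV. \<Sum>j\<in>UNIV. h $ i * h $ j * (B (axis j 1, 0) \<bullet> (axis i 1, 0))) = B (h, 0) \<bullet> (h, 0)"
  unfolding Bh by (subst sum.swap) (simp add: mult_ac del: inner_Pair)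
 finally show "(spatial_matrix B *v h) \<bullet> h = B (h, 0) \<bullet> (h, 0)" unfolding Bh by simp
qed

text \<open>The translate \<open>Y Z + k\<close> competes in the supremum at \<open>Z + k\<close>,
  so an expansion of the sup-convolution at \<open>Z\<close> bounds \<open>a\<close> near
  \<open>Y Z\<close> with the same first and second derivatives. Young's inequality removes the
  mixed terms: the spatial Hessian pays \<open>e\<close>, and the time direction receives a harmless
  \<open>C * s^2\<close>.\<close>

lemma supconv_jet:
 fixes a :: "(real^'m) \<times> real => real"
 assumes sc: "is_supconv (UNIV \<times> {..0}) a N Y" and so: "second_order_at (supconv_convex a N Y) Z P B"
  and t: "snd (Y Z) < 0" and e: "e > 0"
 shows "EX C. EX r>0. ALL h s. norm h < r --> \<bar>s\<bar> < r --> a (fst (Y Z) + h, snd (Y Z) + s) <= a (Y Z) + snd (P - (2 * N) *\<^sub>R Z) * s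
  + fst (P - (2 * N) *\<^sub>R Z) \<bullet> h + (((spatial_matrix B + (e - 2 * N) *\<^sub>R mat 1) *v h) \<bullet> h) / 2 + C * s^2"
proof -
 have linB: "linear B" using so unfolding second_order_at_def by blast
 obtain b where b: "b > 0" "!!k. norm (B k) <= b * norm k" using linear_bounded_pos[OF linB] by blast
 have e4: "e / 4 > 0" using e by simp
 obtain delta where delta: "delta > 0" "!!k. norm k < delta ==> \<bar>supconv_convex a N Y (Z + k) - supconv_convex a N Y Z - P \<bullet> k - (B k \<bullet> k) / 2\<bar> <= e / 4 * (norm k)^2"
  using so e4 unfolding second_order_at_def by blast
 define r where "r = min (delta / 2) (- snd (Y Z))"
 have r: "r > 0" "2 * r <= delta" "r <= - snd (Y Z)" unfolding r_def using delta(1) t by auto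
 define C where "C = 4 * b^2 / e + b + e + \<bar>N\<bar>"
 have "a (fst (Y Z) + h, snd (Y Z) + s) <= a (Y Z) + snd (P - (2 * N) *\<^sub>R Z) * s
  + fst (P - (2 * N) *\<^sub>R Z) \<bullet> h + (((spatial_matrix B + (e - 2 * N) *\<^sub>R mat 1) *v h) \<bullet> h) / 2 + C * s^2"
  if h: "norm h < r" and s: "\<bar>s\<bar> < r" for h s
 proof -
  let ?k = "(h, s)" and ?y = "(fst (Y Z) + h, snd (Y Z) + s)"
  have nk: "(norm ?k)^2 = (norm h)^2 + s^2" by (simp add: norm_Pair)
  have "norm ?k <= norm h + \<bar>s\<bar>" using norm_Pair_le[of h s] by simp
  then have k: "norm ?k < delta" using h s r by linarith
  have yS: "?y \<in> UNIV \<times> {..0}" using s r by auto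
  have ky: "?y = Y Z + ?k" by (cases "Y Z") simp
  have "a ?y - N * (norm (Z + ?k - ?y))^2 + N * (norm (Z + ?k))^2 <= supconv_convex a N Y (Z + ?k)"
   by (rule supconv_convex_ge[OF sc yS])
  also have "... <= supconv_convex a N Y Z + P \<bullet> ?k + (B ?k \<bullet> ?k) / 2 + e / 4 * (norm ?k)^2" using delta(2)[OF k] unfolding abs_le_iff by linarith
  also have "supconv_convex a N Y Z = a (Y Z) - N * (norm (Z + ?k - ?y))^2 + N * (norm Z)^2"
   unfolding supconv_convex_def ky by simp
  finally have 1: "a ?y <= a (Y Z) + (P \<bullet> ?k - 2 * N * (Z \<bullet> ?k)) + (B ?k \<bullet> ?k) / 2 - N * (norm ?k)^2 + e / 4 * (norm ?k)^2"
   unfolding power2_norm_eq_inner by (simp add: inner_add inner_commute algebra_simps del: inner_Pair)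
  have lin: "P \<bullet> ?k - 2 * N * (Z \<bullet> ?k) = snd (P - (2 * N) *\<^sub>R Z) * s + fst (P - (2 * N) *\<^sub>R Z) \<bullet> h"
   by (cases P; cases Z) (simp add: inner_diff_left algebra_simps)
  have "B ?k = B (h, 0) + B (0, s)" using linear_add[OF linB, of "(h, 0)" "(0, s)"] by simp
  moreover have "B (h, 0) \<bullet> ?k = B (h, 0) \<bullet> (h, 0) + B (h, 0) \<bullet> (0, s)" using inner_add_right[of "B (h, 0)" "(h, 0)" "(0, s)"] by simp
  ultimately have "B ?k \<bullet> ?k = B (h, 0) \<bullet> (h, 0) + (B (h, 0) \<bullet> (0, s) + B (0, s) \<bullet> ?k)" by (simp only: inner_add_left add.assoc)
  also have "B (h, 0) \<bullet> (0, s) + B (0, s) \<bullet> ?k <= 2 * (b * norm h * \<bar>s\<bar>) + b * s^2"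
  proof -
   have "B (h, 0) \<bullet> (0, s) <= norm (B (h, 0)) * norm ((0, s) :: (real^'m) \<times> real)" by (rule norm_cauchy_schwarz)
   also have "... <= (b * norm h) * \<bar>s\<bar>" using b(1) b(2)[of "(h, 0)"] by (intro mult_mono) auto
   finally have 2: "B (h, 0) \<bullet> (0, s) <= b * norm h * \<bar>s\<bar>" .
   have "B (0, s) \<bullet> ?k <= norm (B (0, s)) * norm ?k" by (rule norm_cauchy_schwarz)
   also have "... <= (b * \<bar>s\<bar>) * (norm h + \<bar>s\<bar>)" using b(2)[of "(0, s)"] b(1) \<open>norm ?k <= norm h + \<bar>s\<bar>\<close> by (intro mult_mono) auto
   also have "... = b * norm h * \<bar>s\<bar> + b * s^2" by (simp add: algebra_simps power2_eq_square abs_mult_self_eq)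
   finally show ?thesis using 2 by linarith
  qed
  also have "2 * (b * norm h * \<bar>s\<bar>) <= e / 4 * (norm h)^2 + 4 * b^2 / e * s^2"
  proof -
   have "0 <= (e * norm h - 4 * b * \<bar>s\<bar>)^2 / (4 * e)" using e by simp
   also have "... = e / 4 * (norm h)^2 + 4 * b^2 / e * s^2 - 2 * (b * norm h * \<bar>s\<bar>)"
    using e by (simp add: power2_eq_square field_simps abs_mult_self_eq)
   finally show ?thesis by simp
  qed
  finally have Bk: "B ?k \<bullet> ?k <= (spatial_matrix B *v h) \<bullet> h + e / 4 * (norm h)^2 + (4 * b^2 / e + b) * s^2"
   unfolding spatial_matrix(2)[OF linB] by (simp add: distrib_right)
  have M: "((spatial_matrix B + (e - 2 * N) *\<^sub>R mat 1) *v h) \<bullet> h = (spatial_matrix B *v h) \<bullet> h + (e - 2 * N) * (norm h)^2"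
   by (simp add: matrix_vector_mult_add_rdistrib scaleR_matrix_vector_assoc[symmetric] inner_add_left power2_norm_eq_inner)
  have s2: "0 <= s^2" "0 <= e * s^2" "0 <= (\<bar>N\<bar> + N) * s^2" "0 <= e * (norm h)^2" "0 <= b * s^2" "0 <= 4 * b^2 / e * s^2" using e b by auto
  have "a ?y <= a (Y Z) + (snd (P - (2 * N) *\<^sub>R Z) * s + fst (P - (2 * N) *\<^sub>R Z) \<bullet> h)
   + ((spatial_matrix B *v h) \<bullet> h + e / 4 * (norm h)^2 + (4 * b^2 / e + b) * s^2) / 2 - N * ((norm h)^2 + s^2) + e / 4 * ((norm h)^2 + s^2)"
   using 1 divide_right_mono[OF Bk, of 2] unfolding lin nk by linarith
  also have "... <= a (Y Z) + snd (P - (2 * N) *\<^sub>R Z) * s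
  + fst (P - (2 * N) *\<^sub>R Z) \<bullet> h + (((spatial_matrix B + (e - 2 * N) *\<^sub>R mat 1) *v h) \<bullet> h) / 2 + C * s^2"
  proof -
   define U q where "U = (spatial_matrix B *v h) \<bullet> h" and "q = 4 * b^2 / e + b"
   have "((U + (e - 2 * N) * (norm h)^2) / 2 + (q + e + \<bar>N\<bar>) * s^2) - ((U + e / 4 * (norm h)^2 + q * s^2) / 2 - N * ((norm h)^2 + s^2) + e / 4 * ((norm h)^2 + s^2))
    = e * (norm h)^2 / 8 + q * s^2 / 2 + 3 * (e * s^2) / 4 + (\<bar>N\<bar> + N) * s^2" by (simp add: field_simps)
   moreover have "q * s^2 >= 0" unfolding q_def using e b by simp
   ultimately show ?thesis unfolding M C_def U_def[symmetric] q_def[symmetric] using s2 by linarith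
  qed
  finally show ?thesis .
 qed
 with r(1) show ?thesis by blast
qed

lemma second_order_nonneg:
 assumes so: "second_order_at g Z P B" and sub: "subgradient g Z xi"
 shows "0 <= B H \<bullet> H"
proof (rule ccontr)
 assume "~ ?thesis"
 then have neg: "B H \<bullet> H < 0" by simp
 have linB: "linear B" using so unfolding second_order_at_def by blast
 have H: "H ~= 0" using neg linear_0[OF linB] by auto
 define e where "e = - (B H \<bullet> H) / (4 * (norm H)^2)"
 have e: "e > 0" unfolding e_def using neg H by (intro divide_pos_pos) auto
 obtain delta where delta: "delta > 0" "!!k. norm k < delta ==> \<bar>g (Z + k) - g Z - P \<bullet> k - (B k \<bullet> k) / 2\<bar> <= e * (norm k)^2"
  using so e unfolding second_order_at_def by blast
 define t where "t = delta / (2 * norm H)"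
 have t: "t > 0" "norm (t *\<^sub>R H) < delta" unfolding t_def using delta(1) H by auto
 have q: "B (t *\<^sub>R H) \<bullet> (t *\<^sub>R H) = t^2 * (B H \<bullet> H)" "B (- (t *\<^sub>R H)) \<bullet> (- (t *\<^sub>R H)) = t^2 * (B H \<bullet> H)"
  by (simp_all add: linear_cmul[OF linB] linear_neg[OF linB] power2_eq_square)
 have "xi \<bullet> (t *\<^sub>R H) <= g (Z + t *\<^sub>R H) - g Z" "xi \<bullet> (- (t *\<^sub>R H)) <= g (Z + - (t *\<^sub>R H)) - g Z"
  using sub unfolding subgradient_def by (metis add_diff_cancel_left' le_diff_eq add.commute)+
 then have "0 <= t^2 * (B H \<bullet> H) + 2 * (e * (norm (t *\<^sub>R H))^2)"
  using delta(2)[of "t *\<^sub>R H"] delta(2)[of "- (t *\<^sub>R H)"] t unfolding q by (simp add: abs_le_iff inner_minus_right)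
 also have "... = t^2 * (B H \<bullet> H) / 2" unfolding e_def using H by (simp add: power_mult_distrib field_simps)
 finally show False using neg t(1) by (simp add: zero_le_mult_iff)
qed

subsection \<open>The comparison principle\<close>

lemma second_order_at_components:
 assumes so: "second_order_at g (Z1, Z2) P B" and g: "!!Z. g Z = f1 (fst Z) + f2 (snd Z)"
 shows "second_order_at f1 Z1 (fst P) (%k. fst (B (k, 0)))" "second_order_at f2 Z2 (snd P) (%k. snd (B (0, k)))"
proof -
 have lin: "linear B" using so unfolding second_order_at_def by blast
 have "linear (%k. (k, 0 :: 'b))" "linear (%k. (0 :: 'a, k))" by (auto intro!: linearI)
 then have l1: "linear (%k. fst (B (k, 0)))" "linear (%k. snd (B (0, k)))"
  using linear_compose[OF linear_compose[OF _ lin] linear_fst] linear_compose[OF linear_compose[OF _ lin] linear_snd]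
  by (auto simp: o_def)
 show "second_order_at f1 Z1 (fst P) (%k. fst (B (k, 0)))"
  unfolding second_order_at_def
 proof (intro conjI l1 allI impI)
  fix e :: real assume "e > 0"
  then obtain delta where delta: "delta > 0" "!!H. norm H < delta ==> \<bar>g ((Z1, Z2) + H) - g (Z1, Z2) - P \<bullet> H - (B H \<bullet> H) / 2\<bar> <= e * (norm H)^2"
   using so unfolding second_order_at_def by blast
  have "\<bar>f1 (Z1 + k) - f1 Z1 - fst P \<bullet> k - (fst (B (k, 0)) \<bullet> k) / 2\<bar> <= e * (norm k)^2" if "norm k < delta" for k
   using delta(2)[of "(k, 0)"] that g by (simp add: inner_prod_def)
  with delta(1) show "EX delta>0. ALL k. norm k < delta --> \<bar>f1 (Z1 + k) - f1 Z1 - fst P \<bullet> k - (fst (B (k, 0)) \<bullet> k) / 2\<bar> <= e * (norm k)^2" by blast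
 qed
 show "second_order_at f2 Z2 (snd P) (%k. snd (B (0, k)))"
  unfolding second_order_at_def
 proof (intro conjI l1 allI impI)
  fix e :: real assume "e > 0"
  then obtain delta where delta: "delta > 0" "!!H. norm H < delta ==> \<bar>g ((Z1, Z2) + H) - g (Z1, Z2) - P \<bullet> H - (B H \<bullet> H) / 2\<bar> <= e * (norm H)^2"
   using so unfolding second_order_at_def by blast
  have "\<bar>f2 (Z2 + k) - f2 Z2 - snd P \<bullet> k - (snd (B (0, k)) \<bullet> k) / 2\<bar> <= e * (norm k)^2" if "norm k < delta" for k
   using delta(2)[of "(0, k)"] that g by (simp add: inner_prod_def)
  with delta(1) show "EX delta>0. ALL k. norm k < delta --> \<bar>f2 (Z2 + k) - f2 Z2 - snd P \<bullet> k - (snd (B (0, k)) \<bullet> k) / 2\<bar> <= e * (norm k)^2" by blast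
 qed
qed

lemma second_order_ray:
 assumes so: "second_order_at f Z P B" and e: "e > 0"
 shows "EX delta>0. ALL t. 0 < t & t < delta --> f Z + t * (P \<bullet> k) + t^2 * ((B k \<bullet> k) / 2 - e) <= f (Z + t *\<^sub>R k)"
proof -
 have lin: "linear B" using so unfolding second_order_at_def by blast
 define e' where "e' = e / ((norm k)^2 + 1)"
 have n1: "(norm k)^2 + 1 > 0" by (simp add: add_nonneg_pos)
 have e': "e' > 0" "e' * (norm k)^2 <= e" unfolding e'_def using e n1 by (auto simp: pos_divide_le_eq mult_left_mono)
 obtain delta where delta: "delta > 0" "!!H. norm H < delta ==> \<bar>f (Z + H) - f Z - P \<bullet> H - (B H \<bullet> H) / 2\<bar> <= e' * (norm H)^2"
  using so e'(1) unfolding second_order_at_def by blast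
 have "f Z + t * (P \<bullet> k) + t^2 * ((B k \<bullet> k) / 2 - e) <= f (Z + t *\<^sub>R k)" if t: "0 < t" "t < delta / (norm k + 1)" for t
 proof -
  have "t * (norm k + 1) < delta" using t(2) by (simp add: pos_less_divide_eq add_nonneg_pos)
  then have "norm (t *\<^sub>R k) < delta" using t(1) by (simp add: distrib_left)
  from delta(2)[OF this] have "f Z + P \<bullet> (t *\<^sub>R k) + (B (t *\<^sub>R k) \<bullet> (t *\<^sub>R k)) / 2 - e' * (norm (t *\<^sub>R k))^2 <= f (Z + t *\<^sub>R k)"
   unfolding abs_le_iff by linarith
  moreover have "e' * (norm (t *\<^sub>R k))^2 <= t^2 * e"
   using mult_left_mono[OF e'(2), of "t^2"] by (simp add: power_mult_distrib mult_ac)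
  ultimately show ?thesis by (simp add: linear_cmul[OF lin] power2_eq_square algebra_simps)
 qed
 then show ?thesis using delta(1) by (intro exI[of _ "delta / (norm k + 1)"]) (auto intro!: divide_pos_pos add_nonneg_pos)
qed

text \<open>The first-order terms cancel along the ray, and after division by \<open>t^2\<close> the
  cubic error vanishes as \<open>t\<close> tends to 0.\<close>

lemma contact_quadratic:
 assumes so: "second_order_at f1 Z1 P1 B1" "second_order_at f2 Z2 P2 B2" "second_order_at f3 Z3 P3 B3"
  and le: "!!t. 0 < t ==> t <= 1 ==> f1 (Z1 + t *\<^sub>R k1) + f2 (Z2 + t *\<^sub>R k2) + f3 (Z3 + t *\<^sub>R k3) <=
   f1 Z1 + f2 Z2 + f3 Z3 + t * (P1 \<bullet> k1 + P2 \<bullet> k2 + P3 \<bullet> k3) + c * t^2 + C * t^3"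
 shows "(B1 k1 \<bullet> k1 + B2 k2 \<bullet> k2 + B3 k3 \<bullet> k3) / 2 <= c"
proof (rule field_le_epsilon)
 fix e :: real assume e: "e > 0"
 then have e4: "e / 4 > 0" by simp
 obtain d1 where d1: "d1 > 0" "!!t. 0 < t & t < d1 ==> f1 Z1 + t * (P1 \<bullet> k1) + t^2 * ((B1 k1 \<bullet> k1) / 2 - e/4) <= f1 (Z1 + t *\<^sub>R k1)"
  using second_order_ray[OF so(1) e4] by blast
 obtain d2 where d2: "d2 > 0" "!!t. 0 < t & t < d2 ==> f2 Z2 + t * (P2 \<bullet> k2) + t^2 * ((B2 k2 \<bullet> k2) / 2 - e/4) <= f2 (Z2 + t *\<^sub>R k2)"
  using second_order_ray[OF so(2) e4] by blast
 obtain d3 where d3: "d3 > 0" "!!t. 0 < t & t < d3 ==> f3 Z3 + t * (P3 \<bullet> k3) + t^2 * ((B3 k3 \<bullet> k3) / 2 - e/4) <= f3 (Z3 + t *\<^sub>R k3)"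
  using second_order_ray[OF so(3) e4] by blast
 obtain t where t': "0 < t" "t < min (min d1 d2) (min d3 (min 1 (e / (4 * (\<bar>C\<bar> + 1)))))"
  using dense[of 0 "min (min d1 d2) (min d3 (min 1 (e / (4 * (\<bar>C\<bar> + 1)))))"] d1(1) d2(1) d3(1) e by auto
 have t: "0 < t" "t < d1" "t < d2" "t < d3" "t <= 1" "t < e / (4 * (\<bar>C\<bar> + 1))" using t' by auto
 have "C * t <= (\<bar>C\<bar> + 1) * t" using t(1) by (intro mult_right_mono) auto
 also have "... <= e / 4" using t(6) by (simp add: pos_less_divide_eq algebra_simps)
 finally have Ct: "C * t <= e / 4" .
 have "t^2 * ((B1 k1 \<bullet> k1) / 2 - e/4) + t^2 * ((B2 k2 \<bullet> k2) / 2 - e/4) + t^2 * ((B3 k3 \<bullet> k3) / 2 - e/4) <= c * t^2 + C * t^3"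
  using le[OF t(1,5)] d1(2)[of t] d2(2)[of t] d3(2)[of t] t by (simp add: distrib_left)
 then have "t^2 * ((B1 k1 \<bullet> k1 + B2 k2 \<bullet> k2 + B3 k3 \<bullet> k3) / 2 - 3 * e/4) <= t^2 * (c + C * t)"
  by (simp add: algebra_simps power2_eq_square power3_eq_cube)
 then have "(B1 k1 \<bullet> k1 + B2 k2 \<bullet> k2 + B3 k3 \<bullet> k3) / 2 - 3 * e/4 <= c + C * t" using t(1) by simp
 then show "(B1 k1 \<bullet> k1 + B2 k2 \<bullet> k2 + B3 k3 \<bullet> k3) / 2 <= c + e" using Ct by linarith
qed

lemma symmetric_norm_bound:
 fixes M :: "real^'m^'m"
 assumes sym: "transpose M = M" and q: "!!h. \<bar>(M *v h) \<bullet> h\<bar> <= A * (h \<bullet> h)"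
 shows "norm (M *v x) <= A * norm x"
proof (cases "M *v x = 0 | x = 0")
 case True
 have "0 <= A * (axis i 1 \<bullet> (axis i 1 :: real^'m))" for i using q[of "axis i 1"] by linarith
 then have "0 <= A" by (simp add: inner_axis_axis)
 then show ?thesis using True by auto
next
 case False
 define a where "a = norm x"
 define b where "b = norm (M *v x)"
 have ab: "a > 0" "b > 0" unfolding a_def b_def using False by auto
 define y where "y = (a / b) *\<^sub>R (M *v x)"
 have ny: "y \<bullet> y = a^2" unfolding y_def using ab by (simp add: b_def dot_square_norm power2_eq_square)
 have nx: "x \<bullet> x = a^2" unfolding a_def by (simp add: dot_square_norm)
 have "4 * ((M *v x) \<bullet> y) = (M *v (x + y)) \<bullet> (x + y) - (M *v (x - y)) \<bullet> (x - y)"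
  using symmetric_matrix_inner[OF sym, of y x]
  by (simp add: matrix_vector_right_distrib matrix_vector_mult_diff_distrib inner_add inner_diff inner_commute)
 also have "... <= A * ((x + y) \<bullet> (x + y)) + A * ((x - y) \<bullet> (x - y))" using q[of "x + y"] q[of "x - y"] by linarith
 also have "... = A * (4 * a^2)" using nx ny by (simp add: inner_add inner_diff inner_commute algebra_simps)
 finally have "(M *v x) \<bullet> y <= A * a^2" by simp
 moreover have "(M *v x) \<bullet> y = a * b" unfolding y_def using ab by (simp add: b_def dot_square_norm power2_eq_square)
 ultimately have "a * b <= a * (A * a)" by (simp add: power2_eq_square mult_ac)
 then show ?thesis using ab unfolding a_def b_def by simp
qed

text \<open>All three gradients are close to \<open>D\<close> or \<open>- D\<close>, and the
  operator is even and homogeneous of degree 0 in the gradient. Moving them to \<open>D\<close>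
  costs four times \<open>8 * A * mu / norm D\<close>, the first operator counting twice; there
  convexity in the matrix applies.\<close>

lemma curv_max_three_point:
 fixes Mw M2 M3 :: "real^'m^'m"
 assumes J: "index_set TYPE('m) J" and sym: "transpose Mw = Mw" "transpose M2 = M2" "transpose M3 = M3" and D: "D ~= 0"
  and p: "norm (pw - D) <= mu" "norm (p2 + D) <= mu" "norm (p3 + D) <= mu" "mu <= norm D / 2"
  and bd: "!!h. norm (Mw *v h) <= A * norm h" "!!h. norm (M2 *v h) <= A * norm h" "!!h. norm (M3 *v h) <= A * norm h" "0 <= A"
  and le: "!!h. 2 * ((Mw *v h) \<bullet> h) + (M2 *v h) \<bullet> h + (M3 *v h) \<bullet> h <= c * (h \<bullet> h)" and c: "0 <= c"
 shows "2 * curv_max J Mw pw - curv_max J (- M2) p2 - curv_max J (- M3) p3 <= real CARD('m) * (c + 32 * A * mu / norm D)"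
proof -
 let ?m = "real CARD('m)"
 have neg: "(- B) *v v = - (B *v v)" for B :: "real^'m^'m" and v by (simp add: matrix_vector_mult_def vec_eq_iff sum_negf)
 have tneg: "transpose (- B) = - B" if "transpose B = B" for B :: "real^'m^'m" using that by (simp add: transpose_def vec_eq_iff)
 have near: "\<bar>curv_max J B D - curv_max J B q\<bar> <= ?m * (8 * A * mu / norm D)"
  if B: "transpose B = B" "!!h. norm (B *v h) <= A * norm h" and q: "norm (q - D) <= mu" for B q
 proof -
  have "\<bar>curv_max J B D - curv_max J B q\<bar> <= ?m * (8 * A * norm (q - D) / norm D)"
   by (rule curv_max_near[OF J B(1) D _ B(2) bd(4)]) (use q p(4) in linarith)
  also have "... <= ?m * (8 * A * mu / norm D)" using q bd(4) by (intro mult_left_mono divide_right_mono) auto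
  finally show ?thesis .
 qed
 have flip: "curv_max J B (- q) = curv_max J B q" for B and q :: "real^'m" using curv_max_scale[of "-1" J B q] by simp
 have n1: "\<bar>curv_max J Mw D - curv_max J Mw pw\<bar> <= ?m * (8 * A * mu / norm D)" by (rule near[OF sym(1) bd(1) p(1)])
 have "- p2 - D = - (p2 + D)" "- p3 - D = - (p3 + D)" by auto
 then have q2: "norm (- p2 - D) <= mu" "norm (- p3 - D) <= mu" using p(2,3) by (simp_all only: norm_minus_cancel)
 have n2: "\<bar>curv_max J (- M2) D - curv_max J (- M2) p2\<bar> <= ?m * (8 * A * mu / norm D)"
  using near[OF tneg[OF sym(2)] _ q2(1)] bd(2) unfolding flip neg by simp
 have n3: "\<bar>curv_max J (- M3) D - curv_max J (- M3) p3\<bar> <= ?m * (8 * A * mu / norm D)"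
  using near[OF tneg[OF sym(3)] _ q2(2)] bd(3) unfolding flip neg by simp
 have "2 * curv_max J Mw D <= curv_max J (- M2) D + curv_max J (- M3) D + ?m * c"
 proof (rule curv_max_convex[OF J sym(1) tneg[OF sym(2)] tneg[OF sym(3)] D c])
  fix h show "2 * ((Mw *v h) \<bullet> h) <= (- M2 *v h) \<bullet> h + (- M3 *v h) \<bullet> h + c * (h \<bullet> h)" using le[of h] unfolding neg by simp
 qed
 moreover have "?m * (c + 32 * A * mu / norm D) = ?m * c + 4 * (?m * (8 * A * mu / norm D))" by (simp add: distrib_left)
 ultimately show ?thesis using n1 n2 n3 by linarith
qed

section \<open>The three-point penalty\<close>

type_synonym 'm triple = "((real^'m) \<times> real) \<times> ((real^'m) \<times> real) \<times> ((real^'m) \<times> real)"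

definition gap :: "'m::finite triple => real^'m" where
 "gap Z = 2 *\<^sub>R fst (fst Z) - fst (fst (snd Z)) - fst (snd (snd Z))"

text \<open>The Hessian is of order \<open>(norm (gap Z))^2\<close> and the gradient of order
  \<open>(norm (gap Z))^3\<close>, so either the Hessian is small or the gradient is bounded away
  from zero. Times enter quadratically, since no second time derivative occurs in the
  equation.\<close>

definition penalty :: "real => 'm::finite triple => real" where
 "penalty N Z = N * (gap Z \<bullet> gap Z)^2 + N * ((snd (fst Z) - snd (fst (snd Z)))^2 + (snd (fst Z) - snd (snd (snd Z)))^2)"

definition penalty_grad :: "real => 'm::finite triple => 'm triple" where
 "penalty_grad N Z =
  (((8 * N * (gap Z \<bullet> gap Z)) *\<^sub>R gap Z, 2 * N * (2 * snd (fst Z) - snd (fst (snd Z)) - snd (snd (snd Z)))),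
  ((- (4 * N * (gap Z \<bullet> gap Z))) *\<^sub>R gap Z, - (2 * N * (snd (fst Z) - snd (fst (snd Z))))),
  ((- (4 * N * (gap Z \<bullet> gap Z))) *\<^sub>R gap Z, - (2 * N * (snd (fst Z) - snd (snd (snd Z))))))"

definition penalty_rem :: "real => 'm::finite triple => 'm triple => real" where
 "penalty_rem N Z H = N * (2 * (gap Z \<bullet> gap Z) * (gap H \<bullet> gap H) + 4 * (gap Z \<bullet> gap H)^2 + 4 * (gap Z \<bullet> gap H) * (gap H \<bullet> gap H) + (gap H \<bullet> gap H)^2)
  + N * ((snd (fst H) - snd (fst (snd H)))^2 + (snd (fst H) - snd (snd (snd H)))^2)"

lemma gap_add: "gap (Z + H) = gap Z + gap H"
 unfolding gap_def by (simp add: algebra_simps)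

lemma gap_scale: "gap (t *\<^sub>R H) = t *\<^sub>R gap H"
 unfolding gap_def by (simp add: algebra_simps)

lemma penalty_expand: "penalty N (Z + H) = penalty N Z + penalty_grad N Z \<bullet> H + penalty_rem N Z H"
proof -
 obtain z r x s y q where Z: "Z = ((z, r), (x, s), (y, q))" by (metis prod.exhaust)
 obtain z' r' x' s' y' q' where H: "H = ((z', r'), (x', s'), (y', q'))" by (metis prod.exhaust)
 let ?d = "gap Z" and ?v = "gap H"
 define d v where "d = gap Z" and "v = gap H"
 have v: "v = 2 *\<^sub>R z' - x' - y'" unfolding H gap_def v_def by simp
 have 1: "(gap (Z + H) \<bullet> gap (Z + H))^2 = (?d \<bullet> ?d)^2 + 4 * (?d \<bullet> ?d) * (?d \<bullet> ?v)
  + (2 * (?d \<bullet> ?d) * (?v \<bullet> ?v) + 4 * (?d \<bullet> ?v)^2 + 4 * (?d \<bullet> ?v) * (?v \<bullet> ?v) + (?v \<bullet> ?v)^2)"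
  unfolding gap_add by (simp add: inner_add inner_commute power2_eq_square algebra_simps)
 have dz: "d \<bullet> z' = (d \<bullet> v + d \<bullet> x' + d \<bullet> y') / 2" unfolding v by (simp add: inner_diff_right)
 have 2: "penalty_grad N Z \<bullet> H = N * (4 * (?d \<bullet> ?d) * (?d \<bullet> ?v)) + 2 * N * ((2 * r - s - q) * r' - (r - s) * s' - (r - q) * q')"
  unfolding penalty_grad_def d_def[symmetric] v_def[symmetric] unfolding H by (simp add: Z dz field_simps)
 show ?thesis unfolding penalty_def 1 2 penalty_rem_def by (simp add: Z H power2_eq_square algebra_simps)
qed

lemma triple_norms:
 fixes H :: "'m::finite triple"
 shows "norm (fst (fst H)) <= norm H" "norm (fst (fst (snd H))) <= norm H" "norm (fst (snd (snd H))) <= norm H"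
  "\<bar>snd (fst H)\<bar> <= norm H" "\<bar>snd (fst (snd H))\<bar> <= norm H" "\<bar>snd (snd (snd H))\<bar> <= norm H"
proof -
 have f: "norm (fst z) <= norm z" "norm (snd z) <= norm z" for z :: "'p::real_normed_vector \<times> 'q::real_normed_vector"
  by (cases z, simp add: norm_fst_le norm_snd_le)+
 note ss = f(2)[of "snd H"] f(1)[of "snd H"] f(1)[of H] f(2)[of H]
 show "norm (fst (fst H)) <= norm H" "norm (fst (fst (snd H))) <= norm H" "norm (fst (snd (snd H))) <= norm H"
  using f(1)[of "fst H"] f(1)[of "fst (snd H)"] f(1)[of "snd (snd H)"] ss by linarith+
 show "\<bar>snd (fst H)\<bar> <= norm H" "\<bar>snd (fst (snd H))\<bar> <= norm H" "\<bar>snd (snd (snd H))\<bar> <= norm H"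
  using f(2)[of "fst H"] f(2)[of "fst (snd H)"] f(2)[of "snd (snd H)"] ss unfolding real_norm_def by linarith+
qed

lemma gap_norm_le: "norm (gap H) <= 4 * norm H"
proof -
 have "norm (gap H) <= norm (2 *\<^sub>R fst (fst H) - fst (fst (snd H))) + norm (fst (snd (snd H)))"
  unfolding gap_def by (rule norm_triangle_ineq4)
 also have "... <= norm (2 *\<^sub>R fst (fst H)) + norm (fst (fst (snd H))) + norm (fst (snd (snd H)))"
  by (intro add_right_mono norm_triangle_ineq4)
 finally show ?thesis using triple_norms[of H] by simp
qed

lemma penalty_rem_le:
 assumes N: "N >= 0" and H: "norm H <= 1"
 shows "penalty_rem N Z H <= N * (96 * (norm (gap Z))^2 + 256 * norm (gap Z) + 264) * (norm H)^2"
proof -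
 let ?d = "norm (gap Z)" and ?v = "norm (gap H)" and ?n = "norm H"
 have v: "?v <= 4 * ?n" by (rule gap_norm_le)
 have v2: "?v^2 <= 16 * ?n^2" using power_mono[OF v, of 2] by (simp add: power_mult_distrib)
 have v4: "?v <= 4" using v H by simp
 have dv: "\<bar>gap Z \<bullet> gap H\<bar> <= ?d * ?v" by (rule Cauchy_Schwarz_ineq2)
 have dv2: "(gap Z \<bullet> gap H)^2 <= ?d^2 * ?v^2" using power_mono[OF dv, of 2] by (simp add: power_mult_distrib)
 have dvv: "(gap Z \<bullet> gap H) * ?v^2 <= (?d * 4) * ?v^2"
  using dv v4 mult_left_mono[OF v4, of ?d] by (intro mult_right_mono) (auto simp: abs_le_iff)
 have vv: "(?v^2)^2 <= 16 * ?v^2" using mult_right_mono[of "?v^2" 16 "?v^2"] v4 power_mono[OF v4, of 2] by (simp add: power2_eq_square)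
 note c = triple_norms(4-6)[of H]
 have t: "(snd (fst H) - snd (fst (snd H)))^2 <= (2 * ?n)^2" "(snd (fst H) - snd (snd (snd H)))^2 <= (2 * ?n)^2"
  using c by (intro abs_le_square_iff[THEN iffD1]; simp)+
 have "2 * (gap Z \<bullet> gap Z) * (gap H \<bullet> gap H) + 4 * (gap Z \<bullet> gap H)^2 + 4 * (gap Z \<bullet> gap H) * (gap H \<bullet> gap H) + (gap H \<bullet> gap H)^2
  <= (6 * ?d^2 + 16 * ?d + 16) * ?v^2"
  using dv2 dvv vv unfolding dot_square_norm by (simp add: algebra_simps)
 also have "... <= (6 * ?d^2 + 16 * ?d + 16) * (16 * ?n^2)" using v2 by (intro mult_left_mono) auto
 finally have "penalty_rem N Z H <= N * ((6 * ?d^2 + 16 * ?d + 16) * (16 * ?n^2)) + N * ((2 * ?n)^2 + (2 * ?n)^2)"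
  unfolding penalty_rem_def using N t by (intro add_mono mult_left_mono) auto
 also have "... = N * (96 * ?d^2 + 256 * ?d + 264) * ?n^2" by (simp add: power2_eq_square algebra_simps)
 finally show ?thesis .
qed

lemma penalty_grad_differentiable: "penalty_grad N differentiable (at Z)"
proof -
 note D = bounded_linear_imp_differentiable
 have l: "bounded_linear (gap :: 'a triple => _)"
  unfolding gap_def by (intro bounded_linear_intros)
 have r: "bounded_linear (%Z :: 'a triple. 2 * snd (fst Z) - snd (fst (snd Z)) - snd (snd (snd Z)))"
  "bounded_linear (%Z :: 'a triple. snd (fst Z) - snd (fst (snd Z)))"
  "bounded_linear (%Z :: 'a triple. snd (fst Z) - snd (snd (snd Z)))"
  by (intro bounded_linear_intros)+
 note ds = D[OF l] r[THEN D]
 have P: "(%z. (f z, g z)) differentiable at Z"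
  if "f differentiable at Z" "g differentiable at Z" for f :: "'a triple => 'p::real_normed_vector" and g :: "'a triple => 'q::real_normed_vector"
  using that unfolding differentiable_def by (blast intro: has_derivative_Pair)
 show ?thesis
  unfolding penalty_grad_def
  by (intro P differentiable_scaleR differentiable_mult differentiable_minus differentiable_const differentiable_inner ds)
qed

definition past :: "'m::finite triple set" where
 "past = (UNIV \<times> {..0}) \<times> (UNIV \<times> {..0}) \<times> (UNIV \<times> {..0})"

text \<open>The barrier bound for \<open>A\<close> is linear in the gap and in the times, so a large
  \<open>N\<close> makes the penalised expression bounded and forces gap, time differences and
  \<open>Z - Y\<close> to be small whenever its value is at least \<open>sig / 2\<close>. If one of
  the times were 0, the time of the first point would be small too, and the bound would drop below
  \<open>sig / 2\<close>.\<close>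

lemma penalized_estimate:
 fixes A :: "'m::finite triple => real"
 assumes pos: "0 < sig" "0 < L" "0 < theta" "0 <= K"
  and A: "!!eta Y. 0 < eta ==> Y \<in> past ==> A Y <= L * norm (gap Y) + 2 * L * eta
   + (K * L / eta) * (2 * \<bar>snd (fst Y)\<bar> + \<bar>snd (fst (snd Y))\<bar> + \<bar>snd (snd (snd Y))\<bar>) - theta * (snd (fst Y))^2"
 shows "EX N>0. EX C>=0. ALL Y:past. ALL Z. A Y - N * (norm (Z - Y))^2 - penalty N Z <= C &
  (sig / 2 <= A Y - N * (norm (Z - Y))^2 - penalty N Z -->
   norm (gap Z) <= 1 & snd (fst Y) < 0 & snd (fst (snd Y)) < 0 & snd (snd (snd Y)) < 0)"
proof -
 define eta where "eta = sig / (16 * L)"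
 have eta: "eta > 0" "2 * L * eta = sig / 8" unfolding eta_def using pos by auto
 define M where "M = K * L / eta"
 have M: "M >= 0" unfolding M_def using pos eta by simp
 define C where "C = sig / 8 + 4 * M^2 / theta + 5 * L + 6 * M"
 \<comment> \<open>The 5 comes from \<open>e + 4 * U\<close>. The 18 is
   \<open>4 * 3 + 1 + 1 + 4\<close>: the time \<open>r\<close> is at most \<open>3 * rho\<close> in
   modulus and enters four times, next to \<open>tau1 + tau2 + 4 * U\<close>.\<close>
 define rho where "rho = min 1 (sig / (8 * (5 * L + 18 * M)))"
 have LM: "5 * L + 18 * M > 0" using pos M by linarith
 have rho: "0 < rho" "rho <= 1" unfolding rho_def using pos LM by auto
 have "rho * (8 * (5 * L + 18 * M)) <= sig / (8 * (5 * L + 18 * M)) * (8 * (5 * L + 18 * M))"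
  unfolding rho_def using LM by (intro mult_right_mono) auto
 also have "... = sig" using LM by (intro nonzero_eq_divide_eq[THEN iffD1]) auto
 finally have rho2: "5 * (L * rho) + 18 * (M * rho) <= sig / 8" by (simp add: algebra_simps)
 have C0: "4 * M^2 / theta >= 0" using pos by simp
 then have C: "C > 0" "4 * L + 4 * M <= C" unfolding C_def using pos M by linarith+
 \<comment> \<open>The first summand absorbs the growth \<open>C * Q\<close>; the second makes a
   positive value imply \<open>Q < rho^4\<close>, so that each contribution is small.\<close>
 define N where "N = C + C / rho^4"
 have N: "N > 0" unfolding N_def using C rho by (simp add: add_pos_pos)
 have "A Y - N * (norm (Z - Y))^2 - penalty N Z <= C &
  (sig / 2 <= A Y - N * (norm (Z - Y))^2 - penalty N Z -->
   norm (gap Z) <= 1 & snd (fst Y) < 0 & snd (fst (snd Y)) < 0 & snd (snd (snd Y)) < 0)"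
  if Y: "Y \<in> past" for Y Z
 proof -
  define \<Theta> where "\<Theta> = A Y - N * (norm (Z - Y))^2 - penalty N Z"
  define U e where "U = norm (Z - Y)" and "e = norm (gap Z)"
  define r s q where "r = snd (fst Y)" and "s = snd (fst (snd Y))" and "q = snd (snd (snd Y))"
  define tau1 tau2 where "tau1 = \<bar>snd (fst Z) - snd (fst (snd Z))\<bar>" and "tau2 = \<bar>snd (fst Z) - snd (snd (snd Z))\<bar>"
  define Q where "Q = U^2 + (e^2)^2 + (tau1^2 + tau2^2)"
  have nn: "U >= 0" "e >= 0" "tau1 >= 0" "tau2 >= 0" unfolding U_def e_def tau1_def tau2_def by auto
  have neg: "r <= 0" "s <= 0" "q <= 0" using Y unfolding past_def r_def s_def q_def by auto
  have d: "\<bar>snd (fst Z) - r\<bar> <= U" "\<bar>snd (fst (snd Z)) - s\<bar> <= U" "\<bar>snd (snd (snd Z)) - q\<bar> <= U"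
   using triple_norms(4-6)[of "Z - Y"] unfolding U_def r_def s_def q_def by simp_all
  have rs: "\<bar>r - s\<bar> <= tau1 + 2 * U" "\<bar>r - q\<bar> <= tau2 + 2 * U" using d unfolding tau1_def tau2_def by linarith+
  have "norm (gap Y) <= norm (gap Z) + norm (gap (Y - Z))" using gap_add[of Z "Y - Z"] norm_triangle_ineq[of "gap Z" "gap (Y - Z)"] by simp
  moreover have "norm (gap (Y - Z)) <= 4 * U" using gap_norm_le[of "Y - Z"] unfolding U_def by (simp add: norm_minus_commute)
  ultimately have gY: "L * norm (gap Y) <= L * (e + 4 * U)" unfolding e_def using pos by (intro mult_left_mono) auto
  have pen: "penalty N Z = N * ((e^2)^2 + (tau1^2 + tau2^2))"
   unfolding penalty_def e_def tau1_def tau2_def by (simp add: dot_square_norm distrib_left)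
  have T: "\<Theta> <= L * (e + 4 * U) + sig / 8 + M * (2 * \<bar>r\<bar> + \<bar>s\<bar> + \<bar>q\<bar>) - theta * r^2 - N * Q"
   using A[OF eta(1) Y] gY unfolding \<Theta>_def pen Q_def eta(2) M_def r_def s_def q_def U_def[symmetric] by (simp add: distrib_left)
  have "M * (2 * \<bar>r\<bar> + \<bar>s\<bar> + \<bar>q\<bar>) <= M * (4 * \<bar>r\<bar> + tau1 + tau2 + 4 * U)" using rs M by (intro mult_left_mono) auto
  with T have T: "\<Theta> <= L * (e + 4 * U) + sig / 8 + M * (4 * \<bar>r\<bar> + tau1 + tau2 + 4 * U) - theta * r^2 - N * Q" by linarith
  have sq: "x <= 1 + x^2" for x :: real
  proof -
   have "0 <= (x - 1/2)^2 + 3/4" by simp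
   also have "... = 1 + x^2 - x" by (simp add: power2_eq_square algebra_simps)
   finally show ?thesis by simp
  qed
  have e4: "e <= 1 + (e^2)^2"
  proof (cases "e <= 1")
   case False
   then have "e * 1 <= e * e" "e * e * 1 <= e * e * (e * e)" by (intro mult_left_mono; simp add: mult_ge1_I less_imp_le)+
   then show ?thesis by (simp add: power2_eq_square)
  qed (simp add: add_increasing2)
  have "L * (e + 4 * U) <= L * (5 + ((e^2)^2 + 4 * U^2))" using pos e4 sq[of U] by (intro mult_left_mono) auto
  also have "... <= 5 * L + L * (4 * Q)" unfolding Q_def using pos by (simp add: distrib_left)
  finally have 1: "L * (e + 4 * U) <= 5 * L + 4 * L * Q" by simp
  have "M * (tau1 + tau2 + 4 * U) <= M * (6 + (tau1^2 + tau2^2 + 4 * U^2))" using M sq[of tau1] sq[of tau2] sq[of U] by (intro mult_left_mono) auto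
  also have "... <= 6 * M + M * (4 * Q)" unfolding Q_def using M by (simp add: distrib_left)
  finally have 2: "M * (tau1 + tau2 + 4 * U) <= 6 * M + 4 * M * Q" by simp
  have "0 <= theta * (\<bar>r\<bar> - 2 * M / theta)^2" using pos by simp
  also have "... = theta * r^2 - 4 * (M * \<bar>r\<bar>) + 4 * M^2 / theta" using pos by (simp add: power2_diff power2_eq_square field_simps)
  finally have 3: "4 * (M * \<bar>r\<bar>) - theta * r^2 <= 4 * M^2 / theta" by linarith
  have Q0: "Q >= 0" unfolding Q_def by simp
  have "(4 * L + 4 * M) * Q <= C * Q" using C(2) Q0 by (rule mult_right_mono)
  then have "\<Theta> <= C + C * Q - N * Q" using T 1 2 3 unfolding C_def by (simp add: distrib_left distrib_right)
  then have TC: "\<Theta> <= C - C / rho^4 * Q" unfolding N_def by (simp add: distrib_right)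
  moreover have "0 <= C / rho^4 * Q" using C Q0 by simp
  ultimately have "\<Theta> <= C" by linarith
  moreover have "norm (gap Z) <= 1 & snd (fst Y) < 0 & snd (fst (snd Y)) < 0 & snd (snd (snd Y)) < 0" if big: "sig / 2 <= \<Theta>"
  proof -
   have "0 < \<Theta>" using big pos by linarith
   then have "C / rho^4 * Q < C" using TC by linarith
   then have "Q < rho^4" using C rho by (simp add: field_simps)
   then have Qrho: "Q < (rho^2)^2" by simp
   have rhorho: "rho^2 <= rho" using rho by (simp add: power2_eq_square mult_left_le)
   have small: "x <= rho^2" if "x^2 <= Q" "0 <= x" for x
    using that Qrho by (intro power2_le_imp_le[of x "rho^2"]) auto
   have "U <= rho^2" "e^2 <= rho^2" "tau1 <= rho^2" "tau2 <= rho^2" by (rule small; use nn in "simp add: Q_def")+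
   then have sm: "U <= rho" "e <= rho" "tau1 <= rho" "tau2 <= rho" using rhorho rho power2_le_imp_le[of e rho] by auto
   have "r < 0 & s < 0 & q < 0"
   proof (rule ccontr)
    assume "~ ?thesis"
    then have "r = 0 | s = 0 | q = 0" using neg by linarith
    then have "\<bar>r\<bar> <= 3 * rho" using rs sm rho by auto
    then have "M * (4 * \<bar>r\<bar> + tau1 + tau2 + 4 * U) <= M * (18 * rho)" "L * (e + 4 * U) <= L * (5 * rho)"
     using sm M pos by (intro mult_left_mono; simp)+
    moreover have "0 <= theta * r^2" "0 <= N * Q" using pos N Q0 by auto
    ultimately show False using T rho2 big pos by linarith
   qed
   then show ?thesis using sm rho unfolding r_def s_def q_def e_def by simp
  qed
  ultimately show ?thesis unfolding \<Theta>_def by blast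
 qed
 then show ?thesis using N C(1) by (intro exI[of _ N] conjI exI[of _ C]) auto
qed

definition upper_jet :: "((real^'m) \<times> real => real) => (real^'m) \<times> real => (real^'m) \<times> real => real^'m^'m => bool" where
 "upper_jet a y w M \<longleftrightarrow> (EX C. EX r>0. ALL h s. norm h < r --> \<bar>s\<bar> < r -->
  a (fst y + h, snd y + s) <= a y + snd w * s + fst w \<bullet> h + ((M *v h) \<bullet> h) / 2 + C * s^2)"

lemma continuous_imp_usc_on: "continuous_on S f ==> usc_on S f"
 unfolding usc_on_def continuous_on by (blast intro: order_tendstoD(2))

lemma norm_triple:
 fixes Z :: "'a::real_inner \<times> 'b::real_inner \<times> 'c::real_inner"
 shows "(norm Z)^2 = (norm (fst Z))^2 + (norm (fst (snd Z)))^2 + (norm (snd (snd Z)))^2"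
 unfolding power2_norm_eq_inner by (simp add: inner_prod_def)

lemma inner_triple: "W \<bullet> Z = fst W \<bullet> fst Z + fst (snd W) \<bullet> fst (snd Z) + snd (snd W) \<bullet> snd (snd Z)"
 by (simp add: inner_prod_def)

text \<open>Moving all three times equally leaves the time penalty unchanged; the terms of third and
  fourth order are merged into one cubic error for \<open>contact_quadratic\<close>.\<close>

lemma penalty_rem_scaled:
 assumes N: "0 <= N" and t: "0 < t" "t <= 1" and k: "snd (fst k) = snd (fst (snd k))" "snd (fst k) = snd (snd (snd k))"
 shows "penalty_rem N Z (t *\<^sub>R k) <= N * (6 * (norm (gap Z))^2 * (norm (gap k))^2) * t^2
  + N * (4 * norm (gap Z) * (norm (gap k))^3 + (norm (gap k))^4) * t^3"
proof -
 define d v x where "d = norm (gap Z)" and "v = norm (gap k)" and "x = gap Z \<bullet> gap k"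
 have x: "\<bar>x\<bar> <= d * v" unfolding d_def v_def x_def by (rule Cauchy_Schwarz_ineq2)
 have x2: "x^2 <= d^2 * v^2" using power_mono[OF x, of 2] by (simp add: power_mult_distrib)
 have "x * v^2 <= (d * v) * v^2" using x by (intro mult_right_mono) auto
 then have x3: "t^3 * (x * v^2) <= t^3 * (d * v^3)" using t by (intro mult_left_mono) (auto simp: power2_eq_square power3_eq_cube mult_ac)
 have x4: "t^4 * v^4 <= t^3 * v^4" using t by (intro mult_right_mono power_decreasing) auto
 have "penalty_rem N Z (t *\<^sub>R k) = N * (t^2 * (2 * (d^2 * v^2) + 4 * x^2) + 4 * (t^3 * (x * v^2)) + t^4 * v^4)"
  unfolding penalty_rem_def gap_scale using k
  by (simp add: d_def v_def x_def dot_square_norm power_mult_distrib algebra_simps power2_eq_square power3_eq_cube power4_eq_xxxx)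
 also have "... <= N * (t^2 * (6 * (d^2 * v^2)) + 4 * (t^3 * (d * v^3)) + t^3 * v^4)"
 proof (rule mult_left_mono[OF _ N])
  have "t^2 * (2 * (d^2 * v^2) + 4 * x^2) <= t^2 * (6 * (d^2 * v^2))" using x2 by (intro mult_left_mono) auto
  then show "t^2 * (2 * (d^2 * v^2) + 4 * x^2) + 4 * (t^3 * (x * v^2)) + t^4 * v^4 <= t^2 * (6 * (d^2 * v^2)) + 4 * (t^3 * (d * v^3)) + t^3 * v^4"
   using x3 x4 by linarith
 qed
 finally show ?thesis unfolding d_def v_def by (simp add: algebra_simps)
qed

text \<open>Takes the part of the Crandall-Ishii theorem on sums. The three functions are
  sup-convolved separately, Jensen's perturbation \<open>q\<close> gives a maximum with a
  second-order expansion, this splits into the three variables, and \<open>supconv_jet\<close>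
  carries the pieces back to \<open>Y\<close>. The lower bound \<open>- 2 * N\<close> reflects the
  convexification, the upper one the Hessian of the penalty in a single variable.\<close>

lemma penalized_contact:
 fixes a1 a2 :: "(real^'m) \<times> real => real" and Z0 :: "'m triple"
 assumes usc: "usc_on (UNIV \<times> {..0}) a1" "usc_on (UNIV \<times> {..0}) a2"
  and gr: "!!y. y \<in> UNIV \<times> {..0} ==> a1 y <= C * (1 + norm y)" "!!y. y \<in> UNIV \<times> {..0} ==> a2 y <= C * (1 + norm y)"
  and N: "N > 0" and eta: "eta > 0" and A: "!!Y. A Y = a1 (fst Y) + a2 (fst (snd Y)) + a2 (snd (snd Y))"
  and C2: "!!Y Z. Y \<in> past ==> A Y - N * (norm (Z - Y))^2 - penalty N Z <= C2"
  and Z0: "Z0 \<in> past" "penalty N Z0 = 0"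
 shows "EX Y Z q W M1 M2 M3. Y \<in> past & norm q <= eta & W = penalty_grad N Z + (2 * eta) *\<^sub>R Z + q &
  A Z0 - eta * ((norm Z0)^2 + norm Z0 + 1/2) + eta / 2 * (norm Z)^2 <= A Y - N * (norm (Z - Y))^2 - penalty N Z &
  (snd (fst Y) < 0 --> upper_jet a1 (fst Y) (fst W) M1) &
  (snd (fst (snd Y)) < 0 --> upper_jet a2 (fst (snd Y)) (fst (snd W)) M2) &
  (snd (snd (snd Y)) < 0 --> upper_jet a2 (snd (snd Y)) (snd (snd W)) M3) &
  (ALL M:{M1, M2, M3}. transpose M = M & (ALL h. - (2 * N) * (h \<bullet> h) <= (M *v h) \<bullet> h &
   (M *v h) \<bullet> h <= (48 * N * (norm (gap Z))^2 + 3 * eta) * (h \<bullet> h))) &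
  (ALL h. (M1 *v h) \<bullet> h + (M2 *v h) \<bullet> h + (M3 *v h) \<bullet> h <= 9 * eta * (h \<bullet> h))"
proof -
 let ?S = "UNIV \<times> {..0} :: ((real^'m) \<times> real) set"
 have S: "closed ?S" "(0, 0) \<in> ?S" by (auto intro: closed_Times)
 obtain Y1 where Y1: "is_supconv ?S a1 N Y1" using supconv_exists[OF S usc(1) gr(1) N] by blast
 obtain Y2 where Y2: "is_supconv ?S a2 N Y2" using supconv_exists[OF S usc(2) gr(2) N] by blast
 define G1 G2 where "G1 = supconv_convex a1 N Y1" and "G2 = supconv_convex a2 N Y2"
 define g where "g Z = G1 (fst Z) + (G2 (fst (snd Z)) + G2 (snd (snd Z)))" for Z :: "'m triple"
 \<comment> \<open>\<open>N\<close> undoes the quadratic added by \<open>supconv_convex\<close>;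
   \<open>eta\<close> makes the maximum exist.\<close>
 define psi where "psi Z = penalty N Z + (N + eta) * (Z \<bullet> Z)" for Z :: "'m triple"
 define D where "D Z = penalty_grad N Z + (2 * (N + eta)) *\<^sub>R Z" for Z :: "'m triple"
 define Yf where "Yf Z = (Y1 (fst Z), Y2 (fst (snd Z)), Y2 (snd (snd Z)))" for Z :: "'m triple"
 have Yf: "Yf Z \<in> past" for Z
  using Y1 Y2 unfolding Yf_def past_def is_supconv_def by (blast intro: SigmaI)
 have sub1: "subgradient G1 Z ((2 * N) *\<^sub>R Y1 Z)" for Z unfolding G1_def by (rule supconv_subgradient[OF Y1])
 have sub2: "subgradient G2 Z ((2 * N) *\<^sub>R Y2 Z)" for Z unfolding G2_def by (rule supconv_subgradient[OF Y2])
 have sub: "subgradient g Z ((2 * N) *\<^sub>R Yf Z)" for Z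
  unfolding subgradient_def
 proof
  fix Z'
  show "g Z + ((2 * N) *\<^sub>R Yf Z) \<bullet> (Z' - Z) <= g Z'"
   using sub1[of "fst Z"] sub2[of "fst (snd Z)"] sub2[of "snd (snd Z)"]
   unfolding subgradient_def g_def inner_triple Yf_def by (smt (verit) fst_conv snd_conv fst_diff snd_diff fst_scaleR snd_scaleR)
 qed
 have gY: "g Z = A (Yf Z) - N * (norm (Z - Yf Z))^2 + N * (norm Z)^2" for Z
  unfolding g_def G1_def G2_def supconv_convex_def A norm_triple Yf_def by (simp add: algebra_simps)
 have psie: "psi (Z + H) = psi Z + D Z \<bullet> H + penalty_rem N Z H + (N + eta) * (norm H)^2" for Z H
  unfolding psi_def D_def penalty_expand power2_norm_eq_inner
  by (simp add: inner_add inner_commute algebra_simps del: inner_Pair)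
 obtain q where q: "norm q < eta" "!!Z. (!!Y. g Y - psi Y - q \<bullet> Y <= g Z - psi Z - q \<bullet> Z) ==> EX B. second_order_at g Z (D Z + q) B"
 proof (rule jensen_alexandrov[of g psi D eta])
  show "EX xi. subgradient g Z xi" for Z using sub by blast
  show "EX C r. 0 < r & (ALL H. norm H <= r --> psi (Z + H) <= psi Z + D Z \<bullet> H + C * (norm H)^2)" for Z
  proof (rule exI[of _ "N * (96 * (norm (gap Z))^2 + 256 * norm (gap Z) + 264) + (N + eta)"], rule exI[of _ 1], intro conjI allI impI)
   fix H :: "'m triple" assume "norm H <= 1"
   then show "psi (Z + H) <= psi Z + D Z \<bullet> H + (N * (96 * (norm (gap Z))^2 + 256 * norm (gap Z) + 264) + (N + eta)) * (norm H)^2"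
    using penalty_rem_le[of N H Z] N unfolding psie by (simp add: distrib_right)
  qed simp
  show "D differentiable (at Z)" for Z
   unfolding D_def by (intro differentiable_add penalty_grad_differentiable differentiable_scaleR differentiable_const differentiable_ident)
 qed (use eta in auto)
 define F where "F Z = g Z - psi Z - q \<bullet> Z" for Z
 have qZ: "\<bar>q \<bullet> Z\<bar> <= eta * norm Z" for Z
  using Cauchy_Schwarz_ineq2[of q Z] mult_right_mono[OF less_imp_le[OF q(1)] norm_ge_zero, of Z] by linarith
 have F: "F Z = A (Yf Z) - N * (norm (Z - Yf Z))^2 - penalty N Z - eta * (norm Z)^2 - q \<bullet> Z" for Z
  unfolding F_def gY psi_def power2_norm_eq_inner by (simp add: algebra_simps del: inner_Pair)
 have "continuous_on UNIV g" by (rule convex_on_continuous[OF open_UNIV subgradients_imp_convex]) (use sub in blast)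
 then have "continuous_on UNIV F"
  unfolding F_def psi_def penalty_def gap_def by (intro continuous_intros)
 then have usF: "usc_on UNIV F" by (rule continuous_imp_usc_on)
 obtain R where R: "R >= 0" "!!r. r > R ==> (C2 - F 0) + eta * r - eta * r^2 < 0" using quadratic_dominates[OF eta] by metis
 have "F Z <= F 0" if "R < norm Z" for Z
  using R(2)[OF that] C2[OF Yf[of Z], of Z] qZ[of Z] unfolding F[of Z] by linarith
 from usc_coercive_max[OF closed_UNIV UNIV_I usF this] obtain Z where Z: "!!Y. F Y <= F Z" by blast
 then obtain B where B: "second_order_at g Z (D Z + q) B" using q(2)[of Z] unfolding F_def by blast
 define B1 where "B1 = (%k. fst (B (k, 0)))"
 define B' where "B' = (%k. snd (B (0, k)))"
 define B2 where "B2 = (%k. fst (B' (k, 0)))"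
 define B3 where "B3 = (%k. snd (B' (0, k)))"
 have B': "second_order_at g (fst Z, snd Z) (D Z + q) B" using B by simp
 have so1: "second_order_at G1 (fst Z) (fst (D Z + q)) B1"
  unfolding B1_def by (rule second_order_at_components(1)[OF B' g_def])
 have "second_order_at (%Z. G2 (fst Z) + G2 (snd Z)) (fst (snd Z), snd (snd Z)) (snd (D Z + q)) B'"
  using second_order_at_components(2)[OF B' g_def] unfolding B'_def by simp
 note so2 = second_order_at_components[OF this refl, folded B2_def B3_def]
 define W where "W = penalty_grad N Z + (2 * eta) *\<^sub>R Z + q"
 have DW: "D Z + q - (2 * N) *\<^sub>R Z = W" unfolding D_def W_def by (simp add: algebra_simps)
 define M where "M B = spatial_matrix B + (eta - 2 * N) *\<^sub>R mat 1" for B :: "(real^'m) \<times> real => (real^'m) \<times> real"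
 have lin: "linear B1" "linear B2" "linear B3" using so1 so2 unfolding second_order_at_def by auto
 have MB: "transpose (M B) = M B" "(M B *v h) \<bullet> h = B (h, 0) \<bullet> (h, 0) + (eta - 2 * N) * (h \<bullet> h)" if "linear B" for B h
 proof -
  show "transpose (M B) = M B" using spatial_matrix(1)[OF that] unfolding M_def by (auto simp: transpose_def vec_eq_iff mat_def)
  show "(M B *v h) \<bullet> h = B (h, 0) \<bullet> (h, 0) + (eta - 2 * N) * (h \<bullet> h)"
   unfolding M_def matrix_vector_mult_add_rdistrib inner_add_left spatial_matrix(2)[OF that] by (simp add: scaleR_matrix_vector_assoc[symmetric])
 qed
 have contact: "G1 (fst Z + t *\<^sub>R k1) + G2 (fst (snd Z) + t *\<^sub>R k2) + G2 (snd (snd Z) + t *\<^sub>R k3)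
   <= G1 (fst Z) + G2 (fst (snd Z)) + G2 (snd (snd Z)) + t * (fst (D Z + q) \<bullet> k1 + fst (snd (D Z + q)) \<bullet> k2 + snd (snd (D Z + q)) \<bullet> k3)
    + penalty_rem N Z (t *\<^sub>R (k1, k2, k3)) + (N + eta) * t^2 * (norm (k1, k2, k3))^2" for t k1 k2 k3
 proof -
  let ?H = "t *\<^sub>R (k1, k2, k3)"
  have "g (Z + ?H) <= g Z + (psi (Z + ?H) - psi Z) + q \<bullet> ?H" using Z[of "Z + ?H"] unfolding F_def inner_add_right by linarith
  also have "... = g Z + (D Z + q) \<bullet> ?H + penalty_rem N Z ?H + (N + eta) * (norm ?H)^2"
   unfolding psie inner_add_left by linarith
  also have "(D Z + q) \<bullet> ?H = t * (fst (D Z + q) \<bullet> k1 + fst (snd (D Z + q)) \<bullet> k2 + snd (snd (D Z + q)) \<bullet> k3)"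
   using inner_triple[of "D Z + q" "(k1, k2, k3)"] by (simp only: inner_scaleR_right fst_conv snd_conv)
  also have "(norm ?H)^2 = t^2 * (norm (k1, k2, k3))^2" unfolding norm_scaleR power_mult_distrib by simp
  finally show ?thesis unfolding g_def by (simp add: algebra_simps)
 qed
 have quad: "(B1 k1 \<bullet> k1 + B2 k2 \<bullet> k2 + B3 k3 \<bullet> k3) / 2
   <= 6 * N * (norm (gap Z))^2 * (norm (gap (k1, k2, k3)))^2 + (N + eta) * (norm (k1, k2, k3))^2"
  if k: "snd k1 = snd k2" "snd k1 = snd k3" for k1 k2 k3
 proof (rule contact_quadratic[OF so1 so2, where C = "N * (4 * norm (gap Z) * (norm (gap (k1, k2, k3)))^3 + (norm (gap (k1, k2, k3)))^4)"])
  fix t :: real assume t: "0 < t" "t <= 1"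
  have "penalty_rem N Z (t *\<^sub>R (k1, k2, k3)) <= N * (6 * (norm (gap Z))^2 * (norm (gap (k1, k2, k3)))^2) * t^2
    + N * (4 * norm (gap Z) * (norm (gap (k1, k2, k3)))^3 + (norm (gap (k1, k2, k3)))^4) * t^3"
   by (rule penalty_rem_scaled) (use k N t in auto)
  then show "G1 (fst Z + t *\<^sub>R k1) + G2 (fst (snd Z) + t *\<^sub>R k2) + G2 (snd (snd Z) + t *\<^sub>R k3)
   <= G1 (fst Z) + G2 (fst (snd Z)) + G2 (snd (snd Z)) + t * (fst (D Z + q) \<bullet> k1 + fst (snd (D Z + q)) \<bullet> k2 + snd (snd (D Z + q)) \<bullet> k3)
   + (6 * N * (norm (gap Z))^2 * (norm (gap (k1, k2, k3)))^2 + (N + eta) * (norm (k1, k2, k3))^2) * t^2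
   + N * (4 * norm (gap Z) * (norm (gap (k1, k2, k3)))^3 + (norm (gap (k1, k2, k3)))^4) * t^3"
   using contact[of t k1 k2 k3] by (simp only: distrib_right distrib_left mult_ac)
 qed
 have g4: "(norm (2 *\<^sub>R h))^2 = 4 * (h \<bullet> h)" "(norm (- h))^2 = h \<bullet> h" for h :: "real^'m"
  by (simp_all add: power_mult_distrib dot_square_norm)
 have n3: "(norm ((h1, 0::real), (h2, 0::real), (h3, 0::real)))^2 = h1 \<bullet> h1 + h2 \<bullet> h2 + h3 \<bullet> h3" for h1 h2 h3 :: "real^'m"
  unfolding norm_triple by (simp add: dot_square_norm)
 \<comment> \<open>A common shift does not change the gap, so only \<open>N + eta\<close>
   contributes; three times \<open>eta - 2 * N\<close> added to \<open>6 * (N + eta)\<close> leaves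
   the \<open>9 * eta\<close> of the conclusion.\<close>
 have sumB: "(B1 (h, 0) \<bullet> (h, 0) + B2 (h, 0) \<bullet> (h, 0) + B3 (h, 0) \<bullet> (h, 0)) / 2 <= 3 * (N + eta) * (h \<bullet> h)" for h
 proof -
  have "gap ((h, 0::real), (h, 0::real), (h, 0::real)) = 0" unfolding gap_def by (simp add: scaleR_2)
  then show ?thesis using quad[of "(h, 0)" "(h, 0)" "(h, 0)"] unfolding n3 by (simp add: algebra_simps)
 qed
 have single: "(B1 (h, 0) \<bullet> (h, 0)) / 2 <= (24 * N * (norm (gap Z))^2 + N + eta) * (h \<bullet> h)"
  "(B2 (h, 0) \<bullet> (h, 0)) / 2 <= (24 * N * (norm (gap Z))^2 + N + eta) * (h \<bullet> h)"
  "(B3 (h, 0) \<bullet> (h, 0)) / 2 <= (24 * N * (norm (gap Z))^2 + N + eta) * (h \<bullet> h)" for h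
 proof -
  have gp: "gap ((h, 0::real), (0, 0::real), (0, 0::real)) = 2 *\<^sub>R h" "gap ((0, 0::real), (h, 0::real), (0, 0::real)) = - h"
   "gap ((0, 0::real), (0, 0::real), (h, 0::real)) = - h" unfolding gap_def by simp_all
  have "0 <= N * (norm (gap Z))^2 * (h \<bullet> h)" using N by simp
  then show "(B1 (h, 0) \<bullet> (h, 0)) / 2 <= (24 * N * (norm (gap Z))^2 + N + eta) * (h \<bullet> h)"
   "(B2 (h, 0) \<bullet> (h, 0)) / 2 <= (24 * N * (norm (gap Z))^2 + N + eta) * (h \<bullet> h)"
   "(B3 (h, 0) \<bullet> (h, 0)) / 2 <= (24 * N * (norm (gap Z))^2 + N + eta) * (h \<bullet> h)"
   using quad[of "(h, 0)" "(0, 0)" "(0, 0)"] quad[of "(0, 0)" "(h, 0)" "(0, 0)"] quad[of "(0, 0)" "(0, 0)" "(h, 0)"] lin[THEN linear_0]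
   unfolding n3 gp g4 by (simp_all add: zero_prod_def algebra_simps)
 qed
 have up: "B1 (h, 0) \<bullet> (h, 0) <= 2 * ((24 * N * (norm (gap Z))^2 + N + eta) * (h \<bullet> h))"
  "B2 (h, 0) \<bullet> (h, 0) <= 2 * ((24 * N * (norm (gap Z))^2 + N + eta) * (h \<bullet> h))"
  "B3 (h, 0) \<bullet> (h, 0) <= 2 * ((24 * N * (norm (gap Z))^2 + N + eta) * (h \<bullet> h))" for h
  using single[of h] by linarith+
 have lo: "0 <= B1 (h, 0) \<bullet> (h, 0)" "0 <= B2 (h, 0) \<bullet> (h, 0)" "0 <= B3 (h, 0) \<bullet> (h, 0)" for h
  using second_order_nonneg[OF so1 sub1] second_order_nonneg[OF so2(1) sub2] second_order_nonneg[OF so2(2) sub2] by auto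
 have bnd: "- (2 * N) * (h \<bullet> h) <= b + (eta - 2 * N) * (h \<bullet> h) & b + (eta - 2 * N) * (h \<bullet> h) <= (48 * N * (norm (gap Z))^2 + 3 * eta) * (h \<bullet> h)"
  if "0 <= b" "b <= 2 * ((24 * N * (norm (gap Z))^2 + N + eta) * (h \<bullet> h))" for b and h :: "real^'m"
 proof -
  have "0 <= eta * (h \<bullet> h)" using eta by simp
  then show ?thesis using that by (simp add: algebra_simps)
 qed
 have Mall: "ALL X:{M B1, M B2, M B3}. transpose X = X & (ALL h. - (2 * N) * (h \<bullet> h) <= (X *v h) \<bullet> h &
   (X *v h) \<bullet> h <= (48 * N * (norm (gap Z))^2 + 3 * eta) * (h \<bullet> h))"
  using MB(1)[OF lin(1)] MB(1)[OF lin(2)] MB(1)[OF lin(3)] bnd[OF lo(1) up(1)] bnd[OF lo(2) up(2)] bnd[OF lo(3) up(3)]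
  unfolding MB(2)[OF lin(1)] MB(2)[OF lin(2)] MB(2)[OF lin(3)] ball_simps by (auto simp: MB(2) lin)
 have Msum: "(M B1 *v h) \<bullet> h + (M B2 *v h) \<bullet> h + (M B3 *v h) \<bullet> h <= 9 * eta * (h \<bullet> h)" for h
  using sumB[of h] unfolding MB(2)[OF lin(1)] MB(2)[OF lin(2)] MB(2)[OF lin(3)] by (simp add: algebra_simps)
 have jets: "snd (Y1 (fst Z)) < 0 ==> upper_jet a1 (Y1 (fst Z)) (fst W) (M B1)"
  "snd (Y2 (fst (snd Z))) < 0 ==> upper_jet a2 (Y2 (fst (snd Z))) (fst (snd W)) (M B2)"
  "snd (Y2 (snd (snd Z))) < 0 ==> upper_jet a2 (Y2 (snd (snd Z))) (snd (snd W)) (M B3)"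
  using supconv_jet[OF Y1 so1[unfolded G1_def] _ eta] supconv_jet[OF Y2 so2(1)[unfolded G2_def] _ eta] supconv_jet[OF Y2 so2(2)[unfolded G2_def] _ eta]
  unfolding upper_jet_def M_def DW[symmetric] by (simp_all only: fst_diff snd_diff fst_scaleR snd_scaleR)
 have "A Z0 - eta * (norm Z0)^2 - eta * norm Z0 <= F Z0"
 proof -
  have "fst Z0 \<in> ?S" "fst (snd Z0) \<in> ?S" "snd (snd Z0) \<in> ?S" using Z0(1) unfolding past_def by (auto simp: mem_Times_iff)
  then have "A Z0 + N * (norm Z0)^2 <= g Z0"
   using supconv_convex_ge[OF Y1, of "fst Z0" "fst Z0"] supconv_convex_ge[OF Y2, of "fst (snd Z0)" "fst (snd Z0)"] supconv_convex_ge[OF Y2, of "snd (snd Z0)" "snd (snd Z0)"]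
   unfolding g_def G1_def G2_def A norm_triple[of Z0] by (simp add: distrib_left)
  then show ?thesis using qZ[of Z0] Z0(2) unfolding F_def psi_def power2_norm_eq_inner by (simp add: algebra_simps del: inner_Pair)
 qed
 also have "... <= F Z" by (rule Z)
 also have "... <= A (Yf Z) - N * (norm (Z - Yf Z))^2 - penalty N Z - eta * (norm Z)^2 + eta * norm Z" using qZ[of Z] unfolding F by linarith
 also have "eta * norm Z <= eta * (1/2 + (norm Z)^2 / 2)"
 proof (rule mult_left_mono)
  have "0 <= (norm Z - 1)^2" by simp
  also have "... = (norm Z)^2 - 2 * norm Z + 1" by (simp add: power2_eq_square algebra_simps)
  finally show "norm Z <= 1/2 + (norm Z)^2 / 2" by simp
 qed (use eta in auto)
 finally have "A Z0 - eta * ((norm Z0)^2 + norm Z0 + 1/2) + eta / 2 * (norm Z)^2 <= A (Yf Z) - N * (norm (Z - Yf Z))^2 - penalty N Z"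
  by (simp add: algebra_simps)
 moreover have "norm q <= eta" using q(1) by simp
 moreover have "snd (fst (Yf Z)) < 0 --> upper_jet a1 (fst (Yf Z)) (fst W) (M B1)"
  "snd (fst (snd (Yf Z))) < 0 --> upper_jet a2 (fst (snd (Yf Z))) (fst (snd W)) (M B2)"
  "snd (snd (snd (Yf Z))) < 0 --> upper_jet a2 (snd (snd (Yf Z))) (snd (snd W)) (M B3)"
  using jets unfolding Yf_def fst_conv snd_conv by blast+
 moreover note Yf[of Z] Mall Msum W_def
 ultimately show ?thesis
  by - (rule exI[of _ "Yf Z"], rule exI[of _ Z], rule exI[of _ q], rule exI[of _ W], rule exI[of _ "M B1"], rule exI[of _ "M B2"], rule exI[of _ "M B3"],
   intro conjI allI, assumption+)
qed

text \<open>Undoes the factor \<open>c\<close> and the localisation in time, whose derivative is the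
  term \<open>2 * theta * snd y - gamma\<close>.\<close>

lemma upper_jet_weak_sub:
 fixes u :: "(real^'m) \<times> real => real"
 assumes W: "weak_sub F K u" and c: "c > 0" and y: "snd y < 0" and sym: "transpose M = M"
  and jet: "upper_jet (%z. c * u z - (theta * (snd z)^2 - gamma * snd z)) y w M"
 shows "fst w ~= 0 ==> 0 <= (snd w + 2 * theta * snd y - gamma) / c + F ((1/c) *\<^sub>R M) ((1/c) *\<^sub>R fst w)"
  "0 <= l ==> (!!h. (M *v h) \<bullet> h <= l * (h \<bullet> h)) ==> 0 <= snd w + 2 * theta * snd y - gamma + K * l"
proof -
 obtain C r where r: "r > 0" and le: "!!h s. norm h < r ==> \<bar>s\<bar> < r ==>
  c * u (fst y + h, snd y + s) - (theta * (snd y + s)^2 - gamma * (snd y + s)) <= c * u y - (theta * (snd y)^2 - gamma * snd y) + snd w * s + fst w \<bullet> h + ((M *v h) \<bullet> h) / 2 + C * s^2"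
  using jet unfolding upper_jet_def by auto
 have le': "u (fst y + h, snd y + s) <= u (fst y, snd y) + (snd w + 2 * theta * snd y - gamma) / c * s + ((1/c) *\<^sub>R fst w) \<bullet> h + ((((1/c) *\<^sub>R M) *v h) \<bullet> h) / 2 + ((C + theta) / c) * s^2"
  if "norm h < r" "\<bar>s\<bar> < r" for h s
 proof -
  have "c * u (fst y + h, snd y + s) <= c * u y + (snd w + 2 * theta * snd y - gamma) * s + fst w \<bullet> h + ((M *v h) \<bullet> h) / 2 + (C + theta) * s^2"
   using le[OF that] by (simp add: power2_eq_square algebra_simps)
  then have "u (fst y + h, snd y + s) <= (c * u y + (snd w + 2 * theta * snd y - gamma) * s + fst w \<bullet> h + ((M *v h) \<bullet> h) / 2 + (C + theta) * s^2) / c"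
   using c by (simp add: pos_le_divide_eq mult.commute)
  also have "... = u y + (snd w + 2 * theta * snd y - gamma) / c * s + (fst w \<bullet> h) / c + ((M *v h) \<bullet> h) / (2 * c) + ((C + theta) / c) * s^2"
   using c by (simp add: add_divide_distrib distrib_right)
  finally show ?thesis by (simp add: scaleR_matrix_vector_assoc[symmetric] mult.commute)
 qed
 have sym': "transpose ((1/c) *\<^sub>R M) = (1/c) *\<^sub>R M" using sym by (simp add: transpose_def vec_eq_iff)
 note Q = weak_sub_quadratic[OF W y sym' r le']
 show "0 <= (snd w + 2 * theta * snd y - gamma) / c + F ((1/c) *\<^sub>R M) ((1/c) *\<^sub>R fst w)" if "fst w ~= 0"
  by (rule Q(1)) (use that c in auto)
 show "0 <= snd w + 2 * theta * snd y - gamma + K * l" if l: "0 <= l" "!!h. (M *v h) \<bullet> h <= l * (h \<bullet> h)"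
 proof -
  have "0 <= (snd w + 2 * theta * snd y - gamma) / c + K * (l / c)"
  proof (rule Q(2))
   show "((1/c) *\<^sub>R M *v h) \<bullet> h <= l / c * (h \<bullet> h)" for h
    using divide_right_mono[OF l(2)[of h], of c] c by (simp add: scaleR_matrix_vector_assoc[symmetric])
  qed (use l c in auto)
  also have "... = (snd w + 2 * theta * snd y - gamma + K * l) / c" by (simp add: add_divide_distrib)
  finally show ?thesis using c by (simp add: zero_le_divide_iff)
 qed
qed

text \<open>The comparison principle in a form that also contains convexity in space: taking \<open>x = y\<close> gives
 \<open>w <= v\<close>. A violation is penalised by the fourth power of \<open>2 z - x - y\<close>, which makes the
 Hessians small when this quantity is small, where the operator is singular.\<close>

theorem three_point_comparison:
 fixes w v :: "(real^'m) \<times> real => real"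
 assumes J: "index_set TYPE('m) J" and K: "0 <= K"
  and W: "weak_sub (curv_max J) K w" and V: "weak_sub (%M p. - curv_max J (- M) p) K (%z. - v z)"
  and h: "norm_like c L h0" and w0: "!!x. w (x, 0) <= h0 x" and v0: "!!x. - v (x, 0) <= - h0 x"
  and grw: "upper_growth w" and grv: "upper_growth (%z. - v z)" and t0: "t0 <= 0"
 shows "2 * w ((1/2) *\<^sub>R (x0 + y0), t0) <= v (x0, t0) + v (y0, t0)"
proof (rule ccontr)
 define sig where "sig = 2 * w ((1/2) *\<^sub>R (x0 + y0), t0) - v (x0, t0) - v (y0, t0)"
 assume "~ ?thesis"
 then have sig: "sig > 0" unfolding sig_def by simp
 have "t0 ~= 0"
 proof
  assume "t0 = 0"
  then show False using sig w0[of "(1/2) *\<^sub>R (x0 + y0)"] v0[of x0] v0[of y0] norm_like_midpoint[OF h, of x0 y0] unfolding sig_def by simp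
 qed
 then have t0: "t0 < 0" using t0 by simp
 \<comment> \<open>\<open>theta\<close> confines the maximum in time and \<open>gamma\<close> makes
   the inequality strict. Each costs \<open>sig / 8\<close> at time \<open>t0\<close>.\<close>
 define theta where "theta = sig / (8 * t0^2)"
 define gamma where "gamma = sig / (8 * (- t0))"
 have theta: "theta > 0" "theta * t0^2 = sig / 8" and gamma: "gamma > 0" "gamma * t0 = - (sig / 8)" unfolding theta_def gamma_def using sig t0 by (auto simp: field_simps)
 have L: "0 < L" and hL: "!!x. h0 x <= L * norm x" "!!x. 0 <= h0 x" and hadd: "!!x y. h0 (x + y) <= h0 x + h0 y" and h2: "!!x. h0 (2 *\<^sub>R x) = 2 * h0 x"
  using h unfolding norm_like_def by (blast, blast, meson mult_nonneg_nonneg norm_ge_zero order_trans less_imp_le, blast, simp)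
 have barw: "w (x, r) <= h0 x + L * eta / 2 + (K * L / eta) * (- r)" if "0 < eta" "r <= 0" for x r eta
  by (rule weak_sub_barrier[OF W K grw w0 L norm_like_lipschitz[OF h] that])
 have barv: "- v (x, r) <= - h0 x + L * eta / 2 + (K * L / eta) * (- r)" if "0 < eta" "r <= 0" for x r eta
 proof (rule weak_sub_barrier[OF V K grv v0 L _ that])
  show "- h0 x <= - h0 y + L * norm (x - y)" for x y using norm_like_lipschitz[OF h, of y x] by (simp add: norm_minus_commute)
 qed
 define a1 where "a1 z = 2 * w z - (theta * (snd z)^2 - gamma * snd z)" for z
 define a2 where "a2 z = 1 * (- v z) - (0 * (snd z)^2 - 0 * snd z)" for z :: "(real^'m) \<times> real"
 define A where "A Y = a1 (fst Y) + a2 (fst (snd Y)) + a2 (snd (snd Y))" for Y :: "'m triple"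
 have us: "usc_on (UNIV \<times> {..0}) a1" "usc_on (UNIV \<times> {..0}) a2"
  unfolding a1_def a2_def using W V unfolding weak_sub_def by (intro usc_on_diff_continuous continuous_intros; simp)+
 have a1le: "a1 z <= 2 * h0 (fst z) + L * eta + (K * L / eta) * (2 * \<bar>snd z\<bar>) - theta * (snd z)^2" if "0 < eta" "snd z <= 0" for z eta
  using barw[OF that, of "fst z"] mult_nonneg_nonpos[OF less_imp_le[OF gamma(1)] that(2)] abs_of_nonpos[OF that(2)] unfolding a1_def prod.collapse
  by (simp only: mult.left_commute[of _ 2])
 have a2le: "a2 z <= - h0 (fst z) + L * eta / 2 + (K * L / eta) * \<bar>snd z\<bar>" if "0 < eta" "snd z <= 0" for z eta
  using barv[OF that, of "fst z"] that unfolding a2_def by simp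
 have gr: "a1 z <= (3 * L + 2 * K * L) * (1 + norm z)" "a2 z <= (3 * L + 2 * K * L) * (1 + norm z)" if "z \<in> UNIV \<times> {..0}" for z
 proof -
  have s: "snd z <= 0" using that by (auto simp: mem_Times_iff)
  have n: "norm (fst z) <= norm z" "\<bar>snd z\<bar> <= norm z" using norm_fst_le[of "fst z" "snd z"] norm_snd_le[of "snd z" "fst z"] by auto
  have b: "L * norm (fst z) <= L * norm z" "K * L * \<bar>snd z\<bar> <= K * L * norm z" using n L K by (auto intro!: mult_left_mono)
  have "0 <= theta * (snd z)^2" "0 <= L * norm z" "0 <= K * L" "0 <= K * L * norm z" using theta L K by auto
  moreover have "(3 * L + 2 * K * L) * (1 + norm z) = 3 * L + 2 * (K * L) + 3 * (L * norm z) + 2 * (K * L * norm z)" by (simp add: algebra_simps)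
  moreover have "K * L * (2 * \<bar>snd z\<bar>) = 2 * (K * L * \<bar>snd z\<bar>)" "L * norm (fst z) <= L * norm z" using b by simp_all
  moreover note a1le[of 1 z, OF zero_less_one s] a2le[of 1 z, OF zero_less_one s] hL[of "fst z"]
  ultimately show "a1 z <= (3 * L + 2 * K * L) * (1 + norm z)" "a2 z <= (3 * L + 2 * K * L) * (1 + norm z)"
   using b L unfolding div_by_1 mult_1_right by linarith+
 qed
 have "A Y <= L * norm (gap Y) + 2 * L * eta + (K * L / eta) * (2 * \<bar>snd (fst Y)\<bar> + \<bar>snd (fst (snd Y))\<bar> + \<bar>snd (snd (snd Y))\<bar>) - theta * (snd (fst Y))^2"
  if eta: "0 < eta" and Y: "Y \<in> past" for eta Y
 proof -
  have s: "snd (fst Y) <= 0" "snd (fst (snd Y)) <= 0" "snd (snd (snd Y)) <= 0" using Y unfolding past_def by auto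
  have "2 * h0 (fst (fst Y)) = h0 (gap Y + (fst (fst (snd Y)) + fst (snd (snd Y))))" unfolding h2[symmetric] gap_def by simp
  also have "... <= L * norm (gap Y) + (h0 (fst (fst (snd Y))) + h0 (fst (snd (snd Y))))" by (intro order_trans[OF hadd] add_mono hL hadd)
  finally show ?thesis using a1le[OF eta s(1)] a2le[OF eta s(2)] a2le[OF eta s(3)] unfolding A_def by (simp add: distrib_left)
 qed
 from penalized_estimate[OF sig L theta(1) K this] obtain N C2 where N: "N > 0" "C2 >= 0"
  and C2: "!!Y Z. Y \<in> past ==> A Y - N * (norm (Z - Y))^2 - penalty N Z <= C2"
  and interior: "!!Y Z. Y \<in> past ==> sig / 2 <= A Y - N * (norm (Z - Y))^2 - penalty N Z ==>
   norm (gap Z) <= 1 & snd (fst Y) < 0 & snd (fst (snd Y)) < 0 & snd (snd (snd Y)) < 0" by blast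
 let ?m = "real CARD('m)"
 \<comment> \<open>The threshold for the gap between the two cases: below it the crude terms
   \<open>3 * K * (48 * N * d^2)\<close> stay below \<open>gamma / 4\<close>.\<close>
 define rho where "rho = sqrt (gamma / (4 * (144 * K * N + 1)))"
 have KN: "0 <= 144 * K * N" using K N by simp
 have rho: "rho > 0" "rho^2 = gamma / (4 * (144 * K * N + 1))" unfolding rho_def using gamma KN by (auto intro!: divide_pos_pos)
 have "144 * K * N * rho^2 <= (144 * K * N + 1) * rho^2" by (intro mult_right_mono) auto
 also have "... = gamma / 4" unfolding rho(2) using KN by (simp add: field_simps)
 finally have rhoK: "144 * K * N * rho^2 <= gamma / 4" .
 \<comment> \<open>A lower bound for the penalty gradient \<open>D\<close> once the gap is at least
   \<open>rho\<close>; it is fixed before the perturbation \<open>eta\<close> is chosen.\<close>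
 define delta where "delta = 4 * N * rho^3"
 have delta: "delta > 0" unfolding delta_def using N rho by simp
 define B where "B = 48 * N + 3"
 \<comment> \<open>Collects the coefficients of the errors proportional to \<open>nu\<close> in both
   cases; together they amount to at most \<open>gamma / 2\<close>.\<close>
 define c1 where "c1 = 6 + 9 * ?m + 64 * ?m * B / delta + 9 * K"
 have B: "B > 0" unfolding B_def using N by simp
 have c1: "c1 > 0" unfolding c1_def using B delta K by (auto intro!: add_pos_nonneg)
 define nu where "nu = min (gamma / (2 * c1)) (delta / 4)"
 have nu: "nu > 0" "2 * nu <= delta / 2" unfolding nu_def using gamma c1 delta by auto
 have "nu * c1 <= gamma / (2 * c1) * c1" unfolding nu_def using c1 by (intro mult_right_mono) auto
 then have nuc: "c1 * nu <= gamma / 2" using c1 by (simp add: field_simps)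
 define Z0 :: "'m triple" where "Z0 = (((1/2) *\<^sub>R (x0 + y0), t0), (x0, t0), (y0, t0))"
 define Q where "Q = (norm Z0)^2 + norm Z0 + 1/2"
 have Q: "Q > 0" unfolding Q_def by (simp add: add_nonneg_pos)
 \<comment> \<open>The perturbation is chosen last. It keeps the value at least
   \<open>sig / 2\<close> and, through the coercive term, makes \<open>eta * norm Z\<close> small
   although no bound on \<open>Z\<close> independent of \<open>eta\<close> is available.\<close>
 obtain eta where eta: "0 < eta" "eta < min (min 1 (nu / 2)) (min (nu^2 / (8 * (C2 + 1))) (sig / (4 * Q)))"
  using dense[of 0 "min (min 1 (nu / 2)) (min (nu^2 / (8 * (C2 + 1))) (sig / (4 * Q)))"] nu N(2) sig Q by auto
 have etaQ: "eta * Q <= sig / 4" and etaC: "eta * (8 * (C2 + 1)) <= nu^2"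
  using eta(2) Q N(2) by (auto simp: pos_less_divide_eq mult_ac intro!: less_imp_le)
 have Z0: "Z0 \<in> past" "penalty N Z0 = 0" unfolding Z0_def past_def penalty_def gap_def using t0 by auto
 have "A Z0 = sig - theta * t0^2 + gamma * t0" unfolding A_def a1_def a2_def Z0_def sig_def by simp
 then have AZ0: "A Z0 = 3 * sig / 4" using theta(2) gamma(2) by simp
 obtain Y Z q W' M1 M2 M3 where Y: "Y \<in> past" and q: "norm q <= eta" and W': "W' = penalty_grad N Z + (2 * eta) *\<^sub>R Z + q"
  and val: "A Z0 - eta * ((norm Z0)^2 + norm Z0 + 1/2) + eta / 2 * (norm Z)^2 <= A Y - N * (norm (Z - Y))^2 - penalty N Z"
  and jets: "snd (fst Y) < 0 --> upper_jet a1 (fst Y) (fst W') M1"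
   "snd (fst (snd Y)) < 0 --> upper_jet a2 (fst (snd Y)) (fst (snd W')) M2"
   "snd (snd (snd Y)) < 0 --> upper_jet a2 (snd (snd Y)) (snd (snd W')) M3"
  and M: "ALL M:{M1, M2, M3}. transpose M = M & (ALL h. - (2 * N) * (h \<bullet> h) <= (M *v h) \<bullet> h &
   (M *v h) \<bullet> h <= (48 * N * (norm (gap Z))^2 + 3 * eta) * (h \<bullet> h))"
  and Ms: "ALL h. (M1 *v h) \<bullet> h + (M2 *v h) \<bullet> h + (M3 *v h) \<bullet> h <= 9 * eta * (h \<bullet> h)"
  using penalized_contact[OF us gr N(1) eta(1) A_def C2 Z0] by blast
 have etaZ: "0 <= eta / 2 * (norm Z)^2" using eta by simp
 have val': "sig / 2 + eta / 2 * (norm Z)^2 <= A Y - N * (norm (Z - Y))^2 - penalty N Z"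
  using val etaQ unfolding AZ0 Q_def by linarith
 then have int: "norm (gap Z) <= 1" "snd (fst Y) < 0" "snd (fst (snd Y)) < 0" "snd (snd (snd Y)) < 0"
  using interior[OF Y, of Z] etaZ by linarith+
 have "eta * (norm Z)^2 <= 2 * C2" using val' C2[OF Y, of Z] sig by linarith
 then have "eta * (eta * (norm Z)^2) <= eta * (2 * C2)" using eta by (intro mult_left_mono) auto
 then have "(eta * norm Z)^2 <= eta * (2 * C2)" by (simp add: power2_eq_square mult_ac)
 also have "... <= (nu / 2)^2" using etaC eta(1) by (simp add: power_divide algebra_simps)
 finally have "eta * norm Z <= nu / 2" using nu by (intro power2_le_imp_le[of "eta * norm Z"]) auto
 then have etanu: "eta * norm Z + eta <= nu" "eta <= nu" using eta nu by auto
 have sym: "transpose M1 = M1" "transpose M2 = M2" "transpose M3 = M3" using M by auto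
 note J1 = upper_jet_weak_sub[OF W _ int(2) sym(1) jets(1)[rule_format, OF int(2), unfolded a1_def], simplified]
 note J2 = upper_jet_weak_sub[OF V _ int(3) sym(2) jets(2)[rule_format, OF int(3), unfolded a2_def], simplified]
 note J3 = upper_jet_weak_sub[OF V _ int(4) sym(3) jets(3)[rule_format, OF int(4), unfolded a2_def], simplified]
 have r: "2 * theta * snd (fst Y) <= 0" using theta int(2) by (simp add: mult_le_0_iff)
 \<comment> \<open>The time derivatives of the penalty add up to zero, so only the perturbations
   remain.\<close>
 have times: "snd (fst W') + snd (fst (snd W')) + snd (snd (snd W')) <= 6 * nu"
 proof -
  have "snd (fst W') + snd (fst (snd W')) + snd (snd (snd W'))
   = 2 * (eta * snd (fst Z) + eta * snd (fst (snd Z)) + eta * snd (snd (snd Z))) + (snd (fst q) + snd (fst (snd q)) + snd (snd (snd q)))"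
   unfolding W' penalty_grad_def by (simp add: algebra_simps)
  moreover have "eta * snd (fst Z) <= eta * norm Z" "eta * snd (fst (snd Z)) <= eta * norm Z" "eta * snd (snd (snd Z)) <= eta * norm Z"
   using triple_norms(4-6)[of Z] eta(1) by (auto intro!: mult_left_mono)
  ultimately show ?thesis using triple_norms(4-6)[of q, THEN abs_le_D1] q etanu eta(1) by argo
 qed
 define d where "d = norm (gap Z)"
 have Knu: "K * eta <= K * nu" using etanu K by (intro mult_left_mono) auto
 have m0: "0 <= 9 * ?m * nu" "0 <= 64 * ?m * B / delta * nu" "0 <= 9 * K * nu" using B delta nu K by auto
 show False
 proof (cases "d < rho")
  \<comment> \<open>Small gap: the crude inequalities with the Hessian bound \<open>l\<close>
    contradict the strictness \<open>gamma\<close>.\<close>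
  case True
  define l where "l = 48 * N * d^2 + 3 * eta"
  have l: "0 <= l" unfolding l_def using N eta by simp
  have "0 <= snd (fst W') + 2 * theta * snd (fst Y) - gamma + K * l" by (rule J1(2)[OF l]) (use M in "auto simp: l_def d_def")
  moreover have "0 <= snd (fst (snd W')) + K * l" by (rule J2(2)[OF l]) (use M in "auto simp: l_def d_def")
  moreover have "0 <= snd (snd (snd W')) + K * l" by (rule J3(2)[OF l]) (use M in "auto simp: l_def d_def")
  ultimately have "gamma <= 6 * nu + 3 * (K * l)" using times r by linarith
  moreover have "3 * (K * l) = 144 * K * N * d^2 + 9 * (K * eta)" unfolding l_def by (simp add: algebra_simps)
  moreover have "144 * K * N * d^2 <= 144 * K * N * rho^2" using True KN by (intro mult_left_mono power_mono) (auto simp: d_def)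
  ultimately have "gamma <= 6 * nu + gamma / 4 + 9 * (K * nu)" using rhoK Knu by linarith
  moreover have "6 * nu + 9 * (K * nu) <= c1 * nu" unfolding c1_def using m0 by (simp add: distrib_right)
  ultimately show False using nuc gamma by linarith
 next
  case False
  \<comment> \<open>Up to the perturbations the gradients are \<open>2 *\<^sub>R D\<close>,
    \<open>- D\<close> and \<open>- D\<close>, and \<open>w\<close> is counted twice, so one
    direction serves all three operators.\<close>
  define D where "D = (4 * N * d^2) *\<^sub>R gap Z"
  have "rho^3 <= d^3" using False rho by (intro power_mono) auto
  then have "delta <= 4 * N * d^3" unfolding delta_def using N by simp
  also have "... = norm D" unfolding D_def d_def using N by (simp add: power2_eq_square power3_eq_cube)
  finally have D: "delta <= norm D" .
  then have D0: "D ~= 0" using delta by auto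
  define mu where "mu = 2 * nu"
  have mu: "mu <= norm D / 2" using D nu unfolding mu_def by linarith
  have tri: "norm ((2 * eta) *\<^sub>R a + b) <= mu" if "norm a <= norm Z" "norm b <= norm q" for a b :: "real^'m"
  proof -
   have "norm ((2 * eta) *\<^sub>R a + b) <= 2 * (eta * norm a) + norm b" using norm_triangle_ineq[of "(2 * eta) *\<^sub>R a" b] eta by simp
   moreover have "eta * norm a <= eta * norm Z" using that eta by (intro mult_left_mono) auto
   ultimately show ?thesis using that q etanu eta unfolding mu_def by linarith
  qed
  have pW: "fst (fst W') = 2 *\<^sub>R D + ((2 * eta) *\<^sub>R fst (fst Z) + fst (fst q))"
   "fst (fst (snd W')) = - D + ((2 * eta) *\<^sub>R fst (fst (snd Z)) + fst (fst (snd q)))"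
   "fst (snd (snd W')) = - D + ((2 * eta) *\<^sub>R fst (snd (snd Z)) + fst (snd (snd q)))"
   unfolding W' penalty_grad_def D_def d_def by (simp_all add: dot_square_norm)
  have p1: "norm ((1/2) *\<^sub>R fst (fst W') - D) <= mu"
  proof -
   have "(1/2) *\<^sub>R fst (fst W') - D = (1/2) *\<^sub>R ((2 * eta) *\<^sub>R fst (fst Z) + fst (fst q))" unfolding pW by (simp add: scaleR_add_right)
   then have "norm ((1/2) *\<^sub>R fst (fst W') - D) = (1/2) * norm ((2 * eta) *\<^sub>R fst (fst Z) + fst (fst q))" by simp
   then show ?thesis using tri[OF triple_norms(1) triple_norms(1)] norm_ge_zero[of "(2 * eta) *\<^sub>R fst (fst Z) + fst (fst q)"] by linarith
  qed
  have p23: "norm (fst (fst (snd W')) + D) <= mu" "norm (fst (snd (snd W')) + D) <= mu"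
   unfolding pW using tri[OF triple_norms(2) triple_norms(2)] tri[OF triple_norms(3) triple_norms(3)] by simp_all
  have nz: "fst (fst W') ~= 0" "fst (fst (snd W')) ~= 0" "fst (snd (snd W')) ~= 0"
  proof -
   have nD: "norm D > mu" "norm (- D) > mu" using mu D0 by (simp_all add: le_less_trans[OF mu])
   show "fst (fst W') ~= 0" using p1 nD by (auto simp: algebra_simps)
   show "fst (fst (snd W')) ~= 0" "fst (snd (snd W')) ~= 0" using p23 nD by auto
  qed
  have bd: "norm (X *v h) <= B * norm h" if X: "X \<in> {M1, M2, M3}" for X h
  proof (rule symmetric_norm_bound)
   show "transpose X = X" using M X by blast
   fix h :: "real^'m"
   have "d^2 <= 1" using int(1) unfolding d_def by (simp add: power_le_one)
   then have "N * d^2 <= N * 1" using N(1) by (intro mult_left_mono) auto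
   then have "48 * N * d^2 + 3 * eta <= B" unfolding B_def using eta(2) by simp
   then have "(48 * N * d^2 + 3 * eta) * (h \<bullet> h) <= B * (h \<bullet> h)" by (intro mult_right_mono) auto
   moreover have "2 * N * (h \<bullet> h) <= B * (h \<bullet> h)" unfolding B_def using N by (intro mult_right_mono) auto
   moreover have "- (2 * N) * (h \<bullet> h) <= (X *v h) \<bullet> h" "(X *v h) \<bullet> h <= (48 * N * d^2 + 3 * eta) * (h \<bullet> h)" using M X unfolding d_def by blast+
   ultimately show "\<bar>(X *v h) \<bullet> h\<bar> <= B * (h \<bullet> h)" by simp
  qed
  have sm: "transpose ((1/2) *\<^sub>R M1) = (1/2) *\<^sub>R M1" using sym(1) by (simp add: transpose_def vec_eq_iff)
  have "2 * curv_max J ((1/2) *\<^sub>R M1) ((1/2) *\<^sub>R fst (fst W')) - curv_max J (- M2) (fst (fst (snd W'))) - curv_max J (- M3) (fst (snd (snd W')))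
    <= ?m * (9 * eta + 32 * B * mu / norm D)"
  proof (rule curv_max_three_point[OF J sm sym(2,3) D0 p1 p23 mu])
   show "norm (((1/2) *\<^sub>R M1) *v h) <= B * norm h" for h
    using bd[of M1 h] norm_ge_zero[of "M1 *v h"] by (simp add: scaleR_matrix_vector_assoc[symmetric] del: norm_ge_zero)
   show "2 * (((1/2) *\<^sub>R M1 *v h) \<bullet> h) + (M2 *v h) \<bullet> h + (M3 *v h) \<bullet> h <= 9 * eta * (h \<bullet> h)" for h
    using Ms by (simp add: scaleR_matrix_vector_assoc[symmetric])
  qed (use bd B eta in auto)
  moreover have "?m * (9 * eta + 32 * B * mu / norm D) <= ?m * (9 * nu + 32 * B * mu / delta)"
   using etanu D delta B nu by (intro mult_left_mono add_mono divide_left_mono) (auto simp: mu_def intro!: mult_pos_pos)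
  moreover have "?m * (9 * nu + 32 * B * mu / delta) = 9 * ?m * nu + 64 * ?m * B / delta * nu" unfolding mu_def by (simp add: algebra_simps)
  ultimately have "gamma <= 6 * nu + (9 * ?m * nu + 64 * ?m * B / delta * nu)" using J1(1)[OF nz(1)] J2(1)[OF nz(2)] J3(1)[OF nz(3)] times r by argo
  also have "... <= c1 * nu" unfolding c1_def using m0 by (simp add: distrib_right)
  finally show False using nuc gamma by linarith
 qed
qed

subsection \<open>Viscosity solutions as weak subsolutions\<close>

text \<open>The inequality between \<open>- a\<close> and the upper envelope of \<open>F\<close>,
  with the upper limit spelled out. Unlike those of \<open>at\<close>, the neighbourhoods here
  contain the point \<open>(M, p)\<close>.\<close>

definition near_ineq :: "(real^'m^'m => real^'m => real) => real => real^'m^'m => real^'m => bool" where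
 "near_ineq F a M p \<longleftrightarrow>
  (ALL e>0. EX M' p'. transpose M' = M' & p' ~= 0 & dist (M', p') (M, p) < e & - a - e <= F M' p')"

text \<open>If the nearby argument is \<open>(M, p)\<close> itself, it is replaced by
  \<open>(M, (1 + s) *\<^sub>R p)\<close>, where \<open>F\<close> has the same value by homogeneity;
  so the punctured upper limit loses nothing.\<close>

lemma near_ineq_Limsup:
 assumes hom: "!!M c p. c ~= 0 ==> F M (c *\<^sub>R p) = F M p"
 shows "0 <= ereal a + Limsup (at (M, p) within curv_op_domain) (%(M', p'). ereal (F M' p')) \<longleftrightarrow> near_ineq F a M p"
  (is "0 <= ereal a + ?L \<longleftrightarrow> _")
proof
 assume le: "0 <= ereal a + ?L"
 show "near_ineq F a M p"
  unfolding near_ineq_def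
 proof (intro allI impI, rule ccontr)
  fix e :: real assume e: "e > 0" and no: "~ (EX M' p'. transpose M' = M' & p' ~= 0 & dist (M', p') (M, p) < e & - a - e <= F M' p')"
  have "F M' p' <= - a - e" if "(M', p') \<in> curv_op_domain" "dist (M', p') (M, p) < e" for M' p'
   using no that unfolding curv_op_domain_def by (force simp: not_le)
  then have "?L <= ereal (- a - e)" by (intro Limsup_bounded) (use e in "auto simp: eventually_at intro!: exI[of _ e]")
  then have "ereal a + ?L <= ereal a + ereal (- a - e)" by (rule add_left_mono)
  also have "... = ereal (- e)" by simp
  finally have "0 <= ereal (- e)" using le by (rule order_trans[rotated])
  then show False using e by simp
 qed
next
 assume near: "near_ineq F a M p"
 show "0 <= ereal a + ?L"
 proof (rule ccontr)
  assume "~ ?thesis"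
  then have "?L < ereal (- a)" by (cases ?L) (auto simp: zero_ereal_def)
  then obtain c where c: "?L < ereal c" "c < - a" using ereal_dense2 by fastforce
  from Limsup_lessD[OF c(1)] obtain d where d: "d > 0"
   "!!M' p'. transpose M' = M' ==> p' ~= 0 ==> (M', p') ~= (M, p) ==> dist (M', p') (M, p) < d ==> F M' p' < c"
   unfolding eventually_at curv_op_domain_def by auto
  have "min d (- a - c) > 0" using d c by simp
  then obtain M' p' where M': "transpose M' = M'" "p' ~= 0" "dist (M', p') (M, p) < min d (- a - c)" "- a - min d (- a - c) <= F M' p'"
   using near unfolding near_ineq_def by blast
  have ge: "c <= F M' p'" using M'(4) by linarith
  show False
  proof (cases "(M', p') = (M, p)")
   case False
   then show False using d(2)[OF M'(1,2)] M'(3) ge by auto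
  next
   case True
   define s where "s = d / (2 * norm p)"
   have p: "norm p > 0" using M'(2) True by simp
   have s: "s > 0" "s * norm p = d / 2" unfolding s_def using d p by auto
   have "(1 + s) *\<^sub>R p - p = s *\<^sub>R p" by (simp add: algebra_simps)
   then have "dist ((1 + s) *\<^sub>R p) p = d / 2" using s by (simp add: dist_norm)
   then have "dist (M, (1 + s) *\<^sub>R p) (M, p) < d" "(1 + s) *\<^sub>R p ~= p" using d by (auto simp: dist_Pair_Pair)
   then have "F M ((1 + s) *\<^sub>R p) < c" using d(2)[of M "(1 + s) *\<^sub>R p"] M'(1,2) True s by auto
   then show False using ge True hom[of "1 + s" M p] s by auto
  qed
 qed
qed

lemma curv_op_upper_iff: "0 <= ereal a + curv_op_upper k M p \<longleftrightarrow> near_ineq (curv_max {k}) a M p"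
 using near_ineq_Limsup[of "curv_max {k}" a M p, OF curv_max_scale] unfolding curv_op_upper_def curv_max_single by simp

text \<open>A supersolution \<open>u\<close> is handled as the subsolution \<open>- u\<close>, whose
  test functions have the opposite derivatives; hence all signs are reversed.\<close>

lemma curv_op_lower_iff:
 "ereal a + curv_op_lower k M p <= 0 \<longleftrightarrow> near_ineq (%M p. - curv_max {k} (- M) p) (- a) (- M) (- p)"
proof -
 let ?F = "%M p. - curv_op k M p"
 have "Limsup (at (M, p) within curv_op_domain) (%(M', p'). ereal (?F M' p')) = - curv_op_lower k M p"
  unfolding curv_op_lower_def ereal_Limsup_uminus[symmetric] by (simp add: case_prod_unfold)
 moreover have "0 <= ereal (- a) + - l \<longleftrightarrow> ereal a + l <= 0" for l by (cases l) (auto simp: zero_ereal_def)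
 ultimately have "ereal a + curv_op_lower k M p <= 0 \<longleftrightarrow> near_ineq ?F (- a) M p"
  using near_ineq_Limsup[of ?F "- a" M p] by (simp add: curv_op_scale)
 also have "... \<longleftrightarrow> near_ineq (%M p. - curv_max {k} (- M) p) (- a) (- M) (- p)"
 proof -
  have tr: "transpose (- N) = - N \<longleftrightarrow> transpose N = N" for N :: "real^'a^'a" by (auto simp: transpose_def vec_eq_iff)
  have ds: "dist (- N, - q) (- M, - p) = dist (N, q) (M, p)" for N q by (simp add: dist_Pair_Pair dist_minus)
  have fl: "curv_op k N (- q) = curv_op k N q" for N q using curv_op_scale[of "-1" k N q] by simp
  have *: "(EX N q. P N q) \<longleftrightarrow> (EX N q. P (- N) (- q))" for P :: "real^'a^'a => real^'a => bool" by (metis minus_minus)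
  show ?thesis unfolding near_ineq_def curv_max_single by (subst (2) *) (simp add: tr ds fl)
 qed
 finally show ?thesis .
qed

lemma usc_on_iff:
 fixes f :: "'a::metric_space => real"
 shows "usc_on S f \<longleftrightarrow> (ALL x:S. ALL c>f x. EX d>0. ALL y:S. dist y x < d --> f y < c)"
 unfolding usc_on_def eventually_at by (intro ball_cong refl all_cong ex_cong) auto

lemma usc_on_fst:
 fixes f :: "'a::metric_space => real" and T :: "'b::metric_space set"
 assumes "usc_on S f" shows "usc_on (S \<times> T) (%w. f (fst w))"
 unfolding usc_on_iff
proof (intro ballI allI impI)
 fix w c assume "w \<in> S \<times> T" "f (fst w) < c"
 then obtain d where "d > 0" "!!y. y \<in> S ==> dist y (fst w) < d ==> f y < c" using assms unfolding usc_on_iff by (metis mem_Times_iff)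
 then show "EX d>0. ALL y:S \<times> T. dist y w < d --> f (fst y) < c"
  by (intro exI[of _ d]) (use order.strict_trans1[OF dist_fst_le] in "fastforce simp: mem_Times_iff")
qed

text \<open>A fourth-order error does not affect symmetric second differences. It comes from the
  quartic penalty in one application and is zero in the other, for functions convex in
  space.\<close>

lemma hessian_nonneg:
 fixes y :: "real^'m"
 assumes tf: "test_function phi phit g H" and t: "t < 0" and rho: "rho > 0"
  and le: "!!h. norm h < rho ==> 2 * phi (y, t) - C * (norm h)^4 <= phi (y + h, t) + phi (y - h, t)"
 shows "0 <= (H (y, t) *v h) \<bullet> h"
proof (rule field_le_epsilon)
 fix e :: real assume e: "e > 0"
 define omega where "omega = e / (4 * ((norm h)^2 + 1))"
 have n: "(norm h)^2 + 1 > 0" by (simp add: add_nonneg_pos)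
 have omega: "omega > 0" "2 * omega * (norm h)^2 <= e / 2" unfolding omega_def using e n by (auto simp: field_simps)
 obtain r where r: "r > 0" "!!k. norm k < r ==> phi (y + k, t) <= phi (y, t) + g (y, t) \<bullet> k + ((H (y, t) *v k) \<bullet> k) / 2 + omega * (norm k)^2"
  using test_function_taylor[OF tf t omega(1), of y] by (metis (no_types, opaque_lifting) abs_zero add.right_neutral dist_self mult_zero_right)
 have "((%s. norm (s *\<^sub>R h)) \<longlongrightarrow> norm (0 *\<^sub>R h)) (at_right 0)" "((%s. C * (s^2 * (norm h)^4)) \<longlongrightarrow> C * (0^2 * (norm h)^4)) (at_right 0)"
  by (intro tendsto_intros)+
 then have "\<forall>\<^sub>F s in at_right 0. 0 < s & norm (s *\<^sub>R h) < min rho r & C * (s^2 * (norm h)^4) < e / 2"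
  using rho r(1) e by (intro eventually_conj eventually_at_right_less order_tendstoD(2)) auto
 then obtain s where s: "0 < s" "norm (s *\<^sub>R h) < rho" "norm (s *\<^sub>R h) < r" "C * (s^2 * (norm h)^4) < e / 2"
  by (auto dest!: eventually_happens)
 have "2 * phi (y, t) - C * (norm (s *\<^sub>R h))^4 <= 2 * phi (y, t) + (H (y, t) *v (s *\<^sub>R h)) \<bullet> (s *\<^sub>R h) + 2 * omega * (norm (s *\<^sub>R h))^2"
  using le[OF s(2)] r(2)[OF s(3)] r(2)[of "- (s *\<^sub>R h)"] s(3) by (simp add: linear_neg[OF matrix_vector_mul_linear])
 then have "0 <= s^2 * ((H (y, t) *v h) \<bullet> h + 2 * omega * (norm h)^2 + C * (s^2 * (norm h)^4))"
  by (simp add: power_mult_distrib matrix_vector_mult_scaleR power2_eq_square power4_eq_xxxx algebra_simps)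
 then show "0 <= (H (y, t) *v h) \<bullet> h + e" using s(1,4) omega(2) by (simp add: zero_le_mult_iff)
qed

text \<open>Shared by the sum of the \<open>k\<close> largest eigenvalues, for subsolutions, and by
  that of the \<open>k\<close> smallest, to which supersolutions lead after the change of
  sign.\<close>

locale curvature_operator =
 fixes F :: "real^'m^'m => real^'m => real" and K :: real
 assumes nonneg: "transpose M = M ==> p ~= 0 ==> (!!h. 0 <= (M *v h) \<bullet> h) ==> 0 <= F M p"
  and le: "transpose M = M ==> p ~= 0 ==> 0 <= l ==> (!!h. (M *v h) \<bullet> h <= l * (h \<bullet> h)) ==> F M p <= K * l"
  and continuous: "transpose M = M ==> p ~= 0 ==> 0 < e ==> EX d>0. ALL M' p'. transpose M' = M' --> dist (M', p') (M, p) < d --> \<bar>F M' p' - F M p\<bar> <= e"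
begin

lemma near_ineq_imp:
 assumes near: "near_ineq F a M p" and sym: "transpose M = M"
 shows "p ~= 0 ==> 0 <= a + F M p" "0 <= l ==> (!!h. (M *v h) \<bullet> h <= l * (h \<bullet> h)) ==> 0 <= a + K * l"
proof -
 show "0 <= a + F M p" if p: "p ~= 0"
 proof (rule field_le_epsilon)
  fix e :: real assume e: "e > 0"
  obtain d where d: "d > 0" "!!M' p'. transpose M' = M' ==> dist (M', p') (M, p) < d ==> \<bar>F M' p' - F M p\<bar> <= e / 2"
   using continuous[OF sym p, of "e / 2"] e by auto
  have "min d (e / 2) > 0" using d e by simp
  then obtain M' p' where "transpose M' = M'" "dist (M', p') (M, p) < min d (e / 2)" "- a - min d (e / 2) <= F M' p'"
   using near unfolding near_ineq_def by blast
  then show "0 <= a + F M p + e" using d(2)[of M' p'] unfolding abs_le_iff min_less_iff_conj by linarith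
 qed
 show "0 <= a + K * l" if l: "0 <= l" "!!h. (M *v h) \<bullet> h <= l * (h \<bullet> h)"
 proof (rule field_le_epsilon)
  fix e :: real assume e: "e > 0"
  define d where "d = e / (\<bar>K\<bar> + 1)"
  have d: "d > 0" "(\<bar>K\<bar> + 1) * d = e" unfolding d_def using e by (auto simp: add_nonneg_eq_0_iff)
  then obtain M' p' where M': "transpose M' = M'" "p' ~= 0" "dist (M', p') (M, p) < d" "- a - d <= F M' p'"
   using near unfolding near_ineq_def by blast
  have "norm (M' - M) < d" using M'(3) dist_fst_le[of "(M', p')" "(M, p)"] by (simp add: dist_norm)
  have "F M' p' <= K * (l + d)"
  proof (rule le[OF M'(1,2)])
   fix h
   have "(M' *v h) \<bullet> h = (M *v h) \<bullet> h + ((M' - M) *v h) \<bullet> h" by (simp add: matrix_vector_mult_diff_rdistrib inner_diff_left)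
   moreover have "((M' - M) *v h) \<bullet> h <= d * (h \<bullet> h)"
    using quadratic_form_le[of "M' - M" h] mult_right_mono[OF less_imp_le[OF \<open>norm (M' - M) < d\<close>], of "(norm h)^2"] by (simp add: dot_square_norm)
   ultimately show "(M' *v h) \<bullet> h <= (l + d) * (h \<bullet> h)" using l(2)[of h] by (simp add: distrib_right)
  qed (use l d in auto)
  moreover have "K * d <= \<bar>K\<bar> * d" using d by (intro mult_right_mono) auto
  moreover have "e = \<bar>K\<bar> * d + d" using d(2) by (simp add: distrib_right)
  ultimately show "0 <= a + K * l + e" using M'(4) by (simp add: distrib_left)
 qed
qed

text \<open>The variables are doubled with a quartic penalty, whose Hessian vanishes where its gradient does.
 If the penalty vanishes at the maximum, then the test function has a nonnegative time derivative and a
 nonnegative Hessian there; otherwise its gradient does not vanish there.\<close>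

lemma weak_sub_imp_near_ineq:
 fixes u :: "(real^'m) \<times> real => real" and x0 :: "real^'m"
 assumes W: "weak_sub F K' u" and tf: "test_function phi phit g H" and t0: "t0 < 0"
  and max: "\<forall>\<^sub>F z in nhds (x0, t0). u z - phi z <= u (x0, t0) - phi (x0, t0)"
 shows "near_ineq F (phit (x0, t0)) (H (x0, t0)) (g (x0, t0))"
proof (rule strictify_test_function[OF tf t0 max])
 let ?z0 = "(x0, t0)"
 fix phi' phit' g' H' r
 assume tf': "test_function phi' phit' g' H'" and same: "phit' ?z0 = phit ?z0" "g' ?z0 = g ?z0" "H' ?z0 = H ?z0"
  and r: "r > 0" "!!z. dist z ?z0 < r ==> u z - phi' z <= u ?z0 - phi' ?z0 - strict_bump ?z0 z"
 show ?thesis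
  unfolding near_ineq_def same[symmetric]
 proof (intro allI impI)
  fix e :: real assume e: "e > 0"
  obtain r' where r': "r' > 0" "!!z. dist z ?z0 < r' ==> snd z < 0 & transpose (H' z) = H' z & \<bar>phit' z - phit' ?z0\<bar> < e/4 &
    norm (g' z - g' ?z0) < e/4 & norm (H' z - H' ?z0) < e/4"
   using test_function_near[OF tf' t0, of "e/4"] e by auto
  define rho where "rho = min r r' / 2"
  have rho: "rho > 0" "rho < r" "rho < r'" unfolding rho_def using r r' by auto
  let ?B = "cball ?z0 rho"
  have Bneg: "snd z < 0" if "z \<in> ?B" for z using r'(2)[of z] that rho by (auto simp: dist_commute)
  have cphi: "continuous_on ?B phi'"
   by (rule continuous_on_subset[OF test_function_continuous[OF tf']]) (use Bneg in "auto simp: mem_Times_iff")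
  obtain C where C: "!!z. z \<in> ?B ==> \<bar>phi' z\<bar> <= C"
   using compact_imp_bounded[OF compact_continuous_image[OF cphi compact_cball]] unfolding bounded_iff by (auto simp: Ball_def simp del: mem_cball)
  \<comment> \<open>A value of the bump below \<open>beta\<close> puts both the spatial and the time
    coordinate within \<open>rho / 4\<close> of the centre.\<close>
  define beta where "beta = min ((rho/4)^4) ((rho/4)^2)"
  have beta: "beta > 0" unfolding beta_def using rho by simp
  have bump: "dist z ?z0 < rho / 2" if "strict_bump ?z0 z < beta" for z
  proof -
   have "(norm (fst z - x0))^4 + \<bar>snd z - t0\<bar>^2 < beta" using that unfolding strict_bump_def dot_square_norm by simp
   moreover have "0 <= (norm (fst z - x0))^4" "0 <= \<bar>snd z - t0\<bar>^2" by simp_all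
   ultimately have pw: "(norm (fst z - x0))^4 < (rho/4)^4" "\<bar>snd z - t0\<bar>^2 < (rho/4)^2" unfolding beta_def by linarith+
   have "norm (fst z - x0) < rho/4" by (rule power_less_imp_less_base[OF pw(1)]) (use rho in simp)
   moreover have "\<bar>snd z - t0\<bar> < rho/4" by (rule power_less_imp_less_base[OF pw(2)]) (use rho in simp)
   ultimately show ?thesis using norm_Pair_le[of "fst z - x0" "snd z - t0"] by (cases z) (auto simp: dist_norm)
  qed
  obtain delta where delta: "delta > 0" "!!z z'. z \<in> ?B ==> z' \<in> ?B ==> dist z' z < delta ==> \<bar>phi' z' - phi' z\<bar> < beta"
   using compact_uniformly_continuous[OF cphi compact_cball] beta unfolding uniformly_continuous_on_def dist_real_def by metis
  define mu where "mu = min delta (rho/2)"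
  have mu: "mu > 0" "mu <= delta" "mu <= rho/2" unfolding mu_def using delta rho by auto
  \<comment> \<open>The oscillation of \<open>phi'\<close> on the ball is at most twice the modulus
    of \<open>C\<close>, so the penalty forces \<open>norm a < mu\<close> at the maximum.\<close>
  define N where "N = (2 * \<bar>C\<bar> + 1) / mu^4"
  have N: "N > 0" "N * mu^4 = 2 * \<bar>C\<bar> + 1" unfolding N_def using mu by (auto intro!: divide_pos_pos)
  define K0 where "K0 = cball ?z0 (rho/2) \<times> cball (0::real^'m) (rho/2)"
  define P where "P w = phi' (fst (fst w) - snd w, snd (fst w)) + N * ((snd w) \<bullet> (snd w))^2" for w :: "((real^'m) \<times> real) \<times> (real^'m)"
  have shB: "(fst (fst w) - snd w, snd (fst w)) \<in> ?B" if "w \<in> K0" for w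
  proof -
   have "(fst (fst w) - snd w, snd (fst w)) - ?z0 = (fst w - ?z0) - (snd w, 0)" by (auto simp: prod_eq_iff)
   then have "norm ((fst (fst w) - snd w, snd (fst w)) - ?z0) <= norm (fst w - ?z0) + norm (snd w, 0::real)" using norm_triangle_ineq4 by metis
   moreover have "norm (fst w - ?z0) <= rho/2" "norm (snd w, 0::real) <= rho/2"
    using that unfolding K0_def by (auto simp: dist_norm norm_minus_commute mem_Times_iff norm_Pair)
   ultimately show ?thesis unfolding mem_cball dist_norm norm_minus_commute[of ?z0] by linarith
  qed
  have K0: "compact K0" "(?z0, 0) \<in> K0" "fst w \<in> ?B" if "w \<in> K0" for w
   using that rho unfolding K0_def by (auto intro: compact_Times)
  have Kz: "compact K0" "(?z0, 0) \<in> K0" unfolding K0_def using rho by (auto intro: compact_Times)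
  have "continuous_on K0 (%w. phi' (fst (fst w) - snd w, snd (fst w)))"
   by (rule continuous_on_compose2[OF cphi]) (use shB in "auto intro!: continuous_intros")
  then have cP: "continuous_on K0 P" unfolding P_def by (intro continuous_intros)
  have "cball ?z0 (rho/2) <= UNIV \<times> {..0}"
  proof
   fix z assume "z \<in> cball ?z0 (rho/2)"
   then have "snd z < 0" using rho by (intro Bneg) simp
   then show "z \<in> UNIV \<times> {..0}" by (simp add: mem_Times_iff)
  qed
  with W have "usc_on (cball ?z0 (rho/2)) u" unfolding weak_sub_def by (blast intro: usc_on_subset)
  then have "usc_on K0 (%w. u (fst w))" unfolding K0_def by (rule usc_on_fst)
  then have "usc_on K0 (%w. 1 * u (fst w) - P w)" by (rule usc_on_diff_continuous[OF _ cP]) simp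
  from usc_attains_max[OF Kz(1) _ this order_refl] Kz(2) obtain w where w: "w \<in> K0" "!!v. v \<in> K0 ==> u (fst v) - P v <= u (fst w) - P w" by force
  obtain x t a where wx: "w = ((x, t), a)" by (metis prod.exhaust)
  let ?y = "x - a"
  have z: "(x, t) \<in> ?B" "(?y, t) \<in> ?B" using K0(3)[OF w(1)] shB[OF w(1)] unfolding wx by auto
  have t: "t < 0" using Bneg[OF z(1)] by simp
  have Pw: "P w = phi' (?y, t) + N * (norm a)^4" unfolding P_def wx by (simp add: dot_square_norm)
  have "u ?z0 - phi' ?z0 <= u (x, t) - P w" using w(2)[OF Kz(2)] unfolding P_def wx by simp
  moreover have "u (x, t) - phi' (x, t) <= u ?z0 - phi' ?z0 - strict_bump ?z0 (x, t)" using z(1) rho by (intro r(2)) (auto simp: dist_commute)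
  ultimately have key: "strict_bump ?z0 (x, t) + N * (norm a)^4 <= phi' (x, t) - phi' (?y, t)" unfolding Pw by linarith
  have b0: "0 <= strict_bump ?z0 (x, t)" unfolding strict_bump_def by simp
  have "N * (norm a)^4 < N * mu^4" using key b0 C[OF z(1)] C[OF z(2)] unfolding N(2) by linarith
  then have "(norm a)^4 < mu^4" using N(1) by simp
  then have a: "norm a < mu" using mu by (auto intro: power_less_imp_less_base)
  have "dist (?y, t) (x, t) < delta" using a mu by (simp add: dist_Pair_Pair dist_norm)
  then have "\<bar>phi' (?y, t) - phi' (x, t)\<bar> < beta" by (rule delta(2)[OF z])
  moreover have "0 <= N * (norm a)^4" using N by simp
  ultimately have "strict_bump ?z0 (x, t) < beta" using key by linarith
  then have xin: "dist (x, t) ?z0 < rho/2" by (rule bump)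
  have evx: "\<forall>\<^sub>F z in nhds (x, t). z \<in> ball ?z0 (rho/2)" using xin by (intro eventually_nhds_in_open) (auto simp: dist_commute)
  have y: "snd (?y, t) < 0" "transpose (H' (?y, t)) = H' (?y, t)" "\<bar>phit' (?y, t) - phit' ?z0\<bar> < e/4" "norm (g' (?y, t) - g' ?z0) < e/4" "norm (H' (?y, t) - H' ?z0) < e/4"
   using r'(2)[of "(?y, t)"] z(2) rho by (auto simp: dist_commute)
  have conclude: "EX M' p'. transpose M' = M' & p' ~= 0 & dist (M', p') (H' ?z0, g' ?z0) < e & - phit' ?z0 - e <= F M' p'"
   if p': "p' ~= 0" "norm (p' - g' (?y, t)) < e/4" "- phit' (?y, t) <= F (H' (?y, t)) p'" for p'
  proof (intro exI conjI)
   have "norm (p' - g' ?z0) <= norm (p' - g' (?y, t)) + norm (g' (?y, t) - g' ?z0)" using norm_triangle_ineq[of "p' - g' (?y, t)" "g' (?y, t) - g' ?z0"] by simp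
   then show "dist (H' (?y, t), p') (H' ?z0, g' ?z0) < e"
    using norm_Pair_le[of "H' (?y, t) - H' ?z0" "p' - g' ?z0"] y(4,5) p'(2) e unfolding dist_norm diff_Pair by linarith
   show "- phit' ?z0 - e <= F (H' (?y, t)) p'" using p'(3) y(3) e by linarith
  qed (use y p' in auto)
  show "EX M' p'. transpose M' = M' & p' ~= 0 & dist (M', p') (H' ?z0, g' ?z0) < e & - phit' ?z0 - e <= F M' p'"
  proof (cases "a = 0")
   case False
   \<comment> \<open>Maximality in \<open>a\<close> at fixed \<open>(x, t)\<close> balances the
     gradient of \<open>phi'\<close> against that of the penalty, which is not zero for nonzero
     \<open>a\<close>.\<close>
   have "g' (?y, t) ~= 0"
   proof
    assume g0: "g' (?y, t) = 0"
    let ?q = "%b. phi' (x - b, t) + N * (b \<bullet> b)^2"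
    have "((%y. phi' (y, t)) has_derivative (%h. g' (?y, t) \<bullet> h)) (at ?y)" using tf' t unfolding test_function_def by blast
    then have "((%b. phi' (x - b, t)) has_derivative (%h. g' (?y, t) \<bullet> (0 - h))) (at a)"
     by (rule has_derivative_compose[rotated]) (intro derivative_intros)
    then have "(?q has_derivative (%h. N * (4 * (a \<bullet> a) * (a \<bullet> h)))) (at a)"
     unfolding g0 by (auto intro!: derivative_eq_intros simp: inner_commute algebra_simps)
    moreover have "?q a <= ?q b" if "b \<in> ball 0 (rho/2)" for b
    proof -
     have "((x, t), b) \<in> K0" using w(1) that unfolding K0_def wx by auto
     from w(2)[OF this] show ?thesis unfolding P_def wx by simp
    qed
    ultimately have "(%h. N * (4 * (a \<bullet> a) * (a \<bullet> h))) = (%h. 0)"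
     using a mu by (intro differential_zero_maxmin[where S = "ball 0 (rho/2)" and f = ?q and x = a]) auto
    from fun_cong[OF this, of a] show False using N False by simp
   qed
   moreover have "\<forall>\<^sub>F z in nhds (x, t). u z - phi' (fst z - a, snd z) <= u (x, t) - phi' (fst (x, t) - a, snd (x, t))"
    using evx
   proof eventually_elim
    case (elim z)
    then have "(z, a) \<in> K0" using w(1) unfolding K0_def wx by auto
    from w(2)[OF this] show ?case unfolding P_def wx by simp
   qed
   ultimately have "0 <= phit' (?y, t) + F (H' (?y, t)) (g' (?y, t))"
    using weak_subD(1)[OF W test_function_shift[OF tf'] t] by simp
   then show ?thesis using \<open>g' (?y, t) ~= 0\<close> e by (intro conclude[of "g' (?y, t)"]) auto
  next
   case True
   have mx: "u z - (phi' (x', snd z) + N * ((fst z - x') \<bullet> (fst z - x'))^2) <= u (x, t) - phi' (x, t)"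
    if "dist z ?z0 < rho/2" "dist (fst z) x' <= rho/2" for z x'
   proof -
    have "(z, fst z - x') \<in> K0" using that unfolding K0_def by (auto simp: dist_commute dist_norm)
    from w(2)[OF this] show ?thesis unfolding P_def wx True by simp
   qed
   \<comment> \<open>With the second point fixed at \<open>x\<close>, the competing function has
     zero gradient and Hessian at \<open>x\<close>; the crude inequality with \<open>l = 0\<close>
     then gives the sign of \<open>phit'\<close>.\<close>
   note tq = test_function_add[OF test_function_section[OF tf', of x] test_function_quartic[of N x]]
   have "\<forall>\<^sub>F z in nhds (x, t). z \<in> ball (x, t) (rho/2)" using rho by (intro eventually_nhds_in_open) auto
   with evx have "\<forall>\<^sub>F z in nhds (x, t). u z - (phi' (x, snd z) + N * ((fst z - x) \<bullet> (fst z - x))^2)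
     <= u (x, t) - (phi' (x, snd (x, t)) + N * ((fst (x, t) - x) \<bullet> (fst (x, t) - x))^2)"
   proof eventually_elim
    case (elim z)
    have "dist (fst z) x <= rho/2" using elim(2) dist_fst_le[of "(x, t)" z] by (auto simp: dist_commute)
    then show ?case using mx[of z x] elim(1) by (simp add: dist_commute)
   qed
   from weak_subD(2)[OF W tq t this, of 0] have pt: "0 <= phit' (x, t)" by (simp add: outer_matrix_mult scaleR_matrix_vector_assoc[symmetric])
   have psd: "0 <= (H' (x, t) *v h) \<bullet> h" for h
   proof (rule hessian_nonneg[OF tf' t, of "rho/2" x "2 * N"])
    fix h :: "real^'m" assume h: "norm h < rho/2"
    have "dist (fst (x, t)) (x + h) <= rho/2" "dist (fst (x, t)) (x - h) <= rho/2" using h by (simp_all add: dist_norm)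
    from mx[OF xin this(1)] mx[OF xin this(2)]
    show "2 * phi' (x, t) - 2 * N * (norm h)^4 <= phi' (x + h, t) + phi' (x - h, t)" by (simp add: dot_square_norm)
   qed (use rho in auto)
   \<comment> \<open>The envelope admits nonzero vectors only; a short arbitrary one replaces a
     vanishing gradient, since \<open>F\<close> is nonnegative on nonnegative matrices whatever the
     direction.\<close>
   obtain p' where p': "p' ~= 0" "norm (p' - g' (?y, t)) < e/4"
   proof (cases "g' (?y, t) = 0")
    case True
    have "norm ((e/8) *\<^sub>R axis undefined 1 :: real^'m) = e/8" using e by simp
    then show ?thesis using e True by (intro that[of "(e/8) *\<^sub>R axis undefined 1"]) (auto simp: axis_eq_0_iff)
   qed (use e that[of "g' (?y, t)"] in auto)
   have "0 <= F (H' (?y, t)) p'" using psd y(2) unfolding True by (intro nonneg p'(1)) auto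
   then show ?thesis using pt unfolding True by (intro conclude[OF p', unfolded True]) auto
  qed
 qed
qed

end

lemma curvature_operator_curv_op:
 assumes k: "k <= CARD('m::finite) - 1"
 shows "curvature_operator (curv_max {k} :: real^'m^'m => _) (real CARD('m))"
  "curvature_operator (%M p. - curv_max {k} (- M :: real^'m^'m) p) (real CARD('m))"
proof -
 have J: "index_set TYPE('m) {k}" using k unfolding index_set_def by simp
 have neg: "(- B) *v v = - (B *v v)" for B :: "real^'m^'m" and v by (simp add: matrix_vector_mult_def vec_eq_iff sum_negf)
 have tneg: "transpose (- B) = - B" if "transpose B = B" for B :: "real^'m^'m" using that by (simp add: transpose_def vec_eq_iff)
 have cont: "EX d>0. ALL M' p'. transpose M' = M' --> dist (M', p') (M, p) < d --> \<bar>curv_max {k} M' p' - curv_max {k} M p\<bar> <= e"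
  if "transpose M = M" "p ~= 0" "0 < e" for M :: "real^'m^'m" and p e
 proof (rule curv_max_continuous[OF J that])
  fix d assume d: "d > 0" "!!M' p'. transpose M' = M' ==> norm (M' - M) < d ==> norm (p' - p) < d ==> \<bar>curv_max {k} M' p' - curv_max {k} M p\<bar> <= e & p' ~= 0"
  have "norm (M' - M) <= dist (M', p') (M, p)" "norm (p' - p) <= dist (M', p') (M, p)" for M' p'
   using dist_fst_le[of "(M', p')" "(M, p)"] dist_snd_le[of "(M', p')" "(M, p)"] by (simp_all add: dist_norm)
  with d show ?thesis by (meson le_less_trans)
 qed
 show "curvature_operator (curv_max {k} :: real^'m^'m => _) (real CARD('m))"
 proof
  show "0 <= curv_max {k} M p" if "transpose M = M" "p ~= 0" "!!h. 0 <= (M *v h) \<bullet> h" for M :: "real^'m^'m" and p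
   using curv_max_ge_neg[OF J that(1,2), of 0] that(3) by simp
 qed (use curv_max_le[OF J] cont in auto)
 show "curvature_operator (%M p. - curv_max {k} (- M :: real^'m^'m) p) (real CARD('m))"
 proof
  show "0 <= - curv_max {k} (- M) p" if "transpose M = M" "p ~= 0" "!!h. 0 <= (M *v h) \<bullet> h" for M :: "real^'m^'m" and p
   using curv_max_le[OF J tneg[OF that(1)] that(2), of 0] that(3) by (simp add: neg)
  show "- curv_max {k} (- M) p <= real CARD('m) * l" if "transpose M = M" "p ~= 0" "0 <= l" "!!h. (M *v h) \<bullet> h <= l * (h \<bullet> h)" for M :: "real^'m^'m" and p l
   using curv_max_ge_neg[OF J tneg[OF that(1)] that(2,3)] that(4) by (simp add: neg)
  show "EX d>0. ALL M' p'. transpose M' = M' --> dist (M', p') (M, p) < d --> \<bar>- curv_max {k} (- M') p' - - curv_max {k} (- M) p\<bar> <= e"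
   if M: "transpose M = M" "p ~= 0" "0 < e" for M :: "real^'m^'m" and p e
  proof -
   obtain d where d: "d > 0" "!!M' p'. transpose M' = M' ==> dist (M', p') (- M, p) < d ==> \<bar>curv_max {k} M' p' - curv_max {k} (- M) p\<bar> <= e"
    using cont[OF tneg[OF M(1)] M(2,3)] by metis
   have "\<bar>- curv_max {k} (- M') p' - - curv_max {k} (- M) p\<bar> <= e" if "transpose M' = M'" "dist (M', p') (M, p) < d" for M' p'
    using d(2)[OF tneg[OF that(1)], of p'] that(2) by (simp add: dist_Pair_Pair dist_minus)
   with d(1) show ?thesis by blast
  qed
 qed
qed

lemma test_function_uminus:
 assumes tf: "test_function phi phit g H" shows "test_function (%z. - phi z) (%z. - phit z) (%z. - g z) (%z. - H z)"
proof -
 have neg: "(- B) *v v = - (B *v v)" for B :: "real^'m^'m" and v by (simp add: matrix_vector_mult_def vec_eq_iff sum_negf)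
 have d: "((%s. phi (x, s)) has_real_derivative phit (x, t)) (at t)" "((%y. phi (y, t)) has_derivative (%h. g (x, t) \<bullet> h)) (at x)"
  "((%y. g (y, t)) has_derivative (%h. H (x, t) *v h)) (at x)" if "t < 0" for x t
  using tf that unfolding test_function_def by blast+
 have n: "((%y. - phi (y, t)) has_derivative (%h. (- g (x, t)) \<bullet> h)) (at x)" "((%y. - g (y, t)) has_derivative (%h. (- H (x, t)) *v h)) (at x)"
  if "t < 0" for x t
  by (rule has_derivative_eq_rhs[OF has_derivative_minus[OF d(2)[OF that]]] has_derivative_eq_rhs[OF has_derivative_minus[OF d(3)[OF that]]]; simp add: fun_eq_iff neg)+
 have c: "continuous_on (UNIV \<times> {..<0}) (%z. - phit z)" "continuous_on (UNIV \<times> {..<0}) (%z. - g z)" "continuous_on (UNIV \<times> {..<0}) (%z. - H z)"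
  using tf unfolding test_function_def by (blast intro: continuous_on_minus)+
 show ?thesis unfolding test_function_def by (intro conjI allI impI c n DERIV_minus d)
qed

text \<open>The same notion arises for every \<open>K\<close> that is at least the dimension: the
  weak property implies the envelope inequality, and this implies the weak property with the
  constant \<open>CARD('m)\<close>. So the crude constant of the game may be enlarged
  freely.\<close>

theorem viscosity_solution_iff_weak_sub:
 fixes u :: "(real^'m) \<times> real => real"
 assumes k: "k <= CARD('m) - 1" and K: "real CARD('m) <= K"
 shows "viscosity_solution k u \<longleftrightarrow>
  weak_sub (curv_max {k}) K u & weak_sub (%M p. - curv_max {k} (- M) p) K (%z. - u z)"
proof -
 have iff: "weak_sub F K u \<longleftrightarrow> usc_on (UNIV \<times> {..0}) u & (ALL phi phit g H x t.
    test_function phi phit g H & t < 0 & (\<forall>\<^sub>F z in nhds (x, t). u z - phi z <= u (x, t) - phi (x, t)) -->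
    near_ineq F (phit (x, t)) (H (x, t)) (g (x, t)))" (is "_ \<longleftrightarrow> ?R")
  if F: "curvature_operator F (real CARD('m))" for F and u :: "(real^'m) \<times> real => real"
 proof
  assume "weak_sub F K u"
  then show ?R using curvature_operator.weak_sub_imp_near_ineq[OF F, of K u] weak_sub_def[of F K u] by blast
 next
  assume R: ?R
  have "weak_sub F (real CARD('m)) u"
   unfolding weak_sub_def
  proof (intro conjI allI impI)
   show "usc_on (UNIV \<times> {..0}) u" using R by blast
   fix phi phit g H x t assume A: "test_function phi phit g H & t < 0 & (\<forall>\<^sub>F z in nhds (x, t). u z - phi z <= u (x, t) - phi (x, t))"
   then have ni: "near_ineq F (phit (x, t)) (H (x, t)) (g (x, t))" using R by blast
   have sym: "transpose (H (x, t)) = H (x, t)" using test_function_symmetric A by blast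
   show "0 <= phit (x, t) + F (H (x, t)) (g (x, t))" if "g (x, t) ~= 0"
    by (rule curvature_operator.near_ineq_imp(1)[OF F ni sym that])
   show "0 <= phit (x, t) + real CARD('m) * l" if "0 <= l" "ALL h. (H (x, t) *v h) \<bullet> h <= l * (h \<bullet> h)" for l
    by (rule curvature_operator.near_ineq_imp(2)[OF F ni sym that(1)]) (use that(2) in blast)
  qed
  then show "weak_sub F K u" using K by (rule weak_sub_mono_const)
 qed
 have sub: "viscosity_subsolution k u \<longleftrightarrow> weak_sub (curv_max {k}) K u"
  unfolding viscosity_subsolution_def iff[OF curvature_operator_curv_op(1)[OF k]] curv_op_upper_iff ..
 have usc: "lsc_on (UNIV \<times> {..0}) u \<longleftrightarrow> usc_on (UNIV \<times> {..0}) (%z. - u z)"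
 proof -
  have "(ALL c<u x. \<forall>\<^sub>F y in G. c < u y) \<longleftrightarrow> (ALL c>- u x. \<forall>\<^sub>F y in G. - u y < c)" for x G
  proof (intro iffI allI impI)
   fix c assume "ALL c<u x. \<forall>\<^sub>F y in G. c < u y" "- u x < c"
   then show "\<forall>\<^sub>F y in G. - u y < c" by (auto dest!: spec[of _ "- c"] simp: minus_less_iff)
  next
   fix c assume "ALL c>- u x. \<forall>\<^sub>F y in G. - u y < c" "c < u x"
   then show "\<forall>\<^sub>F y in G. c < u y" by (auto dest!: spec[of _ "- c"])
  qed
  then show ?thesis unfolding lsc_on_def usc_on_def by simp
 qed
 have touch: "(ALL phi phit g H x t. test_function phi phit g H & t < 0 & (\<forall>\<^sub>F z in nhds (x, t). u z - phi z >= u (x, t) - phi (x, t)) -->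
    near_ineq F (- phit (x, t)) (- H (x, t)) (- g (x, t))) \<longleftrightarrow>
  (ALL phi phit g H x t. test_function phi phit g H & t < 0 & (\<forall>\<^sub>F z in nhds (x, t). - u z - phi z <= - u (x, t) - phi (x, t)) -->
    near_ineq F (phit (x, t)) (H (x, t)) (g (x, t)))" (is "?A \<longleftrightarrow> ?B") for F
 proof (intro iffI allI impI; elim conjE)
  fix phi phit g H x t
  assume tf: "test_function phi phit g H" and t: "t < (0::real)" and ev: "\<forall>\<^sub>F z in nhds (x, t). - u z - phi z <= - u (x, t) - phi (x, t)" and ?A
  from this(4)[rule_format, OF conjI[OF test_function_uminus[OF tf] conjI[OF t]], of x]
  show "near_ineq F (phit (x, t)) (H (x, t)) (g (x, t))" using ev by (simp add: algebra_simps)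
 next
  fix phi phit g H x t
  assume tf: "test_function phi phit g H" and t: "t < (0::real)" and ev: "\<forall>\<^sub>F z in nhds (x, t). u z - phi z >= u (x, t) - phi (x, t)" and ?B
  from this(4)[rule_format, OF conjI[OF test_function_uminus[OF tf] conjI[OF t]], of x]
  show "near_ineq F (- phit (x, t)) (- H (x, t)) (- g (x, t))" using ev by (simp add: algebra_simps)
 qed
 have super: "viscosity_supersolution k u \<longleftrightarrow> weak_sub (%M p. - curv_max {k} (- M) p) K (%z. - u z)"
  unfolding viscosity_supersolution_def iff[OF curvature_operator_curv_op(2)[OF k]] curv_op_lower_iff usc touch ..
 show ?thesis unfolding viscosity_solution_def sub super ..
qed

subsection \<open>The limit of the game and the extinction time\<close>

lemma weak_sub_cong:
 assumes W: "weak_sub F K u" and eq: "!!x t. t <= 0 ==> u (x, t) = u' (x, t)"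
 shows "weak_sub F K u'"
proof -
 have eqS: "u z = u' z" if "z \<in> UNIV \<times> {..0}" for z using eq that by (cases z) auto
 have "usc_on (UNIV \<times> {..0}) u'"
 proof -
  have "usc_on (UNIV \<times> {..0}) u" using W unfolding weak_sub_def by blast
  then show ?thesis unfolding usc_on_iff by (simp add: eqS cong: ball_cong)
 qed
 moreover have "(\<forall>\<^sub>F z in nhds (x, t). u z - phi z <= u (x, t) - phi (x, t))"
  if t: "t < 0" and ev: "\<forall>\<^sub>F z in nhds (x, t). u' z - phi z <= u' (x, t) - phi (x, t)" for x t phi
 proof -
  have "\<forall>\<^sub>F z in nhds (x, t). z \<in> UNIV \<times> {..<0}" using t by (intro eventually_nhds_in_open open_Times) auto
  with ev show ?thesis
  proof eventually_elim
   case (elim z) then show ?case using eqS[of z] eq[of t x] t by (cases z) auto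
  qed
 qed
 ultimately show ?thesis using W unfolding weak_sub_def by blast
qed

definition game_limit :: "'n::finite itself => (real^'m) set => (real^'m) \<times> real => real" where
 "game_limit N E = upper_limit (scaled_game N E)"

context
 fixes E :: "(real^'m) set" and b L :: real
 assumes h: "norm_like b L (body_norm E)" and m: "CARD('m) >= 2"
begin

lemma game_limit_even: "game_limit TYPE('n::finite) E (- x, t) = game_limit TYPE('n) E (x, t)"
proof -
 have n: "(c, n, y) \<in> near_set rho (- x, t) \<longleftrightarrow> (c, n, - y) \<in> near_set rho (x, t)" for c n y rho
  using dist_minus[of "- y" x] unfolding near_set_def by (simp add: dist_Pair_Pair)
 have s: "scaled_game TYPE('n) E c n (- y) = scaled_game TYPE('n) E c n y" for c n y
  unfolding scaled_game_def using game_value_even[where 'n='n, OF h, of n "c *\<^sub>R y"] by simp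
 have "(ALL (c, n, y):near_set rho (- x, t). scaled_game TYPE('n) E c n y <= a) \<longleftrightarrow> (ALL (c, n, y):near_set rho (x, t). scaled_game TYPE('n) E c n y <= a)" for rho a
 proof (intro iffI ballI; clarify)
  fix c n y assume "ALL (c, n, y):near_set rho (- x, t). scaled_game TYPE('n) E c n y <= a" "(c, n, y) \<in> near_set rho (x, t)"
  then show "scaled_game TYPE('n) E c n y <= a" using n[of c n "- y"] s[of c n y] by fastforce
 next
  fix c n y assume "ALL (c, n, y):near_set rho (x, t). scaled_game TYPE('n) E c n y <= a" "(c, n, y) \<in> near_set rho (- x, t)"
  then show "scaled_game TYPE('n) E c n y <= a" using n[of c n y] s[of c n y] by fastforce
 qed
 then show ?thesis unfolding game_limit_def upper_limit_def by simp
qed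

lemma game_limit_growth:
 assumes "S > 0" "t \<in> {-S..0}"
 shows "game_limit TYPE('n::finite) E (x, t) <= (L + L * real CARD('n) * sqrt (2 * S)) * (1 + norm x)"
proof -
 have L: "0 < L" "body_norm E x <= L * norm x" using h unfolding norm_like_def by auto
 have t: "t <= 0" "2 * (- t) <= 2 * S" using assms by auto
 have "L * real CARD('n) * sqrt (2 * (- t)) <= L * real CARD('n) * sqrt (2 * S)"
  using L t by (intro mult_left_mono) (auto intro!: mult_nonneg_nonneg)
 moreover have "0 <= L * real CARD('n) * sqrt (2 * S)" using L assms by simp
 then have "0 <= L * real CARD('n) * sqrt (2 * S) * norm x" by simp
 ultimately show ?thesis using game_limit_bounds(2)[where 'n='n, OF h m t(1), of x] L unfolding game_limit_def distrib_left distrib_right mult_1_right by linarith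
qed

lemma game_limit_three_point:
 assumes t: "t <= 0"
 shows "2 * game_limit TYPE('n::finite) E ((1/2) *\<^sub>R (x + y), t)
  <= - upper_limit (%c n y. - scaled_game TYPE('n) E c n y) (x, t) - upper_limit (%c n y. - scaled_game TYPE('n) E c n y) (y, t)"
proof -
 let ?v = "%z. - upper_limit (%c n y. - scaled_game TYPE('n) E c n y) z"
 have J: "index_set TYPE('m) {..min CARD('n) (CARD('m) - 1)}" unfolding index_set_def by auto
 have "2 * game_limit TYPE('n) E ((1/2) *\<^sub>R (x + y), t) <= ?v (x, t) + ?v (y, t)"
 proof (rule three_point_comparison[OF J _ _ _ h _ _ _ _ t])
  show "weak_sub (curv_max {..min CARD('n) (CARD('m) - 1)}) ((real CARD('n))^2) (game_limit TYPE('n) E)"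
   unfolding game_limit_def by (rule game_upper_limit_weak_sub[OF h m])
  show "weak_sub (%M p. - curv_max {..min CARD('n) (CARD('m) - 1)} (- M) p) ((real CARD('n))^2) (%z. - ?v z)"
   using game_lower_limit_weak_sub[OF h m] by simp
  show "game_limit TYPE('n) E (x, 0) <= body_norm E x" for x
   using game_limit_bounds(2)[where 'n='n, OF h m order_refl, of x] unfolding game_limit_def by simp
  show "- ?v (x, 0) <= - body_norm E x" for x
   using game_limit_bounds(3)[where 'n='n, OF h m order_refl, of x] by simp
  show "upper_growth (game_limit TYPE('n) E)" unfolding upper_growth_def using game_limit_growth by blast
  have "- ?v (x, t) <= 0 * (1 + norm x)" if "t <= 0" for x t
  proof -
   have "0 <= b * norm x" "b * norm x <= body_norm E x" using h unfolding norm_like_def by auto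
   then show ?thesis using game_limit_bounds(3)[where 'n='n, OF h m that, of x] by simp
  qed
  then show "upper_growth (%z. - ?v z)" unfolding upper_growth_def by (metis atLeastAtMost_iff)
 qed simp
 then show ?thesis by simp
qed

text \<open>The three-point inequality at \<open>x = y\<close> gives one direction; the other holds
  for relaxed limits in general, because their neighbourhoods share a sample of the game.\<close>

lemma game_limit_lower:
 assumes t: "t <= 0"
 shows "upper_limit (%c n y. - scaled_game TYPE('n::finite) E c n y) (x, t) = - game_limit TYPE('n) E (x, t)"
proof (rule antisym)
 have "(1/2) *\<^sub>R (x + x) = x" by (simp add: scaleR_2[symmetric])
 then show "upper_limit (%c n y. - scaled_game TYPE('n) E c n y) (x, t) <= - game_limit TYPE('n) E (x, t)"
  using game_limit_three_point[where 'n='n, OF t, of x x] by simp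
 show "- game_limit TYPE('n) E (x, t) <= upper_limit (%c n y. - scaled_game TYPE('n) E c n y) (x, t)"
 proof (rule field_le_epsilon)
  fix e :: real assume "e > 0"
  then have e: "e / 2 > 0" by simp
  have z: "snd (x, t) <= 0" using t by simp
  obtain rho1 where 1: "rho1 > 0" "!!c n y. (c, n, y) \<in> near_set rho1 (x, t) ==> scaled_game TYPE('n) E c n y <= upper_limit (scaled_game TYPE('n) E) (x, t) + e / 2"
   using upper_limit_above[OF scaled_game_bounded(1)[OF h m] z e] by blast
  obtain c n y where 2: "(c, n, y) \<in> near_set rho1 (x, t)" "upper_limit (scaled_game TYPE('n) E) (x, t) - e / 2 < scaled_game TYPE('n) E c n y"
   using upper_limit_below[OF scaled_game_bounded(1)[OF h m] z e 1(1)] by blast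
  obtain rho2 where 3: "rho2 > 0" "!!c n y. (c, n, y) \<in> near_set rho2 (x, t) ==> - scaled_game TYPE('n) E c n y <= upper_limit (%c n y. - scaled_game TYPE('n) E c n y) (x, t) + e / 2"
   using upper_limit_above[OF scaled_game_bounded(2)[OF h m] z e] by blast
  define rho where "rho = min rho1 rho2"
  have rho: "rho > 0" "rho <= rho1" "rho <= rho2" unfolding rho_def using 1 3 by auto
  obtain c n y where 4: "(c, n, y) \<in> near_set rho (x, t)"
   using upper_limit_below[OF scaled_game_bounded(1)[OF h m] z e rho(1)] by blast
  have "near_set rho (x, t) <= near_set r (x, t)" if "rho <= r" for r
   using that rho(1) frac_le[of 1 1 rho r] unfolding near_set_def by auto
  then have "(c, n, y) \<in> near_set rho1 (x, t)" "(c, n, y) \<in> near_set rho2 (x, t)" using 4 rho by blast+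
  from 1(2)[OF this(1)] 3(2)[OF this(2)]
  show "- game_limit TYPE('n) E (x, t) <= upper_limit (%c n y. - scaled_game TYPE('n) E c n y) (x, t) + e"
   unfolding game_limit_def by linarith
 qed
qed

lemma game_limit_midpoint:
 assumes t: "t <= 0"
 shows "2 * game_limit TYPE('n::finite) E ((1/2) *\<^sub>R (x + y), t) <= game_limit TYPE('n) E (x, t) + game_limit TYPE('n) E (y, t)"
 using game_limit_three_point[where 'n='n, OF t, of x y] unfolding game_limit_lower[OF t] by simp

lemma game_limit_initial: "game_limit TYPE('n::finite) E (x, 0) = body_norm E x"
 using game_limit_bounds(1,2)[where 'n='n, OF h m order_refl, of x] unfolding game_limit_def by (intro antisym) auto

text \<open>The limit is convex in space, so only test functions with nonnegative Hessian touch it from above,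
 and for these the game operator reduces to the sum of the \<open>k\<close> largest eigenvalues.\<close>

lemma game_limit_viscosity_solution:
 "viscosity_solution (min CARD('n) (CARD('m) - 1)) (restrict (game_limit TYPE('n::finite) E) (UNIV \<times> {..0}))"
proof -
 let ?k = "min CARD('n) (CARD('m) - 1)" and ?U = "game_limit TYPE('n) E"
 \<comment> \<open>Large enough both for the constant of the game and for
   \<open>viscosity_solution_iff_weak_sub\<close>.\<close>
 let ?K = "(real CARD('n))^2 + real CARD('m)"
 have k: "?k <= CARD('m) - 1" by simp
 have up: "weak_sub (curv_max {..?k}) ((real CARD('n))^2) ?U" unfolding game_limit_def by (rule game_upper_limit_weak_sub[OF h m])
 have "weak_sub (curv_max {?k}) ((real CARD('n))^2) ?U"
  unfolding weak_sub_def
 proof (rule conjI, use up weak_sub_def in blast, intro allI impI, elim conjE)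
  fix phi phit g H x t
  assume tf: "test_function phi phit g H" and t: "t < 0" and ev: "\<forall>\<^sub>F z in nhds (x, t). ?U z - phi z <= ?U (x, t) - phi (x, t)"
  note S = weak_subD[OF up tf t ev]
  obtain rho where rho: "rho > 0" "!!z. dist z (x, t) < rho ==> ?U z - phi z <= ?U (x, t) - phi (x, t)" using ev unfolding eventually_nhds_metric by blast
  have psd: "0 <= (H (x, t) *v k) \<bullet> k" for k
  proof (rule hessian_nonneg[OF tf t rho(1), where C = 0])
   fix k :: "real^'m" assume k: "norm k < rho"
   have "(1/2) *\<^sub>R ((x + k) + (x - k)) = x" by (simp add: scaleR_2[symmetric])
   then have "2 * ?U (x, t) <= ?U (x + k, t) + ?U (x - k, t)" using game_limit_midpoint[where 'n='n, of t "x + k" "x - k"] t by simp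
   moreover have "dist (x + k, t) (x, t) < rho" "dist (x - k, t) (x, t) < rho" using k by (simp_all add: dist_Pair_Pair dist_norm)
   ultimately show "2 * phi (x, t) - 0 * (norm k)^4 <= phi (x + k, t) + phi (x - k, t)" using rho(2)[of "(x + k, t)"] rho(2)[of "(x - k, t)"] by simp
  qed
  have "g (x, t) ~= 0 --> 0 <= phit (x, t) + curv_max {?k} (H (x, t)) (g (x, t))"
   using S(1) curv_max_psd[OF test_function_symmetric[OF tf t] _ k psd] unfolding curv_max_single by auto
  then show "(g (x, t) ~= 0 --> 0 <= phit (x, t) + curv_max {?k} (H (x, t)) (g (x, t))) &
    (ALL l>=0. (ALL h. (H (x, t) *v h) \<bullet> h <= l * (h \<bullet> h)) --> 0 <= phit (x, t) + (real CARD('n))^2 * l)"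
   using S(2) by blast
 qed
 then have 1: "weak_sub (curv_max {?k}) ?K ?U" by (rule weak_sub_mono_const) simp
 have low: "weak_sub (%M p. - curv_max {..?k} (- M) p) ((real CARD('n))^2) (%z. - ?U z)"
  by (rule weak_sub_cong[OF game_lower_limit_weak_sub[OF h m]]) (rule game_limit_lower)
 \<comment> \<open>Here monotonicity is enough: the maximum over \<open>{..?k}\<close> includes the
   sum of \<open>?k\<close> eigenvalues.\<close>
 have "curv_max {?k} M p <= curv_max {..?k} M p" for M :: "real^'m^'m" and p
  unfolding curv_max_single curv_max_def by (rule Max_ge) auto
 then have F: "0 <= a + - curv_max {..?k} (- M) p ==> 0 <= a + - curv_max {?k} (- M) p" for a and M :: "real^'m^'m" and p
  by (meson add_left_mono le_imp_neg_le order_trans)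
 have "weak_sub (%M p. - curv_max {?k} (- M) p) ((real CARD('n))^2) (%z. - ?U z)"
  using low F unfolding weak_sub_def by blast
 then have 2: "weak_sub (%M p. - curv_max {?k} (- M) p) ?K (%z. - ?U z)" by (rule weak_sub_mono_const) simp
 show ?thesis
  using weak_sub_cong[OF 1, of "restrict ?U (UNIV \<times> {..0})"] weak_sub_cong[OF 2, of "%z. - restrict ?U (UNIV \<times> {..0}) z"]
  by (subst viscosity_solution_iff_weak_sub[OF k, of ?K]) auto
qed

lemma linear_growth_imp_upper_growth:
 assumes "linear_growth u" shows "upper_growth u" "upper_growth (%z. - u z)"
 using assms unfolding linear_growth_def upper_growth_def abs_le_iff by blast+

lemma viscosity_solution_le:
 assumes k: "k <= CARD('m) - 1" and u: "viscosity_solution k u" "linear_growth u" "!!x. u (x, 0) = body_norm E x"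
  and v: "viscosity_solution k v" "linear_growth v" "!!x. v (x, 0) = body_norm E x" and t: "t <= 0"
 shows "u (x, t) <= v (x, t)"
proof -
 have J: "index_set TYPE('m) {k}" using k unfolding index_set_def by simp
 have K: "0 <= real CARD('m)" by simp
 note iff = viscosity_solution_iff_weak_sub[OF k order_refl]
 have "2 * u ((1/2) *\<^sub>R (x + x), t) <= v (x, t) + v (x, t)"
  by (rule three_point_comparison[OF J K _ _ h _ _ _ _ t])
   (use u v iff linear_growth_imp_upper_growth in auto)
 moreover have "(1/2) *\<^sub>R (x + x) = x" by (simp add: scaleR_2[symmetric])
 ultimately show ?thesis by simp
qed

lemma level_set_solution_eq:
 "level_set_solution (min CARD('n) (CARD('m) - 1)) E = restrict (game_limit TYPE('n::finite) E) (UNIV \<times> {..0})"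
 unfolding level_set_solution_def
proof (rule the_equality)
 let ?U = "restrict (game_limit TYPE('n) E) (UNIV \<times> {..0})" and ?k = "min CARD('n) (CARD('m) - 1)"
 have k: "?k <= CARD('m) - 1" by simp
 have gr: "linear_growth ?U"
  unfolding linear_growth_def
 proof (intro allI impI exI ballI)
  fix S t :: real and x :: "real^'m" assume S: "S > 0" and t: "t \<in> {-S..0}"
  have "0 <= b * norm x" "b * norm x <= body_norm E x" using h unfolding norm_like_def by auto
  then show "\<bar>?U (x, t)\<bar> <= (L + L * real CARD('n) * sqrt (2 * S)) * (1 + norm x)"
   using game_limit_growth[where 'n='n, OF S t, of x] game_limit_bounds(1)[where 'n='n, OF h m, of t x] t unfolding game_limit_def by simp
 qed
 have vs: "viscosity_solution ?k ?U" by (rule game_limit_viscosity_solution)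
 have init: "?U (x, 0) = body_norm E x" for x using game_limit_initial[where 'n='n, of x] by simp
 show "?U \<in> extensional (UNIV \<times> {..0}) & viscosity_solution ?k ?U & linear_growth ?U & (ALL x. ?U (x, 0) = body_norm E x)"
  by (intro conjI allI vs gr init restrict_extensional)
 fix u assume u: "u \<in> extensional (UNIV \<times> {..0}) & viscosity_solution ?k u & linear_growth u & (ALL x. u (x, 0) = body_norm E x)"
 then have u': "u \<in> extensional (UNIV \<times> {..0})" "viscosity_solution ?k u" "linear_growth u" "u (x, 0) = body_norm E x" for x by blast+
 show "u = ?U"
 proof (rule extensionalityI[of _ "UNIV \<times> {..0}"])
  fix z :: "(real^'m) \<times> real" assume z: "z \<in> UNIV \<times> {..0}"
  then have t: "snd z <= 0" by (simp add: mem_Times_iff)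
  have "u (fst z, snd z) = ?U (fst z, snd z)"
   by (rule antisym[OF viscosity_solution_le[OF k u'(2,3,4) vs gr init t] viscosity_solution_le[OF k vs gr init u'(2,3,4) t]])
  then show "u z = ?U z" by simp
 qed (rule u'(1), rule restrict_extensional)
qed

section \<open>Asymptotics at the origin and extinction\<close>

lemma game_value_tendsto:
 assumes t: "t < 0"
 shows "(%T. game_value TYPE('n::finite) E T / sqrt (real T) * sqrt (2 * (- t))) \<longlonglongrightarrow> game_limit TYPE('n) E (0, t)"
proof -
 define a where "a = 2 * (- t)"
 have a: "a > 0" "t = - (a / 2)" unfolding a_def using t by auto
 have "(%T. game_value TYPE('n) E T / sqrt (real T) * sqrt a) \<longlonglongrightarrow> game_limit TYPE('n) E (0, t)"
proof (rule LIMSEQ_I)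
 fix e :: real assume "e > 0"
 then have e: "e / 2 > 0" by simp
 have z: "snd (0 :: real^'m, t) <= 0" using t by simp
 obtain rho1 where 1: "rho1 > 0" "!!c n y. (c, n, y) \<in> near_set rho1 (0, t) ==> scaled_game TYPE('n) E c n y <= game_limit TYPE('n) E (0, t) + e / 2"
  using upper_limit_above[OF scaled_game_bounded(1)[OF h m] z e] unfolding game_limit_def by blast
 obtain rho2 where 2: "rho2 > 0" "!!c n y. (c, n, y) \<in> near_set rho2 (0, t) ==> - scaled_game TYPE('n) E c n y <= - game_limit TYPE('n) E (0, t) + e / 2"
  using upper_limit_above[OF scaled_game_bounded(2)[OF h m] z e] unfolding game_limit_lower[OF less_imp_le[OF t]] by blast
 define r where "r = min rho1 rho2"
 have r: "r > 0" "r <= rho1" "r <= rho2" unfolding r_def using 1 2 by auto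
 obtain T0 :: nat where T0: "a / r^2 < real T0" using reals_Archimedean2 by blast
 show "EX no. ALL n>=no. norm (game_value TYPE('n) E n / sqrt (real n) * sqrt a - game_limit TYPE('n) E (0, t)) < e"
 proof (intro exI allI impI)
  fix T assume "T0 <= T"
  then have T: "a / r^2 < real T" using T0 by simp
  have "0 < a / r^2" using a r by simp
  then have T1: "real T > 0" using T by linarith
  \<comment> \<open>This step size places \<open>T\<close> rounds exactly at the time
    \<open>t\<close>, so the rescaled value is sampled at the point \<open>(0, t)\<close>
    itself.\<close>
  define c where "c = sqrt (real T / a)"
  have c2: "c^2 = real T / a" "c > 0" unfolding c_def using a T1 by (auto intro!: divide_pos_pos)
  have gt: "grid_time c T = t" unfolding grid_time_def c2 a(2) using a(1) T1 by (simp add: field_simps)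
  have "a < real T * r^2" using T r by (simp add: pos_divide_less_eq)
  then have "(1 / r)^2 < c^2" unfolding c2(1) using a r by (simp add: power_divide field_simps)
  then have "1 / r < c" using c2(2) by (rule power2_less_imp_less[OF _ less_imp_le])
  moreover have "1 / rho1 <= 1 / r" "1 / rho2 <= 1 / r" using r 1(1) 2(1) by (auto intro!: divide_left_mono)
  ultimately have "(c, T, 0) \<in> near_set rho1 (0, t)" "(c, T, 0) \<in> near_set rho2 (0, t)" unfolding near_set_def using gt 1(1) 2(1) by auto
  from 1(2)[OF this(1)] 2(2)[OF this(2)] have "\<bar>scaled_game TYPE('n) E c T 0 - game_limit TYPE('n) E (0, t)\<bar> <= e / 2" by linarith
  moreover have "scaled_game TYPE('n) E c T 0 = game_value TYPE('n) E T / sqrt (real T) * sqrt a"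
   unfolding scaled_game_def c_def game_value_def by (simp add: real_sqrt_divide)
  ultimately show "norm (game_value TYPE('n) E T / sqrt (real T) * sqrt a - game_limit TYPE('n) E (0, t)) < e" using e by simp
 qed
qed
 then show ?thesis unfolding a_def .
qed

text \<open>\<open>l\<close> is read off at time \<open>- 1/2\<close>, where
  \<open>sqrt (2 * (- t))\<close> is 1. A level set is nonempty only if
  \<open>l * sqrt (2 * t) <= 1\<close>, as the origin is a minimum point, and it has interior if the
  inequality is strict, by upper semicontinuity; both conditions have the same supremum
  \<open>1 / (2 * l^2)\<close>.\<close>

lemma game_value_limit: "(%T. game_value TYPE('n::finite) E T / sqrt (real T)) \<longlonglongrightarrow> 1 / sqrt (2 * extinction_time CARD('n) E)"
proof -
 let ?U = "game_limit TYPE('n) E"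
 define l where "l = ?U (0, - 1/2)"
 have lim: "(%T. game_value TYPE('n) E T / sqrt (real T)) \<longlonglongrightarrow> l"
  using game_value_tendsto[where 'n='n, of "- 1/2"] unfolding l_def by simp
 have l: "?U (0, t) = l * sqrt (2 * (- t))" if "t < 0" for t
  using LIMSEQ_unique[OF game_value_tendsto[OF that] tendsto_mult_right[OF lim]] .
 have "b <= l"
 proof (rule LIMSEQ_le_const[OF lim], intro exI[of _ 1] allI impI)
  fix T :: nat assume "1 <= T"
  moreover have "b * sqrt (real T) <= game_value TYPE('n) E T" using game_value_growth[where 'n='n, OF h m, of 0 T] unfolding game_value_def by simp
  ultimately show "b <= game_value TYPE('n) E T / sqrt (real T)" by (simp add: pos_le_divide_eq)
 qed
 then have l0: "l > 0" using h unfolding norm_like_def by linarith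
 have min: "?U (0, t) <= ?U (x, t)" if "t < 0" for x t
  using game_limit_midpoint[where 'n='n, of t x "- x"] that by (simp add: game_limit_even)
 have flow: "curvature_flow CARD('n) E t = {x. ?U (x, - t) <= 1}" if "t > 0" for t
  unfolding curvature_flow_def level_set_solution_eq using that by auto
 define S where "S = {t. 0 < t & interior (curvature_flow CARD('n) E t) ~= {}}"
 have root: "l * sqrt (2 * t) <= 1 \<longleftrightarrow> t <= 1 / (2 * l^2)" "l * sqrt (2 * t) < 1 \<longleftrightarrow> t < 1 / (2 * l^2)" if "t > 0" for t
 proof -
  have sq: "(l * sqrt (2 * t))^2 = l^2 * (2 * t)" using that by (simp add: power_mult_distrib)
  have "l * sqrt (2 * t) <= 1 \<longleftrightarrow> (l * sqrt (2 * t))^2 <= 1^2" using l0 that by (intro power_mono_iff[symmetric]) auto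
  also have "... \<longleftrightarrow> t <= 1 / (2 * l^2)" unfolding sq using l0 by (simp add: field_simps)
  finally show "l * sqrt (2 * t) <= 1 \<longleftrightarrow> t <= 1 / (2 * l^2)" .
  have "1 <= l * sqrt (2 * t) \<longleftrightarrow> 1^2 <= (l * sqrt (2 * t))^2" using l0 that by (intro power_mono_iff[symmetric]) auto
  then have "l * sqrt (2 * t) < 1 \<longleftrightarrow> (l * sqrt (2 * t))^2 < 1^2" by linarith
  also have "... \<longleftrightarrow> t < 1 / (2 * l^2)" unfolding sq using l0 by (simp add: field_simps)
  finally show "l * sqrt (2 * t) < 1 \<longleftrightarrow> t < 1 / (2 * l^2)" .
 qed
 have upper: "t <= 1 / (2 * l^2)" if "t \<in> S" for t
 proof -
  have t: "t > 0" and "curvature_flow CARD('n) E t ~= {}" using that interior_subset unfolding S_def by blast+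
  then obtain x where "?U (x, - t) <= 1" unfolding flow[OF t] by blast
  then have "l * sqrt (2 * t) <= 1" using min[of "- t" x] l[of "- t"] t by simp
  then show ?thesis using root(1)[OF t] by simp
 qed
 have lower: "t \<in> S" if t: "0 < t" "t < 1 / (2 * l^2)" for t
 proof -
  have "?U (0, - t) < 1" using root(2)[OF t(1)] t l[of "- t"] by simp
  moreover have "usc_on (UNIV \<times> {..0}) ?U" unfolding game_limit_def by (rule upper_limit_usc[OF scaled_game_bounded(1)[OF h m]])
  moreover have "(0, - t) \<in> UNIV \<times> {..0}" using t by simp
  ultimately obtain d where d: "d > 0" "!!y. y \<in> UNIV \<times> {..0} ==> dist y (0, - t) < d ==> ?U y < 1" unfolding usc_on_iff by metis
  have "ball 0 d <= curvature_flow CARD('n) E t"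
   unfolding flow[OF t(1)]
  proof
   fix x :: "real^'m" assume "x \<in> ball 0 d"
   then show "x \<in> {x. ?U (x, - t) <= 1}" using d(2)[of "(x, - t)"] t by (simp add: dist_Pair_Pair dist_commute)
  qed
  then have "0 \<in> interior (curvature_flow CARD('n) E t)" using d(1) by (meson centre_in_ball interior_maximal open_ball subsetD)
  then show ?thesis using t unfolding S_def by blast
 qed
 have "Sup S = 1 / (2 * l^2)"
 proof (rule cSup_eq_non_empty)
  have p: "0 < 1 / (2 * l^2)" using l0 by simp
  show "S ~= {}" using lower dense[OF p] by blast
  show "1 / (2 * l^2) <= y" if "!!t. t \<in> S ==> t <= y" for y
  proof (rule dense_le_bounded[OF p])
   show "w <= y" if "0 < w" "w < 1 / (2 * l^2)" for w using \<open>!!t. t \<in> S ==> t <= y\<close> lower[OF that] by blast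
  qed
 qed (rule upper)
 then have "1 / sqrt (2 * extinction_time CARD('n) E) = l" unfolding extinction_time_def S_def using l0 by (simp add: real_sqrt_divide)
 then show ?thesis using lim by simp
qed

end

theorem theorem2p1:
  fixes E :: "(real^'m::finite) set"
  assumes "CARD('m) \<ge> 2"
    and "sym_convex_body E"
  shows "(\<lambda>T. game_value TYPE('n::finite) E T / sqrt (real T))
           \<longlonglongrightarrow> 1 / sqrt (2 * extinction_time CARD('n) E)"
  using body_norm_norm_like[OF assms(2)] game_value_limit[OF _ assms(1)] by blast

end
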